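(* Let $\varphi$ be a strong $\mathrm{G}_2T$-structure on a $7$-manifold. Then the scalar curvature of the induced metric $g_\varphi$ is $$\mathrm{Scal}(g_\varphi)=10\,\delta\tau_1+\frac{49}{24}\,\tau_0^2+24\,|\tau_1|^2,$$ where $\tau_0$ and $\tau_1$ are the intrinsic torsion forms of $\varphi$ of degree $0$ and $1$.
   Context: Write $e^{ij\cdots}=e^i\wedge e^j\wedge\cdots$. A $\mathrm{G}_2$-structure on a $7$-manifold $M$ is a definite $3$-form $\varphi$: at each point there is a coframe $(e^1,\dots,e^7)$ with $\varphi=e^{123}+e^1\wedge(e^{45}+e^{67})+e^2\wedge(e^{46}-e^{57})-e^3\wedge(e^{47}+e^{56})$. It induces the metric $g_\varphi$ for which this coframe is orthonormal, the orientation $e^{1234567}$, and a Hodge operator $\star$. The intrinsic torsion forms of $\varphi$ are the unique forms $\tau_0\in C^\infty(M)$, $\tau_1\in\Omega^1(M)$, $\tau_2\in\Omega^2(M)$ with $\tau_2\wedge\varphi=-\star\tau_2$, and $\tau_3\in\Omega^3(M)$ with $\tau_3\wedge\varphi=0=\tau_3\wedge\star\varphi$, such that $$d\varphi=\tau_0\star\varphi+3\tau_1\wedge\varphi+\star\tau_3,\qquad d\star\varphi=4\tau_1\wedge\star\varphi+\star\tau_2.$$ $\varphi$ is a $\mathrm{G}_2T$-structure if $\tau_2=0$, i.e. $d\star\varphi=\theta\wedge\star\varphi$ with Lee form $\theta=4\tau_1$. Its torsion $3$-form is $T=\frac16\star(d\varphi\wedge\varphi)\varphi-\star d\varphi+\star(\theta\wedge\varphi)=\frac16\tau_0\varphi+\star(\tau_1\wedge\varphi)-\tau_3$,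 and $\varphi$ is strong if $dT=0$. Here $\delta$ is the codifferential of $g_\varphi$; on $1$-forms $\delta\alpha=-\star d\star\alpha$. Norms are those induced by $g_\varphi$. *)

theory Defs
  imports "HOL-Analysis.Analysis"
begin

section \<open>Smooth functions on open subsets of Euclidean space\<close>

text \<open>For an open set and a finite-dimensional domain, all derivatives up to order \<open>k\<close> exist and
  are continuous.\<close>

primrec Ck_on ::
    "nat \<Rightarrow> 'v::real_normed_vector set \<Rightarrow> ('v \<Rightarrow> 'w::real_normed_vector) \<Rightarrow> bool" where
  "Ck_on 0 S f \<longleftrightarrow> continuous_on S f"
| "Ck_on (Suc k) S f \<longleftrightarrow>
     (\<forall>x\<in>S. f differentiable (at x)) \<and>
     (\<forall>v. Ck_on k S (\<lambda>x. frechet_derivative f (at x) v))"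

definition smooth_on ::
    "'v::real_normed_vector set \<Rightarrow> ('v \<Rightarrow> 'w::real_normed_vector) \<Rightarrow> bool" where
  "smooth_on S f \<longleftrightarrow> (\<forall>k. Ck_on k S f)"


section \<open>Exterior forms on a vector space\<close>

text \<open>An exterior form is a function on argument lists. A \<open>k\<close>-form is multilinear and alternating
  on lists of length \<open>k\<close> and vanishes on lists of any other length, so that the operations below
  need no degree arguments. A 0-form is determined by its value on the empty list.\<close>

type_synonym 'v form = "'v list \<Rightarrow> real"

definition alternating_form :: "nat \<Rightarrow> 'v::real_vector form \<Rightarrow> bool" where
  "alternating_form k \<alpha> \<longleftrightarrow>
     (\<forall>vs. length vs \<noteq> k \<longrightarrow> \<alpha> vs = 0) \<and>
     (\<forall>vs i. length vs = k \<longrightarrow> i < k \<longrightarrow> linear (\<lambda>v. \<alpha> (vs[i := v]))) \<and>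
     (\<forall>vs. length vs = k \<longrightarrow> \<not> distinct vs \<longrightarrow> \<alpha> vs = 0)"

text \<open>The sum runs over shuffles: \<open>\<alpha>\<close> receives the arguments at the positions in \<open>A\<close>, \<open>\<beta>\<close> the
  remaining ones, and the exponent counts inversions. The normalisation is
  \<open>(e\<^sup>1 \<and> e\<^sup>2)(v,w) = e\<^sup>1(v) e\<^sup>2(w) - e\<^sup>1(w) e\<^sup>2(v)\<close>.\<close>

definition wedge :: "'v form \<Rightarrow> 'v form \<Rightarrow> 'v form" where
  "wedge \<alpha> \<beta> = (\<lambda>vs. \<Sum>A \<in> Pow {..<length vs}.
     (-1) ^ card {(i, j). i \<in> A \<and> j \<in> {..<length vs} - A \<and> j < i} *
     \<alpha> (nths vs A) * \<beta> (nths vs (- A)))"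

definition unit_form :: "'v form" where
  "unit_form = (\<lambda>vs. if vs = [] then 1 else 0)"

definition covector_form :: "('v \<Rightarrow> real) \<Rightarrow> 'v form" where
  "covector_form a = (\<lambda>vs. case vs of [v] \<Rightarrow> a v | _ \<Rightarrow> 0)"

definition pullback_form :: "('v \<Rightarrow> 'w) \<Rightarrow> 'w form \<Rightarrow> 'v form" where
  "pullback_form L \<alpha> = (\<lambda>vs. \<alpha> (map L vs))"

text \<open>For a coframe given by an invertible matrix, the covector \<open>e\<^sup>i\<close> is
  \<open>v \<mapsto> (e *v v) $ i\<close>; \<open>coframe_monomial e [i, j, \<dots>]\<close> is
  \<open>e\<^sup>i \<and> e\<^sup>j \<and> \<dots>\<close>.\<close>

definition coframe_monomial :: "real^'n^'n \<Rightarrow> 'n list \<Rightarrow> (real^'n) form" where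
  "coframe_monomial e is =
     foldr wedge (map (\<lambda>i. covector_form (\<lambda>v. (e *v v) $ i)) is) unit_form"

text \<open>Hodge operator of an inner product with matrix \<open>g\<close> and volume form \<open>vol\<close>, by the index formula
  \<open>(\<star>\<alpha>)\<^sub>J = (1/k!) \<Sum>\<^sub>I \<alpha>\<^sup>I vol\<^sub>I\<^sub>J\<close>, where \<open>k\<close> is the dimension minus the length of \<open>J\<close> and the
  indices of \<open>\<alpha>\<close> are raised with the rows of the inverse of \<open>g\<close>. It satisfies
  \<open>\<alpha> \<and> \<star>\<beta> = \<langle>\<alpha>,\<beta>\<rangle> vol\<close>.\<close>

definition hodge :: "real^'n^'n \<Rightarrow> (real^'n) form \<Rightarrow> (real^'n) form \<Rightarrow> (real^'n) form" where
  "hodge g vol \<alpha> = (\<lambda>vs. let k = CARD('n) - length vs in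
     (\<Sum>is \<in> {is :: 'n list. length is = k}.
        \<alpha> (map (\<lambda>i. matrix_inv g $ i) is) * vol (map (\<lambda>i. axis i 1) is @ vs)) / fact k)"

definition covector_norm_sq :: "real^'n^'n \<Rightarrow> (real^'n) form \<Rightarrow> real" where
  "covector_norm_sq g \<alpha> =
     (\<Sum>i\<in>UNIV. \<Sum>j\<in>UNIV. matrix_inv g $ i $ j * \<alpha> [axis i 1] * \<alpha> [axis j 1])"


section \<open>Calculus in a coordinate domain\<close>

text \<open>The standard formula for the exterior derivative evaluated on constant vector fields.\<close>

definition ext_d ::
    "('v::real_normed_vector \<Rightarrow> 'v form) \<Rightarrow> 'v \<Rightarrow> 'v form" where
  "ext_d \<alpha> = (\<lambda>x vs. \<Sum>i<length vs. (-1) ^ i *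
     frechet_derivative (\<lambda>y. \<alpha> y (take i vs @ drop (Suc i) vs)) (at x) (vs ! i))"

definition pd :: "'n::finite \<Rightarrow> (real^'n \<Rightarrow> real) \<Rightarrow> real^'n \<Rightarrow> real" where
  "pd i f x = frechet_derivative f (at x) (axis i 1)"

text \<open>\<open>christoffel g l i j\<close> is the symbol with upper index \<open>l\<close> and lower indices \<open>i\<close>, \<open>j\<close>.\<close>

definition christoffel ::
    "(real^'n \<Rightarrow> real^'n^'n) \<Rightarrow> 'n \<Rightarrow> 'n \<Rightarrow> 'n \<Rightarrow> real^'n \<Rightarrow> real" where
  "christoffel g l i j x = (\<Sum>m\<in>UNIV. matrix_inv (g x) $ l $ m *
     (pd i (\<lambda>y. g y $ j $ m) x + pd j (\<lambda>y. g y $ i $ m) x - pd m (\<lambda>y. g y $ i $ j) x)) / 2"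

text \<open>\<open>riemann g l k i j\<close> is the \<open>\<partial>\<^sub>l\<close>-component of
  \<open>R(\<partial>\<^sub>i,\<partial>\<^sub>j)\<partial>\<^sub>k = \<nabla>\<^sub>i\<nabla>\<^sub>j\<partial>\<^sub>k - \<nabla>\<^sub>j\<nabla>\<^sub>i\<partial>\<^sub>k\<close>. With these conventions round spheres have positive
  scalar curvature.\<close>

definition riemann ::
    "(real^'n \<Rightarrow> real^'n^'n) \<Rightarrow> 'n \<Rightarrow> 'n \<Rightarrow> 'n \<Rightarrow> 'n \<Rightarrow> real^'n \<Rightarrow> real" where
  "riemann g l k i j x =
     pd i (christoffel g l j k) x - pd j (christoffel g l i k) x +
     (\<Sum>m\<in>UNIV. christoffel g l i m x * christoffel g m j k x
               - christoffel g l j m x * christoffel g m i k x)"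

definition ricci :: "(real^'n \<Rightarrow> real^'n^'n) \<Rightarrow> 'n \<Rightarrow> 'n \<Rightarrow> real^'n \<Rightarrow> real" where
  "ricci g j k x = (\<Sum>i\<in>UNIV. riemann g i k i j x)"

definition scalar_curvature :: "(real^'n \<Rightarrow> real^'n^'n) \<Rightarrow> real^'n \<Rightarrow> real" where
  "scalar_curvature g x =
     (\<Sum>j\<in>UNIV. \<Sum>k\<in>UNIV. matrix_inv (g x) $ j $ k * ricci g j k x)"


section \<open>Smooth manifolds and differential forms\<close>

text \<open>A manifold is a Hausdorff, second countable space (the type \<open>'a\<close>) with a smooth atlas. A chart is
  a domain together with a coordinate map, whose values outside the domain are irrelevant.\<close>

type_synonym ('a, 'n) chart = "'a set \<times> ('a \<Rightarrow> real^'n)"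

definition transition :: "('a, 'n) chart \<Rightarrow> ('a, 'n) chart \<Rightarrow> real^'n \<Rightarrow> real^'n" where
  "transition c c' = snd c' \<circ> inv_into (fst c) (snd c)"

definition smooth_atlas ::
    "('a::{t2_space, second_countable_topology}, 'n::finite) chart set \<Rightarrow> bool" where
  "smooth_atlas M \<longleftrightarrow>
     (\<Union>c\<in>M. fst c) = UNIV \<and>
     (\<forall>c\<in>M. open (fst c) \<and> open (snd c ` fst c) \<and>
        (\<exists>h. homeomorphism (fst c) (snd c ` fst c) (snd c) h)) \<and>
     (\<forall>c\<in>M. \<forall>c'\<in>M. smooth_on (snd c ` (fst c \<inter> fst c')) (transition c c'))"

definition smooth_function :: "('a, 'n::finite) chart set \<Rightarrow> ('a \<Rightarrow> real) \<Rightarrow> bool" where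
  "smooth_function M f \<longleftrightarrow>
     (\<forall>c\<in>M. smooth_on (snd c ` fst c) (f \<circ> inv_into (fst c) (snd c)))"

text \<open>A differential form is a family of coordinate representations, one for each chart, related by
  pullback along the transition maps.\<close>

type_synonym ('a, 'n) form_field = "('a, 'n) chart \<Rightarrow> real^'n \<Rightarrow> (real^'n) form"

definition differential_form ::
    "('a, 'n::finite) chart set \<Rightarrow> nat \<Rightarrow> ('a, 'n) form_field \<Rightarrow> bool" where
  "differential_form M k \<alpha> \<longleftrightarrow>
     (\<forall>c\<in>M. (\<forall>x\<in>snd c ` fst c. alternating_form k (\<alpha> c x)) \<and>
             (\<forall>vs. smooth_on (snd c ` fst c) (\<lambda>x. \<alpha> c x vs))) \<and>
     (\<forall>c\<in>M. \<forall>c'\<in>M. \<forall>p\<in>fst c \<inter> fst c'.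
        \<alpha> c (snd c p) =
        pullback_form (frechet_derivative (transition c c') (at (snd c p))) (\<alpha> c' (snd c' p)))"

definition vanishes :: "('a, 'n) chart set \<Rightarrow> ('a, 'n) form_field \<Rightarrow> bool" where
  "vanishes M \<alpha> \<longleftrightarrow> (\<forall>c\<in>M. \<forall>x\<in>snd c ` fst c. \<forall>vs. \<alpha> c x vs = 0)"


section \<open>G2-structures\<close>

text \<open>In the index type \<open>7\<close> the numeral \<open>7\<close> denotes \<open>0\<close>, so \<open>1, \<dots>, 7\<close> are its seven distinct
  elements.\<close>

definition G2_form :: "real^7^7 \<Rightarrow> (real^7) form" where
  "G2_form e = (\<lambda>vs.
       coframe_monomial e [1,2,3] vs
     + (coframe_monomial e [1,4,5] vs + coframe_monomial e [1,6,7] vs)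
     + (coframe_monomial e [2,4,6] vs - coframe_monomial e [2,5,7] vs)
     - (coframe_monomial e [3,4,7] vs + coframe_monomial e [3,5,6] vs))"

definition G2_coframe :: "(real^7) form \<Rightarrow> real^7^7 \<Rightarrow> bool" where
  "G2_coframe \<phi> e \<longleftrightarrow> invertible e \<and> \<phi> = G2_form e"

text \<open>The metric and volume form do not depend on the adapted coframe, since the stabiliser
  of the model 3-form is contained in SO(7).\<close>

definition G2_metric :: "(real^7) form \<Rightarrow> real^7^7" where
  "G2_metric \<phi> = (THE g. \<exists>e. G2_coframe \<phi> e \<and> g = transpose e ** e)"

definition G2_volume :: "(real^7) form \<Rightarrow> (real^7) form" where
  "G2_volume \<phi> =
     (THE vol. \<exists>e. G2_coframe \<phi> e \<and> vol = coframe_monomial e [1,2,3,4,5,6,7])"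

definition G2_structure :: "('a, 7) chart set \<Rightarrow> ('a, 7) form_field \<Rightarrow> bool" where
  "G2_structure M \<phi> \<longleftrightarrow> differential_form M 3 \<phi> \<and>
     (\<forall>c\<in>M. \<forall>x\<in>snd c ` fst c. \<exists>e. G2_coframe (\<phi> c x) e)"

text \<open>From here on, \<open>\<phi>\<close>, \<open>\<alpha>\<close>, \<open>\<theta>\<close> in the operators are representations in a single chart.\<close>

definition star ::
    "(real^7 \<Rightarrow> (real^7) form) \<Rightarrow> (real^7 \<Rightarrow> (real^7) form) \<Rightarrow> real^7 \<Rightarrow> (real^7) form" where
  "star \<phi> \<alpha> = (\<lambda>x. hodge (G2_metric (\<phi> x)) (G2_volume (\<phi> x)) (\<alpha> x))"

definition codifferential1 ::
    "(real^7 \<Rightarrow> (real^7) form) \<Rightarrow> (real^7 \<Rightarrow> (real^7) form) \<Rightarrow> real^7 \<Rightarrow> real" where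
  "codifferential1 \<phi> \<alpha> x = - star \<phi> (ext_d (star \<phi> \<alpha>)) x []"

definition intrinsic_torsion ::
    "('a, 7) chart set \<Rightarrow> ('a, 7) form_field \<Rightarrow> ('a \<Rightarrow> real) \<Rightarrow> ('a, 7) form_field \<Rightarrow>
     ('a, 7) form_field \<Rightarrow> ('a, 7) form_field \<Rightarrow> bool" where
  "intrinsic_torsion M \<phi> \<tau>\<^sub>0 \<tau>\<^sub>1 \<tau>\<^sub>2 \<tau>\<^sub>3 \<longleftrightarrow>
     smooth_function M \<tau>\<^sub>0 \<and> differential_form M 1 \<tau>\<^sub>1 \<and>
     differential_form M 2 \<tau>\<^sub>2 \<and> differential_form M 3 \<tau>\<^sub>3 \<and>
     (\<forall>c\<in>M. \<forall>p\<in>fst c. \<forall>vs. let x = snd c p in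
        wedge (\<tau>\<^sub>2 c x) (\<phi> c x) vs = - star (\<phi> c) (\<tau>\<^sub>2 c) x vs \<and>
        wedge (\<tau>\<^sub>3 c x) (\<phi> c x) vs = 0 \<and>
        wedge (\<tau>\<^sub>3 c x) (star (\<phi> c) (\<phi> c) x) vs = 0 \<and>
        ext_d (\<phi> c) x vs =
          \<tau>\<^sub>0 p * star (\<phi> c) (\<phi> c) x vs + 3 * wedge (\<tau>\<^sub>1 c x) (\<phi> c x) vs
          + star (\<phi> c) (\<tau>\<^sub>3 c) x vs \<and>
        ext_d (star (\<phi> c) (\<phi> c)) x vs =
          4 * wedge (\<tau>\<^sub>1 c x) (star (\<phi> c) (\<phi> c) x) vs + star (\<phi> c) (\<tau>\<^sub>2 c) x vs)"

definition lee_form :: "(real^7 \<Rightarrow> (real^7) form) \<Rightarrow> real^7 \<Rightarrow> (real^7) form" where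
  "lee_form \<tau>\<^sub>1 = (\<lambda>x vs. 4 * \<tau>\<^sub>1 x vs)"

text \<open>\<open>T = (1/6) \<star>(d\<phi> \<and> \<phi>) \<phi> - \<star>d\<phi> + \<star>(\<theta> \<and> \<phi>)\<close>\<close>

definition torsion_form ::
    "(real^7 \<Rightarrow> (real^7) form) \<Rightarrow> (real^7 \<Rightarrow> (real^7) form) \<Rightarrow> real^7 \<Rightarrow> (real^7) form" where
  "torsion_form \<phi> \<theta> = (\<lambda>x vs.
       1 / 6 * star \<phi> (\<lambda>y. wedge (ext_d \<phi> y) (\<phi> y)) x [] * \<phi> x vs
     - star \<phi> (ext_d \<phi>) x vs
     + star \<phi> (\<lambda>y. wedge (\<theta> y) (\<phi> y)) x vs)"

definition strong_G2T_structure ::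
    "('a, 7) chart set \<Rightarrow> ('a, 7) form_field \<Rightarrow> ('a \<Rightarrow> real) \<Rightarrow> ('a, 7) form_field \<Rightarrow>
     ('a, 7) form_field \<Rightarrow> ('a, 7) form_field \<Rightarrow> bool" where
  "strong_G2T_structure M \<phi> \<tau>\<^sub>0 \<tau>\<^sub>1 \<tau>\<^sub>2 \<tau>\<^sub>3 \<longleftrightarrow>
     G2_structure M \<phi> \<and> intrinsic_torsion M \<phi> \<tau>\<^sub>0 \<tau>\<^sub>1 \<tau>\<^sub>2 \<tau>\<^sub>3 \<and>
     vanishes M \<tau>\<^sub>2 \<and>
     vanishes M (\<lambda>c. ext_d (torsion_form (\<phi> c) (lee_form (\<tau>\<^sub>1 c))))"

end

theory Submission
  imports Defs
begin

text \<open>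
  A \<open>G\<^sub>2\<close>-structure with \<open>\<tau>\<^sub>2 = 0\<close> is parallel for the metric connection
  \<open>\<nabla>\<^sup>T = \<nabla> + T/2\<close> with skew torsion \<open>T\<close>: the deviation of the derivative of \<open>\<phi>\<close> from the action of
  the connection form lies in \<open>\<Lambda>\<^sup>1 \<otimes> \<Lambda>\<^sup>3\<^sub>7\<close> because \<open>\<phi>\<close> induces the metric, and its part there is
  determined by the prescribed \<open>d\<phi>\<close> and \<open>d\<star>\<phi>\<close>. Hence the curvature of \<open>\<nabla>\<^sup>T\<close> annihilates \<open>\<phi>\<close>,
  so its double trace is half of its contraction with \<open>\<psi> = \<star>\<phi>\<close>, and by the Bianchi identity and
  \<open>dT = 0\<close> that contraction is quadratic in \<open>T\<close>. Moreover \<open>\<star>\<tau>\<^sub>1 = - (T \<and> \<phi>)/4\<close>, so \<open>dT = 0\<close>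
  gives \<open>4 \<delta>\<tau>\<^sub>1\<close> as minus the pairing of \<open>T\<close> with \<open>\<star>d\<phi>\<close>, which is again quadratic in the torsion.
  Comparing the two quadratic expressions with \<open>|T|\<^sup>2\<close> eliminates \<open>|\<tau>\<^sub>3|\<^sup>2\<close> and yields the formula.
\<close>

section \<open>Multilinear and skew functions of argument lists\<close>

text \<open>An adapted coframe is only chosen pointwise, by \<open>SOME\<close>, and need not even
  be continuous. So the frame adapted at a point is frozen and used as a constant frame near it. It
  is orthonormal only at that point, hence derivatives of the inverse metric appear, and only
  quantities independent of the choice of coframe are differentiated. Their regularity is itself an
  issue, since the metric is given by a definite description: it is extracted from polynomials in
  \<phi> by division and a cube root.

  The deviation from parallelism vanishes by a count of representations. It is a 7 by 7 matrix, that
  is 1 + 27 + 7 + 14. Its alternation in the 4-forms, which are 1 + 7 + 27, detects all but the 14,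
  and the alternation in the 5-forms, which are 7 + 14, detects the rest.

  The parallel equation then holds on an open set, so the holonomy condition follows by
  differentiating it once more and exchanging the second derivatives of \<phi>; the Bianchi identity
  is replaced by symmetry properties of the partial derivatives under the pairing with
  \<psi>.\<close>

definition mlin :: "nat \<Rightarrow> 'v::real_vector form \<Rightarrow> bool" where
  "mlin k \<alpha> \<longleftrightarrow> (\<forall>xs ys. Suc (length xs + length ys) = k \<longrightarrow> linear (\<lambda>v. \<alpha> (xs @ v # ys)))"

text \<open>Only adjacent swaps are required, but in every length, so that fixing leading arguments
  preserves the notion. As the values are real, vanishing on repeated arguments follows.\<close>

definition skew :: "'v form \<Rightarrow> bool" where
  "skew \<alpha> \<longleftrightarrow> (\<forall>xs a b ys. \<alpha> (xs @ a # b # ys) = - \<alpha> (xs @ b # a # ys))"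

lemma mlinD: "mlin k \<alpha> \<Longrightarrow> Suc (length xs + length ys) = k \<Longrightarrow> linear (\<lambda>v. \<alpha> (xs @ v # ys))"
  unfolding mlin_def by blast

lemma mlinI: "(\<And>xs ys. Suc (length xs + length ys) = k \<Longrightarrow> linear (\<lambda>v. \<alpha> (xs @ v # ys))) \<Longrightarrow> mlin k \<alpha>"
  unfolding mlin_def by blast

lemma skewI: "(\<And>xs a b ys. \<alpha> (xs @ a # b # ys) = - \<alpha> (xs @ b # a # ys)) \<Longrightarrow> skew \<alpha>"
  unfolding skew_def by blast

lemma skewD: "skew \<alpha> \<Longrightarrow> \<alpha> (xs @ a # b # ys) = - \<alpha> (xs @ b # a # ys)"
  unfolding skew_def by blast

lemma mlin_Cons:
  assumes "mlin (Suc k) \<alpha>" shows "mlin k (\<lambda>l. \<alpha> (v # l))"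
proof (rule mlinI)
  fix xs ys :: "'a list" assume "Suc (length xs + length ys) = k"
  then show "linear (\<lambda>w. \<alpha> (v # xs @ w # ys))" using mlinD[OF assms, of "v # xs" ys] by simp
qed

lemma mlin_linear_Cons: "mlin (Suc k) \<alpha> \<Longrightarrow> length l = k \<Longrightarrow> linear (\<lambda>v. \<alpha> (v # l))"
  using mlinD[of "Suc k" \<alpha> "[]" l] by simp

lemma skew_Cons:
  assumes "skew \<alpha>" shows "skew (\<lambda>l. \<alpha> (v # l))"
proof (rule skewI)
  fix xs ys a b
  show "\<alpha> (v # xs @ a # b # ys) = - \<alpha> (v # xs @ b # a # ys)" using skewD[OF assms, of "v # xs" a b ys] by simp
qed

lemma skew_swap_hd: "skew \<alpha> \<Longrightarrow> \<alpha> (a # b # ys) = - \<alpha> (b # a # ys)"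
  using skewD[of \<alpha> "[]" a b ys] by simp

lemma skew_move: "skew \<alpha> \<Longrightarrow> \<alpha> (xs @ a # ys @ zs) = (-1) ^ length ys * \<alpha> (xs @ ys @ a # zs)"
proof (induction ys arbitrary: xs)
  case (Cons y ys)
  have "\<alpha> (xs @ a # (y # ys) @ zs) = - \<alpha> ((xs @ [y]) @ a # ys @ zs)"
    using skewD[OF Cons.prems, of xs a y "ys @ zs"] by simp
  then show ?case using Cons.IH[OF Cons.prems, of "xs @ [y]"] by simp
qed simp

text \<open>Moving one of two equal entries next to the other costs only a sign, and a value equal
  to its own negative is zero.\<close>

lemma skew_repeat: assumes "skew \<alpha>" "\<not> distinct vs" shows "\<alpha> vs = 0"
proof -
  obtain xs ys zs y where vs: "vs = xs @ [y] @ ys @ [y] @ zs"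
    using not_distinct_decomp[OF assms(2)] by blast
  have 1: "\<alpha> vs = (-1) ^ length ys * \<alpha> (xs @ ys @ y # y # zs)"
    unfolding vs using skew_move[OF assms(1), of xs y ys "y # zs"] by simp
  have "\<alpha> ((xs @ ys) @ y # y # zs) = - \<alpha> ((xs @ ys) @ y # y # zs)"
    by (rule skewD[OF assms(1)])
  then show ?thesis using 1 by simp
qed

lemma alternating_form_length: "alternating_form k \<alpha> \<Longrightarrow> length vs \<noteq> k \<Longrightarrow> \<alpha> vs = 0"
  unfolding alternating_form_def by blast

lemma alternating_form_repeat:
  "alternating_form k \<alpha> \<Longrightarrow> \<not> distinct vs \<Longrightarrow> \<alpha> vs = 0"
  unfolding alternating_form_def by blast

text \<open>In a length other than the degree the form is identically zero, hence linear in each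
  slot. So \<open>j\<close> is arbitrary, which spares degree bookkeeping later.\<close>

lemma alternating_form_mlin:
  assumes "alternating_form k \<alpha>" shows "mlin j \<alpha>"
  unfolding mlin_def
proof (intro allI impI)
  fix xs ys :: "'a list" assume j: "Suc (length xs + length ys) = j"
  show "linear (\<lambda>v. \<alpha> (xs @ v # ys))"
  proof (cases "j = k")
    case True
    have "linear (\<lambda>v. \<alpha> ((xs @ 0 # ys)[length xs := v]))"
      using assms[unfolded alternating_form_def, THEN conjunct2, THEN conjunct1, rule_format,
          of "xs @ 0 # ys" "length xs"] j True by simp
    then show ?thesis by simp
  next
    case False
    have "(\<lambda>v. \<alpha> (xs @ v # ys)) = (\<lambda>v. 0)"
      using j False by (intro ext alternating_form_length[OF assms]) simp
    then show ?thesis by (simp add: linear_iff)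
  qed
qed

text \<open>Polarisation of the vanishing on two equal adjacent arguments, applied to
  \<open>a + b\<close>.\<close>

lemma alternating_form_skew:
  assumes "alternating_form k \<alpha>" shows "skew \<alpha>"
  unfolding skew_def
proof (intro allI)
  fix xs ys :: "'a list" and a b
  have lin1: "linear (\<lambda>v. \<alpha> (xs @ v # c # ys))" for c
    using mlinD[OF alternating_form_mlin[OF assms], of xs "c # ys"] by simp
  have lin2: "linear (\<lambda>v. \<alpha> (xs @ c # v # ys))" for c
    using mlinD[OF alternating_form_mlin[OF assms], of "xs @ [c]" ys] by simp
  have z: "\<alpha> (xs @ c # c # ys) = 0" for c
    by (rule alternating_form_repeat[OF assms]) simp
  have "0 = \<alpha> (xs @ (a + b) # (a + b) # ys)" by (simp add: z)
  also have "\<dots> = \<alpha> (xs @ a # b # ys) + \<alpha> (xs @ b # a # ys)"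
    unfolding linear_add[OF lin1] linear_add[OF lin2] by (simp add: z)
  finally show "\<alpha> (xs @ a # b # ys) = - \<alpha> (xs @ b # a # ys)" by linarith
qed

lemma linear_cmult: "linear f \<Longrightarrow> linear (\<lambda>v. c * f v)" for f :: "'v::real_vector \<Rightarrow> real"
  using linear_compose_scale_right[of f c] by simp

lemma mlin_add: "mlin k \<alpha> \<Longrightarrow> mlin k \<beta> \<Longrightarrow> mlin k (\<lambda>l. \<alpha> l + \<beta> l)"
  by (rule mlinI, rule linear_compose_add) (rule mlinD; assumption)+

lemma mlin_cmult: "mlin k \<alpha> \<Longrightarrow> mlin k (\<lambda>l. c * \<alpha> l)"
  by (rule mlinI, rule linear_cmult) (rule mlinD; assumption)

lemma skew_add:
  assumes "skew \<alpha>" "skew \<beta>" shows "skew (\<lambda>l. \<alpha> l + \<beta> l)"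
proof (rule skewI)
  fix xs ys a b
  show "\<alpha> (xs @ a # b # ys) + \<beta> (xs @ a # b # ys) = - (\<alpha> (xs @ b # a # ys) + \<beta> (xs @ b # a # ys))"
    using skewD[OF assms(1), of xs a b ys] skewD[OF assms(2), of xs a b ys] by simp
qed

lemma skew_cmult:
  assumes "skew \<alpha>" shows "skew (\<lambda>l. c * \<alpha> l)"
proof (rule skewI)
  fix xs ys a b
  show "c * \<alpha> (xs @ a # b # ys) = - (c * \<alpha> (xs @ b # a # ys))"
    using skewD[OF assms, of xs a b ys] by simp
qed

section \<open>Wedge products, evaluated one argument at a time\<close>

lemma wedge_Nil: "wedge \<alpha> \<beta> [] = \<alpha> [] * \<beta> []"
  by (simp add: wedge_def)

text \<open>Splitting off the first argument: \<open>\<iota>\<^sub>v (\<alpha> \<and> \<beta>) = \<iota>\<^sub>v \<alpha> \<and> \<beta> + \<alpha>' \<and> \<iota>\<^sub>v \<beta>\<close>, where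
  \<open>\<alpha>'\<close> is the image of \<open>\<alpha>\<close> under the grading involution.\<close>

lemma wedge_Cons:
  "wedge \<alpha> \<beta> (v # vs) =
     wedge (\<lambda>l. \<alpha> (v # l)) \<beta> vs + wedge (\<lambda>l. (-1) ^ length l * \<alpha> l) (\<lambda>l. \<beta> (v # l)) vs"
proof -
  let ?n = "length vs"
  define inv where "inv n A = {(i, j). i \<in> A \<and> j \<in> {..<n} - A \<and> j < i}" for n and A :: "nat set"
  define F where "F A = (-1) ^ card (inv (Suc ?n) A) * \<alpha> (nths (v # vs) A) * \<beta> (nths (v # vs) (- A))" for A
  \<comment> \<open>The shuffles split according to whether position 0 is given to \<alpha> or to
    \<beta>; the remaining positions are shifted by one.\<close>
  have P: "Pow {..<Suc ?n} = (\<lambda>A. insert 0 (Suc ` A)) ` Pow {..<?n} \<union> (\<lambda>A. Suc ` A) ` Pow {..<?n}"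
    (is "_ = ?R")
  proof
    show "Pow {..<Suc ?n} \<subseteq> ?R"
    proof
      fix B assume B: "B \<in> Pow {..<Suc ?n}"
      let ?A = "{i. Suc i \<in> B}"
      have A: "?A \<in> Pow {..<?n}" using B by auto
      have "B = insert 0 (Suc ` ?A) \<or> B = Suc ` ?A"
      proof (cases "0 \<in> B")
        case True
        have "x \<in> insert 0 (Suc ` ?A)" if "x \<in> B" for x using that by (cases x) auto
        then show ?thesis using True by auto
      next
        case False
        have "x \<in> Suc ` ?A" if "x \<in> B" for x using that False by (cases x) auto
        then show ?thesis by auto
      qed
      then show "B \<in> ?R" using A by blast
    qed
    show "?R \<subseteq> Pow {..<Suc ?n}" by auto
  qed
  have inj1: "inj_on (\<lambda>A. insert 0 (Suc ` A)) (Pow {..<?n})"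
  proof (rule inj_onI)
    fix A B assume "insert 0 (Suc ` A) = insert 0 (Suc ` B)"
    then have "Suc ` A = Suc ` B" by (auto simp: insert_eq_iff)
    then show "A = B" by (simp add: inj_image_eq_iff)
  qed
  have inj2: "inj_on (\<lambda>A. Suc ` A) (Pow {..<?n})"
    by (simp add: inj_image_eq_iff inj_on_def)
  have disj: "(\<lambda>A. insert 0 (Suc ` A)) ` Pow {..<?n} \<inter> (\<lambda>A. Suc ` A) ` Pow {..<?n} = {}"
    by auto
  have i1: "inv (Suc ?n) (insert 0 (Suc ` A)) = map_prod Suc Suc ` inv ?n A" for A
  proof -
    have "(Suc i, j) \<in> map_prod Suc Suc ` {(i, j). i \<in> A \<and> j \<in> {..<?n} - A \<and> j < i}"
      if "i \<in> A" "j < Suc ?n" "j \<notin> Suc ` A" "j \<noteq> 0" "j < Suc i" for i j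
      using that by (cases j) (auto simp: image_iff)
    then show ?thesis unfolding inv_def by auto
  qed
  \<comment> \<open>When \<beta> receives position 0, each of the \<open>card A\<close> positions of
    \<alpha> forms one inversion with it; this is the sign of the grading involution.\<close>
  have i2: "inv (Suc ?n) (Suc ` A) = map_prod Suc Suc ` inv ?n A \<union> (\<lambda>i. (Suc i, 0)) ` A" for A
  proof -
    have "(Suc i, j) \<in> map_prod Suc Suc ` {(i, j). i \<in> A \<and> j \<in> {..<?n} - A \<and> j < i} \<union> (\<lambda>i. (Suc i, 0)) ` A"
      if "i \<in> A" "j < Suc ?n" "j \<notin> Suc ` A" "j < Suc i" for i j
      using that by (cases j) (auto simp: image_iff)
    then show ?thesis unfolding inv_def by auto
  qed
  have fin: "finite (inv ?n A)" if "A \<subseteq> {..<?n}" for A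
    by (rule finite_subset[of _ "{..<?n} \<times> {..<?n}"]) (use that in \<open>auto simp: inv_def\<close>)
  have cm: "card (map_prod Suc Suc ` S) = card S" for S
    by (rule card_image) (auto simp: inj_on_def)
  have c1: "card (inv (Suc ?n) (insert 0 (Suc ` A))) = card (inv ?n A)" for A
    unfolding i1 by (rule cm)
  have c2: "card (inv (Suc ?n) (Suc ` A)) = card (inv ?n A) + card A" if "A \<subseteq> {..<?n}" for A
  proof -
    have fA: "finite A" using that finite_subset by blast
    have "card (inv (Suc ?n) (Suc ` A)) = card (map_prod Suc Suc ` inv ?n A) + card ((\<lambda>i. (Suc i, 0::nat)) ` A)"
      unfolding i2 by (rule card_Un_disjoint) (use fin[OF that] fA in auto)
    also have "\<dots> = card (inv ?n A) + card A"
      by (simp add: cm card_image inj_on_def)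
    finally show ?thesis .
  qed
  have n1: "nths (v # vs) (insert 0 (Suc ` A)) = v # nths vs A"
    "nths (v # vs) (- insert 0 (Suc ` A)) = nths vs (- A)"
    "nths (v # vs) (Suc ` A) = nths vs A" "nths (v # vs) (- (Suc ` A)) = v # nths vs (- A)" for A
  proof -
    have "{j. Suc j \<in> insert 0 (Suc ` A)} = A" "{j. Suc j \<in> - insert 0 (Suc ` A)} = - A"
       "{j. Suc j \<in> Suc ` A} = A" "{j. Suc j \<in> - (Suc ` A)} = - A" by auto
    then show "nths (v # vs) (insert 0 (Suc ` A)) = v # nths vs A"
      "nths (v # vs) (- insert 0 (Suc ` A)) = nths vs (- A)"
      "nths (v # vs) (Suc ` A) = nths vs A" "nths (v # vs) (- (Suc ` A)) = v # nths vs (- A)"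
      unfolding nths_Cons by auto
  qed
  have len: "length (nths vs A) = card A" if "A \<subseteq> {..<?n}" for A
  proof -
    have "{i. i < ?n \<and> i \<in> A} = A" using that by auto
    then show ?thesis by (simp add: length_nths)
  qed
  have "wedge \<alpha> \<beta> (v # vs) = (\<Sum>A\<in>Pow {..<Suc ?n}. F A)"
    by (simp add: wedge_def F_def inv_def)
  also have "\<dots> = (\<Sum>A\<in>Pow {..<?n}. F (insert 0 (Suc ` A))) + (\<Sum>A\<in>Pow {..<?n}. F (Suc ` A))"
    unfolding P by (subst sum.union_disjoint[OF _ _ disj]) (simp_all add: sum.reindex[OF inj1] sum.reindex[OF inj2])
  also have "(\<Sum>A\<in>Pow {..<?n}. F (insert 0 (Suc ` A))) = wedge (\<lambda>l. \<alpha> (v # l)) \<beta> vs"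
    unfolding wedge_def F_def c1 n1 by (simp add: inv_def)
  also have "(\<Sum>A\<in>Pow {..<?n}. F (Suc ` A)) = wedge (\<lambda>l. (-1) ^ length l * \<alpha> l) (\<lambda>l. \<beta> (v # l)) vs"
    unfolding wedge_def
  proof (rule sum.cong[OF refl])
    fix A assume "A \<in> Pow {..<?n}"
    then have A: "A \<subseteq> {..<?n}" by simp
    show "F (Suc ` A) = (-1) ^ card {(i, j). i \<in> A \<and> j \<in> {..<?n} - A \<and> j < i} *
      ((-1) ^ length (nths vs A) * \<alpha> (nths vs A)) * \<beta> (v # nths vs (- A))"
      unfolding F_def c2[OF A] n1 len[OF A] by (simp add: inv_def power_add)
  qed
  finally show ?thesis .
qed

lemma wedge_cmult_left: "wedge (\<lambda>l. c * \<alpha> l) \<beta> vs = c * wedge \<alpha> \<beta> vs"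
  unfolding wedge_def sum_distrib_left by (rule sum.cong) simp_all

lemma wedge_cmult_right: "wedge \<alpha> (\<lambda>l. c * \<beta> l) vs = c * wedge \<alpha> \<beta> vs"
  unfolding wedge_def sum_distrib_left by (rule sum.cong) simp_all

lemma wedge_minus_left: "wedge (\<lambda>l. - \<alpha> l) \<beta> vs = - wedge \<alpha> \<beta> vs"
  using wedge_cmult_left[of "-1"] by simp

text \<open>Expands a wedge product on an explicit list by rewriting alone, without enumerating
  subsets and inversions. \<open>A\<close> and \<open>B\<close> collect the arguments already given
  to \<alpha> and \<beta>; an argument given to \<alpha> has to pass those held by \<beta>.\<close>

fun wedge_split :: "'v form \<Rightarrow> 'v form \<Rightarrow> real \<Rightarrow> 'v list \<Rightarrow> 'v list \<Rightarrow> 'v list \<Rightarrow> real" where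
  "wedge_split \<alpha> \<beta> s A B [] = s * (\<alpha> A * \<beta> B)"
| "wedge_split \<alpha> \<beta> s A B (v # vs) =
     wedge_split \<alpha> \<beta> ((-1) ^ length B * s) (A @ [v]) B vs + wedge_split \<alpha> \<beta> s A (B @ [v]) vs"

lemma wedge_split_eq:
  "wedge_split \<alpha> \<beta> s A B vs =
     s * wedge (\<lambda>l. (-1) ^ (length l * length B) * \<alpha> (A @ l)) (\<lambda>l. \<beta> (B @ l)) vs"
proof (induction vs arbitrary: s A B)
  case (Cons v vs)
  show ?case
    unfolding wedge_split.simps Cons.IH wedge_Cons
    by (simp add: power_add wedge_cmult_left[symmetric] mult_ac distrib_left)
qed (simp add: wedge_Nil)

lemma wedge_eq_split: "wedge \<alpha> \<beta> vs = wedge_split \<alpha> \<beta> 1 [] [] vs"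
  by (simp add: wedge_split_eq)

lemma linear_wedge_left:
  assumes "\<And>l. linear (\<lambda>v. A v l)" shows "linear (\<lambda>v. wedge (A v) \<beta> vs)"
proof -
  have "linear (\<lambda>v. c * A v l * d)" for c d l
    using linear_cmult[OF assms, of "c * d" l] by (simp add: mult_ac)
  then show ?thesis unfolding wedge_def by (intro linear_compose_sum ballI)
qed

lemma linear_wedge_right:
  assumes "\<And>l. linear (\<lambda>v. A v l)" shows "linear (\<lambda>v. wedge \<alpha> (A v) vs)"
  unfolding wedge_def by (intro linear_compose_sum ballI linear_cmult assms)

lemma mlin_all_Cons: "\<forall>k. mlin k \<alpha> \<Longrightarrow> \<forall>k. mlin k (\<lambda>l. \<alpha> (v # l))"
  using mlin_Cons by blast

lemma mlin_sign:
  assumes "\<forall>k. mlin k \<alpha>" shows "\<forall>k. mlin k (\<lambda>l. (-1) ^ length l * \<alpha> l)"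
proof (intro allI mlinI)
  fix k and xs ys :: "'a list" assume "Suc (length xs + length ys) = k"
  then have "linear (\<lambda>v. \<alpha> (xs @ v # ys))" using assms mlinD by blast
  from linear_cmult[OF this, of "(-1) ^ k"]
  show "linear (\<lambda>v. (-1) ^ length (xs @ v # ys) * \<alpha> (xs @ v # ys))"
    using \<open>Suc _ = k\<close> by simp
qed

lemma skew_sign:
  assumes "skew \<alpha>" shows "skew (\<lambda>l. (-1) ^ length l * \<alpha> l)"
proof (rule skewI)
  fix xs ys a b
  show "(-1) ^ length (xs @ a # b # ys) * \<alpha> (xs @ a # b # ys) =
      - ((-1) ^ length (xs @ b # a # ys) * \<alpha> (xs @ b # a # ys))"
    using skewD[OF assms, of xs a b ys] by simp
qed

text \<open>Multilinearity is assumed in all lengths at once because the shuffles distribute the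
  arguments over the two factors in every possible proportion.\<close>

lemma mlin_wedge:
  assumes "\<forall>k. mlin k \<alpha>" "\<forall>k. mlin k \<beta>" shows "mlin j (wedge \<alpha> \<beta>)"
proof -
  have "linear (\<lambda>v. wedge \<alpha> \<beta> (xs @ v # ys))" for xs ys
    using assms
  proof (induction xs arbitrary: \<alpha> \<beta>)
    case Nil
    have "\<forall>k. mlin k (\<lambda>l. (-1) ^ length l * \<alpha> l)" using Nil.prems(1) by (rule mlin_sign)
    show ?case unfolding append_Nil wedge_Cons
      by (intro linear_compose_add linear_wedge_left linear_wedge_right)
         (use Nil.prems mlin_linear_Cons in blast)+
  next
    case (Cons x xs)
    show ?case unfolding append_Cons wedge_Cons
      by (intro linear_compose_add Cons.IH)
         (use Cons.prems mlin_all_Cons mlin_sign in blast)+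
  qed
  then show ?thesis unfolding mlin_def by blast
qed

lemma skew_wedge:
  assumes "skew \<alpha>" "skew \<beta>" shows "skew (wedge \<alpha> \<beta>)"
proof -
  have "wedge \<alpha> \<beta> (xs @ a # b # ys) = - wedge \<alpha> \<beta> (xs @ b # a # ys)" for xs a b ys
    using assms
  proof (induction xs arbitrary: \<alpha> \<beta>)
    case Nil
    have 1: "(\<lambda>l. \<alpha> (a # b # l)) = (\<lambda>l. - \<alpha> (b # a # l))"
      "(\<lambda>l. \<beta> (a # b # l)) = (\<lambda>l. - \<beta> (b # a # l))"
      using skew_swap_hd[OF Nil(1)] skew_swap_hd[OF Nil(2)] by blast+
    have 2: "wedge (\<lambda>l. - f l) g ys = - wedge f g ys" "wedge f (\<lambda>l. - g l) ys = - wedge f g ys" for f g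
      using wedge_cmult_left[of "-1" f g ys] wedge_cmult_right[of f "-1" g ys] by simp_all
    \<comment> \<open>After splitting off both vectors, the terms with both in one factor change
      sign by skewness of that factor. The two mixed terms are exchanged, and the powers of -1 give
      them opposite signs.\<close>
    show ?case
      unfolding append_Nil wedge_Cons 1 by (simp add: 2)
  next
    case (Cons x xs)
    show ?case unfolding append_Cons wedge_Cons
      using Cons.IH[OF skew_Cons[OF Cons.prems(1)] Cons.prems(2), of x]
        Cons.IH[OF skew_sign[OF Cons.prems(1)] skew_Cons[OF Cons.prems(2)], of x] by simp
  qed
  then show ?thesis unfolding skew_def by blast
qed

section \<open>Sums over index lists\<close>

lemma sum_lists_Suc:
  "(\<Sum>is | length is = Suc k. f is) = (\<Sum>i\<in>UNIV. \<Sum>is | length is = k. f (i # is))"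
  for f :: "'n::finite list \<Rightarrow> 'b::comm_monoid_add"
proof -
  have "{is :: 'n list. length is = Suc k} = (\<lambda>(i, is). i # is) ` (UNIV \<times> {is. length is = k})"
    by (auto simp: length_Suc_conv image_iff)
  then show ?thesis
    by (simp add: sum.reindex inj_on_def sum.cartesian_product split_def)
qed

lemma sum_lists_append:
  "(\<Sum>is | length is = j + k. f is) = (\<Sum>is | length is = j. \<Sum>js | length js = k. f (is @ js))"
  for f :: "'n::finite list \<Rightarrow> 'b::comm_monoid_add"
  by (induction j arbitrary: f) (simp_all add: sum_lists_Suc)

lemma linear_sum_scale:
  fixes F :: "'v::real_vector \<Rightarrow> real"
  assumes "linear F" shows "F (\<Sum>a\<in>S. c a *\<^sub>R p a) = (\<Sum>a\<in>S. c a * F (p a))"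
  using assms by (simp add: linear_sum linear_scale)

text \<open>A sum over all index lists of a product of two multilinear expressions does not depend on the
  basis if the two families of arguments transform contragrediently.\<close>

lemma sum_lists_change_basis:
  fixes P Q p q :: "'n::finite \<Rightarrow> 'v::real_vector"
  assumes "mlin k \<beta>" "mlin k \<gamma>"
    and P: "\<And>i. P i = (\<Sum>a\<in>UNIV. M i a *\<^sub>R p a)"
    and q: "\<And>a. q a = (\<Sum>i\<in>UNIV. M i a *\<^sub>R Q i)"
  shows "(\<Sum>is | length is = k. \<beta> (map P is) * \<gamma> (map Q is)) =
         (\<Sum>as | length as = k. \<beta> (map p as) * \<gamma> (map q as))"
  using assms(1,2)
proof (induction k arbitrary: \<beta> \<gamma>)
  case (Suc k)
  have b: "\<beta> (P i # map P is) = (\<Sum>a\<in>UNIV. M i a * \<beta> (p a # map P is))" if "length is = k" for i "is"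
    unfolding P by (rule linear_sum_scale[OF mlin_linear_Cons[OF Suc.prems(1)]]) (simp add: that)
  have g: "\<gamma> (q a # map Q is) = (\<Sum>i\<in>UNIV. M i a * \<gamma> (Q i # map Q is))" if "length is = k" for a "is"
    unfolding q by (rule linear_sum_scale[OF mlin_linear_Cons[OF Suc.prems(2)]]) (simp add: that)
  have "(\<Sum>is | length is = Suc k. \<beta> (map P is) * \<gamma> (map Q is)) =
     (\<Sum>is | length is = k. \<Sum>i\<in>UNIV. \<beta> (P i # map P is) * \<gamma> (Q i # map Q is))"
    unfolding sum_lists_Suc by (subst sum.swap) simp
  also have "\<dots> = (\<Sum>is | length is = k. \<Sum>i\<in>UNIV. \<Sum>a\<in>UNIV. M i a * \<beta> (p a # map P is) * \<gamma> (Q i # map Q is))"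
    by (intro sum.cong refl) (simp add: b sum_distrib_right)
  also have "\<dots> = (\<Sum>is | length is = k. \<Sum>a\<in>UNIV. \<beta> (p a # map P is) * \<gamma> (q a # map Q is))"
  proof (rule sum.cong[OF refl])
    fix "is" :: "'n list" assume "is \<in> {is. length is = k}"
    then show "(\<Sum>i\<in>UNIV. \<Sum>a\<in>UNIV. M i a * \<beta> (p a # map P is) * \<gamma> (Q i # map Q is)) =
          (\<Sum>a\<in>UNIV. \<beta> (p a # map P is) * \<gamma> (q a # map Q is))"
      by (subst sum.swap) (simp add: g sum_distrib_left mult_ac)
  qed
  also have "\<dots> = (\<Sum>a\<in>UNIV. \<Sum>is | length is = k. \<beta> (p a # map P is) * \<gamma> (q a # map Q is))"
    by (rule sum.swap)
  also have "\<dots> = (\<Sum>a\<in>UNIV. \<Sum>is | length is = k. \<beta> (p a # map p is) * \<gamma> (q a # map q is))"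
    by (intro sum.cong refl Suc.IH mlin_Cons Suc.prems)
  also have "\<dots> = (\<Sum>as | length as = Suc k. \<beta> (map p as) * \<gamma> (map q as))"
    by (simp add: sum_lists_Suc)
  finally show ?case .
qed simp

text \<open>Adjacent swaps generate all permutations: the head of the first list is carried to the
  front of the second, and the induction continues with the tails.\<close>

lemma adjacent_swap_invariant:
  assumes "\<And>xs a b ys. h (xs @ a # b # ys) = h (xs @ b # a # ys)" and "mset is = mset js"
  shows "h is = h js"
  using assms
proof (induction "is" arbitrary: js h)
  case (Cons x "is")
  then have "x \<in> set js" by (metis list.set_intros(1) mset_eq_setD)
  then obtain us vs where js: "js = us @ x # vs" by (meson split_list)
  have mv: "h (us @ x # vs) = h (x # us @ vs)" for us
  proof (induction us arbitrary: vs rule: rev_induct)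
    case (snoc u us)
    have "h ((us @ [u]) @ x # vs) = h (us @ x # u # vs)"
      using Cons.prems(1)[of us u x vs] by simp
    then show ?case using snoc[of "u # vs"] by simp
  qed simp
  have "h (x # is) = h (x # us @ vs)"
  proof (rule Cons.IH[of "\<lambda>l. h (x # l)"])
    show "h (x # xs @ a # b # ys) = h (x # xs @ b # a # ys)" for xs a b ys
      using Cons.prems(1)[of "x # xs" a b ys] by simp
  qed (use Cons.prems(2) js in simp)
  then show ?case using mv js by simp
qed simp

lemma skew_append:
  assumes "skew \<beta>" shows "skew (\<lambda>l. \<beta> (l @ J))"
proof (rule skewI)
  fix xs ys a b
  show "\<beta> ((xs @ a # b # ys) @ J) = - \<beta> ((xs @ b # a # ys) @ J)"
    using skewD[OF assms, of xs a b "ys @ J"] by simp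
qed

text \<open>The product of two skew expressions is symmetric, so in the sum over index lists only one
  representative of each set of indices matters.\<close>

lemma sum_lists_skew:
  fixes \<alpha> \<beta> :: "'n::finite list \<Rightarrow> real"
  assumes "skew \<alpha>" "skew \<beta>" and I: "distinct I" "set I = - set J" "length I = k" and J: "distinct J"
  shows "(\<Sum>is | length is = k. \<alpha> is * \<beta> (is @ J)) = fact k * (\<alpha> I * \<beta> (I @ J))"
proof -
  have sk: "skew (\<lambda>l. \<beta> (l @ J))" by (rule skew_append[OF assms(2)])
  let ?S = "{is. distinct is \<and> set is = set I}"
  have S: "?S \<subseteq> {is. length is = k}" using I(1,3) by (auto simp: distinct_card[symmetric])
  have "(\<Sum>is | length is = k. \<alpha> is * \<beta> (is @ J)) = (\<Sum>is\<in>?S. \<alpha> is * \<beta> (is @ J))"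
  proof (rule sum.mono_neutral_right[OF _ S])
    show "finite {is :: 'n list. length is = k}"
      using finite_lists_length_eq[of "UNIV :: 'n set" k] by simp
    show "\<forall>is\<in>{is. length is = k} - ?S. \<alpha> is * \<beta> (is @ J) = 0"
    proof
      fix "is" assume "is \<in> {is. length is = k} - ?S"
      then have a: "length is = k" "\<not> (distinct is \<and> set is = set I)" by blast+
      \<comment> \<open>Otherwise \<open>is\<close> would enumerate the complement of
        \<open>J\<close>, which is \<open>set I\<close>.\<close>
      have "\<not> distinct (is @ J)"
      proof
        assume d: "distinct (is @ J)"
        then have d': "distinct is" by simp
        have "set is = set I"
        proof (rule card_subset_eq)
          show "set is \<subseteq> set I" using d I(2) by auto
          show "card (set is) = card (set I)"
            using a(1) d' I(1,3) by (metis distinct_card)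
        qed simp
        then show False using a(2) d' by blast
      qed
      then show "\<alpha> is * \<beta> (is @ J) = 0" using skew_repeat[OF assms(2)] by simp
    qed
  qed
  also have "\<dots> = (\<Sum>is\<in>?S. \<alpha> I * \<beta> (I @ J))"
  proof (rule sum.cong[OF refl])
    fix "is" assume "is \<in> ?S"
    then have "mset is = mset I" using I(1) set_eq_iff_mset_eq_distinct by blast
    moreover have "\<alpha> (xs @ a # b # ys) * \<beta> ((xs @ a # b # ys) @ J) =
        \<alpha> (xs @ b # a # ys) * \<beta> ((xs @ b # a # ys) @ J)" for xs a b ys
      unfolding skewD[OF assms(1), of xs a b ys] skewD[OF sk, of xs a b ys] by simp
    ultimately show "\<alpha> is * \<beta> (is @ J) = \<alpha> I * \<beta> (I @ J)"
      by (rule adjacent_swap_invariant[where h="\<lambda>is. \<alpha> is * \<beta> (is @ J)", rotated])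
  qed
  also have "\<dots> = fact k * (\<alpha> I * \<beta> (I @ J))"
  proof -
    have cI: "card (set I) = k" using I(1,3) distinct_card by blast
    have "distinct xs \<and> set xs = set I \<longleftrightarrow> length xs = k \<and> distinct xs \<and> set xs \<subseteq> set I" for xs
    proof
      assume "distinct xs \<and> set xs = set I"
      then show "length xs = k \<and> distinct xs \<and> set xs \<subseteq> set I"
        using distinct_card[of xs] cI by auto
    next
      assume a: "length xs = k \<and> distinct xs \<and> set xs \<subseteq> set I"
      then have "card (set xs) = card (set I)" using distinct_card[of xs] cI by auto
      then show "distinct xs \<and> set xs = set I" using a by (metis card_subset_eq List.finite_set)
    qed
    then have "card ?S = card {xs. length xs = k \<and> distinct xs \<and> set xs \<subseteq> set I}" by simp
    also have "\<dots> = fact k"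
      using card_lists_distinct_length_eq[of "set I" k] cI by (simp add: fact_prod)
    finally have "card ?S = fact k" .
    then show ?thesis by simp
  qed
  finally show ?thesis .
qed

lemma skew_map:
  assumes "skew \<alpha>" shows "skew (\<lambda>is. \<alpha> (map f is))"
proof (rule skewI)
  fix xs ys a b
  show "\<alpha> (map f (xs @ a # b # ys)) = - \<alpha> (map f (xs @ b # a # ys))"
    using skewD[OF assms, of "map f xs" "f a" "f b" "map f ys"] by simp
qed

lemma skew_append_left:
  assumes "skew \<beta>" shows "skew (\<lambda>l. \<beta> (J @ l))"
proof (rule skewI)
  fix xs ys a b
  show "\<beta> (J @ xs @ a # b # ys) = - \<beta> (J @ xs @ b # a # ys)"
    using skewD[OF assms, of "J @ xs" a b ys] by simp
qed

lemma mlin_append_right: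
  assumes "mlin (j + length J) \<beta>" shows "mlin j (\<lambda>l. \<beta> (l @ J))"
proof (rule mlinI)
  fix xs ys :: "'a list" assume "Suc (length xs + length ys) = j"
  then show "linear (\<lambda>v. \<beta> ((xs @ v # ys) @ J))" using mlinD[OF assms, of xs "ys @ J"] by simp
qed

section \<open>The exterior derivative on constant vector fields\<close>

lemma ext_d_Nil: "ext_d \<alpha> x [] = 0"
  by (simp add: ext_d_def)

text \<open>Cartan's formula for a constant vector field \<open>v\<close>, whose Lie derivative is
  the plain directional derivative of the components.\<close>

lemma ext_d_Cons:
  assumes "\<And>vs. (\<lambda>y. \<alpha> y vs) differentiable (at x)"
  shows "ext_d \<alpha> x (v # vs) =
    frechet_derivative (\<lambda>y. \<alpha> y vs) (at x) v - ext_d (\<lambda>y l. \<alpha> y (v # l)) x vs"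
  unfolding ext_d_def length_Cons sum.lessThan_Suc_shift by (simp add: sum_negf)

lemma frechet_derivativeI: "(f has_derivative f') (at x) \<Longrightarrow> frechet_derivative f (at x) v = f' v"
  using frechet_derivative_at by fastforce

lemma frechet_derivative_add:
  assumes "f differentiable (at x)" "g differentiable (at x)"
  shows "frechet_derivative (\<lambda>y. f y + g y) (at x) v =
    frechet_derivative f (at x) v + frechet_derivative g (at x) v"
  using assms by (intro frechet_derivativeI has_derivative_add) (simp_all flip: frechet_derivative_works)

lemma frechet_derivative_cmult:
  fixes f :: "'a::real_normed_vector \<Rightarrow> real"
  assumes "f differentiable (at x)"
  shows "frechet_derivative (\<lambda>y. c * f y) (at x) v = c * frechet_derivative f (at x) v"
  using assms by (intro frechet_derivativeI has_derivative_mult_right) (simp_all flip: frechet_derivative_works)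

lemma frechet_derivative_minus:
  fixes f :: "'a::real_normed_vector \<Rightarrow> real"
  assumes "f differentiable (at x)"
  shows "frechet_derivative (\<lambda>y. - f y) (at x) v = - frechet_derivative f (at x) v"
  using frechet_derivative_cmult[OF assms, of "-1"] by simp

lemma frechet_derivative_diff:
  assumes "f differentiable (at x)" "g differentiable (at x)"
  shows "frechet_derivative (\<lambda>y. f y - g y) (at x) v =
    frechet_derivative f (at x) v - frechet_derivative g (at x) v"
  using assms by (intro frechet_derivativeI has_derivative_diff) (simp_all flip: frechet_derivative_works)

lemma frechet_derivative_mult:
  fixes f g :: "'a::real_normed_vector \<Rightarrow> real"
  assumes "f differentiable (at x)" "g differentiable (at x)"
  shows "frechet_derivative (\<lambda>y. f y * g y) (at x) v =
    f x * frechet_derivative g (at x) v + frechet_derivative f (at x) v * g x"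
  using assms by (intro frechet_derivativeI has_derivative_mult) (simp_all flip: frechet_derivative_works)

lemma frechet_derivative_sum:
  assumes "\<And>i. i \<in> I \<Longrightarrow> f i differentiable (at x)"
  shows "frechet_derivative (\<lambda>y. \<Sum>i\<in>I. f i y) (at x) v = (\<Sum>i\<in>I. frechet_derivative (f i) (at x) v)"
  using assms by (intro frechet_derivativeI has_derivative_sum) (simp_all flip: frechet_derivative_works)

text \<open>Linearity in the parameter is an identity that gets differentiated in \<open>y\<close>,
  so it is assumed on a neighbourhood and not only at \<open>x\<close>.\<close>

lemma linear_frechet_derivative_family:
  fixes A :: "'v::real_vector \<Rightarrow> 'a::real_normed_vector \<Rightarrow> real"
  assumes "\<And>y. y \<in> U \<Longrightarrow> linear (\<lambda>v. A v y)" "\<And>v. A v differentiable (at x)" "open U" "x \<in> U"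
  shows "linear (\<lambda>v. frechet_derivative (A v) (at x) w)"
proof (rule linearI)
  fix u v c
  have "frechet_derivative (A (u + v)) (at x) = frechet_derivative (\<lambda>y. A u y + A v y) (at x)"
    by (rule frechet_derivative_transform_within_open[OF assms(2-4)]) (use assms(1) linear_add in blast)
  then show "frechet_derivative (A (u + v)) (at x) w =
    frechet_derivative (A u) (at x) w + frechet_derivative (A v) (at x) w"
    using frechet_derivative_add[OF assms(2,2)] by simp
  have "frechet_derivative (A (c *\<^sub>R v)) (at x) = frechet_derivative (\<lambda>y. c * A v y) (at x)"
    by (rule frechet_derivative_transform_within_open[OF assms(2-4)])
       (use assms(1) linear_scale in \<open>fastforce simp: linear_scale\<close>)
  then show "frechet_derivative (A (c *\<^sub>R v)) (at x) w = c *\<^sub>R frechet_derivative (A v) (at x) w"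
    using frechet_derivative_cmult[OF assms(2)] by simp
qed

lemma mlin_ext_d:
  fixes \<alpha> :: "'v::real_normed_vector \<Rightarrow> 'v form"
  assumes "\<And>y k. y \<in> U \<Longrightarrow> mlin k (\<alpha> y)" "\<And>vs. (\<lambda>y. \<alpha> y vs) differentiable (at x)" "open U" "x \<in> U"
  shows "mlin j (ext_d \<alpha> x)"
proof -
  have "linear (\<lambda>v. ext_d \<alpha> x (xs @ v # ys))" for xs ys
    using assms(1,2)
  proof (induction xs arbitrary: \<alpha>)
    case Nil
    have "linear (\<lambda>v. ext_d (\<lambda>y l. \<alpha> y (v # l)) x ys)"
      unfolding ext_d_def
    proof (intro linear_compose_sum ballI)
      fix i
      have "linear (\<lambda>v. frechet_derivative (\<lambda>y. \<alpha> y (v # take i ys @ drop (Suc i) ys)) (at x) (ys ! i))"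
        by (rule linear_frechet_derivative_family[OF _ _ assms(3,4)])
           (use Nil mlin_linear_Cons in blast)+
      then show "linear (\<lambda>v. (-1) ^ i * frechet_derivative (\<lambda>y. \<alpha> y (v # take i ys @ drop (Suc i) ys)) (at x) (ys !
          i))"
        by (rule linear_cmult)
    qed
    moreover have "linear (frechet_derivative (\<lambda>y. \<alpha> y ys) (at x))"
      by (rule linear_frechet_derivative[OF Nil(2)])
    ultimately show ?case unfolding append_Nil ext_d_Cons[OF Nil(2)]
      by (rule linear_compose_sub[rotated])
  next
    case (Cons u xs)
    have "linear (\<lambda>v. ext_d (\<lambda>y l. \<alpha> y (u # l)) x (xs @ v # ys))"
      by (rule Cons.IH) (use Cons.prems mlin_Cons in blast)+
    moreover have "linear (\<lambda>v. frechet_derivative (\<lambda>y. \<alpha> y (xs @ v # ys)) (at x) u)"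
      by (rule linear_frechet_derivative_family[OF _ _ assms(3,4)]) (use Cons.prems mlinD in blast)+
    ultimately show ?case unfolding append_Cons ext_d_Cons[OF Cons.prems(2)]
      by (rule linear_compose_sub[rotated])
  qed
  then show ?thesis unfolding mlin_def by blast
qed

lemma skew_ext_d:
  fixes \<alpha> :: "'v::real_normed_vector \<Rightarrow> 'v form"
  assumes "\<And>y. y \<in> U \<Longrightarrow> skew (\<alpha> y)" "\<And>vs. (\<lambda>y. \<alpha> y vs) differentiable (at x)" "open U" "x \<in> U"
  shows "skew (ext_d \<alpha> x)"
proof -
  have tr: "frechet_derivative f (at x) v = - frechet_derivative g (at x) v"
    if "f differentiable (at x)" "g differentiable (at x)" "\<And>y. y \<in> U \<Longrightarrow> f y = - g y"
    for f g :: "'v \<Rightarrow> real" and v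
    using frechet_derivative_transform_within_open[OF that(1) assms(3,4) that(3)]
      frechet_derivative_minus[OF that(2)] by simp
  have "ext_d \<alpha> x (xs @ a # b # ys) = - ext_d \<alpha> x (xs @ b # a # ys)" for xs a b ys
    using assms(1,2)
  proof (induction xs arbitrary: \<alpha>)
    case Nil
    \<comment> \<open>The two directional derivatives split off by \<open>ext_d_Cons\<close> are
      exchanged with opposite signs under the swap. What remains contains both vectors as arguments
      of the form and changes sign with it.\<close>
    have "ext_d (\<lambda>y l. \<alpha> y (a # b # l)) x ys = - ext_d (\<lambda>y l. \<alpha> y (b # a # l)) x ys"
      unfolding ext_d_def sum_negf[symmetric]
      by (intro sum.cong refl) (subst tr[OF Nil(2) Nil(2) skew_swap_hd[OF Nil(1)]], simp_all)
    then show ?case by (simp add: ext_d_Cons[OF Nil(2)])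
  next
    case (Cons u xs)
    have "ext_d (\<lambda>y l. \<alpha> y (u # l)) x (xs @ a # b # ys) = - ext_d (\<lambda>y l. \<alpha> y (u # l)) x (xs @ b # a # ys)"
      by (rule Cons.IH) (rule Cons.prems(2) | rule skew_Cons, erule Cons.prems(1))+
    moreover have "frechet_derivative (\<lambda>y. \<alpha> y (xs @ a # b # ys)) (at x) u =
        - frechet_derivative (\<lambda>y. \<alpha> y (xs @ b # a # ys)) (at x) u"
      by (rule tr[OF Cons.prems(2) Cons.prems(2)]) (rule skewD, erule Cons.prems(1))
    ultimately show ?case by (simp add: ext_d_Cons[OF Cons.prems(2)])
  qed
  then show ?thesis unfolding skew_def by blast
qed

section \<open>The model forms on Euclidean 7-space\<close>

lemma exhaust_7: fixes x :: 7
  shows "x = 1 \<or> x = 2 \<or> x = 3 \<or> x = 4 \<or> x = 5 \<or> x = 6 \<or> x = 7"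
proof (induct x)
  case (of_int z)
  then have "z = 0 \<or> z = 1 \<or> z = 2 \<or> z = 3 \<or> z = 4 \<or> z = 5 \<or> z = 6" by fastforce
  then show ?case by auto
qed

lemma forall_7: "(\<forall>i::7. P i) \<longleftrightarrow> P 1 \<and> P 2 \<and> P 3 \<and> P 4 \<and> P 5 \<and> P 6 \<and> P 7"
  by (metis exhaust_7)

lemma UNIV_7: "(UNIV :: 7 set) = {1, 2, 3, 4, 5, 6, 7}"
  using exhaust_7 by auto

lemma sum_7: "sum f (UNIV :: 7 set) = f 1 + f 2 + f 3 + f 4 + f 5 + f 6 + f 7"
  unfolding UNIV_7 by (simp add: ac_simps)

lemma covector_form_Nil: "covector_form a [] = 0"
  and covector_form_Cons: "covector_form a (v # vs) = (if vs = [] then a v else 0)"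
  and covector_form_length: "length vs \<noteq> 1 \<Longrightarrow> covector_form a vs = 0"
  by (auto simp: covector_form_def split: list.splits)

lemma mlin_covector_form: "linear a \<Longrightarrow> mlin k (covector_form a)"
proof (rule mlinI)
  fix xs ys :: "'a list" assume "linear a"
  have "(\<lambda>v. covector_form a (xs @ v # ys)) = (if xs = [] \<and> ys = [] then a else (\<lambda>v. 0))"
    by (auto simp: fun_eq_iff covector_form_length covector_form_Cons)
  then show "linear (\<lambda>v. covector_form a (xs @ v # ys))"
    using \<open>linear a\<close> by (simp add: module_hom_zero)
qed

lemma skew_covector_form: "skew (covector_form a)"
  by (rule skewI) (simp add: covector_form_length)

lemma mlin_unit_form: "mlin k (unit_form :: 'v::real_vector form)"
proof (rule mlinI)
  fix xs ys :: "'v list"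
  have "(\<lambda>v. unit_form (xs @ v # ys)) = (\<lambda>v. 0)" by (auto simp: unit_form_def)
  then show "linear (\<lambda>v. unit_form (xs @ v # ys))" by (simp add: module_hom_zero)
qed

lemma skew_unit_form: "skew unit_form"
  by (rule skewI) (simp add: unit_form_def)

lemma coframe_monomial_Nil: "coframe_monomial e [] = unit_form"
  and coframe_monomial_Cons: "coframe_monomial e (i # is) =
    wedge (covector_form (\<lambda>v. (e *v v) $ i)) (coframe_monomial e is)"
  by (simp_all add: coframe_monomial_def)

lemma linear_coordinate: "linear (\<lambda>v. (e *v v) $ i)" for e :: "real^'n^'m"
  by (simp add: linear_iff matrix_vector_right_distrib matrix_vector_mult_scaleR)

lemma mlin_coframe_monomial: "mlin k (coframe_monomial e is)"
proof (induction "is" arbitrary: k)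
  case (Cons i "is")
  then show ?case unfolding coframe_monomial_Cons
    by (intro mlin_wedge allI mlin_covector_form linear_coordinate)
qed (simp add: coframe_monomial_Nil mlin_unit_form)

lemma skew_coframe_monomial: "skew (coframe_monomial e is)"
  by (induction "is")
     (simp_all add: coframe_monomial_Nil skew_unit_form coframe_monomial_Cons skew_wedge skew_covector_form)

lemma wedge_map: "wedge \<alpha> \<beta> (map L vs) = wedge (\<lambda>l. \<alpha> (map L l)) (\<lambda>l. \<beta> (map L l)) vs"
  unfolding wedge_def by (simp add: nths_map)

lemma coframe_monomial_map:
  "coframe_monomial e is vs = coframe_monomial (mat 1) is (map ((*v) e) vs)"
proof (induction "is" arbitrary: vs)
  case Nil
  then show ?case by (simp add: coframe_monomial_Nil unit_form_def)
next
  case (Cons i "is")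
  have 1: "covector_form (\<lambda>v. (e *v v) $ i) = (\<lambda>l. covector_form (\<lambda>v. (mat 1 *v v) $ i) (map ((*v) e) l))"
    by (auto simp: covector_form_def split: list.splits)
  have 2: "coframe_monomial e is = (\<lambda>l. coframe_monomial (mat 1) is (map ((*v) e) l))"
    using Cons.IH by blast
  show ?case unfolding coframe_monomial_Cons wedge_map
    by (subst 1, subst 2, rule refl)
qed

lemma wedge_zero_left: "wedge (\<lambda>l. 0) \<beta> vs = 0"
  by (simp add: wedge_def)

lemma wedge_unit_form_left: "wedge unit_form \<beta> vs = \<beta> vs"
proof (induction vs arbitrary: \<beta>)
  case (Cons v vs)
  have 1: "(\<lambda>l. unit_form (v # l)) = (\<lambda>l. 0)"
    "(\<lambda>l. (-1) ^ length l * unit_form l) = unit_form"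
    by (auto simp: unit_form_def)
  show ?case unfolding wedge_Cons 1 by (simp add: wedge_zero_left Cons.IH)
qed (simp add: wedge_Nil unit_form_def)

lemma wedge_covector_Cons: "wedge (covector_form a) \<beta> (v # vs) =
    a v * \<beta> vs - wedge (covector_form a) (\<lambda>l. \<beta> (v # l)) vs"
proof -
  have 1: "(\<lambda>l. covector_form a (v # l)) = (\<lambda>l. a v * unit_form l)"
    "(\<lambda>l. (-1) ^ length l * covector_form a l) = (\<lambda>l. - covector_form a l)"
    by (auto simp: unit_form_def covector_form_def fun_eq_iff split: list.splits)
  show ?thesis unfolding wedge_Cons 1
    by (simp add: wedge_cmult_left wedge_unit_form_left wedge_minus_left)
qed

text \<open>The second argument collects the vectors that have been passed over.\<close>

fun dual_monomial :: "'n list \<Rightarrow> 'n list \<Rightarrow> 'n list \<Rightarrow> real" where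
  "dual_monomial [] pre js = (if pre = [] \<and> js = [] then 1 else 0)"
| "dual_monomial (i # is) pre [] = 0"
| "dual_monomial (i # is) pre (j # js) =
    (if i = j then (-1) ^ length pre * dual_monomial is [] (pre @ js) + dual_monomial (i # is) (pre @ [j]) js
     else dual_monomial (i # is) (pre @ [j]) js)"

lemma coframe_monomial_axis:
  "coframe_monomial (mat 1) is (map (\<lambda>i. axis i 1) js) = dual_monomial is [] js"
proof (induction "is" arbitrary: js)
  case Nil
  then show ?case by (simp add: coframe_monomial_Nil unit_form_def)
next
  case (Cons i "is")
  let ?a = "\<lambda>v. (mat 1 *v v) $ i" and ?X = "\<lambda>i. axis i (1::real)"
  have "(-1) ^ length pre * wedge (covector_form ?a) (\<lambda>l. coframe_monomial (mat 1) is (map ?X pre @ l)) (map ?X js)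
      = dual_monomial (i # is) pre js" for pre
  proof (induction js arbitrary: pre)
    case Nil
    then show ?case by (simp add: wedge_Nil covector_form_Nil)
  next
    case (Cons j js)
    show ?case
      using Cons.IH[of "pre @ [j]"] \<open>\<And>js. coframe_monomial (mat 1) is (map ?X js) = _\<close>[of "pre @ js"]
      by (cases "i = j") (simp_all add: wedge_covector_Cons axis_def algebra_simps)
  qed
  from this[of "[]"] show ?case by (simp add: coframe_monomial_Cons)
qed

section \<open>Components of the model forms\<close>

definition phi0 :: "7 \<Rightarrow> 7 \<Rightarrow> 7 \<Rightarrow> real" where
  "phi0 a b c = G2_form (mat 1) [axis a 1, axis b 1, axis c 1]"

definition eps :: "7 list \<Rightarrow> real" where
  "eps is = coframe_monomial (mat 1) [1,2,3,4,5,6,7] (map (\<lambda>i. axis i 1) is)"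

text \<open>Components of star \<phi> in the standard basis, by the Hodge index formula with
  \<open>eps\<close> as Levi-Civita symbol; the divisor is 3 factorial.\<close>

definition psi0 :: "7 \<Rightarrow> 7 \<Rightarrow> 7 \<Rightarrow> 7 \<Rightarrow> real" where
  "psi0 a b c d = (\<Sum>is | length is = 3. G2_form (mat 1) (map (\<lambda>i. axis i 1) is) * eps (is @ [a, b, c, d])) / 6"

lemma eps_eq: "eps is = dual_monomial [1,2,3,4,5,6,7] [] is"
  unfolding eps_def by (rule coframe_monomial_axis)

lemma phi0_eq: "phi0 a b c = dual_monomial [1,2,3] [] [a,b,c]
  + (dual_monomial [1,4,5] [] [a,b,c] + dual_monomial [1,6,7] [] [a,b,c])
  + (dual_monomial [2,4,6] [] [a,b,c] - dual_monomial [2,5,7] [] [a,b,c])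
  - (dual_monomial [3,4,7] [] [a,b,c] + dual_monomial [3,5,6] [] [a,b,c])"
  unfolding phi0_def G2_form_def
  using coframe_monomial_axis[of _ "[a,b,c]"] by simp

lemma mlin_G2_form: "mlin k (G2_form e)"
  unfolding G2_form_def diff_conv_add_uminus
  by (intro mlin_add mlin_coframe_monomial mlin_cmult[of _ _ "-1", simplified])

lemma skew_G2_form: "skew (G2_form e)"
  unfolding G2_form_def diff_conv_add_uminus
  by (intro skew_add skew_coframe_monomial skew_cmult[of _ "-1", simplified])

lemma G2_form_map: "G2_form e vs = G2_form (mat 1) (map ((*v) e) vs)"
  unfolding G2_form_def by (simp only: coframe_monomial_map[of e])

lemma skew_eps: "skew eps"
  unfolding eps_def by (rule skew_map[OF skew_coframe_monomial])

section \<open>Skew arrays and the tables of the model forms\<close>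

definition skew2 :: "('i \<Rightarrow> 'i \<Rightarrow> real) \<Rightarrow> bool" where
  "skew2 X \<longleftrightarrow> (\<forall>a b. X a b = - X b a)"

definition skew3 :: "('i \<Rightarrow> 'i \<Rightarrow> 'i \<Rightarrow> real) \<Rightarrow> bool" where
  "skew3 X \<longleftrightarrow> (\<forall>a b c. X a b c = - X b a c \<and> X a b c = - X a c b)"

definition skew4 :: "('i \<Rightarrow> 'i \<Rightarrow> 'i \<Rightarrow> 'i \<Rightarrow> real) \<Rightarrow> bool" where
  "skew4 X \<longleftrightarrow> (\<forall>a b c d. X a b c d = - X b a c d \<and> X a b c d = - X a c b d \<and> X a b c d = - X a b d c)"

text \<open>An order on the index type, used to orient the rewriting of skew arrays to sorted indices.\<close>

definition idx :: "7 \<Rightarrow> nat" where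
  "idx a = (if a = 1 then 1 else if a = 2 then 2 else if a = 3 then 3 else if a = 4 then 4
    else if a = 5 then 5 else if a = 6 then 6 else 7)"

lemma idx_simps: "idx 1 = 1" "idx 2 = 2" "idx 3 = 3" "idx 4 = 4" "idx 5 = 5" "idx 6 = 6" "idx 7 = 7"
  by (simp_all add: idx_def)

text \<open>As conditional rewrite rules these sort the indices by adjacent exchanges; the strict
  inequality of \<open>idx\<close> keeps the rewriting from looping.\<close>

lemma skew3_sort:
  assumes "skew3 X"
  shows "idx b < idx a \<Longrightarrow> X a b c = - X b a c" "idx c < idx b \<Longrightarrow> X a b c = - X a c b"
    "X a a c = 0" "X a b b = 0"
proof -
  show "X a b c = - X b a c" "X a b c = - X a c b" using assms unfolding skew3_def by blast+
  have "X a a c = - X a a c" "X a b b = - X a b b" using assms unfolding skew3_def by blast+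
  then show "X a a c = 0" "X a b b = 0" by linarith+
qed

lemma skew4_sort:
  assumes "skew4 X"
  shows "idx b < idx a \<Longrightarrow> X a b c d = - X b a c d" "idx c < idx b \<Longrightarrow> X a b c d = - X a c b d"
    "idx d < idx c \<Longrightarrow> X a b c d = - X a b d c"
    "X a a c d = 0" "X a b b d = 0" "X a b c c = 0"
proof -
  show "X a b c d = - X b a c d" "X a b c d = - X a c b d" "X a b c d = - X a b d c"
    using assms unfolding skew4_def by blast+
  have "X a a c d = - X a a c d" "X a b b d = - X a b b d" "X a b c c = - X a b c c"
    using assms unfolding skew4_def by blast+
  then show "X a a c d = 0" "X a b b d = 0" "X a b c c = 0" by linarith+
qed

lemma skew3_of_skew:
  assumes "skew \<alpha>" shows "skew3 (\<lambda>a b c. \<alpha> [f a, f b, f c])"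
  unfolding skew3_def
proof (intro allI conjI)
  fix a b c
  show "\<alpha> [f a, f b, f c] = - \<alpha> [f b, f a, f c]" using skewD[OF assms, of "[]" "f a" "f b" "[f c]"] by simp
  show "\<alpha> [f a, f b, f c] = - \<alpha> [f a, f c, f b]" using skewD[OF assms, of "[f a]" "f b" "f c" "[]"] by simp
qed

lemma skew4_of_skew:
  assumes "skew \<alpha>" shows "skew4 (\<lambda>a b c d. \<alpha> [f a, f b, f c, f d])"
  unfolding skew4_def
proof (intro allI conjI)
  fix a b c d
  show "\<alpha> [f a, f b, f c, f d] = - \<alpha> [f b, f a, f c, f d]"
    using skewD[OF assms, of "[]" "f a" "f b" "[f c, f d]"] by simp
  show "\<alpha> [f a, f b, f c, f d] = - \<alpha> [f a, f c, f b, f d]"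
    using skewD[OF assms, of "[f a]" "f b" "f c" "[f d]"] by simp
  show "\<alpha> [f a, f b, f c, f d] = - \<alpha> [f a, f b, f d, f c]"
    using skewD[OF assms, of "[f a, f b]" "f c" "f d" "[]"] by simp
qed

lemma skew3_phi0: "skew3 phi0"
  using skew3_of_skew[OF skew_G2_form, of "mat 1" "\<lambda>a. axis a 1"] by (simp add: phi0_def[abs_def])

lemma skew4_psi0: "skew4 psi0"
proof -
  have "skew (\<lambda>l. (\<Sum>is | length is = 3. G2_form (mat 1) (map (\<lambda>i. axis i 1) is) * eps (is @ l)) / 6)"
  proof (rule skewI)
    fix xs ys and a b :: 7
    have "eps (is @ xs @ a # b # ys) = - eps (is @ xs @ b # a # ys)" for "is"
      using skewD[OF skew_append_left[OF skew_eps], of "is" xs a b ys] by simp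
    then show "(\<Sum>is | length is = 3. G2_form (mat 1) (map (\<lambda>i. axis i 1) is) * eps (is @ xs @ a # b # ys)) / 6 =
      - ((\<Sum>is | length is = 3. G2_form (mat 1) (map (\<lambda>i. axis i 1) is) * eps (is @ xs @ b # a # ys)) / 6)"
      by (simp add: sum_negf)
  qed
  from skew4_of_skew[OF this, of "\<lambda>a. a"] show ?thesis by (simp add: psi0_def[abs_def])
qed

lemmas phi0_sort = skew3_sort[OF skew3_phi0]
lemmas psi0_sort = skew4_sort[OF skew4_psi0]

lemma phi0_table:
  "phi0 1 2 3 = 1" "phi0 1 2 4 = 0" "phi0 1 2 5 = 0"
  "phi0 1 2 6 = 0" "phi0 1 2 7 = 0" "phi0 1 3 4 = 0"
  "phi0 1 3 5 = 0" "phi0 1 3 6 = 0" "phi0 1 3 7 = 0"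
  "phi0 1 4 5 = 1" "phi0 1 4 6 = 0" "phi0 1 4 7 = 0"
  "phi0 1 5 6 = 0" "phi0 1 5 7 = 0" "phi0 1 6 7 = 1"
  "phi0 2 3 4 = 0" "phi0 2 3 5 = 0" "phi0 2 3 6 = 0"
  "phi0 2 3 7 = 0" "phi0 2 4 5 = 0" "phi0 2 4 6 = 1"
  "phi0 2 4 7 = 0" "phi0 2 5 6 = 0" "phi0 2 5 7 = - 1"
  "phi0 2 6 7 = 0" "phi0 3 4 5 = 0" "phi0 3 4 6 = 0"
  "phi0 3 4 7 = - 1" "phi0 3 5 6 = - 1" "phi0 3 5 7 = 0"
  "phi0 3 6 7 = 0" "phi0 4 5 6 = 0" "phi0 4 5 7 = 0"
  "phi0 4 6 7 = 0" "phi0 5 6 7 = 0"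
  by (simp_all add: phi0_eq)

lemma distinct_index_set:
  fixes I J :: "7 list"
  assumes "distinct (I @ J)" "length I + length J = 7" shows "set I = - set J"
proof -
  have "card (set (I @ J)) = CARD(7)" using assms distinct_card[of "I @ J"] by simp
  then have "set (I @ J) = UNIV" by (intro card_subset_eq) simp_all
  then show ?thesis using assms(1) by auto
qed

text \<open>Only the six orderings of the one complementary triple contribute, all by the same
  amount, so the division by 6 leaves a single product.\<close>

lemma psi0_complement:
  assumes "distinct [i, j, k, a, b, c, d]"
  shows "psi0 a b c d = phi0 i j k * eps [i, j, k, a, b, c, d]"
proof -
  have "psi0 a b c d = fact 3 * (G2_form (mat 1) (map (\<lambda>i. axis i 1) [i,j,k]) * eps ([i,j,k] @ [a,b,c,d])) / 6"
    unfolding psi0_def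
    by (subst sum_lists_skew[of "\<lambda>is. G2_form (mat 1) (map (\<lambda>i. axis i 1) is)" eps "[i,j,k]" "[a,b,c,d]" 3])
       (use assms distinct_index_set[of "[i,j,k]" "[a,b,c,d]"] in
         \<open>simp_all add: skew_eps skew_map[OF skew_G2_form]\<close>)
  then show ?thesis by (simp add: phi0_def fact_numeral)
qed

lemma psi0_table:
  "psi0 1 2 3 4 = 0" "psi0 1 2 3 5 = 0" "psi0 1 2 3 6 = 0"
  "psi0 1 2 3 7 = 0" "psi0 1 2 4 5 = 0" "psi0 1 2 4 6 = 0"
  "psi0 1 2 4 7 = - 1" "psi0 1 2 5 6 = - 1" "psi0 1 2 5 7 = 0"
  "psi0 1 2 6 7 = 0" "psi0 1 3 4 5 = 0" "psi0 1 3 4 6 = - 1"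
  "psi0 1 3 4 7 = 0" "psi0 1 3 5 6 = 0" "psi0 1 3 5 7 = 1"
  "psi0 1 3 6 7 = 0" "psi0 1 4 5 6 = 0" "psi0 1 4 5 7 = 0"
  "psi0 1 4 6 7 = 0" "psi0 1 5 6 7 = 0" "psi0 2 3 4 5 = 1"
  "psi0 2 3 4 6 = 0" "psi0 2 3 4 7 = 0" "psi0 2 3 5 6 = 0"
  "psi0 2 3 5 7 = 0" "psi0 2 3 6 7 = 1" "psi0 2 4 5 6 = 0"
  "psi0 2 4 5 7 = 0" "psi0 2 4 6 7 = 0" "psi0 2 5 6 7 = 0"
  "psi0 3 4 5 6 = 0" "psi0 3 4 5 7 = 0" "psi0 3 4 6 7 = 0"
  "psi0 3 5 6 7 = 0" "psi0 4 5 6 7 = 1"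
  by (simp_all add:
  psi0_complement[of 5 6 7 1 2 3 4] psi0_complement[of 4 6 7 1 2 3 5]
  psi0_complement[of 4 5 7 1 2 3 6] psi0_complement[of 4 5 6 1 2 3 7]
  psi0_complement[of 3 6 7 1 2 4 5] psi0_complement[of 3 5 7 1 2 4 6]
  psi0_complement[of 3 5 6 1 2 4 7] psi0_complement[of 3 4 7 1 2 5 6]
  psi0_complement[of 3 4 6 1 2 5 7] psi0_complement[of 3 4 5 1 2 6 7]
  psi0_complement[of 2 6 7 1 3 4 5] psi0_complement[of 2 5 7 1 3 4 6]
  psi0_complement[of 2 5 6 1 3 4 7] psi0_complement[of 2 4 7 1 3 5 6]
  psi0_complement[of 2 4 6 1 3 5 7] psi0_complement[of 2 4 5 1 3 6 7]
  psi0_complement[of 2 3 7 1 4 5 6] psi0_complement[of 2 3 6 1 4 5 7]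
  psi0_complement[of 2 3 5 1 4 6 7] psi0_complement[of 2 3 4 1 5 6 7]
  psi0_complement[of 1 6 7 2 3 4 5] psi0_complement[of 1 5 7 2 3 4 6]
  psi0_complement[of 1 5 6 2 3 4 7] psi0_complement[of 1 4 7 2 3 5 6]
  psi0_complement[of 1 4 6 2 3 5 7] psi0_complement[of 1 4 5 2 3 6 7]
  psi0_complement[of 1 3 7 2 4 5 6] psi0_complement[of 1 3 6 2 4 5 7]
  psi0_complement[of 1 3 5 2 4 6 7] psi0_complement[of 1 3 4 2 5 6 7]
  psi0_complement[of 1 2 7 3 4 5 6] psi0_complement[of 1 2 6 3 4 5 7]
  psi0_complement[of 1 2 5 3 4 6 7] psi0_complement[of 1 2 4 3 5 6 7]
  psi0_complement[of 1 2 3 4 5 6 7]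
    phi0_table eps_eq)

section \<open>Adapted coframes\<close>

text \<open>Contractions of \<phi> with a vector are eigenvectors, for the eigenvalue 4, of the
  contraction of 2-forms with \<psi>. Like the next two identities it is a finite check on the
  tables; the three together evaluate every contraction of the model forms used below.\<close>

lemma phi0_psi0: "(\<Sum>c\<in>UNIV. \<Sum>d\<in>UNIV. psi0 a b c d * phi0 k c d) = 4 * phi0 k a b"
proof -
  have "\<forall>a b k. (\<Sum>c\<in>UNIV. \<Sum>d\<in>UNIV. psi0 a b c d * phi0 k c d) = 4 * phi0 k a b"
    by (simp add: forall_7 sum_7 phi0_sort psi0_sort idx_simps phi0_table psi0_table)
  then show ?thesis by blast
qed

lemma phi0_phi0: "(\<Sum>m\<in>UNIV. phi0 a b m * phi0 c d m) =
  (if a = c \<and> b = d then 1 else 0) - (if a = d \<and> b = c then 1 else 0) + psi0 a b c d"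
proof -
  have "\<forall>a b c d. (\<Sum>m\<in>UNIV. phi0 a b m * phi0 c d m) =
    (if a = c \<and> b = d then 1 else 0) - (if a = d \<and> b = c then 1 else 0) + psi0 a b c d"
    by (simp add: forall_7 sum_7 phi0_sort psi0_sort idx_simps phi0_table psi0_table)
  then show ?thesis by blast
qed

lemma phi0_phi0_2: "(\<Sum>c\<in>UNIV. \<Sum>d\<in>UNIV. phi0 a c d * phi0 b c d) = (if a = b then 6 else 0)"
proof -
  have "\<forall>a b. (\<Sum>c\<in>UNIV. \<Sum>d\<in>UNIV. phi0 a c d * phi0 b c d) = (if a = b then 6 else 0)"
    by (simp add: forall_7 sum_7 phi0_sort idx_simps phi0_table)
  then show ?thesis by blast
qed

lemma eps_sq:
  assumes "distinct is" "length is = 7" shows "eps is * eps is = 1"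
proof -
  have "eps is * eps is = eps [1,2,3,4,5,6,7] * eps [1,2,3,4,5,6,7]"
  proof (rule adjacent_swap_invariant[where h="\<lambda>l. eps l * eps l"])
    show "eps (xs @ a # b # ys) * eps (xs @ a # b # ys) = eps (xs @ b # a # ys) * eps (xs @ b # a # ys)" for xs a b ys
      using skewD[OF skew_eps, of xs a b ys] by simp
    have "set is = UNIV" using distinct_index_set[of "is" "[]"] assms by simp
    then show "mset is = mset [1,2,3,4,5,6,7]"
      using assms(1) UNIV_7 by (subst set_eq_iff_mset_eq_distinct[symmetric]) auto
  qed
  then show ?thesis by (simp add: eps_eq)
qed

text \<open>Forms of top degree are one-dimensional. The product with \<open>eps\<close> is
  invariant under swaps, so every ordering can be compared with the increasing one.\<close>

lemma skew_top:
  assumes "skew \<gamma>" "length is = 7"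
  shows "\<gamma> (map h is) = \<gamma> (map h [1,2,3,4,5,6,7]) * eps is"
proof (cases "distinct is")
  case False
  then show ?thesis using skew_repeat[OF skew_map[OF assms(1)]] skew_repeat[OF skew_eps] by auto
next
  case True
  have "\<gamma> (map h is) * eps is = \<gamma> (map h [1,2,3,4,5,6,7]) * eps [1,2,3,4,5,6,7]"
  proof (rule adjacent_swap_invariant[where h="\<lambda>l. \<gamma> (map h l) * eps l"])
    show "\<gamma> (map h (xs @ a # b # ys)) * eps (xs @ a # b # ys) = \<gamma> (map h (xs @ b # a # ys)) * eps (xs @ b # a # ys)"
        for xs a b ys
      using skewD[OF skew_eps, of xs a b ys] skewD[OF skew_map[OF assms(1)], of h xs a b ys] by simp
    have "set is = UNIV" using distinct_index_set[of "is" "[]"] assms True by simp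
    then show "mset is = mset [1,2,3,4,5,6,7]"
      using True UNIV_7 by (subst set_eq_iff_mset_eq_distinct[symmetric]) auto
  qed
  then have "\<gamma> (map h is) * eps is = \<gamma> (map h [1,2,3,4,5,6,7])" by (simp add: eps_eq)
  then show ?thesis using eps_sq[OF True assms(2)] by (metis mult.assoc mult.right_neutral)
qed

lemma coframe_monomial_length: "length vs \<noteq> length is \<Longrightarrow> coframe_monomial e is vs = 0"
proof (induction "is" arbitrary: vs)
  case Nil
  then show ?case by (simp add: coframe_monomial_Nil unit_form_def)
next
  case (Cons i "is")
  have "wedge (covector_form a) \<beta> vs = 0"
    if "\<forall>l. length l \<noteq> n \<longrightarrow> \<beta> l = 0" "length vs \<noteq> Suc n" for a :: "real^'a \<Rightarrow> real" and \<beta> n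
    using that
  proof (induction vs arbitrary: \<beta> n)
    case Nil
    then show ?case by (simp add: wedge_Nil covector_form_Nil)
  next
    case (Cons v vs)
    have "wedge (covector_form a) (\<lambda>l. \<beta> (v # l)) vs = 0"
    proof (cases n)
      case 0
      then have "(\<lambda>l. \<beta> (v # l)) = (\<lambda>l. 0)" using Cons.prems(1) by auto
      then show ?thesis by (simp add: wedge_def)
    next
      case (Suc m)
      then show ?thesis using Cons.prems by (intro Cons.IH[of m]) auto
    qed
    then show ?case using Cons.prems by (simp add: wedge_covector_Cons)
  qed
  then show ?case unfolding coframe_monomial_Cons using Cons by auto
qed

text \<open>\<open>G2_det_metric \<phi> u v\<close> is a polynomial in \<open>\<phi>\<close>, a multiple of the coefficient of
  \<open>\<iota>\<^sub>u \<phi> \<and> \<iota>\<^sub>v \<phi> \<and> \<phi>\<close>; it equals the metric up to the factor \<open>det e\<close>.\<close>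

definition G2_det_metric :: "(real^7) form \<Rightarrow> real^7 \<Rightarrow> real^7 \<Rightarrow> real" where
  "G2_det_metric \<phi> u v = (\<Sum>is | length is = 7.
     \<phi> (take 3 (map (\<lambda>i. axis i 1) is)) * \<phi> (u # take 2 (drop 3 (map (\<lambda>i. axis i 1) is)))
       * \<phi> (v # drop 5 (map (\<lambda>i. axis i 1) is)) * eps is)"

text \<open>Each argument enters exactly one of the three factors: positions 0 to 2, 3 to 4 and 5 to
  6 respectively.\<close>

lemma mlin_det_metric:
  assumes "\<And>k. mlin k \<phi>"
  shows "mlin 7 (\<lambda>l. \<phi> (take 3 l) * \<phi> (u # take 2 (drop 3 l)) * \<phi> (v # drop 5 l))"
proof (rule mlinI)
  fix xs ys :: "'a list" assume "Suc (length xs + length ys) = 7"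
  then consider "length xs < 3" | "length xs = 3 \<or> length xs = 4" | "length xs = 5 \<or> length xs = 6" by linarith
  then show "linear (\<lambda>w. \<phi> (take 3 (xs @ w # ys)) * \<phi> (u # take 2 (drop 3 (xs @ w # ys))) * \<phi> (v # drop 5 (xs @ w #
      ys)))"
  proof cases
    case 1
    have "linear (\<lambda>w. c * \<phi> (xs @ w # take (2 - length xs) ys))" for c
      by (rule linear_cmult[OF mlinD[OF assms refl]])
    from this[of "\<phi> (u # take 2 (drop 3 (xs @ 0 # ys))) * \<phi> (v # drop 5 (xs @ 0 # ys))"]
    show ?thesis using 1 by (simp add: take_Cons' drop_Cons' mult_ac)
  next
    case 2
    have "linear (\<lambda>w. c * \<phi> ((u # drop 3 xs) @ w # take (4 - length xs) ys))" for c
      by (rule linear_cmult[OF mlinD[OF assms refl]])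
    from this[of "\<phi> (take 3 xs) * \<phi> (v # drop 5 (xs @ 0 # ys))"]
    show ?thesis using 2 by (auto simp: take_Cons' drop_Cons' mult_ac)
  next
    case 3
    have "linear (\<lambda>w. c * \<phi> ((v # drop 5 xs) @ w # ys))" for c
      by (rule linear_cmult[OF mlinD[OF assms refl]])
    from this[of "\<phi> (take 3 xs) * \<phi> (u # take 2 (drop 3 xs))"]
    show ?thesis using 3 by (auto simp: take_Cons' drop_Cons' mult_ac)
  qed
qed

section \<open>The orthonormal frame of an adapted coframe\<close>

lemma matrix_inv_unique:
  fixes A B :: "real^'n^'n"
  assumes "A ** B = mat 1" shows "matrix_inv A = B"
proof -
  have "B ** A = mat 1" using assms matrix_left_right_inverse by blast
  then have "A ** matrix_inv A = mat 1 \<and> matrix_inv A ** A = mat 1"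
    unfolding matrix_inv_def
    using someI[of "\<lambda>A'. A ** A' = mat 1 \<and> A' ** A = mat 1" B] assms by blast
  then show ?thesis using \<open>B ** A = mat 1\<close> by (metis matrix_mul_assoc matrix_mul_lid matrix_mul_rid)
qed

lemma
  fixes A :: "real^'n^'n"
  assumes "invertible A"
  shows matrix_inv_right: "A ** matrix_inv A = mat 1" and matrix_inv_left: "matrix_inv A ** A = mat 1"
proof -
  obtain B where "A ** B = mat 1" using assms invertible_def by blast
  then show "A ** matrix_inv A = mat 1" by (simp add: matrix_inv_unique)
  then show "matrix_inv A ** A = mat 1" using matrix_left_right_inverse by blast
qed

lemma linear_inner_matrix:
  "linear (\<lambda>u. c * (u \<bullet> w))" "linear (\<lambda>v. c * (u \<bullet> (A *v v)))" for A :: "real^'n^'n"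
  by (simp_all add: linear_iff inner_add_left inner_add_right matrix_vector_right_distrib
      matrix_vector_mult_scaleR algebra_simps)

locale adapted_coframe =
  fixes \<phi> :: "(real^7) form" and e :: "real^7^7"
  assumes coframe: "G2_coframe \<phi> e"
begin

definition f :: "7 \<Rightarrow> real^7" where "f a = column a (matrix_inv e)"
abbreviation "g \<equiv> transpose e ** e"
abbreviation "gi \<equiv> matrix_inv g"
abbreviation "vol \<equiv> coframe_monomial e [1,2,3,4,5,6,7]"

lemma inv_e: "invertible e" and \<phi>_eq: "\<phi> = G2_form e"
  using coframe by (auto simp: G2_coframe_def)

lemma e_f: "e *v f a = axis a 1"
proof -
  have "f a = matrix_inv e *v axis a 1" by (simp add: f_def matrix_vector_mult_basis)
  then show ?thesis
    by (simp add: matrix_vector_mul_assoc matrix_inv_right[OF inv_e])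
qed

lemma frame_expand: "v = (\<Sum>a\<in>UNIV. (e *v v) $ a *\<^sub>R f a)"
proof -
  have "v = matrix_inv e *v (e *v v)"
    by (simp add: matrix_vector_mul_assoc matrix_inv_left[OF inv_e])
  also have "\<dots> = (\<Sum>a\<in>UNIV. (e *v v) $ a *s column a (matrix_inv e))"
    by (rule matrix_mult_sum)
  finally show ?thesis by (simp add: f_def scalar_mult_eq_scaleR)
qed

lemma linear_frame: "linear P \<Longrightarrow> P v = (\<Sum>a\<in>UNIV. (e *v v) $ a *\<^sub>R P (f a))"
  by (subst frame_expand) (simp add: linear_sum linear_scale)

lemma linear_frame_eqI: "linear P \<Longrightarrow> linear Q \<Longrightarrow> (\<And>a. P (f a) = Q (f a)) \<Longrightarrow> P v = Q v"
  by (simp add: linear_frame[of P v] linear_frame[of Q v])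

lemma mlin_frame_eqI:
  assumes "mlin k \<alpha>" "mlin k \<beta>" "\<And>is. length is = k \<Longrightarrow> \<alpha> (map f is) = \<beta> (map f is)" "length vs = k"
  shows "\<alpha> vs = \<beta> vs"
  using assms
proof (induction vs arbitrary: k \<alpha> \<beta>)
  case (Cons v vs)
  then obtain j where j: "k = Suc j" "length vs = j" by auto
  show ?case
  proof (rule linear_frame_eqI)
    show "linear (\<lambda>v. \<alpha> (v # vs))" "linear (\<lambda>v. \<beta> (v # vs))"
      using Cons.prems(1,2) j by (auto intro: mlin_linear_Cons)
    fix a
    show "\<alpha> (f a # vs) = \<beta> (f a # vs)"
    proof (rule Cons.IH[of j "\<lambda>l. \<alpha> (f a # l)" "\<lambda>l. \<beta> (f a # l)"])
      show "\<alpha> (f a # map f is) = \<beta> (f a # map f is)" if "length is = j" for "is"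
        using Cons.prems(3)[of "a # is"] that j by simp
    qed (use Cons.prems(1,2) j in \<open>auto intro: mlin_Cons\<close>)
  qed
qed (use assms in auto)

lemma g_inner: "u \<bullet> (g *v v) = (e *v u) \<bullet> (e *v v)"
  unfolding matrix_vector_mul_assoc[symmetric] dot_lmul_matrix[symmetric] vector_transpose_matrix ..

lemma g_frame: "f a \<bullet> (g *v f b) = (if a = b then 1 else 0)"
  by (simp add: g_inner e_f inner_axis_axis)

lemma gi_eq: "gi = matrix_inv e ** transpose (matrix_inv e)"
proof (rule matrix_inv_unique)
  have "transpose e ** transpose (matrix_inv e) = mat 1"
    by (simp add: matrix_transpose_mul[symmetric] matrix_inv_left[OF inv_e] transpose_mat)
  then show "g ** (matrix_inv e ** transpose (matrix_inv e)) = mat 1"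
    by (metis matrix_inv_right[OF inv_e] matrix_mul_assoc matrix_mul_rid)
qed

lemma gi_component: "gi $ i $ j = (\<Sum>a\<in>UNIV. f a $ i * f a $ j)"
  unfolding gi_eq by (simp add: matrix_matrix_mult_def transpose_def f_def column_def)

lemma invertible_g: "invertible g"
  by (simp add: invertible_mult inv_e transpose_invertible)

lemma axis_expand: "axis i 1 = (\<Sum>a\<in>UNIV. e $ a $ i *\<^sub>R f a)"
  using frame_expand[of "axis i 1"] by (simp add: matrix_vector_mult_basis column_def)

lemma f_expand: "f a = (\<Sum>i\<in>UNIV. f a $ i *\<^sub>R axis i 1)"
  using basis_expansion[of "f a"] by (simp add: scalar_mult_eq_scaleR)

text \<open>The inverse metric is the sum of the tensor squares of the frame vectors
  (\<open>gi_component\<close>), so a metric trace in coordinates becomes a plain sum over the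
  frame.\<close>

lemma contraction:
  assumes "\<And>y. linear (\<lambda>x. h x y)" "\<And>x. linear (\<lambda>y. h x y)"
  shows "(\<Sum>i\<in>UNIV. \<Sum>j\<in>UNIV. gi $ i $ j * h (axis i 1) (axis j 1)) = (\<Sum>a\<in>UNIV. h (f a) (f a) :: real)"
proof -
  have "h (f a) (f a) = (\<Sum>i\<in>UNIV. \<Sum>j\<in>UNIV. f a $ i * f a $ j * h (axis i 1) (axis j 1))" for a
  proof -
    have "h (f a) (f a) = (\<Sum>i\<in>UNIV. f a $ i * h (axis i 1) (f a))"
      using linear_sum_scale[OF assms(1), of "\<lambda>i. f a $ i" "\<lambda>i. axis i 1" UNIV "f a"] f_expand[of a] by simp
    also have "\<dots> = (\<Sum>i\<in>UNIV. f a $ i * (\<Sum>j\<in>UNIV. f a $ j * h (axis i 1) (axis j 1)))"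
      using linear_sum_scale[OF assms(2), of _ "\<lambda>i. f a $ i" "\<lambda>i. axis i 1" UNIV] f_expand[of a] by simp
    finally show ?thesis by (simp add: sum_distrib_left mult_ac)
  qed
  then have "(\<Sum>a\<in>UNIV. h (f a) (f a)) = (\<Sum>a\<in>UNIV. \<Sum>i\<in>UNIV. \<Sum>j\<in>UNIV. f a $ i * f a $ j * h (axis i 1) (axis j 1))"
    by simp
  also have "\<dots> = (\<Sum>i\<in>UNIV. \<Sum>j\<in>UNIV. \<Sum>a\<in>UNIV. f a $ i * f a $ j * h (axis i 1) (axis j 1))"
    by (subst sum.swap, rule sum.cong[OF refl], rule sum.swap)
  finally show ?thesis by (simp add: gi_component sum_distrib_right)
qed

lemma trace_frame:
  assumes "linear P" shows "(\<Sum>i\<in>UNIV. P (axis i 1) $ i) = (\<Sum>a\<in>UNIV. (e *v P (f a)) $ a)"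
proof -
  have "P (axis i 1) $ i = (\<Sum>a\<in>UNIV. e $ a $ i * P (f a) $ i)" for i
  proof -
    have "P (axis i 1) = (\<Sum>a\<in>UNIV. e $ a $ i *\<^sub>R P (f a))"
      unfolding axis_expand[of i] using assms by (simp add: linear_sum linear_scale)
    then show ?thesis by (simp add: sum_component)
  qed
  then have "(\<Sum>i\<in>UNIV. P (axis i 1) $ i) = (\<Sum>i\<in>UNIV. \<Sum>a\<in>UNIV. e $ a $ i * P (f a) $ i)" by simp
  also have "\<dots> = (\<Sum>a\<in>UNIV. \<Sum>i\<in>UNIV. e $ a $ i * P (f a) $ i)" by (rule sum.swap)
  finally show ?thesis by (simp add: matrix_vector_mult_def)
qed

lemma map_e_f: "map ((*v) e) (map f is) = map (\<lambda>i. axis i 1) is"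
  by (simp add: e_f)

lemma \<phi>_map_f: "\<phi> (map f is) = G2_form (mat 1) (map (\<lambda>i. axis i 1) is)"
  unfolding \<phi>_eq G2_form_map[of e] map_e_f ..

lemma \<phi>_f: "\<phi> [f a, f b, f c] = phi0 a b c"
  using \<phi>_map_f[of "[a,b,c]"] by (simp add: phi0_def)

lemma vol_f: "vol (map f is) = eps is"
  unfolding coframe_monomial_map[of e] map_e_f eps_def ..

lemma mlin_\<phi>: "mlin k \<phi>" unfolding \<phi>_eq by (rule mlin_G2_form)
lemma skew_\<phi>: "skew \<phi>" unfolding \<phi>_eq by (rule skew_G2_form)

lemma linear_\<phi>: "linear (\<lambda>x. \<phi> [x, y, z])" "linear (\<lambda>x. \<phi> [y, x, z])" "linear (\<lambda>x. \<phi> [y, z, x])"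
  using mlinD[OF mlin_\<phi>, of "[]" "[y,z]"] mlinD[OF mlin_\<phi>, of "[y]" "[z]"] mlinD[OF mlin_\<phi>, of "[y,z]" "[]"]
  by simp_all

lemma hodge_frame:
  assumes "mlin (7 - length vs) \<alpha>" "length vs \<le> 7"
  shows "hodge g vol \<alpha> vs =
    (\<Sum>is | length is = 7 - length vs. \<alpha> (map f is) * vol (map f is @ vs)) / fact (7 - length vs)"
proof -
  \<comment> \<open>An orthonormal frame is its own dual: the vectors with raised index and the
    coordinate vectors transform contragrediently to the same \<open>f\<close>.\<close>
  have 1: "matrix_inv g $ i = (\<Sum>a\<in>UNIV. f a $ i *\<^sub>R f a)" for i
    by (simp add: vec_eq_iff gi_component sum_component)
  have "mlin (7 - length vs) (\<lambda>l. vol (l @ vs))"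
    by (rule mlin_append_right[OF mlin_coframe_monomial])
  from sum_lists_change_basis[OF assms(1) this 1 f_expand, unfolded]
  show ?thesis by (simp add: hodge_def Let_def)
qed

lemma hodge_complement:
  assumes "mlin (length I) \<alpha>" "skew \<alpha>" "distinct (I @ J)" "length I + length J = 7"
  shows "hodge g vol \<alpha> (map f J) = \<alpha> (map f I) * eps (I @ J)"
proof -
  have l: "7 - length J = length I" "length J \<le> 7" using assms(4) by linarith+
  have "hodge g vol \<alpha> (map f J) =
    (\<Sum>is | length is = length I. \<alpha> (map f is) * eps (is @ J)) / fact (length I)"
    using hodge_frame[of "map f J" \<alpha>] assms(1) l by (simp flip: map_append add: vol_f)
  also have "\<dots> = \<alpha> (map f I) * eps (I @ J)"
    by (subst sum_lists_skew[of "\<lambda>is. \<alpha> (map f is)" eps I J])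
       (use assms(3,4) distinct_index_set[OF assms(3,4)] in
         \<open>simp_all add: skew_eps skew_map[OF assms(2)]\<close>)
  finally show ?thesis .
qed

text \<open>The frame identity \<open>phi0_phi0_2\<close> in coordinates. The inverse metric occurs
  twice on the left and the metric once on the right; this homogeneity later fixes the scale of the
  metric.\<close>

lemma I1:
  "(\<Sum>i\<in>UNIV. \<Sum>j\<in>UNIV. gi $ i $ j * (\<Sum>k\<in>UNIV. \<Sum>l\<in>UNIV. gi $ k $ l *
      (\<phi> [u, axis i 1, axis k 1] * \<phi> [v, axis j 1, axis l 1]))) = 6 * (u \<bullet> (g *v v))"
proof -
  have lin: "linear (\<lambda>x. \<phi> [u, x, y] * c)" "linear (\<lambda>x. \<phi> [u, y, x] * c)" "linear (\<lambda>x. \<phi> [x, y, z] * c)"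
    "linear (\<lambda>x. c * \<phi> [u, x, y])" "linear (\<lambda>x. c * \<phi> [u, y, x])" "linear (\<lambda>x. c * \<phi> [x, y, z])" for u y z c
    using linear_cmult[OF linear_\<phi>(1)] linear_cmult[OF linear_\<phi>(2)] linear_cmult[OF linear_\<phi>(3)]
    by (simp_all add: mult.commute)
  have "(\<Sum>i\<in>UNIV. \<Sum>j\<in>UNIV. gi $ i $ j * (\<Sum>k\<in>UNIV. \<Sum>l\<in>UNIV. gi $ k $ l *
      (\<phi> [u, axis i 1, axis k 1] * \<phi> [v, axis j 1, axis l 1])))
    = (\<Sum>a\<in>UNIV. \<Sum>b\<in>UNIV. \<phi> [u, f a, f b] * \<phi> [v, f a, f b])"
    by (subst contraction[where h="\<lambda>x y. \<phi> [u, _, x] * \<phi> [v, _, y]"], (rule lin)+,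
        subst contraction[where h="\<lambda>x y. \<Sum>b\<in>UNIV. \<phi> [u, x, f b] * \<phi> [v, y, f b]"])
       (auto intro!: linear_compose_sum lin)
  also have "\<dots> = 6 * (u \<bullet> (g *v v))"
  proof (rule linear_frame_eqI[of "\<lambda>u. \<Sum>a\<in>UNIV. \<Sum>b\<in>UNIV. \<phi> [u, f a, f b] * \<phi> [v, f a, f b]" "\<lambda>u. 6 * (u \<bullet> (g *v v))"])
    fix c
    show "(\<Sum>a\<in>UNIV. \<Sum>b\<in>UNIV. \<phi> [f c, f a, f b] * \<phi> [v, f a, f b]) = 6 * (f c \<bullet> (g *v v))"
    proof (rule linear_frame_eqI[of "\<lambda>v. \<Sum>a\<in>UNIV. \<Sum>b\<in>UNIV. \<phi> [f c, f a, f b] * \<phi> [v, f a, f b]" "\<lambda>v. 6 * (f c \<bullet> (g *v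
        v))"])
      fix d
      show "(\<Sum>a\<in>UNIV. \<Sum>b\<in>UNIV. \<phi> [f c, f a, f b] * \<phi> [f d, f a, f b]) = 6 * (f c \<bullet> (g *v f d))"
        by (simp only: \<phi>_f phi0_phi0_2 g_frame) simp
    qed (intro linear_compose_sum ballI lin linear_inner_matrix)+
  qed (intro linear_compose_sum ballI lin linear_inner_matrix)+
  finally show ?thesis .
qed

text \<open>\<open>D\<close> is the determinant of the coframe. Passing from coordinates to the
  frame yields one factor \<open>D\<close>; the remaining contractions contribute 6 (the
  normalisation of \<open>psi0\<close>), 4 (\<open>phi0_psi0\<close>) and 6
  (\<open>phi0_phi0_2\<close>), with product 144.\<close>

lemma det_metric:
  defines "D \<equiv> coframe_monomial (mat 1) [1,2,3,4,5,6,7] (map (($) e) [1,2,3,4,5,6,7])"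
  shows "G2_det_metric \<phi> u v = 144 * D * (u \<bullet> (g *v v))"
    and "vol vs = D * coframe_monomial (mat 1) [1,2,3,4,5,6,7] vs" "D \<noteq> 0"
proof -
  let ?vol0 = "coframe_monomial (mat 1) [1,2,3,4,5,6,7] :: (real^7) form"
  have row: "?vol0 (map (($) e) is) = D * eps is" if "length is = 7" for "is"
    unfolding D_def by (rule skew_top[OF skew_coframe_monomial that])
  have e_row: "e $ a = (\<Sum>i\<in>UNIV. e $ a $ i *\<^sub>R axis i 1)" for a
    using basis_expansion[of "e $ a"] by (simp add: scalar_mult_eq_scaleR)
  have change: "(\<Sum>is | length is = 7. \<beta> (map (\<lambda>i. axis i 1) is) * eps is) =
      D * (\<Sum>is | length is = 7. \<beta> (map f is) * eps is)" if "mlin 7 \<beta>" for \<beta>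
    using sum_lists_change_basis[OF that mlin_coframe_monomial[of 7 "mat 1" "[1,2,3,4,5,6,7]"] axis_expand e_row]
    by (simp add: row eps_def[symmetric] sum_distrib_left mult_ac)
  have lin: "linear (\<lambda>u. G2_det_metric \<phi> u v)" "linear (\<lambda>v. G2_det_metric \<phi> u v)" for u v
  proof -
    have "linear (\<lambda>u. a * \<phi> (u # l) * b * c)" "linear (\<lambda>u. a * \<phi> (u # l) * c)" for a b c l
      using linear_cmult[OF mlin_linear_Cons[OF mlin_\<phi> refl], of "a*b*c" l]
       linear_cmult[OF mlin_linear_Cons[OF mlin_\<phi> refl], of "a*c" l] by (simp_all add: mult_ac)
    then show "linear (\<lambda>u. G2_det_metric \<phi> u v)" "linear (\<lambda>v. G2_det_metric \<phi> u v)"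
      unfolding G2_det_metric_def by (intro linear_compose_sum ballI; simp)+
  qed
  have fr: "G2_det_metric \<phi> (f a) (f b) = 144 * D * (f a \<bullet> (g *v f b))" for a b
  proof -
    let ?\<beta> = "\<lambda>l. \<phi> (take 3 l) * \<phi> (f a # take 2 (drop 3 l)) * \<phi> (f b # drop 5 l)"
    have "G2_det_metric \<phi> (f a) (f b) = D * (\<Sum>is | length is = 7. ?\<beta> (map f is) * eps is)"
      unfolding G2_det_metric_def by (rule change[OF mlin_det_metric[OF mlin_\<phi>]])
    \<comment> \<open>The first three indices meet only the first factor \<phi> and
      \<open>eps\<close>, so summing them first produces 6 times \<open>psi0\<close>.\<close>
    also have "(\<Sum>is | length is = 7. ?\<beta> (map f is) * eps is) =
      (\<Sum>is | length is = 3. \<Sum>js | length js = 4. ?\<beta> (map f (is @ js)) * eps (is @ js))"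
      using sum_lists_append[of "\<lambda>is. ?\<beta> (map f is) * eps is" 3 4] by simp
    also have "\<dots> = (\<Sum>js | length js = 4. \<Sum>is | length is = 3. ?\<beta> (map f (is @ js)) * eps (is @ js))"
      by (rule sum.swap)
    also have "\<dots> = (\<Sum>c\<in>UNIV. \<Sum>d\<in>UNIV. \<Sum>k\<in>UNIV. \<Sum>l\<in>UNIV. \<Sum>is | length is = 3.
       ?\<beta> (map f (is @ [c,d,k,l])) * eps (is @ [c,d,k,l]))"
    proof -
      have "(\<Sum>js | length js = 4. F js) = (\<Sum>c\<in>UNIV. \<Sum>d\<in>UNIV. \<Sum>k\<in>UNIV. \<Sum>l\<in>UNIV. F [c,d,k,l])"
        for F :: "7 list \<Rightarrow> real"
        by (simp add: sum_lists_Suc numeral_eq_Suc)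
      then show ?thesis .
    qed
    also have "\<dots> = (\<Sum>c\<in>UNIV. \<Sum>d\<in>UNIV. \<Sum>k\<in>UNIV. \<Sum>l\<in>UNIV. 6 * psi0 c d k l * phi0 a c d * phi0 b k l)"
    proof (intro sum.cong refl)
      fix c d k l
      have "(\<Sum>is | length is = 3. ?\<beta> (map f (is @ [c,d,k,l])) * eps (is @ [c,d,k,l])) =
        (\<Sum>is | length is = 3. \<phi> (map f is) * eps (is @ [c,d,k,l]) * (phi0 a c d * phi0 b k l))"
        by (intro sum.cong refl) (simp add: \<phi>_f)
      also have "\<dots> = 6 * psi0 c d k l * phi0 a c d * phi0 b k l"
        by (simp only: sum_distrib_right[symmetric]) (simp add: psi0_def \<phi>_map_f)
      finally show "(\<Sum>is | length is = 3. ?\<beta> (map f (is @ [c,d,k,l])) * eps (is @ [c,d,k,l])) =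
        6 * psi0 c d k l * phi0 a c d * phi0 b k l" .
    qed
    also have "\<dots> = (\<Sum>c\<in>UNIV. \<Sum>d\<in>UNIV. 6 * phi0 a c d * (\<Sum>k\<in>UNIV. \<Sum>l\<in>UNIV. psi0 c d k l * phi0 b k l))"
      by (simp add: sum_distrib_left mult_ac)
    also have "\<dots> = 24 * (\<Sum>c\<in>UNIV. \<Sum>d\<in>UNIV. phi0 a c d * phi0 b c d)"
      unfolding phi0_psi0 by (simp add: sum_distrib_left mult_ac)
    finally show ?thesis unfolding phi0_phi0_2 g_frame by simp
  qed
  have ling: "linear (\<lambda>u. 144 * D * (u \<bullet> (g *v v)))" "linear (\<lambda>v. 144 * D * (u \<bullet> (g *v v)))" for u v
    by (rule linear_inner_matrix)+
  have "G2_det_metric \<phi> (f a) v = 144 * D * (f a \<bullet> (g *v v))" for a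
    by (rule linear_frame_eqI[OF lin(2) ling(2) fr])
  then show "G2_det_metric \<phi> u v = 144 * D * (u \<bullet> (g *v v))"
    by (rule linear_frame_eqI[OF lin(1) ling(1)])
  \<comment> \<open>The sum of the squares of \<open>eps\<close> is computed directly and by passing
    to the frame. The comparison shows that \<open>D\<close> is inverse to the coordinate volume of
    the frame, hence nonzero.\<close>
  have "(\<Sum>is | length is = 7. eps is * eps (is @ [])) = fact 7 * (eps [1,2,3,4,5,6,7] * eps ([1,2,3,4,5,6,7] @ []))"
    by (rule sum_lists_skew) (use skew_eps UNIV_7 in auto)
  then have f7: "(\<Sum>is | length is = 7. eps is * eps is) = fact 7" by (simp add: eps_eq)
  have "(\<Sum>is | length is = 7. eps is * eps is) = D * (\<Sum>is | length is = 7. ?vol0 (map f is) * eps is)"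
    using change[OF mlin_coframe_monomial[of 7 "mat 1" "[1,2,3,4,5,6,7]"]] by (simp add: eps_def[symmetric])
  also have "\<dots> = D * (\<Sum>is | length is = 7. ?vol0 (map f [1,2,3,4,5,6,7]) * (eps is * eps is))"
  proof (rule arg_cong[where f="(*) D"], rule sum.cong[OF refl])
    fix "is" :: "7 list" assume "is \<in> {is. length is = 7}"
    then show "?vol0 (map f is) * eps is = ?vol0 (map f [1,2,3,4,5,6,7]) * (eps is * eps is)"
      using skew_top[OF skew_coframe_monomial, of "is" "mat 1" "[1,2,3,4,5,6,7]" f] by (simp del: list.map)
  qed
  also have "\<dots> = D * ?vol0 (map f [1,2,3,4,5,6,7]) * fact 7"
    by (simp only: sum_distrib_left[symmetric] f7 mult.assoc)
  finally have D1: "D * ?vol0 (map f [1,2,3,4,5,6,7]) = 1" using f7 by simp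
  then show "D \<noteq> 0" by auto
  show "vol vs = D * ?vol0 vs"
  proof (cases "length vs = 7")
    case False
    then show ?thesis by (simp add: coframe_monomial_length)
  next
    case True
    show ?thesis
    proof (rule mlin_frame_eqI[OF mlin_coframe_monomial mlin_cmult[OF mlin_coframe_monomial] _ True])
      fix "is" :: "7 list" assume "length is = 7"
      then show "vol (map f is) = D * ?vol0 (map f is)"
        using D1 skew_top[OF skew_coframe_monomial, of "is" "mat 1" "[1,2,3,4,5,6,7]" f] vol_f[of "is"]
        by (simp del: list.map add: mult.assoc[symmetric])
    qed
  qed
qed

end

section \<open>Algebra of the model forms\<close>

text \<open>The derivation action of a matrix on 3-tensors. With \<open>N\<close> the connection
  coefficients in some direction, a tensor is parallel in that direction exactly if the derivative
  of its components is the action of \<open>N\<close>.\<close>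

definition act3 :: "(7 \<Rightarrow> 7 \<Rightarrow> real) \<Rightarrow> (7 \<Rightarrow> 7 \<Rightarrow> 7 \<Rightarrow> real) \<Rightarrow> 7 \<Rightarrow> 7 \<Rightarrow> 7 \<Rightarrow> real" where
  "act3 N X a b c = (\<Sum>m\<in>UNIV. N a m * X m b c) + (\<Sum>m\<in>UNIV. N b m * X a m c) + (\<Sum>m\<in>UNIV. N c m * X a b m)"

definition act4 :: "(7 \<Rightarrow> 7 \<Rightarrow> real) \<Rightarrow> (7 \<Rightarrow> 7 \<Rightarrow> 7 \<Rightarrow> 7 \<Rightarrow> real) \<Rightarrow> 7 \<Rightarrow> 7 \<Rightarrow> 7 \<Rightarrow> 7 \<Rightarrow> real" where
  "act4 N X a b c d = (\<Sum>m\<in>UNIV. N a m * X m b c d) + (\<Sum>m\<in>UNIV. N b m * X a m c d)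
     + (\<Sum>m\<in>UNIV. N c m * X a b m d) + (\<Sum>m\<in>UNIV. N d m * X a b c m)"

text \<open>If \<open>P i\<close> holds the derivatives in direction \<open>i\<close> of the
  components of a 3-form, this is its exterior derivative; \<open>alt4\<close> plays the same role
  for 4-forms.\<close>

definition alt3 :: "(7 \<Rightarrow> 7 \<Rightarrow> 7 \<Rightarrow> 7 \<Rightarrow> real) \<Rightarrow> 7 \<Rightarrow> 7 \<Rightarrow> 7 \<Rightarrow> 7 \<Rightarrow> real" where
  "alt3 P a b c d = P a b c d - P b a c d + P c a b d - P d a b c"

definition alt4 :: "(7 \<Rightarrow> 7 \<Rightarrow> 7 \<Rightarrow> 7 \<Rightarrow> 7 \<Rightarrow> real) \<Rightarrow> 7 \<Rightarrow> 7 \<Rightarrow> 7 \<Rightarrow> 7 \<Rightarrow> 7 \<Rightarrow> real" where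
  "alt4 P a b c d k = P a b c d k - P b a c d k + P c a b d k - P d a b c k + P k a b c d"

definition wedge13 :: "(7 \<Rightarrow> real) \<Rightarrow> (7 \<Rightarrow> 7 \<Rightarrow> 7 \<Rightarrow> real) \<Rightarrow> 7 \<Rightarrow> 7 \<Rightarrow> 7 \<Rightarrow> 7 \<Rightarrow> real" where
  "wedge13 t X a b c d = t a * X b c d - t b * X a c d + t c * X a b d - t d * X a b c"

definition wedge14 :: "(7 \<Rightarrow> real) \<Rightarrow> (7 \<Rightarrow> 7 \<Rightarrow> 7 \<Rightarrow> 7 \<Rightarrow> real) \<Rightarrow> 7 \<Rightarrow> 7 \<Rightarrow> 7 \<Rightarrow> 7 \<Rightarrow> 7 \<Rightarrow> real" where
  "wedge14 t X a b c d k = t a * X b c d k - t b * X a c d k + t c * X a b d k - t d * X a b c k + t k * X a b c d"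

lemmas tables = phi0_sort psi0_sort idx_simps phi0_table psi0_table

section \<open>Reduction to increasing indices\<close>

lemma phi0_contract:
  "(\<Sum>c\<in>UNIV. \<Sum>d\<in>UNIV. X c d * phi0 1 c d) = X 2 3 - X 3 2 + X 4 5 - X 5 4 + X 6 7 - X 7 6"
  "(\<Sum>c\<in>UNIV. \<Sum>d\<in>UNIV. X c d * phi0 2 c d) = - X 1 3 + X 3 1 + X 4 6 - X 5 7 - X 6 4 + X 7 5"
  "(\<Sum>c\<in>UNIV. \<Sum>d\<in>UNIV. X c d * phi0 3 c d) = X 1 2 - X 2 1 - X 4 7 - X 5 6 + X 6 5 + X 7 4"
  "(\<Sum>c\<in>UNIV. \<Sum>d\<in>UNIV. X c d * phi0 4 c d) = - X 1 5 - X 2 6 + X 3 7 + X 5 1 + X 6 2 - X 7 3"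
  "(\<Sum>c\<in>UNIV. \<Sum>d\<in>UNIV. X c d * phi0 5 c d) = X 1 4 + X 2 7 + X 3 6 - X 4 1 - X 6 3 - X 7 2"
  "(\<Sum>c\<in>UNIV. \<Sum>d\<in>UNIV. X c d * phi0 6 c d) = - X 1 7 + X 2 4 - X 3 5 - X 4 2 + X 5 3 + X 7 1"
  "(\<Sum>c\<in>UNIV. \<Sum>d\<in>UNIV. X c d * phi0 7 c d) = X 1 6 - X 2 5 - X 3 4 + X 4 3 + X 5 2 - X 6 1"
  by (simp_all add: sum_7 tables)

text \<open>Unfolds a claim about a 3-form to its 35 independent components instead of all 343 index
  triples.\<close>

lemma forall_sorted_3:
  "(\<forall>a b. idx a < idx b \<longrightarrow> (\<forall>c. idx b < idx c \<longrightarrow> P a b c)) \<longleftrightarrow>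
   P 1 2 3 \<and> P 1 2 4 \<and> P 1 2 5 \<and> P 1 2 6 \<and> P 1 2 7 \<and> P 1 3 4 \<and> P 1 3 5 \<and> P 1 3 6 \<and> P 1 3 7 \<and> P 1 4 5 \<and> P 1 4 6
       \<and> P 1 4 7 \<and> P 1 5 6 \<and> P 1 5 7 \<and> P 1 6 7 \<and> P 2 3 4 \<and> P 2 3 5 \<and> P 2 3 6 \<and> P 2 3 7 \<and> P 2 4 5 \<and> P 2 4 6 \<and> P 2 4 7
       \<and> P 2 5 6 \<and> P 2 5 7 \<and> P 2 6 7 \<and> P 3 4 5 \<and> P 3 4 6 \<and> P 3 4 7 \<and> P 3 5 6 \<and> P 3 5 7 \<and> P 3 6 7 \<and> P 4 5 6 \<and> P 4 5 7
       \<and> P 4 6 7 \<and> P 5 6 7"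
  by (simp add: forall_7 idx_simps)

lemma forall_sorted_4:
  "(\<forall>a b. idx a < idx b \<longrightarrow> (\<forall>c. idx b < idx c \<longrightarrow> (\<forall>d. idx c < idx d \<longrightarrow> P a b c d))) \<longleftrightarrow>
   P 1 2 3 4 \<and> P 1 2 3 5 \<and> P 1 2 3 6 \<and> P 1 2 3 7 \<and> P 1 2 4 5 \<and> P 1 2 4 6 \<and> P 1 2 4 7 \<and> P 1 2 5 6 \<and> P 1 2 5 7
       \<and> P 1 2 6 7 \<and> P 1 3 4 5 \<and> P 1 3 4 6 \<and> P 1 3 4 7 \<and> P 1 3 5 6 \<and> P 1 3 5 7 \<and> P 1 3 6 7 \<and> P 1 4 5 6 \<and> P 1 4 5 7
       \<and> P 1 4 6 7 \<and> P 1 5 6 7 \<and> P 2 3 4 5 \<and> P 2 3 4 6 \<and> P 2 3 4 7 \<and> P 2 3 5 6 \<and> P 2 3 5 7 \<and> P 2 3 6 7 \<and> P 2 4 5 6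
       \<and> P 2 4 5 7 \<and> P 2 4 6 7 \<and> P 2 5 6 7 \<and> P 3 4 5 6 \<and> P 3 4 5 7 \<and> P 3 4 6 7 \<and> P 3 5 6 7 \<and> P 4 5 6 7"
  by (simp add: forall_7 idx_simps)

lemma forall_sorted_5:
  "(\<forall>a b. idx a < idx b \<longrightarrow> (\<forall>c. idx b < idx c \<longrightarrow> (\<forall>d. idx c < idx d \<longrightarrow> (\<forall>k. idx d < idx k \<longrightarrow> P a b c d k)))) \<longleftrightarrow>
   P 1 2 3 4 5 \<and> P 1 2 3 4 6 \<and> P 1 2 3 4 7 \<and> P 1 2 3 5 6 \<and> P 1 2 3 5 7 \<and> P 1 2 3 6 7 \<and> P 1 2 4 5 6 \<and> P 1 2 4 5 7
       \<and> P 1 2 4 6 7 \<and> P 1 2 5 6 7 \<and> P 1 3 4 5 6 \<and> P 1 3 4 5 7 \<and> P 1 3 4 6 7 \<and> P 1 3 5 6 7 \<and> P 1 4 5 6 7 \<and> P 2 3 4 5 6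
       \<and> P 2 3 4 5 7 \<and> P 2 3 4 6 7 \<and> P 2 3 5 6 7 \<and> P 2 4 5 6 7 \<and> P 3 4 5 6 7"
  by (simp add: forall_7 idx_simps)

lemma skew3_eqI:
  assumes "skew3 X" "skew3 Y"
    and "\<And>a b c. idx a < idx b \<Longrightarrow> idx b < idx c \<Longrightarrow> X a b c = Y a b c"
  shows "X a b c = Y a b c"
proof -
  have "\<forall>a b c. idx a < idx b \<longrightarrow> idx b < idx c \<longrightarrow> X a b c = Y a b c" using assms(3) by blast
  then have e: "X 1 2 3 = Y 1 2 3" "X 1 2 4 = Y 1 2 4" "X 1 2 5 = Y 1 2 5" "X 1 2 6 = Y 1 2 6" "X 1 2 7 = Y 1 2 7"
    "X 1 3 4 = Y 1 3 4" "X 1 3 5 = Y 1 3 5" "X 1 3 6 = Y 1 3 6" "X 1 3 7 = Y 1 3 7" "X 1 4 5 = Y 1 4 5"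
    "X 1 4 6 = Y 1 4 6" "X 1 4 7 = Y 1 4 7" "X 1 5 6 = Y 1 5 6" "X 1 5 7 = Y 1 5 7" "X 1 6 7 = Y 1 6 7"
    "X 2 3 4 = Y 2 3 4" "X 2 3 5 = Y 2 3 5" "X 2 3 6 = Y 2 3 6" "X 2 3 7 = Y 2 3 7" "X 2 4 5 = Y 2 4 5"
    "X 2 4 6 = Y 2 4 6" "X 2 4 7 = Y 2 4 7" "X 2 5 6 = Y 2 5 6" "X 2 5 7 = Y 2 5 7" "X 2 6 7 = Y 2 6 7"
    "X 3 4 5 = Y 3 4 5" "X 3 4 6 = Y 3 4 6" "X 3 4 7 = Y 3 4 7" "X 3 5 6 = Y 3 5 6" "X 3 5 7 = Y 3 5 7"
    "X 3 6 7 = Y 3 6 7" "X 4 5 6 = Y 4 5 6" "X 4 5 7 = Y 4 5 7" "X 4 6 7 = Y 4 6 7" "X 5 6 7 = Y 5 6 7"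
    by (simp_all add: idx_simps)
  have "\<forall>a b c. X a b c = Y a b c"
    by (simp add: forall_7 skew3_sort[OF assms(1)] skew3_sort[OF assms(2)] idx_simps e)
  then show ?thesis by blast
qed

lemma skew3_act3: assumes "skew3 X" shows "skew3 (act3 N X)"
proof -
  have 1: "X a b c = - X b a c" "X a b c = - X a c b" for a b c
    using assms unfolding skew3_def by blast+
  show ?thesis unfolding skew3_def act3_def
  proof (intro allI conjI)
    fix a b c
    show "(\<Sum>m\<in>UNIV. N a m * X m b c) + (\<Sum>m\<in>UNIV. N b m * X a m c) + (\<Sum>m\<in>UNIV. N c m * X a b m) =
      - ((\<Sum>m\<in>UNIV. N b m * X m a c) + (\<Sum>m\<in>UNIV. N a m * X b m c) + (\<Sum>m\<in>UNIV. N c m * X b a m))"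
      by (subst 1(1)[of _ b c], subst 1(1)[of a _ c], subst 1(1)[of a b _]) (simp add: sum_negf)
    show "(\<Sum>m\<in>UNIV. N a m * X m b c) + (\<Sum>m\<in>UNIV. N b m * X a m c) + (\<Sum>m\<in>UNIV. N c m * X a b m) =
      - ((\<Sum>m\<in>UNIV. N a m * X m c b) + (\<Sum>m\<in>UNIV. N c m * X a m b) + (\<Sum>m\<in>UNIV. N b m * X a c m))"
      by (subst 1(2)[of _ b c], subst 1(2)[of a _ c], subst 1(2)[of a b _]) (simp add: sum_negf)
  qed
qed

lemma skew3_diff: "skew3 X \<Longrightarrow> skew3 Y \<Longrightarrow> skew3 (\<lambda>a b c. X a b c - Y a b c)"
  unfolding skew3_def by (metis minus_diff_eq minus_diff_minus)

lemma skew3_psi0_contract: "skew3 (\<lambda>a b c. \<Sum>m\<in>UNIV. w m * psi0 m a b c)"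
proof -
  have 1: "psi0 m a b c = - psi0 m b a c" "psi0 m a b c = - psi0 m a c b" for m a b c
    using skew4_psi0 unfolding skew4_def by blast+
  show ?thesis unfolding skew3_def
  proof (intro allI conjI)
    fix a b c
    show "(\<Sum>m\<in>UNIV. w m * psi0 m a b c) = - (\<Sum>m\<in>UNIV. w m * psi0 m b a c)"
      by (subst 1(1)) (simp add: sum_negf)
    show "(\<Sum>m\<in>UNIV. w m * psi0 m a b c) = - (\<Sum>m\<in>UNIV. w m * psi0 m a c b)"
      by (subst 1(2)) (simp add: sum_negf)
  qed
qed

text \<open>The 3-forms whose product with \<open>\<phi>\<close> in \<open>S\<^sup>2\<close> vanishes form the 7-dimensional summand of
  \<open>\<Lambda>\<^sup>3\<close>: both are annihilated by the map to symmetric tensors that is injective on the complement.\<close>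

lemma Lambda3_7:
  assumes W: "skew3 W"
    and h: "\<And>a b. (\<Sum>c\<in>UNIV. \<Sum>d\<in>UNIV. W a c d * phi0 b c d) + (\<Sum>c\<in>UNIV. \<Sum>d\<in>UNIV. W b c d * phi0 a c d) = 0"
  shows "\<exists>w. \<forall>a b c. W a b c = (\<Sum>m\<in>UNIV. w m * psi0 m a b c)"
proof -
  \<comment> \<open>Each component of \<open>w\<close> is read off from one entry of
    \<open>W\<close> in which, by the table of \<psi>, no other component of \<open>w\<close>
    occurs.\<close>
  define w :: "7 \<Rightarrow> real" where "w = (\<lambda>m. if m = 1 then - W 2 4 7 else if m = 2 then W 1 4 7 else if m = 3 then W 1 4 6
      else if m = 4 then - W 1 2 7 else if m = 5 then - W 1 2 6 else if m = 6 then W 1 2 5 else W 1 2 4)"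
  have wv: "w 1 = - W 2 4 7" "w 2 = W 1 4 7" "w 3 = W 1 4 6" "w 4 = - W 1 2 7" "w 5 = - W 1 2 6" "w 6 = W 1 2 5"
      "w 7 = W 1 2 4"
    by (simp_all add: w_def)
  have "\<forall>a b. (\<Sum>c\<in>UNIV. \<Sum>d\<in>UNIV. W a c d * phi0 b c d) + (\<Sum>c\<in>UNIV. \<Sum>d\<in>UNIV. W b c d * phi0 a c d) = 0"
    using h by blast
  note H = this[unfolded forall_7, simplified phi0_contract skew3_sort[OF W] idx_simps]
  have "\<forall>a b. idx a < idx b \<longrightarrow> (\<forall>c. idx b < idx c \<longrightarrow> W a b c = (\<Sum>m\<in>UNIV. w m * psi0 m a b c))"
    unfolding forall_sorted_3 using H by (simp add: sum_7 tables wv)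
  then have "W a b c = (\<Sum>m\<in>UNIV. w m * psi0 m a b c)" for a b c
    using skew3_eqI[OF W skew3_psi0_contract[of w], of a b c] by blast
  then show ?thesis by blast
qed

text \<open>The derivative of the identity \<open>I1\<close> when \<phi> varies by the action of
  \<open>N\<close> and the metric by \<open>N a b + N b a\<close>; the subtracted sum comes from the
  two inverse metrics. The actions of \<open>N\<close> on the two contracted indices give the same
  sum \<open>K\<close>, which then cancels.\<close>

lemma act3_phi0_sym:
  "(\<Sum>c\<in>UNIV. \<Sum>d\<in>UNIV. act3 N phi0 a c d * phi0 b c d) + (\<Sum>c\<in>UNIV. \<Sum>d\<in>UNIV. act3 N phi0 b c d * phi0 a c d)
     - 2 * (\<Sum>c\<in>UNIV. \<Sum>d\<in>UNIV. (\<Sum>k\<in>UNIV. phi0 b k d * (N c k + N k c)) * phi0 a c d) = 6 * (N a b + N b a)"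
proof -
  define K where "K a b = (\<Sum>c\<in>UNIV. \<Sum>d\<in>UNIV. \<Sum>m\<in>UNIV. N c m * (phi0 a m d * phi0 b c d))" for a b
  have sw: "phi0 a b c = - phi0 a c b" for a b c
    using skew3_phi0 unfolding skew3_def by blast
  have 1: "(\<Sum>c\<in>UNIV. \<Sum>d\<in>UNIV. act3 N phi0 a c d * phi0 b c d) = 6 * N a b + 2 * K a b" for a b
  proof -
    have "(\<Sum>c\<in>UNIV. \<Sum>d\<in>UNIV. (\<Sum>m\<in>UNIV. N a m * phi0 m c d) * phi0 b c d) =
        (\<Sum>c\<in>UNIV. \<Sum>m\<in>UNIV. \<Sum>d\<in>UNIV. N a m * (phi0 m c d * phi0 b c d))"
      unfolding sum_distrib_right mult.assoc by (rule sum.cong[OF refl], rule sum.swap)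
    also have "\<dots> = (\<Sum>m\<in>UNIV. N a m * (\<Sum>c\<in>UNIV. \<Sum>d\<in>UNIV. phi0 m c d * phi0 b c d))"
      unfolding sum_distrib_left by (rule sum.swap)
    also have "\<dots> = 6 * N a b"
      unfolding phi0_phi0_2 by (simp add: if_distrib cong: if_cong)
    finally have a: "(\<Sum>c\<in>UNIV. \<Sum>d\<in>UNIV. (\<Sum>m\<in>UNIV. N a m * phi0 m c d) * phi0 b c d) = 6 * N a b" .
    have b: "(\<Sum>c\<in>UNIV. \<Sum>d\<in>UNIV. (\<Sum>m\<in>UNIV. N c m * phi0 a m d) * phi0 b c d) = K a b"
      unfolding K_def sum_distrib_right mult.assoc ..
    have "(\<Sum>c\<in>UNIV. \<Sum>d\<in>UNIV. (\<Sum>m\<in>UNIV. N d m * phi0 a c m) * phi0 b c d) =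
      (\<Sum>d\<in>UNIV. \<Sum>c\<in>UNIV. (\<Sum>m\<in>UNIV. N d m * phi0 a c m) * phi0 b c d)" by (rule sum.swap)
    also have "\<dots> = K a b"
      unfolding K_def sum_distrib_right mult.assoc
      by (intro sum.cong refl) (subst sw[of a], subst sw[of b], simp)
    finally show ?thesis unfolding act3_def distrib_right sum.distrib a b by simp
  qed
  have "(\<Sum>c\<in>UNIV. \<Sum>d\<in>UNIV. (\<Sum>k\<in>UNIV. phi0 b k d * (N c k + N k c)) * phi0 a c d) =
     (\<Sum>c\<in>UNIV. \<Sum>d\<in>UNIV. \<Sum>k\<in>UNIV. N c k * (phi0 b k d * phi0 a c d)) +
     (\<Sum>c\<in>UNIV. \<Sum>d\<in>UNIV. \<Sum>k\<in>UNIV. N k c * (phi0 a c d * phi0 b k d))"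
    unfolding sum.distrib[symmetric] sum_distrib_right
    by (intro sum.cong refl) (simp add: distrib_left distrib_right mult_ac)
  also have "(\<Sum>c\<in>UNIV. \<Sum>d\<in>UNIV. \<Sum>k\<in>UNIV. N k c * (phi0 a c d * phi0 b k d)) =
     (\<Sum>c\<in>UNIV. \<Sum>k\<in>UNIV. \<Sum>d\<in>UNIV. N k c * (phi0 a c d * phi0 b k d))"
    by (rule sum.cong[OF refl], rule sum.swap)
  also have "\<dots> = (\<Sum>k\<in>UNIV. \<Sum>c\<in>UNIV. \<Sum>d\<in>UNIV. N k c * (phi0 a c d * phi0 b k d))"
    by (rule sum.swap)
  also have "\<dots> = K a b"
    unfolding K_def by (rule sum.cong[OF refl], rule sum.swap)
  finally show ?thesis unfolding 1 by (simp add: K_def)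
qed

text \<open>The derivative of \<open>phi0_phi0\<close>, which expresses \<psi> by \<phi> and the
  metric. The extra variation of \<phi>, the contraction of \<open>w\<close> with \<psi>, leaves the
  metric fixed and changes \<psi> by minus the product of \<open>w\<close> with \<phi>.\<close>

lemma act_psi0:
  assumes w: "\<And>a b c. P a b c = act3 N phi0 a b c + (\<Sum>m\<in>UNIV. w m * psi0 m a b c)"
    and S: "S a b c d = (\<Sum>m\<in>UNIV. P a b m * phi0 c d m) + (\<Sum>m\<in>UNIV. phi0 a b m * P c d m)
      - (\<Sum>m\<in>UNIV. \<Sum>n\<in>UNIV. phi0 a b m * phi0 c d n * (N m n + N n m))
      - (N a c + N c a) * (if b = d then 1 else 0) - (if a = c then 1 else 0) * (N b d + N d b)
      + (N a d + N d a) * (if b = c then 1 else 0) + (if a = d then 1 else 0) * (N b c + N c b)"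
    and s: "idx a < idx b" "idx b < idx c" "idx c < idx d"
  shows "S a b c d = act4 N psi0 a b c d - wedge13 w phi0 a b c d"
proof -
  have "\<forall>a b. idx a < idx b \<longrightarrow> (\<forall>c. idx b < idx c \<longrightarrow> (\<forall>d. idx c < idx d \<longrightarrow>
     (\<Sum>m\<in>UNIV. P a b m * phi0 c d m) + (\<Sum>m\<in>UNIV. phi0 a b m * P c d m)
      - (\<Sum>m\<in>UNIV. \<Sum>n\<in>UNIV. phi0 a b m * phi0 c d n * (N m n + N n m))
      - (N a c + N c a) * (if b = d then 1 else 0) - (if a = c then 1 else 0) * (N b d + N d b)
      + (N a d + N d a) * (if b = c then 1 else 0) + (if a = d then 1 else 0) * (N b c + N c b)
     = act4 N psi0 a b c d - wedge13 w phi0 a b c d))"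
    unfolding forall_sorted_4
    by (intro conjI; simp add: w sum_7 tables act3_def act4_def wedge13_def)
  then show ?thesis using S s by simp
qed

text \<open>The triples of \<phi> are the lines of a Fano plane, and the tables respect the
  resulting grading of the indices. So the 49 unknowns split into seven blocks, each of the six
  index pairs whose lines have the same third point, and the diagonal block. Each block is a system
  of seven equations of full rank.\<close>

lemma alternation_determines:
  assumes A: "\<And>a b c d. idx a < idx b \<Longrightarrow> idx b < idx c \<Longrightarrow> idx c < idx d \<Longrightarrow> alt3 (\<lambda>i a b c. \<Sum>m\<in>UNIV. w i m * psi0 m a b c)
      a b c d = 0"
    and B: "\<And>a b c d k. idx a < idx b \<Longrightarrow> idx b < idx c \<Longrightarrow> idx c < idx d \<Longrightarrow> idx d < idx k
        \<Longrightarrow> alt4 (\<lambda>i. wedge13 (w i) phi0) a b c d k = 0"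
  shows "w i m = 0"
proof -
  have z1: "w 1 5 = 0" "w 2 6 = 0" "w 3 7 = 0" "w 6 2 = 0" "w 7 3 = 0" "w 5 1 = 0"
    using A[of 1 2 3 4, simplified idx_simps, simplified] A[of 1 4 6 7, simplified idx_simps, simplified]
        A[of 2 4 5 7, simplified idx_simps, simplified] A[of 3 4 5 6, simplified idx_simps, simplified]
        B[of 1 2 4 5 6, simplified idx_simps, simplified] B[of 1 3 4 5 7, simplified idx_simps, simplified]
        B[of 2 3 4 6 7, simplified idx_simps, simplified]
    by (simp_all add: alt3_def alt4_def wedge13_def sum_7 phi0_sort psi0_sort idx_simps phi0_table psi0_table)
  have z2: "w 1 4 = 0" "w 2 7 = 0" "w 3 6 = 0" "w 6 3 = 0" "w 7 2 = 0" "w 4 1 = 0"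
    using A[of 1 2 3 5, simplified idx_simps, simplified] A[of 1 5 6 7, simplified idx_simps, simplified]
        A[of 2 4 5 6, simplified idx_simps, simplified] A[of 3 4 5 7, simplified idx_simps, simplified]
        B[of 1 2 4 5 7, simplified idx_simps, simplified] B[of 1 3 4 5 6, simplified idx_simps, simplified]
        B[of 2 3 5 6 7, simplified idx_simps, simplified]
    by (simp_all add: alt3_def alt4_def wedge13_def sum_7 phi0_sort psi0_sort idx_simps phi0_table psi0_table)
  have z3: "w 1 7 = 0" "w 2 4 = 0" "w 3 5 = 0" "w 4 2 = 0" "w 5 3 = 0" "w 7 1 = 0"
    using A[of 1 2 3 6, simplified idx_simps, simplified] A[of 1 4 5 6, simplified idx_simps, simplified]
        A[of 2 5 6 7, simplified idx_simps, simplified] A[of 3 4 6 7, simplified idx_simps, simplified]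
        B[of 1 2 4 6 7, simplified idx_simps, simplified] B[of 1 3 5 6 7, simplified idx_simps, simplified]
        B[of 2 3 4 5 6, simplified idx_simps, simplified]
    by (simp_all add: alt3_def alt4_def wedge13_def sum_7 phi0_sort psi0_sort idx_simps phi0_table psi0_table)
  have z4: "w 1 6 = 0" "w 2 5 = 0" "w 3 4 = 0" "w 4 3 = 0" "w 5 2 = 0" "w 6 1 = 0"
    using A[of 1 2 3 7, simplified idx_simps, simplified] A[of 1 4 5 7, simplified idx_simps, simplified]
        A[of 2 4 6 7, simplified idx_simps, simplified] A[of 3 5 6 7, simplified idx_simps, simplified]
        B[of 1 2 5 6 7, simplified idx_simps, simplified] B[of 1 3 4 6 7, simplified idx_simps, simplified]
        B[of 2 3 4 5 7, simplified idx_simps, simplified]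
    by (simp_all add: alt3_def alt4_def wedge13_def sum_7 phi0_sort psi0_sort idx_simps phi0_table psi0_table)
  have z5: "w 1 3 = 0" "w 4 6 = 0" "w 5 7 = 0" "w 6 4 = 0" "w 7 5 = 0" "w 3 1 = 0"
    using A[of 1 2 4 5, simplified idx_simps, simplified] A[of 1 2 6 7, simplified idx_simps, simplified]
        A[of 2 3 4 7, simplified idx_simps, simplified] A[of 2 3 5 6, simplified idx_simps, simplified]
        B[of 1 2 3 4 6, simplified idx_simps, simplified] B[of 1 2 3 5 7, simplified idx_simps, simplified]
        B[of 2 4 5 6 7, simplified idx_simps, simplified]
    by (simp_all add: alt3_def alt4_def wedge13_def sum_7 phi0_sort psi0_sort idx_simps phi0_table psi0_table)
  have z6: "w 2 3 = 0" "w 4 5 = 0" "w 6 7 = 0" "w 5 4 = 0" "w 7 6 = 0" "w 3 2 = 0"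
    using A[of 1 2 4 6, simplified idx_simps, simplified] A[of 1 2 5 7, simplified idx_simps, simplified]
        A[of 1 3 4 7, simplified idx_simps, simplified] A[of 1 3 5 6, simplified idx_simps, simplified]
        B[of 1 2 3 4 5, simplified idx_simps, simplified] B[of 1 2 3 6 7, simplified idx_simps, simplified]
        B[of 1 4 5 6 7, simplified idx_simps, simplified]
    by (simp_all add: alt3_def alt4_def wedge13_def sum_7 phi0_sort psi0_sort idx_simps phi0_table psi0_table)
  have z7: "w 1 1 = 0" "w 2 2 = 0" "w 4 4 = 0" "w 7 7 = 0" "w 5 5 = 0" "w 6 6 = 0" "w 3 3 = 0"
    using A[of 1 2 4 7, simplified idx_simps, simplified] A[of 1 2 5 6, simplified idx_simps, simplified]
        A[of 1 3 4 6, simplified idx_simps, simplified] A[of 1 3 5 7, simplified idx_simps, simplified]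
        A[of 2 3 4 5, simplified idx_simps, simplified] A[of 2 3 6 7, simplified idx_simps, simplified]
        A[of 4 5 6 7, simplified idx_simps, simplified]
    by (simp_all add: alt3_def alt4_def wedge13_def sum_7 phi0_sort psi0_sort idx_simps phi0_table psi0_table)
  have z8: "w 1 2 = 0" "w 4 7 = 0" "w 5 6 = 0" "w 6 5 = 0" "w 7 4 = 0" "w 2 1 = 0"
    using A[of 1 3 4 5, simplified idx_simps, simplified] A[of 1 3 6 7, simplified idx_simps, simplified]
        A[of 2 3 4 6, simplified idx_simps, simplified] A[of 2 3 5 7, simplified idx_simps, simplified]
        B[of 1 2 3 4 7, simplified idx_simps, simplified] B[of 1 2 3 5 6, simplified idx_simps, simplified]
        B[of 3 4 5 6 7, simplified idx_simps, simplified]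
    by (simp_all add: alt3_def alt4_def wedge13_def sum_7 phi0_sort psi0_sort idx_simps phi0_table psi0_table)
  have "\<forall>i m. w i m = 0" unfolding forall_7 by (simp add: z1 z2 z3 z4 z5 z6 z7 z8)
  then show ?thesis by blast
qed

lemma skew3_cmult: "skew3 X \<Longrightarrow> skew3 (\<lambda>a b c. k * X a b c)"
  unfolding skew3_def by (metis mult_minus_right)

text \<open>\<open>con\<close> says in components that the products of \<open>t3\<close> with \<psi>
  (first equation) and with \<phi> (the other seven) vanish, which leaves a 27-dimensional space;
  \<open>st\<close> says that \<open>s3\<close> is star \<open>t3\<close>. The coefficients 1/6, -1
  and -1 in \<open>T\<close> are those for which half of \<open>T\<close>, acting on \<phi>,
  alternates to the prescribed d\<phi>.\<close>

lemma alt_torsion: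
  fixes T t3 :: "7 \<Rightarrow> 7 \<Rightarrow> 7 \<Rightarrow> real"
  assumes t3: "skew3 t3"
    and T: "\<And>a b c. T a b c = t0 / 6 * phi0 a b c - (\<Sum>m\<in>UNIV. t1 m * psi0 m a b c) - t3 a b c"
    and con: "t3 1 2 3 + t3 1 4 5 + t3 1 6 7 + t3 2 4 6 - t3 2 5 7 - t3 3 4 7 - t3 3 5 6 = 0"
        "- t3 2 4 7 - t3 2 5 6 - t3 3 4 6 + t3 3 5 7 = 0" "t3 1 4 7 + t3 1 5 6 + t3 3 4 5 + t3 3 6 7 = 0"
        "t3 1 4 6 - t3 1 5 7 - t3 2 4 5 - t3 2 6 7 = 0" "- t3 1 2 7 - t3 1 3 6 + t3 2 3 5 + t3 5 6 7 = 0"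
        "- t3 1 2 6 + t3 1 3 7 - t3 2 3 4 - t3 4 6 7 = 0" "t3 1 2 5 + t3 1 3 4 + t3 2 3 7 + t3 4 5 7 = 0"
        "t3 1 2 4 - t3 1 3 5 - t3 2 3 6 - t3 4 5 6 = 0"
    and st: "s3 1 2 3 4 = t3 5 6 7" "s3 1 2 3 5 = - t3 4 6 7" "s3 1 2 3 6 = t3 4 5 7" "s3 1 2 3 7 = - t3 4 5 6"
        "s3 1 2 4 5 = t3 3 6 7" "s3 1 2 4 6 = - t3 3 5 7" "s3 1 2 4 7 = t3 3 5 6" "s3 1 2 5 6 = t3 3 4 7"
        "s3 1 2 5 7 = - t3 3 4 6" "s3 1 2 6 7 = t3 3 4 5" "s3 1 3 4 5 = - t3 2 6 7" "s3 1 3 4 6 = t3 2 5 7"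
        "s3 1 3 4 7 = - t3 2 5 6" "s3 1 3 5 6 = - t3 2 4 7" "s3 1 3 5 7 = t3 2 4 6" "s3 1 3 6 7 = - t3 2 4 5"
        "s3 1 4 5 6 = t3 2 3 7" "s3 1 4 5 7 = - t3 2 3 6" "s3 1 4 6 7 = t3 2 3 5" "s3 1 5 6 7 = - t3 2 3 4"
        "s3 2 3 4 5 = t3 1 6 7" "s3 2 3 4 6 = - t3 1 5 7" "s3 2 3 4 7 = t3 1 5 6" "s3 2 3 5 6 = t3 1 4 7"
        "s3 2 3 5 7 = - t3 1 4 6" "s3 2 3 6 7 = t3 1 4 5" "s3 2 4 5 6 = - t3 1 3 7" "s3 2 4 5 7 = t3 1 3 6"
        "s3 2 4 6 7 = - t3 1 3 5" "s3 2 5 6 7 = t3 1 3 4" "s3 3 4 5 6 = t3 1 2 7" "s3 3 4 5 7 = - t3 1 2 6"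
        "s3 3 4 6 7 = t3 1 2 5" "s3 3 5 6 7 = - t3 1 2 4" "s3 4 5 6 7 = t3 1 2 3"
    and s: "idx a < idx b" "idx b < idx c" "idx c < idx d"
  shows "alt3 (\<lambda>i. act3 (\<lambda>a m. T i a m / 2) phi0) a b c d =
    t0 * psi0 a b c d + 3 * wedge13 t1 phi0 a b c d + s3 a b c d"
proof -
  have T': "skew3 T"
    unfolding T[abs_def] diff_conv_add_uminus
    by (intro skew3_diff[unfolded diff_conv_add_uminus] t3 skew3_psi0_contract skew3_cmult[OF skew3_phi0])
  have "\<forall>a b. idx a < idx b \<longrightarrow> (\<forall>c. idx b < idx c \<longrightarrow>
      T a b c = t0 / 6 * phi0 a b c - (\<Sum>m\<in>UNIV. t1 m * psi0 m a b c) - t3 a b c)"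
    using T by blast
  note Ts = this[unfolded forall_sorted_3, simplified sum_7 tables]
  have "\<forall>a b. idx a < idx b \<longrightarrow> (\<forall>c. idx b < idx c \<longrightarrow> (\<forall>d. idx c < idx d \<longrightarrow>
    alt3 (\<lambda>i. act3 (\<lambda>a m. T i a m / 2) phi0) a b c d =
    t0 * psi0 a b c d + 3 * wedge13 t1 phi0 a b c d + s3 a b c d))"
    unfolding forall_sorted_4 using con
    by (intro conjI; simp add: Ts st sum_7 tables skew3_sort[OF T'] alt3_def act3_def wedge13_def;
      (simp add: field_simps)?; linarith?)
  then show ?thesis using s by blast
qed

text \<open>The same \<open>T\<close> accounts for d\<psi>: the 5-forms are 7 + 14, and 3-forms have
  no component of type 14, so nothing arises in the part that \<tau>_2 would occupy.\<close>

lemma alt_torsion_psi: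
  fixes T t3 :: "7 \<Rightarrow> 7 \<Rightarrow> 7 \<Rightarrow> real"
  assumes t3: "skew3 t3"
    and T: "\<And>a b c. T a b c = t0 / 6 * phi0 a b c - (\<Sum>m\<in>UNIV. t1 m * psi0 m a b c) - t3 a b c"
    and con: "t3 1 2 3 + t3 1 4 5 + t3 1 6 7 + t3 2 4 6 - t3 2 5 7 - t3 3 4 7 - t3 3 5 6 = 0"
        "- t3 2 4 7 - t3 2 5 6 - t3 3 4 6 + t3 3 5 7 = 0" "t3 1 4 7 + t3 1 5 6 + t3 3 4 5 + t3 3 6 7 = 0"
        "t3 1 4 6 - t3 1 5 7 - t3 2 4 5 - t3 2 6 7 = 0" "- t3 1 2 7 - t3 1 3 6 + t3 2 3 5 + t3 5 6 7 = 0"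
        "- t3 1 2 6 + t3 1 3 7 - t3 2 3 4 - t3 4 6 7 = 0" "t3 1 2 5 + t3 1 3 4 + t3 2 3 7 + t3 4 5 7 = 0"
        "t3 1 2 4 - t3 1 3 5 - t3 2 3 6 - t3 4 5 6 = 0"
    and s: "idx a < idx b" "idx b < idx c" "idx c < idx d" "idx d < idx k"
  shows "alt4 (\<lambda>i. act4 (\<lambda>a m. T i a m / 2) psi0) a b c d k = 4 * wedge14 t1 psi0 a b c d k"
proof -
  have T': "skew3 T"
    unfolding T[abs_def] diff_conv_add_uminus
    by (intro skew3_diff[unfolded diff_conv_add_uminus] t3 skew3_psi0_contract skew3_cmult[OF skew3_phi0])
  have "\<forall>a b. idx a < idx b \<longrightarrow> (\<forall>c. idx b < idx c \<longrightarrow>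
      T a b c = t0 / 6 * phi0 a b c - (\<Sum>m\<in>UNIV. t1 m * psi0 m a b c) - t3 a b c)"
    using T by blast
  note Ts = this[unfolded forall_sorted_3, simplified sum_7 tables]
  have "\<forall>a b. idx a < idx b \<longrightarrow> (\<forall>c. idx b < idx c \<longrightarrow> (\<forall>d. idx c < idx d \<longrightarrow> (\<forall>k. idx d < idx k \<longrightarrow>
    alt4 (\<lambda>i. act4 (\<lambda>a m. T i a m / 2) psi0) a b c d k = 4 * wedge14 t1 psi0 a b c d k)))"
    unfolding forall_sorted_5 using con
    by (intro conjI; simp add: Ts sum_7 tables skew3_sort[OF T'] alt4_def act4_def wedge14_def;
      (simp add: field_simps)?; linarith?)
  then show ?thesis using s by blast
qed

text \<open>The stabiliser algebra g_2 consists of the 2-forms of type 14, the kernel of the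
  contraction with \<phi>. The equations on the seven lines determine the diagonal; the others
  separate by the third point of the line, as for \<open>alternation_determines\<close>.\<close>

lemma act3_stabilizer:
  assumes h: "\<And>a b c. act3 A phi0 a b c = 0"
  shows "A a b = - A b a" "(\<Sum>k\<in>UNIV. \<Sum>l\<in>UNIV. A k l * phi0 k l m) = 0"
proof -
  have z0: "A 1 1 = 0" "A 2 2 = 0" "A 3 3 = 0" "A 4 4 = 0" "A 5 5 = 0" "A 6 6 = 0" "A 7 7 = 0"
    using h[of 1 2 3] h[of 1 4 5] h[of 1 6 7] h[of 2 4 6] h[of 2 5 7] h[of 3 4 7] h[of 3 5 6]
    by (simp_all add: act3_def sum_7 tables)
  have z1: "A 6 1 = - A 1 6" "A 5 2 = - A 2 5" "A 4 3 = - A 3 4" "A 1 6 - A 2 5 - A 3 4 = 0"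
    using h[of 1 2 4] h[of 1 3 5] h[of 2 3 6] h[of 4 5 6]
    by (simp_all add: act3_def sum_7 tables)
  have z2: "A 7 1 = - A 1 7" "A 4 2 = - A 2 4" "A 5 3 = - A 3 5" "- A 1 7 + A 2 4 - A 3 5 = 0"
    using h[of 1 2 5] h[of 1 3 4] h[of 2 3 7] h[of 4 5 7]
    by (simp_all add: act3_def sum_7 tables)
  have z3: "A 4 1 = - A 1 4" "A 7 2 = - A 2 7" "A 6 3 = - A 3 6" "A 1 4 + A 2 7 + A 3 6 = 0"
    using h[of 1 2 6] h[of 1 3 7] h[of 2 3 4] h[of 4 6 7]
    by (simp_all add: act3_def sum_7 tables)
  have z4: "A 5 1 = - A 1 5" "A 6 2 = - A 2 6" "A 7 3 = - A 3 7" "- A 1 5 - A 2 6 + A 3 7 = 0"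
    using h[of 1 2 7] h[of 1 3 6] h[of 2 3 5] h[of 5 6 7]
    by (simp_all add: act3_def sum_7 tables)
  have z5: "A 2 1 = - A 1 2" "A 7 4 = - A 4 7" "A 6 5 = - A 5 6" "A 1 2 - A 4 7 - A 5 6 = 0"
    using h[of 1 4 6] h[of 1 5 7] h[of 2 4 5] h[of 2 6 7]
    by (simp_all add: act3_def sum_7 tables)
  have z6: "A 3 1 = - A 1 3" "A 6 4 = - A 4 6" "A 7 5 = - A 5 7" "- A 1 3 + A 4 6 - A 5 7 = 0"
    using h[of 1 4 7] h[of 1 5 6] h[of 3 4 5] h[of 3 6 7]
    by (simp_all add: act3_def sum_7 tables)
  have z7: "A 3 2 = - A 2 3" "A 5 4 = - A 4 5" "A 7 6 = - A 6 7" "A 2 3 + A 4 5 + A 6 7 = 0"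
    using h[of 2 4 7] h[of 2 5 6] h[of 3 4 6] h[of 3 5 7]
    by (simp_all add: act3_def sum_7 tables)
  have "\<forall>a b. A a b = - A b a" by (simp add: forall_7 z0 z1 z2 z3 z4 z5 z6 z7)
  then show "A a b = - A b a" by blast
  have "\<forall>m. (\<Sum>k\<in>UNIV. \<Sum>l\<in>UNIV. A k l * phi0 k l m) = 0"
    using z0 z1 z2 z3 z4 z5 z6 z7 by (simp add: forall_7 sum_7 tables)
  then show "(\<Sum>k\<in>UNIV. \<Sum>l\<in>UNIV. A k l * phi0 k l m) = 0" by blast
qed

text \<open>Of the 24 orderings of each of the seven quadruples in \<psi>, eight belong to each of
  the three ways to split it into pairs; under the curvature symmetries these eight agree.\<close>

lemma psi0_pairing:
  fixes B :: "7 \<Rightarrow> 7 \<Rightarrow> 7 \<Rightarrow> 7 \<Rightarrow> real"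
  assumes "\<And>a b c d. B a b c d = - B b a c d" "\<And>a b c d. B a b c d = - B a b d c"
    "\<And>a b c d. B a b c d = B c d a b"
  shows "(\<Sum>i\<in>UNIV. \<Sum>j\<in>UNIV. \<Sum>k\<in>UNIV. \<Sum>l\<in>UNIV. psi0 i j k l * B i l j k) =
    8 * (0 - (B 1 7 2 4 - B 1 4 2 7 + B 1 2 4 7) - (B 1 6 2 5 - B 1 5 2 6 + B 1 2 5 6) - (B 1 6 3 4 - B 1 4 3 6
        + B 1 3 4 6) + (B 1 7 3 5 - B 1 5 3 7 + B 1 3 5 7) + (B 2 5 3 4 - B 2 4 3 5 + B 2 3 4 5) + (B 2 7 3 6
        - B 2 6 3 7 + B 2 3 6 7) + (B 4 7 5 6 - B 4 6 5 7 + B 4 5 6 7))"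
proof -
  have r: "idx b < idx a \<Longrightarrow> B a b c d = - B b a c d" "idx d < idx c \<Longrightarrow> B a b c d = - B a b d c"
    "idx c < idx a \<Longrightarrow> B a b c d = B c d a b" for a b c d
    using assms by blast+
  show ?thesis by (simp add: sum_7 tables) (simp add: r idx_simps)
qed

lemma skew3_inner:
  fixes X Y :: "7 \<Rightarrow> 7 \<Rightarrow> 7 \<Rightarrow> real"
  assumes "skew3 X" "skew3 Y"
  shows "(\<Sum>a\<in>UNIV. \<Sum>b\<in>UNIV. \<Sum>c\<in>UNIV. X a b c * Y a b c) = 6 * (X 1 2 3 * Y 1 2 3 + X 1 2 4 * Y 1 2 4
      + X 1 2 5 * Y 1 2 5 + X 1 2 6 * Y 1 2 6 + X 1 2 7 * Y 1 2 7 + X 1 3 4 * Y 1 3 4 + X 1 3 5 * Y 1 3 5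
      + X 1 3 6 * Y 1 3 6 + X 1 3 7 * Y 1 3 7 + X 1 4 5 * Y 1 4 5 + X 1 4 6 * Y 1 4 6 + X 1 4 7 * Y 1 4 7
      + X 1 5 6 * Y 1 5 6 + X 1 5 7 * Y 1 5 7 + X 1 6 7 * Y 1 6 7 + X 2 3 4 * Y 2 3 4 + X 2 3 5 * Y 2 3 5
      + X 2 3 6 * Y 2 3 6 + X 2 3 7 * Y 2 3 7 + X 2 4 5 * Y 2 4 5 + X 2 4 6 * Y 2 4 6 + X 2 4 7 * Y 2 4 7
      + X 2 5 6 * Y 2 5 6 + X 2 5 7 * Y 2 5 7 + X 2 6 7 * Y 2 6 7 + X 3 4 5 * Y 3 4 5 + X 3 4 6 * Y 3 4 6
      + X 3 4 7 * Y 3 4 7 + X 3 5 6 * Y 3 5 6 + X 3 5 7 * Y 3 5 7 + X 3 6 7 * Y 3 6 7 + X 4 5 6 * Y 4 5 6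
      + X 4 5 7 * Y 4 5 7 + X 4 6 7 * Y 4 6 7 + X 5 6 7 * Y 5 6 7)"
  by (simp add: sum_7 idx_simps skew3_sort[OF assms(1)] skew3_sort[OF assms(2)])

text \<open>\<open>sd\<close> is star of the alternated action of half of \<open>T\<close> on
  \<phi>, which will be star d\<phi>. Writing S for the sum over increasing triples, the left side
  is 4 S by \<open>psi0_pairing\<close> and the triple sum on the right is 6 S, whence 2/3. The
  abbreviation \<open>B\<close> keeps the products of \<open>T\<close> folded until the final
  comparison.\<close>

lemma torsion_quartic:
  fixes T sd :: "7 \<Rightarrow> 7 \<Rightarrow> 7 \<Rightarrow> real"
  defines "A \<equiv> alt3 (\<lambda>i. act3 (\<lambda>a m. T i a m / 2) phi0)"
  assumes T: "skew3 T" and sd: "skew3 sd"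
    and s: "sd 1 2 3 = A 4 5 6 7" "sd 1 2 4 = - A 3 5 6 7" "sd 1 2 5 = A 3 4 6 7" "sd 1 2 6 = - A 3 4 5 7"
        "sd 1 2 7 = A 3 4 5 6" "sd 1 3 4 = A 2 5 6 7" "sd 1 3 5 = - A 2 4 6 7" "sd 1 3 6 = A 2 4 5 7"
        "sd 1 3 7 = - A 2 4 5 6" "sd 1 4 5 = A 2 3 6 7" "sd 1 4 6 = - A 2 3 5 7" "sd 1 4 7 = A 2 3 5 6"
        "sd 1 5 6 = A 2 3 4 7" "sd 1 5 7 = - A 2 3 4 6" "sd 1 6 7 = A 2 3 4 5" "sd 2 3 4 = - A 1 5 6 7"
        "sd 2 3 5 = A 1 4 6 7" "sd 2 3 6 = - A 1 4 5 7" "sd 2 3 7 = A 1 4 5 6" "sd 2 4 5 = - A 1 3 6 7"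
        "sd 2 4 6 = A 1 3 5 7" "sd 2 4 7 = - A 1 3 5 6" "sd 2 5 6 = - A 1 3 4 7" "sd 2 5 7 = A 1 3 4 6"
        "sd 2 6 7 = - A 1 3 4 5" "sd 3 4 5 = A 1 2 6 7" "sd 3 4 6 = - A 1 2 5 7" "sd 3 4 7 = A 1 2 5 6"
        "sd 3 5 6 = A 1 2 4 7" "sd 3 5 7 = - A 1 2 4 6" "sd 3 6 7 = A 1 2 4 5" "sd 4 5 6 = - A 1 2 3 7"
        "sd 4 5 7 = A 1 2 3 6" "sd 4 6 7 = - A 1 2 3 5" "sd 5 6 7 = A 1 2 3 4"
  shows "(\<Sum>i\<in>UNIV. \<Sum>j\<in>UNIV. \<Sum>k\<in>UNIV. \<Sum>l\<in>UNIV. psi0 i j k l * (\<Sum>m\<in>UNIV. T i l m * T j k m)) =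
    2 / 3 * (\<Sum>a\<in>UNIV. \<Sum>b\<in>UNIV. \<Sum>c\<in>UNIV. T a b c * sd a b c)"
proof -
  let ?S = "T 1 2 3 * sd 1 2 3 + T 1 2 4 * sd 1 2 4 + T 1 2 5 * sd 1 2 5 + T 1 2 6 * sd 1 2 6 + T 1 2 7 * sd 1 2 7
      + T 1 3 4 * sd 1 3 4 + T 1 3 5 * sd 1 3 5 + T 1 3 6 * sd 1 3 6 + T 1 3 7 * sd 1 3 7 + T 1 4 5 * sd 1 4 5
      + T 1 4 6 * sd 1 4 6 + T 1 4 7 * sd 1 4 7 + T 1 5 6 * sd 1 5 6 + T 1 5 7 * sd 1 5 7 + T 1 6 7 * sd 1 6 7
      + T 2 3 4 * sd 2 3 4 + T 2 3 5 * sd 2 3 5 + T 2 3 6 * sd 2 3 6 + T 2 3 7 * sd 2 3 7 + T 2 4 5 * sd 2 4 5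
      + T 2 4 6 * sd 2 4 6 + T 2 4 7 * sd 2 4 7 + T 2 5 6 * sd 2 5 6 + T 2 5 7 * sd 2 5 7 + T 2 6 7 * sd 2 6 7
      + T 3 4 5 * sd 3 4 5 + T 3 4 6 * sd 3 4 6 + T 3 4 7 * sd 3 4 7 + T 3 5 6 * sd 3 5 6 + T 3 5 7 * sd 3 5 7
      + T 3 6 7 * sd 3 6 7 + T 4 5 6 * sd 4 5 6 + T 4 5 7 * sd 4 5 7 + T 4 6 7 * sd 4 6 7 + T 5 6 7 * sd 5 6 7"
  define B where "B a b c d = (\<Sum>m\<in>UNIV. T a b m * T c d m)" for a b c d
  have T1: "T a b c = - T b a c" for a b c using T unfolding skew3_def by blast
  have B: "B a b c d = - B b a c d" "B a b c d = - B a b d c" "B a b c d = B c d a b" for a b c d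
    unfolding B_def by (subst T1[of a], simp add: sum_negf) (subst T1[of c], simp add: sum_negf, simp add:
        mult.commute)
  have "(\<Sum>a\<in>UNIV. \<Sum>b\<in>UNIV. \<Sum>c\<in>UNIV. T a b c * sd a b c) =
     6 * ?S"
    by (rule skew3_inner[OF T sd])
  moreover have "4 * ?S = 8 * (0 - (B 1 7 2 4 - B 1 4 2 7 + B 1 2 4 7) - (B 1 6 2 5 - B 1 5 2 6 + B 1 2 5 6)
      - (B 1 6 3 4 - B 1 4 3 6 + B 1 3 4 6) + (B 1 7 3 5 - B 1 5 3 7 + B 1 3 5 7) + (B 2 5 3 4 - B 2 4 3 5
      + B 2 3 4 5) + (B 2 7 3 6 - B 2 6 3 7 + B 2 3 6 7) + (B 4 7 5 6 - B 4 6 5 7 + B 4 5 6 7))"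
    unfolding s B_def A_def alt3_def act3_def
    by (simp add: sum_7 tables skew3_sort[OF T]) (simp add: algebra_simps)
  ultimately show ?thesis
    using psi0_pairing[OF B] unfolding B_def by simp
qed

text \<open>Torsion-free coefficients do not contribute to an exterior derivative: the action on an
  argument cancels against the term in which this argument and the differentiating index are
  exchanged.\<close>

lemma alt3_symmetric:
  assumes X: "skew3 X" and G: "\<And>i a m. G i a m = G a i m"
  shows "alt3 (\<lambda>i. act3 (G i) X) a b c d = 0"
proof -
  have 1: "X a b c = - X b a c" "X a b c = - X a c b" for a b c
    using X unfolding skew3_def by blast+
  define S where "S p q Y = (\<Sum>m\<in>UNIV. G p q m * Y m)" for p q and Y :: "7 \<Rightarrow> real"
  have S: "S q p Y = S p q Y" "S p q (\<lambda>m. - Y m) = - S p q Y" for p q Y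
    unfolding S_def using G by (auto simp: sum_negf)
  have c: "(\<lambda>m. X b m d) = (\<lambda>m. - X m b d)" "(\<lambda>m. X m b c) = (\<lambda>m. X b c m)" for b c d
    using 1 by (metis, metis 1 minus_minus)
  have "alt3 (\<lambda>i. act3 (G i) X) a b c d =
     S a b (\<lambda>m. X m c d) + S a c (\<lambda>m. X b m d) + S a d (\<lambda>m. X b c m)
     - (S b a (\<lambda>m. X m c d) + S b c (\<lambda>m. X a m d) + S b d (\<lambda>m. X a c m))
     + (S c a (\<lambda>m. X m b d) + S c b (\<lambda>m. X a m d) + S c d (\<lambda>m. X a b m))
     - (S d a (\<lambda>m. X m b c) + S d b (\<lambda>m. X a m c) + S d c (\<lambda>m. X a b m))"
    by (simp add: alt3_def act3_def S_def)
  also have "(\<lambda>m. X a m c) = (\<lambda>m. - X a c m)" using 1(2) by blast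
  also have "(\<lambda>m. X b m d) = (\<lambda>m. - X m b d)" using 1(1) by blast
  also have "(\<lambda>m. X m b c) = (\<lambda>m. X b c m)" by (rule c)
  finally show ?thesis unfolding S(2) using S(1) by (simp add: algebra_simps)
qed

lemma alt4_symmetric:
  assumes X: "skew4 X" and G: "\<And>i a m. G i a m = G a i m"
  shows "alt4 (\<lambda>i. act4 (G i) X) a b c d k = 0"
proof -
  have 1: "X a b c d = - X b a c d" "X a b c d = - X a c b d" "X a b c d = - X a b d c" for a b c d
    using X unfolding skew4_def by blast+
  have r: "X a m c d = - X m a c d" "X a b m d = X m a b d" "X a b c m = - X m a b c" for a b c d m
    using 1 by (metis, metis minus_minus, metis minus_minus)
  define S where "S p q Y = (\<Sum>m\<in>UNIV. G p q m * Y m)" for p q and Y :: "7 \<Rightarrow> real"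
  have S: "S q p Y = S p q Y" "S p q (\<lambda>m. - Y m) = - S p q Y" for p q Y
    unfolding S_def using G by (auto simp: sum_negf)
  have A4: "act4 (G i) X a b c d = S i a (\<lambda>m. X m b c d) - S i b (\<lambda>m. X m a c d) + S i c (\<lambda>m. X m a b d)
      - S i d (\<lambda>m. X m a b c)"
    for i a b c d
  proof -
    have A4: "act4 (G i) X a b c d = S i a (\<lambda>m. X m b c d) + S i b (\<lambda>m. X a m c d) + S i c (\<lambda>m. X a b m d)
        + S i d (\<lambda>m. X a b c m)"
      by (simp add: act4_def S_def)
    also have "(\<lambda>m. X a m c d) = (\<lambda>m. - X m a c d)" using r(1) by blast
    also have "(\<lambda>m. X a b m d) = (\<lambda>m. X m a b d)" using r(2) by blast
    also have "(\<lambda>m. X a b c m) = (\<lambda>m. - X m a b c)" using r(3) by blast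
    finally show ?thesis by (simp add: S(2))
  qed
  show ?thesis unfolding alt4_def A4
    by (simp add: S(1)[of b a] S(1)[of c a] S(1)[of d a] S(1)[of k a] S(1)[of c b] S(1)[of d b]
        S(1)[of k b] S(1)[of d c] S(1)[of k c] S(1)[of k d])
qed

section \<open>Vanishing of the deviation from parallelism\<close>

lemma act_add: "act3 (\<lambda>a m. G a m + H a m) X a b c = act3 G X a b c + act3 H X a b c"
  "act4 (\<lambda>a m. G a m + H a m) Y a b c d = act4 G Y a b c d + act4 H Y a b c d"
  by (simp_all add: act3_def act4_def distrib_right sum.distrib)

text \<open>\<open>P\<close>, \<open>S\<close> and \<open>Dg\<close> stand for the derivatives of
  \<phi>, \<psi> and the metric in a constant frame orthonormal at the point; \<open>e1\<close> and
  \<open>e2\<close> are the differentiated contraction identities. \<open>N\<close> is Koszul's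
  formula plus half of \<open>T\<close>, so its symmetrisation is \<open>Dg\<close>. Hence the
  deviation of \<open>P\<close> from the action of \<open>N\<close> is a contraction of some
  \<open>w\<close> with \<psi>, and \<open>e3\<close> and \<open>e4\<close> make both alternations
  of it vanish.\<close>

lemma first_order_algebra:
  fixes P :: "7 \<Rightarrow> 7 \<Rightarrow> 7 \<Rightarrow> 7 \<Rightarrow> real" and T t3 :: "7 \<Rightarrow> 7 \<Rightarrow> 7 \<Rightarrow> real"
  assumes t3: "skew3 t3"
    and T: "\<And>a b c. T a b c = t0 / 6 * phi0 a b c - (\<Sum>m\<in>UNIV. t1 m * psi0 m a b c) - t3 a b c"
    and con: "t3 1 2 3 + t3 1 4 5 + t3 1 6 7 + t3 2 4 6 - t3 2 5 7 - t3 3 4 7 - t3 3 5 6 = 0"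
        "- t3 2 4 7 - t3 2 5 6 - t3 3 4 6 + t3 3 5 7 = 0" "t3 1 4 7 + t3 1 5 6 + t3 3 4 5 + t3 3 6 7 = 0"
        "t3 1 4 6 - t3 1 5 7 - t3 2 4 5 - t3 2 6 7 = 0" "- t3 1 2 7 - t3 1 3 6 + t3 2 3 5 + t3 5 6 7 = 0"
        "- t3 1 2 6 + t3 1 3 7 - t3 2 3 4 - t3 4 6 7 = 0" "t3 1 2 5 + t3 1 3 4 + t3 2 3 7 + t3 4 5 7 = 0"
        "t3 1 2 4 - t3 1 3 5 - t3 2 3 6 - t3 4 5 6 = 0"
    and st: "s3 1 2 3 4 = t3 5 6 7" "s3 1 2 3 5 = - t3 4 6 7" "s3 1 2 3 6 = t3 4 5 7" "s3 1 2 3 7 = - t3 4 5 6"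
        "s3 1 2 4 5 = t3 3 6 7" "s3 1 2 4 6 = - t3 3 5 7" "s3 1 2 4 7 = t3 3 5 6" "s3 1 2 5 6 = t3 3 4 7"
        "s3 1 2 5 7 = - t3 3 4 6" "s3 1 2 6 7 = t3 3 4 5" "s3 1 3 4 5 = - t3 2 6 7" "s3 1 3 4 6 = t3 2 5 7"
        "s3 1 3 4 7 = - t3 2 5 6" "s3 1 3 5 6 = - t3 2 4 7" "s3 1 3 5 7 = t3 2 4 6" "s3 1 3 6 7 = - t3 2 4 5"
        "s3 1 4 5 6 = t3 2 3 7" "s3 1 4 5 7 = - t3 2 3 6" "s3 1 4 6 7 = t3 2 3 5" "s3 1 5 6 7 = - t3 2 3 4"
        "s3 2 3 4 5 = t3 1 6 7" "s3 2 3 4 6 = - t3 1 5 7" "s3 2 3 4 7 = t3 1 5 6" "s3 2 3 5 6 = t3 1 4 7"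
        "s3 2 3 5 7 = - t3 1 4 6" "s3 2 3 6 7 = t3 1 4 5" "s3 2 4 5 6 = - t3 1 3 7" "s3 2 4 5 7 = t3 1 3 6"
        "s3 2 4 6 7 = - t3 1 3 5" "s3 2 5 6 7 = t3 1 3 4" "s3 3 4 5 6 = t3 1 2 7" "s3 3 4 5 7 = - t3 1 2 6"
        "s3 3 4 6 7 = t3 1 2 5" "s3 3 5 6 7 = - t3 1 2 4" "s3 4 5 6 7 = t3 1 2 3"
    and P: "\<And>i. skew3 (P i)" and Dg: "\<And>i a b. Dg i a b = Dg i b a"
    and e1: "\<And>i a b. (\<Sum>c\<in>UNIV. \<Sum>d\<in>UNIV. P i a c d * phi0 b c d) + (\<Sum>c\<in>UNIV. \<Sum>d\<in>UNIV. P i b c d * phi0 a c d)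
     - 2 * (\<Sum>c\<in>UNIV. \<Sum>d\<in>UNIV. (\<Sum>k\<in>UNIV. phi0 b k d * Dg i c k) * phi0 a c d) = 6 * Dg i a b"
    and e2: "\<And>i a b c d. S i a b c d = (\<Sum>m\<in>UNIV. P i a b m * phi0 c d m) + (\<Sum>m\<in>UNIV. phi0 a b m * P i c d m)
      - (\<Sum>m\<in>UNIV. \<Sum>n\<in>UNIV. phi0 a b m * phi0 c d n * Dg i m n)
      - Dg i a c * (if b = d then 1 else 0) - (if a = c then 1 else 0) * Dg i b d
      + Dg i a d * (if b = c then 1 else 0) + (if a = d then 1 else 0) * Dg i b c"
    and e3: "\<And>a b c d. alt3 P a b c d = t0 * psi0 a b c d + 3 * wedge13 t1 phi0 a b c d + s3 a b c d"
    and e4: "\<And>a b c d k. alt4 S a b c d k = 4 * wedge14 t1 psi0 a b c d k"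
    and N: "\<And>i a m. N i a m = (Dg i a m + Dg a i m - Dg m i a) / 2 + T i a m / 2"
  shows "P i a b c = act3 (N i) phi0 a b c"
proof -
  have T': "skew3 T"
    unfolding T[abs_def] diff_conv_add_uminus
    by (intro skew3_diff[unfolded diff_conv_add_uminus] t3 skew3_psi0_contract skew3_cmult[OF skew3_phi0])
  define G where "G i a m = (Dg i a m + Dg a i m - Dg m i a) / 2" for i a m
  have G: "G i a m = G a i m" for i a m
    unfolding G_def using Dg[of m i a] by simp
  have NG: "N i = (\<lambda>a m. G i a m + T i a m / 2)" for i
    using N[of i] by (auto simp: G_def)
  have NN: "N i a b + N i b a = Dg i a b" for i a b
  proof -
    have "T i a b = - T i b a" using T' unfolding skew3_def by blast
    then show ?thesis unfolding N using Dg[of a i b] Dg[of b i a] Dg[of i a b] by (simp add: field_simps)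
  qed
  have "\<exists>w. \<forall>a b c. P i a b c - act3 (N i) phi0 a b c = (\<Sum>m\<in>UNIV. w m * psi0 m a b c)" for i
  proof (rule Lambda3_7)
    show "skew3 (\<lambda>a b c. P i a b c - act3 (N i) phi0 a b c)"
      by (intro skew3_diff P skew3_act3 skew3_phi0)
    show "(\<Sum>c\<in>UNIV. \<Sum>d\<in>UNIV. (P i a c d - act3 (N i) phi0 a c d) * phi0 b c d) +
        (\<Sum>c\<in>UNIV. \<Sum>d\<in>UNIV. (P i b c d - act3 (N i) phi0 b c d) * phi0 a c d) = 0" for a b
      using act3_phi0_sym[of "N i" a b] e1[of i a b] unfolding NN
      by (simp add: left_diff_distrib sum_subtractf)
  qed
  then have "\<forall>i. \<exists>w. \<forall>a b c. P i a b c - act3 (N i) phi0 a b c = (\<Sum>m\<in>UNIV. w m * psi0 m a b c)" by blast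
  from choice[OF this] obtain w
    where w': "\<forall>i a b c. P i a b c - act3 (N i) phi0 a b c = (\<Sum>m\<in>UNIV. w i m * psi0 m a b c)" by blast
  have w: "P i a b c = act3 (N i) phi0 a b c + (\<Sum>m\<in>UNIV. w i m * psi0 m a b c)" for i a b c
    using w'[rule_format, of i a b c] by linarith
  have w0: "w i m = 0" for i m
  proof (rule alternation_determines)
    fix a b c d assume s: "idx a < idx b" "idx b < idx c" "idx c < idx d"
    \<comment> \<open>The symmetric coefficients \<open>G\<close> drop out and the torsion part
      already equals the right-hand side of \<open>e3\<close>, so only the deviation is
      left.\<close>
    have "alt3 P a b c d = alt3 (\<lambda>i. act3 (G i) phi0) a b c d + alt3 (\<lambda>i. act3 (\<lambda>a m. T i a m / 2) phi0) a b c d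
        + alt3 (\<lambda>i a b c. \<Sum>m\<in>UNIV. w i m * psi0 m a b c) a b c d"
      unfolding alt3_def w NG act_add by simp
    then show "alt3 (\<lambda>i a b c. \<Sum>m\<in>UNIV. w i m * psi0 m a b c) a b c d = 0"
      using alt_torsion[OF t3 T con st s] e3[of a b c d] alt3_symmetric[OF skew3_phi0 G] by simp
  next
    fix a b c d k assume s: "idx a < idx b" "idx b < idx c" "idx c < idx d" "idx d < idx k"
    have S: "S i p q r s = act4 (N i) psi0 p q r s - wedge13 (w i) phi0 p q r s"
      if "idx p < idx q" "idx q < idx r" "idx r < idx s" for i p q r s
      by (rule act_psi0[OF w _ that]) (use e2[of i p q r s] NN in simp)
    have "alt4 S a b c d k = alt4 (\<lambda>i. act4 (G i) psi0) a b c d k + alt4 (\<lambda>i. act4 (\<lambda>a m. T i a m / 2) psi0) a b c d k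
        - alt4 (\<lambda>i. wedge13 (w i) phi0) a b c d k"
      unfolding alt4_def using s by (simp add: S NG act_add)
    then show "alt4 (\<lambda>i. wedge13 (w i) phi0) a b c d k = 0"
      using alt_torsion_psi[OF t3 T con s] e4[of a b c d k] alt4_symmetric[OF skew4_psi0 G] by simp
  qed
  show ?thesis unfolding w w0 by simp
qed

section \<open>Pairing a curvature tensor with \<psi>\<close>

definition psi0_pair :: "(7 \<Rightarrow> 7 \<Rightarrow> 7 \<Rightarrow> 7 \<Rightarrow> real) \<Rightarrow> real" where
  "psi0_pair F = (\<Sum>i\<in>UNIV. \<Sum>j\<in>UNIV. \<Sum>k\<in>UNIV. \<Sum>l\<in>UNIV. psi0 i j k l * F i j k l)"

lemma psi0_swap: "psi0 j i k l = - psi0 i j k l" "psi0 i k j l = - psi0 i j k l" "psi0 i j l k = - psi0 i j k l"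
  using skew4_psi0 unfolding skew4_def by (metis minus_minus)+

lemma psi0_pair_swap:
  "psi0_pair (\<lambda>i j k l. F j i k l) = - psi0_pair F"
  "psi0_pair (\<lambda>i j k l. F i k j l) = - psi0_pair F"
  "psi0_pair (\<lambda>i j k l. F i j l k) = - psi0_pair F"
proof -
  have "psi0_pair (\<lambda>i j k l. F j i k l) = (\<Sum>j\<in>UNIV. \<Sum>i\<in>UNIV. \<Sum>k\<in>UNIV. \<Sum>l\<in>UNIV. psi0 i j k l * F j i k l)"
    unfolding psi0_pair_def by (rule sum.swap)
  also have "\<dots> = - psi0_pair F"
    unfolding psi0_pair_def by (subst psi0_swap(1)) (simp add: sum_negf)
  finally show "psi0_pair (\<lambda>i j k l. F j i k l) = - psi0_pair F" .
  have "psi0_pair (\<lambda>i j k l. F i k j l) = (\<Sum>i\<in>UNIV. \<Sum>k\<in>UNIV. \<Sum>j\<in>UNIV. \<Sum>l\<in>UNIV. psi0 i j k l * F i k j l)"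
    unfolding psi0_pair_def by (rule sum.cong[OF refl], rule sum.swap)
  also have "\<dots> = - psi0_pair F"
    unfolding psi0_pair_def by (subst psi0_swap(2)) (simp add: sum_negf)
  finally show "psi0_pair (\<lambda>i j k l. F i k j l) = - psi0_pair F" .
  have "psi0_pair (\<lambda>i j k l. F i j l k) = (\<Sum>i\<in>UNIV. \<Sum>j\<in>UNIV. \<Sum>l\<in>UNIV. \<Sum>k\<in>UNIV. psi0 i j k l * F i j l k)"
    unfolding psi0_pair_def by (rule sum.cong[OF refl], rule sum.cong[OF refl], rule sum.swap)
  also have "\<dots> = - psi0_pair F"
    unfolding psi0_pair_def by (subst psi0_swap(3)) (simp add: sum_negf)
  finally show "psi0_pair (\<lambda>i j k l. F i j l k) = - psi0_pair F" .
qed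

lemma psi0_pair_add: "psi0_pair (\<lambda>i j k l. F i j k l + H i j k l) = psi0_pair F + psi0_pair H"
  and psi0_pair_diff: "psi0_pair (\<lambda>i j k l. F i j k l - H i j k l) = psi0_pair F - psi0_pair H"
  and psi0_pair_cmult: "psi0_pair (\<lambda>i j k l. c * F i j k l) = c * psi0_pair F"
  unfolding psi0_pair_def
  by (simp_all add: distrib_left right_diff_distrib sum.distrib sum_subtractf sum_distrib_left mult_ac)

lemma psi0_pair_sym23: "(\<And>i j k l. F i j k l = F i k j l) \<Longrightarrow> psi0_pair F = 0"
  using psi0_pair_swap(2)[of F] by (metis (no_types, lifting) ext neg_equal_zero)

text \<open>Exchanging the outer indices is a product of five adjacent swaps, hence odd.\<close>

lemma psi0_pair_sym14:
  assumes "\<And>i j k l. F i j k l = F l j k i" shows "psi0_pair F = 0"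
proof -
  have "psi0_pair F = psi0_pair (\<lambda>i j k l. F l j k i)" using assms by presburger
  also have "\<dots> = - psi0_pair (\<lambda>i j k l. F k j l i)" using psi0_pair_swap(3)[of "\<lambda>i j k l. F k j l i"] by simp
  also have "\<dots> = psi0_pair (\<lambda>i j k l. F j k l i)" using psi0_pair_swap(2)[of "\<lambda>i j k l. F j k l i"] by simp
  also have "\<dots> = - psi0_pair (\<lambda>i j k l. F i k l j)" using psi0_pair_swap(1)[of "\<lambda>i j k l. F i k l j"] by simp
  also have "\<dots> = psi0_pair (\<lambda>i j k l. F i j l k)" using psi0_pair_swap(2)[of "\<lambda>i j k l. F i j l k"] by simp
  also have "\<dots> = - psi0_pair F" by (rule psi0_pair_swap(3))
  finally show ?thesis by simp
qed

text \<open>Each \<open>R i j\<close> lies in g_2, so contracting its last two indices with \<phi>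
  gives zero. Contracting also the first two with \<phi> and applying \<open>phi0_phi0\<close>
  relates both traces to the pairing with \<psi>; skewness in the last two indices makes the traces
  opposite.\<close>

lemma holonomy_trace:
  assumes "\<And>i j a b c. act3 (R i j) phi0 a b c = 0"
  shows "2 * (\<Sum>i\<in>UNIV. \<Sum>j\<in>UNIV. R i j j i) = psi0_pair R"
proof -
  have z: "(\<Sum>k\<in>UNIV. \<Sum>l\<in>UNIV. R i j k l * (\<Sum>m\<in>UNIV. phi0 i j m * phi0 k l m)) = 0" for i j
  proof -
    have "(\<Sum>k\<in>UNIV. \<Sum>l\<in>UNIV. R i j k l * (\<Sum>m\<in>UNIV. phi0 i j m * phi0 k l m)) =
        (\<Sum>k\<in>UNIV. \<Sum>m\<in>UNIV. \<Sum>l\<in>UNIV. phi0 i j m * (R i j k l * phi0 k l m))"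
      unfolding sum_distrib_left by (rule sum.cong[OF refl], subst sum.swap) (simp add: mult_ac)
    also have "\<dots> = (\<Sum>m\<in>UNIV. phi0 i j m * (\<Sum>k\<in>UNIV. \<Sum>l\<in>UNIV. R i j k l * phi0 k l m))"
      unfolding sum_distrib_left by (rule sum.swap)
    also have "\<dots> = 0" using act3_stabilizer(2)[OF assms] by simp
    finally show ?thesis .
  qed
  have d: "(\<Sum>k\<in>UNIV. \<Sum>l\<in>UNIV. R i j k l * (if i = k \<and> j = l then 1 else 0)) = R i j i j"
    "(\<Sum>k\<in>UNIV. \<Sum>l\<in>UNIV. R i j k l * (if i = l \<and> j = k then 1 else 0)) = R i j j i" for i j
  proof -
    have "(\<Sum>l\<in>UNIV. R i j k l * (if i = k \<and> j = l then 1 else 0)) = (if i = k then R i j k j else 0)"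
      "(\<Sum>l\<in>UNIV. R i j k l * (if i = l \<and> j = k then 1 else 0)) = (if j = k then R i j k i else 0)" for k
      by (simp_all add: if_distrib[of "(*) _"] cong: if_cong)
    then show "(\<Sum>k\<in>UNIV. \<Sum>l\<in>UNIV. R i j k l * (if i = k \<and> j = l then 1 else 0)) = R i j i j"
      "(\<Sum>k\<in>UNIV. \<Sum>l\<in>UNIV. R i j k l * (if i = l \<and> j = k then 1 else 0)) = R i j j i"
      by simp_all
  qed
  have "0 = (\<Sum>i\<in>UNIV. \<Sum>j\<in>UNIV. R i j i j - R i j j i + (\<Sum>k\<in>UNIV. \<Sum>l\<in>UNIV. psi0 i j k l * R i j k l))"
    using z unfolding phi0_phi0
    by (simp add: distrib_left right_diff_distrib sum.distrib sum_subtractf d mult.commute[of "R _ _ _ _" "psi0 _ _ _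
        _"])
  also have "\<dots> = (\<Sum>i\<in>UNIV. \<Sum>j\<in>UNIV. - 2 * R i j j i + (\<Sum>k\<in>UNIV. \<Sum>l\<in>UNIV. psi0 i j k l * R i j k l))"
  proof (intro sum.cong refl)
    fix i j
    have "R i j i j = - R i j j i" by (rule act3_stabilizer(1)[OF assms])
    then show "R i j i j - R i j j i + (\<Sum>k\<in>UNIV. \<Sum>l\<in>UNIV. psi0 i j k l * R i j k l) =
      - 2 * R i j j i + (\<Sum>k\<in>UNIV. \<Sum>l\<in>UNIV. psi0 i j k l * R i j k l)" by simp
  qed
  also have "\<dots> = - 2 * (\<Sum>i\<in>UNIV. \<Sum>j\<in>UNIV. R i j j i) + psi0_pair R"
    by (simp add: psi0_pair_def sum.distrib sum_distrib_left sum_negf sum_subtractf)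
  finally show ?thesis by simp
qed

text \<open>\<open>C\<close> are the Levi-Civita coefficients and \<open>N\<close> those with
  torsion, with raised last index; the sum in the assumption on \<open>DN\<close> is the derivative
  of the inverse metric that raises the index of \<open>T\<close>. In the double trace these terms
  cancel the mixed products of \<open>C\<close> and \<open>T\<close>. In the pairing with \<psi>
  each surviving term with \<open>C\<close> is symmetric in two indices and drops out, and the
  derivatives of \<open>T\<close> contribute only through dT.\<close>

lemma curvature_algebra:
  fixes C T :: "7 \<Rightarrow> 7 \<Rightarrow> 7 \<Rightarrow> real" and DC DT :: "7 \<Rightarrow> 7 \<Rightarrow> 7 \<Rightarrow> 7 \<Rightarrow> real"
  assumes C: "\<And>a b m. C a b m = C b a m" and DC: "\<And>i a b c. DC i a b c = DC i b a c"
    and T: "skew3 T" and DT: "\<And>i. skew3 (DT i)"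
    and N: "\<And>a b c. N a b c = C a b c + T a b c / 2"
    and DN: "\<And>i a b c. DN i a b c = DC i a b c - (\<Sum>m\<in>UNIV. (C i c m + C i m c) * T a b m) / 2 + DT i a b c / 2"
    and R: "\<And>i j k l. R i j k l = DN i j k l - DN j i k l + (\<Sum>m\<in>UNIV. N j k m * N i m l - N i k m * N j m l)"
    and hol: "\<And>i j a b c. act3 (R i j) phi0 a b c = 0"
    and dT: "\<And>a b c d. alt3 DT a b c d = 0"
  shows "(\<Sum>i\<in>UNIV. \<Sum>j\<in>UNIV. DC i j j i - DC j i j i + (\<Sum>m\<in>UNIV. C j j m * C i m i - C i j m * C j m i)) =
    ((\<Sum>a\<in>UNIV. \<Sum>b\<in>UNIV. \<Sum>c\<in>UNIV. T a b c * T a b c)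
      - psi0_pair (\<lambda>i j k l. \<Sum>m\<in>UNIV. T i l m * T j k m)) / 4"
proof -
  have T1: "T b a c = - T a b c" "T a c b = - T a b c" for a b c
    using T unfolding skew3_def by (metis minus_minus)+
  have T0: "T a a c = 0" "T a b b = 0" "T a b a = 0" for a b c
    using T1(1)[of a a c] T1(2)[of a b b] T1(1)[of b a a] T1(2)[of b a a] by linarith+
  have DT0: "DT i a a c = 0" "DT i a c c = 0" "DT i a c a = 0" for i a c
  proof -
    have s: "DT i b a c = - DT i a b c" "DT i a c b = - DT i a b c" for a b c
      using DT[of i] unfolding skew3_def by (metis minus_minus)+
    show "DT i a a c = 0" "DT i a c c = 0" "DT i a c a = 0"
      using s(1)[of a a c] s(2)[of a c c] s(1)[of c a a] s(2)[of c a a] by linarith+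
  qed
  have "(\<Sum>i\<in>UNIV. \<Sum>j\<in>UNIV. R i j j i) = (\<Sum>i\<in>UNIV. \<Sum>j\<in>UNIV.
      (DC i j j i - DC j i j i + (\<Sum>m\<in>UNIV. C j j m * C i m i - C i j m * C j m i))
      - (\<Sum>m\<in>UNIV. T i j m * T i j m) / 4)"
  proof (intro sum.cong refl)
    fix i j
    have a: "DN i j j i = DC i j j i" "DN j i j i = DC j i j i - (\<Sum>m\<in>UNIV. (C i j m + C j m i) * T i j m) / 2"
      by (simp_all add: DN T0 DT0 C[of j i])
    have b: "N j j m * N i m i = C j j m * C i m i" for m by (simp add: N T0)
    have c: "N i j m * N j m i = C i j m * C j m i + C i j m * T i j m / 2 + T i j m * C j m i / 2
        + T i j m * T i j m / 4" for m
    proof -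
      have "T j m i = T i j m" using T1(1)[of i j m] T1(2)[of j i m] by simp
      then show ?thesis by (simp add: N field_simps)
    qed
    have "(\<Sum>m\<in>UNIV. (C i j m + C j m i) * T i j m) / 2 = (\<Sum>m\<in>UNIV. C i j m * T i j m / 2)
        + (\<Sum>m\<in>UNIV. T i j m * C j m i / 2)"
      by (simp add: sum_divide_distrib sum.distrib[symmetric] field_simps)
    then show "R i j j i = (DC i j j i - DC j i j i + (\<Sum>m\<in>UNIV. C j j m * C i m i - C i j m * C j m i))
      - (\<Sum>m\<in>UNIV. T i j m * T i j m) / 4"
      unfolding R a b c sum_subtractf sum.distrib sum_divide_distrib by simp
  qed
  also have "\<dots> = (\<Sum>i\<in>UNIV. \<Sum>j\<in>UNIV. DC i j j i - DC j i j i + (\<Sum>m\<in>UNIV. C j j m * C i m i - C i j m * C j m i))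
     - (\<Sum>i\<in>UNIV. \<Sum>j\<in>UNIV. \<Sum>m\<in>UNIV. T i j m * T i j m) / 4"
    by (simp only: sum.distrib sum_subtractf sum_distrib_right[symmetric] sum_divide_distrib[symmetric])
  finally have tr: "(\<Sum>i\<in>UNIV. \<Sum>j\<in>UNIV. R i j j i) =
     (\<Sum>i\<in>UNIV. \<Sum>j\<in>UNIV. DC i j j i - DC j i j i + (\<Sum>m\<in>UNIV. C j j m * C i m i - C i j m * C j m i))
     - (\<Sum>i\<in>UNIV. \<Sum>j\<in>UNIV. \<Sum>m\<in>UNIV. T i j m * T i j m) / 4" .
  have "psi0_pair R = psi0_pair (\<lambda>i j k l. DN i j k l + (\<Sum>m\<in>UNIV. N j k m * N i m l))
      - psi0_pair (\<lambda>i j k l. DN j i k l + (\<Sum>m\<in>UNIV. N i k m * N j m l))"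
    unfolding psi0_pair_diff[symmetric]
    by (rule arg_cong[where f=psi0_pair], intro ext) (simp add: R sum_subtractf)
  also have "\<dots> = 2 * psi0_pair (\<lambda>i j k l. DN i j k l + (\<Sum>m\<in>UNIV. N j k m * N i m l))"
    using psi0_pair_swap(1)[of "\<lambda>i j k l. DN i j k l + (\<Sum>m\<in>UNIV. N j k m * N i m l)"] by simp
  \<comment> \<open>Grouped by symmetry: the first bracket is symmetric in \<open>j\<close> and
    \<open>k\<close>, the next sum in \<open>i\<close> and \<open>l\<close>; what pairs nontrivially
    with \<psi> is at most \<open>DT\<close> and the product of torsions.\<close>
  also have "(\<lambda>i j k l. DN i j k l + (\<Sum>m\<in>UNIV. N j k m * N i m l)) =
     (\<lambda>i j k l. (DC i j k l + (\<Sum>m\<in>UNIV. C j k m * N i m l))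
        + (((- 1 / 2) * (\<Sum>m\<in>UNIV. C i l m * T j k m) + (1 / 2) * DT i j k l)
        + (- 1 / 4) * (\<Sum>m\<in>UNIV. T i l m * T j k m)))"
  proof (intro ext)
    fix i j k l
    have "(\<Sum>m\<in>UNIV. N j k m * N i m l) = (\<Sum>m\<in>UNIV. C j k m * N i m l) + (\<Sum>m\<in>UNIV. C i m l * T j k m) / 2
       + (- 1 / 4) * (\<Sum>m\<in>UNIV. T i l m * T j k m)"
      unfolding sum_distrib_left sum_divide_distrib sum.distrib[symmetric]
    proof (intro sum.cong refl)
      fix m show "N j k m * N i m l = C j k m * N i m l + C i m l * T j k m / 2 + - 1 / 4 * (T i l m * T j k m)"
        using T1(2)[of i l m] by (simp add: N field_simps)
    qed
    then show "DN i j k l + (\<Sum>m\<in>UNIV. N j k m * N i m l) =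
      (DC i j k l + (\<Sum>m\<in>UNIV. C j k m * N i m l))
        + (((- 1 / 2) * (\<Sum>m\<in>UNIV. C i l m * T j k m) + (1 / 2) * DT i j k l)
        + (- 1 / 4) * (\<Sum>m\<in>UNIV. T i l m * T j k m))"
      unfolding DN distrib_right sum.distrib by (simp add: add_divide_distrib)
  qed
  also have "psi0_pair \<dots> = psi0_pair DT / 2 - psi0_pair (\<lambda>i j k l. \<Sum>m\<in>UNIV. T i l m * T j k m) / 4"
  proof -
    have 1: "psi0_pair (\<lambda>i j k l. DC i j k l + (\<Sum>m\<in>UNIV. C j k m * N i m l)) = 0"
      by (rule psi0_pair_sym23) (simp add: DC C)
    have 2: "psi0_pair (\<lambda>i j k l. \<Sum>m\<in>UNIV. C i l m * T j k m) = 0"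
      by (rule psi0_pair_sym14) (simp add: C)
    show ?thesis using 1[unfolded psi0_pair_add] 2 unfolding psi0_pair_add psi0_pair_cmult by simp
  qed
  also have "psi0_pair DT = 0"
  proof -
    \<comment> \<open>By the skewness of \<psi> all four terms of the alternation contribute
      equally, so the pairing with dT is four times the pairing with \<open>DT\<close>.\<close>
    have "psi0_pair (alt3 DT) = psi0_pair DT - psi0_pair (\<lambda>i j k l. DT j i k l)
       + psi0_pair (\<lambda>i j k l. DT k i j l) - psi0_pair (\<lambda>i j k l. DT l i j k)"
      unfolding psi0_pair_diff[symmetric] psi0_pair_add[symmetric]
      by (rule arg_cong[where f=psi0_pair], intro ext) (simp add: alt3_def)
    also have "psi0_pair (\<lambda>i j k l. DT j i k l) = - psi0_pair DT" by (rule psi0_pair_swap)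
    also have "psi0_pair (\<lambda>i j k l. DT k i j l) = psi0_pair DT"
      using psi0_pair_swap(2)[of "\<lambda>i j k l. DT j i k l"] psi0_pair_swap(1)[of DT] by simp
    also have "psi0_pair (\<lambda>i j k l. DT l i j k) = - psi0_pair DT"
      using psi0_pair_swap(3)[of "\<lambda>i j k l. DT k i j l"] psi0_pair_swap(2)[of "\<lambda>i j k l. DT j i k l"]
        psi0_pair_swap(1)[of DT] by simp
    finally have "4 * psi0_pair DT = psi0_pair (alt3 DT)" by simp
    also have "\<dots> = 0" by (simp add: psi0_pair_def dT)
    finally show ?thesis by simp
  qed
  finally have "psi0_pair R = - psi0_pair (\<lambda>i j k l. \<Sum>m\<in>UNIV. T i l m * T j k m) / 2" by simp
  then show ?thesis using tr holonomy_trace[of R, OF hol] by (simp add: field_simps)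
qed

section \<open>Hodge duals in an adapted frame\<close>

lemma linear_mult_const: "linear f \<Longrightarrow> linear (\<lambda>v. f v * c)" for f :: "'v::real_vector \<Rightarrow> real"
  using linear_cmult[of f c] by (simp add: mult.commute)

lemma mlin_hodge:
  fixes g :: "real^'n^'n" and vol \<alpha> :: "(real^'n) form"
  assumes "\<And>k. mlin k vol" shows "mlin j (hodge g vol \<alpha>)"
proof (rule mlinI)
  fix xs ys :: "(real^'n) list"
  \<comment> \<open>The entry \<open>undefined\<close> only counts the place of the argument that
    varies.\<close>
  let ?k = "CARD('n) - length (xs @ ys @ [undefined])"
  have "linear (\<lambda>v. \<alpha> (map (\<lambda>i. matrix_inv g $ i) is) * vol (map (\<lambda>i. axis i 1) is @ xs @ v # ys))" for "is" ::
      "'n list"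
    using linear_cmult[OF mlinD[OF assms refl, of "map (\<lambda>i. axis i 1) is @ xs" ys]] by simp
  then have "linear (\<lambda>v. inverse (fact ?k) * (\<Sum>is\<in>{is :: 'n list. length is = ?k}. \<alpha> (map (\<lambda>i. matrix_inv g $ i) is) *
      vol (map (\<lambda>i. axis i 1) is @ xs @ v # ys)))"
    by - (rule linear_cmult, rule linear_compose_sum, blast)
  then show "linear (\<lambda>v. hodge g vol \<alpha> (xs @ v # ys))"
    by (simp add: hodge_def Let_def divide_inverse mult.commute)
qed

lemma skew_hodge:
  assumes "skew vol" shows "skew (hodge g vol \<alpha>)"
proof (rule skewI)
  fix xs a b ys
  have "vol (l @ xs @ a # b # ys) = - vol (l @ xs @ b # a # ys)" for l
    using skewD[OF assms, of "l @ xs" a b ys] by simp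
  then show "hodge g vol \<alpha> (xs @ a # b # ys) = - hodge g vol \<alpha> (xs @ b # a # ys)"
    by (simp add: hodge_def Let_def sum_negf)
qed

lemma hodge_zero: "(\<And>vs. \<alpha> vs = 0) \<Longrightarrow> hodge g vol \<alpha> vs = 0"
  by (simp add: hodge_def Let_def)

lemma hodge_degree:
  fixes \<alpha> :: "(real^7) form"
  assumes "alternating_form k \<alpha>" "k \<noteq> 7 - length vs" shows "hodge g vol \<alpha> vs = 0"
  unfolding hodge_def Let_def
  by (rule trans[OF _ div_0], rule arg_cong2[where f="(/)"], rule sum.neutral)
     (use alternating_form_length[OF assms(1)] assms(2) in auto)

lemma G2_form_length: "length vs \<noteq> 3 \<Longrightarrow> G2_form e vs = 0"
  by (simp add: G2_form_def coframe_monomial_length)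

lemma wedge_1_3:
  assumes "alternating_form 1 \<alpha>"
  shows "wedge \<alpha> \<beta> [a,b,c,d] = \<alpha> [a] * \<beta> [b,c,d] - \<alpha> [b] * \<beta> [a,c,d] + \<alpha> [c] * \<beta> [a,b,d] - \<alpha> [d] * \<beta> [a,b,c]"
  by (simp add: wedge_eq_split alternating_form_length[OF assms])

lemma wedge_1_4:
  assumes "alternating_form 1 \<alpha>"
  shows "wedge \<alpha> \<beta> [a,b,c,d,k] = \<alpha> [a] * \<beta> [b,c,d,k] - \<alpha> [b] * \<beta> [a,c,d,k] + \<alpha> [c] * \<beta> [a,b,d,k]
    - \<alpha> [d] * \<beta> [a,b,c,k] + \<alpha> [k] * \<beta> [a,b,c,d]"
  by (simp add: wedge_eq_split alternating_form_length[OF assms])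

section \<open>The dual 4-form and the Hodge operator on the frame\<close>

context adapted_coframe
begin

definition \<psi> :: "(real^7) form" where "\<psi> = hodge g vol \<phi>"

lemma mlin_\<psi>: "mlin k \<psi>" unfolding \<psi>_def by (rule mlin_hodge[OF mlin_coframe_monomial])
lemma skew_\<psi>: "skew \<psi>" unfolding \<psi>_def by (rule skew_hodge[OF skew_coframe_monomial])

lemma linear_\<psi>: "linear (\<lambda>x. \<psi> [x, y, z, w])" "linear (\<lambda>x. \<psi> [y, x, z, w])"
  "linear (\<lambda>x. \<psi> [y, z, x, w])" "linear (\<lambda>x. \<psi> [y, z, w, x])"
  using mlinD[OF mlin_\<psi>, of "[]" "[y,z,w]"] mlinD[OF mlin_\<psi>, of "[y]" "[z,w]"]
    mlinD[OF mlin_\<psi>, of "[y,z]" "[w]"] mlinD[OF mlin_\<psi>, of "[y,z,w]" "[]"] by simp_all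

lemma \<psi>_f: "\<psi> [f a, f b, f c, f d] = psi0 a b c d"
proof -
  have "map f is @ [f a, f b, f c, f d] = map f (is @ [a,b,c,d])" for "is" by simp
  then have "vol (map f is @ [f a, f b, f c, f d]) = eps (is @ [a,b,c,d])" for "is"
    using vol_f by metis
  then show ?thesis
    unfolding \<psi>_def by (subst hodge_frame) (simp_all add: mlin_\<phi> psi0_def \<phi>_map_f fact_numeral)
qed

lemma \<phi>_length: "length vs \<noteq> 3 \<Longrightarrow> \<phi> vs = 0"
  unfolding \<phi>_eq by (rule G2_form_length)

lemma star3_table:
  assumes "mlin 3 \<alpha>" "skew \<alpha>"
  shows
    "hodge g vol \<alpha> [f 1,f 2,f 3,f 4] = \<alpha> [f 5,f 6,f 7]" "hodge g vol \<alpha> [f 1,f 2,f 3,f 5] = - \<alpha> [f 4,f 6,f 7]"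
        "hodge g vol \<alpha> [f 1,f 2,f 3,f 6] = \<alpha> [f 4,f 5,f 7]"
    "hodge g vol \<alpha> [f 1,f 2,f 3,f 7] = - \<alpha> [f 4,f 5,f 6]" "hodge g vol \<alpha> [f 1,f 2,f 4,f 5] = \<alpha> [f 3,f 6,f 7]"
        "hodge g vol \<alpha> [f 1,f 2,f 4,f 6] = - \<alpha> [f 3,f 5,f 7]"
    "hodge g vol \<alpha> [f 1,f 2,f 4,f 7] = \<alpha> [f 3,f 5,f 6]" "hodge g vol \<alpha> [f 1,f 2,f 5,f 6] = \<alpha> [f 3,f 4,f 7]"
        "hodge g vol \<alpha> [f 1,f 2,f 5,f 7] = - \<alpha> [f 3,f 4,f 6]"
    "hodge g vol \<alpha> [f 1,f 2,f 6,f 7] = \<alpha> [f 3,f 4,f 5]" "hodge g vol \<alpha> [f 1,f 3,f 4,f 5] = - \<alpha> [f 2,f 6,f 7]"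
        "hodge g vol \<alpha> [f 1,f 3,f 4,f 6] = \<alpha> [f 2,f 5,f 7]"
    "hodge g vol \<alpha> [f 1,f 3,f 4,f 7] = - \<alpha> [f 2,f 5,f 6]" "hodge g vol \<alpha> [f 1,f 3,f 5,f 6] = - \<alpha> [f 2,f 4,f 7]"
        "hodge g vol \<alpha> [f 1,f 3,f 5,f 7] = \<alpha> [f 2,f 4,f 6]"
    "hodge g vol \<alpha> [f 1,f 3,f 6,f 7] = - \<alpha> [f 2,f 4,f 5]" "hodge g vol \<alpha> [f 1,f 4,f 5,f 6] = \<alpha> [f 2,f 3,f 7]"
        "hodge g vol \<alpha> [f 1,f 4,f 5,f 7] = - \<alpha> [f 2,f 3,f 6]"
    "hodge g vol \<alpha> [f 1,f 4,f 6,f 7] = \<alpha> [f 2,f 3,f 5]" "hodge g vol \<alpha> [f 1,f 5,f 6,f 7] = - \<alpha> [f 2,f 3,f 4]"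
        "hodge g vol \<alpha> [f 2,f 3,f 4,f 5] = \<alpha> [f 1,f 6,f 7]"
    "hodge g vol \<alpha> [f 2,f 3,f 4,f 6] = - \<alpha> [f 1,f 5,f 7]" "hodge g vol \<alpha> [f 2,f 3,f 4,f 7] = \<alpha> [f 1,f 5,f 6]"
        "hodge g vol \<alpha> [f 2,f 3,f 5,f 6] = \<alpha> [f 1,f 4,f 7]"
    "hodge g vol \<alpha> [f 2,f 3,f 5,f 7] = - \<alpha> [f 1,f 4,f 6]" "hodge g vol \<alpha> [f 2,f 3,f 6,f 7] = \<alpha> [f 1,f 4,f 5]"
        "hodge g vol \<alpha> [f 2,f 4,f 5,f 6] = - \<alpha> [f 1,f 3,f 7]"
    "hodge g vol \<alpha> [f 2,f 4,f 5,f 7] = \<alpha> [f 1,f 3,f 6]" "hodge g vol \<alpha> [f 2,f 4,f 6,f 7] = - \<alpha> [f 1,f 3,f 5]"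
        "hodge g vol \<alpha> [f 2,f 5,f 6,f 7] = \<alpha> [f 1,f 3,f 4]"
    "hodge g vol \<alpha> [f 3,f 4,f 5,f 6] = \<alpha> [f 1,f 2,f 7]" "hodge g vol \<alpha> [f 3,f 4,f 5,f 7] = - \<alpha> [f 1,f 2,f 6]"
        "hodge g vol \<alpha> [f 3,f 4,f 6,f 7] = \<alpha> [f 1,f 2,f 5]"
    "hodge g vol \<alpha> [f 3,f 5,f 6,f 7] = - \<alpha> [f 1,f 2,f 4]" "hodge g vol \<alpha> [f 4,f 5,f 6,f 7] = \<alpha> [f 1,f 2,f 3]"
proof -
  have h: "hodge g vol \<alpha> [f a, f b, f c, f d] = \<alpha> [f i, f j, f k] * eps [i,j,k,a,b,c,d]"
    if "distinct [i,j,k,a,b,c,d]" for i j k a b c d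
    using hodge_complement[of "[i,j,k]" \<alpha> "[a,b,c,d]"] assms that by (simp add: numeral_eq_Suc)
  show
    "hodge g vol \<alpha> [f 1,f 2,f 3,f 4] = \<alpha> [f 5,f 6,f 7]" "hodge g vol \<alpha> [f 1,f 2,f 3,f 5] = - \<alpha> [f 4,f 6,f 7]"
        "hodge g vol \<alpha> [f 1,f 2,f 3,f 6] = \<alpha> [f 4,f 5,f 7]"
    "hodge g vol \<alpha> [f 1,f 2,f 3,f 7] = - \<alpha> [f 4,f 5,f 6]" "hodge g vol \<alpha> [f 1,f 2,f 4,f 5] = \<alpha> [f 3,f 6,f 7]"
        "hodge g vol \<alpha> [f 1,f 2,f 4,f 6] = - \<alpha> [f 3,f 5,f 7]"
    "hodge g vol \<alpha> [f 1,f 2,f 4,f 7] = \<alpha> [f 3,f 5,f 6]" "hodge g vol \<alpha> [f 1,f 2,f 5,f 6] = \<alpha> [f 3,f 4,f 7]"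
        "hodge g vol \<alpha> [f 1,f 2,f 5,f 7] = - \<alpha> [f 3,f 4,f 6]"
    "hodge g vol \<alpha> [f 1,f 2,f 6,f 7] = \<alpha> [f 3,f 4,f 5]" "hodge g vol \<alpha> [f 1,f 3,f 4,f 5] = - \<alpha> [f 2,f 6,f 7]"
        "hodge g vol \<alpha> [f 1,f 3,f 4,f 6] = \<alpha> [f 2,f 5,f 7]"
    "hodge g vol \<alpha> [f 1,f 3,f 4,f 7] = - \<alpha> [f 2,f 5,f 6]" "hodge g vol \<alpha> [f 1,f 3,f 5,f 6] = - \<alpha> [f 2,f 4,f 7]"
        "hodge g vol \<alpha> [f 1,f 3,f 5,f 7] = \<alpha> [f 2,f 4,f 6]"
    "hodge g vol \<alpha> [f 1,f 3,f 6,f 7] = - \<alpha> [f 2,f 4,f 5]" "hodge g vol \<alpha> [f 1,f 4,f 5,f 6] = \<alpha> [f 2,f 3,f 7]"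
        "hodge g vol \<alpha> [f 1,f 4,f 5,f 7] = - \<alpha> [f 2,f 3,f 6]"
    "hodge g vol \<alpha> [f 1,f 4,f 6,f 7] = \<alpha> [f 2,f 3,f 5]" "hodge g vol \<alpha> [f 1,f 5,f 6,f 7] = - \<alpha> [f 2,f 3,f 4]"
        "hodge g vol \<alpha> [f 2,f 3,f 4,f 5] = \<alpha> [f 1,f 6,f 7]"
    "hodge g vol \<alpha> [f 2,f 3,f 4,f 6] = - \<alpha> [f 1,f 5,f 7]" "hodge g vol \<alpha> [f 2,f 3,f 4,f 7] = \<alpha> [f 1,f 5,f 6]"
        "hodge g vol \<alpha> [f 2,f 3,f 5,f 6] = \<alpha> [f 1,f 4,f 7]"
    "hodge g vol \<alpha> [f 2,f 3,f 5,f 7] = - \<alpha> [f 1,f 4,f 6]" "hodge g vol \<alpha> [f 2,f 3,f 6,f 7] = \<alpha> [f 1,f 4,f 5]"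
        "hodge g vol \<alpha> [f 2,f 4,f 5,f 6] = - \<alpha> [f 1,f 3,f 7]"
    "hodge g vol \<alpha> [f 2,f 4,f 5,f 7] = \<alpha> [f 1,f 3,f 6]" "hodge g vol \<alpha> [f 2,f 4,f 6,f 7] = - \<alpha> [f 1,f 3,f 5]"
        "hodge g vol \<alpha> [f 2,f 5,f 6,f 7] = \<alpha> [f 1,f 3,f 4]"
    "hodge g vol \<alpha> [f 3,f 4,f 5,f 6] = \<alpha> [f 1,f 2,f 7]" "hodge g vol \<alpha> [f 3,f 4,f 5,f 7] = - \<alpha> [f 1,f 2,f 6]"
        "hodge g vol \<alpha> [f 3,f 4,f 6,f 7] = \<alpha> [f 1,f 2,f 5]"
    "hodge g vol \<alpha> [f 3,f 5,f 6,f 7] = - \<alpha> [f 1,f 2,f 4]" "hodge g vol \<alpha> [f 4,f 5,f 6,f 7] = \<alpha> [f 1,f 2,f 3]"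
    by (simp_all add: h[of 5 6 7 1 2 3 4] h[of 4 6 7 1 2 3 5] h[of 4 5 7 1 2 3 6] h[of 4 5 6 1 2 3 7] h[of 3 6 7 1 2 4
        5] h[of 3 5 7 1 2 4 6] h[of 3 5 6 1 2 4 7] h[of 3 4 7 1 2 5 6] h[of 3 4 6 1 2 5 7] h[of 3 4 5 1 2 6 7]
        h[of 2 6 7 1 3 4 5] h[of 2 5 7 1 3 4 6] h[of 2 5 6 1 3 4 7] h[of 2 4 7 1 3 5 6] h[of 2 4 6 1 3 5 7] h[of 2 4 5
        1 3 6 7] h[of 2 3 7 1 4 5 6] h[of 2 3 6 1 4 5 7] h[of 2 3 5 1 4 6 7] h[of 2 3 4 1 5 6 7] h[of 1 6 7 2 3 4 5]
        h[of 1 5 7 2 3 4 6] h[of 1 5 6 2 3 4 7] h[of 1 4 7 2 3 5 6] h[of 1 4 6 2 3 5 7] h[of 1 4 5 2 3 6 7] h[of 1 3 7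
        2 4 5 6] h[of 1 3 6 2 4 5 7] h[of 1 3 5 2 4 6 7] h[of 1 3 4 2 5 6 7] h[of 1 2 7 3 4 5 6] h[of 1 2 6 3 4 5 7]
        h[of 1 2 5 3 4 6 7] h[of 1 2 4 3 5 6 7] h[of 1 2 3 4 5 6 7] eps_eq)
qed

lemma star4_table:
  assumes "mlin 4 \<alpha>" "skew \<alpha>"
  shows
    "hodge g vol \<alpha> [f 1,f 2,f 3] = \<alpha> [f 4,f 5,f 6,f 7]" "hodge g vol \<alpha> [f 1,f 2,f 4] = - \<alpha> [f 3,f 5,f 6,f 7]"
        "hodge g vol \<alpha> [f 1,f 2,f 5] = \<alpha> [f 3,f 4,f 6,f 7]"
    "hodge g vol \<alpha> [f 1,f 2,f 6] = - \<alpha> [f 3,f 4,f 5,f 7]" "hodge g vol \<alpha> [f 1,f 2,f 7] = \<alpha> [f 3,f 4,f 5,f 6]"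
        "hodge g vol \<alpha> [f 1,f 3,f 4] = \<alpha> [f 2,f 5,f 6,f 7]"
    "hodge g vol \<alpha> [f 1,f 3,f 5] = - \<alpha> [f 2,f 4,f 6,f 7]" "hodge g vol \<alpha> [f 1,f 3,f 6] = \<alpha> [f 2,f 4,f 5,f 7]"
        "hodge g vol \<alpha> [f 1,f 3,f 7] = - \<alpha> [f 2,f 4,f 5,f 6]"
    "hodge g vol \<alpha> [f 1,f 4,f 5] = \<alpha> [f 2,f 3,f 6,f 7]" "hodge g vol \<alpha> [f 1,f 4,f 6] = - \<alpha> [f 2,f 3,f 5,f 7]"
        "hodge g vol \<alpha> [f 1,f 4,f 7] = \<alpha> [f 2,f 3,f 5,f 6]"
    "hodge g vol \<alpha> [f 1,f 5,f 6] = \<alpha> [f 2,f 3,f 4,f 7]" "hodge g vol \<alpha> [f 1,f 5,f 7] = - \<alpha> [f 2,f 3,f 4,f 6]"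
        "hodge g vol \<alpha> [f 1,f 6,f 7] = \<alpha> [f 2,f 3,f 4,f 5]"
    "hodge g vol \<alpha> [f 2,f 3,f 4] = - \<alpha> [f 1,f 5,f 6,f 7]" "hodge g vol \<alpha> [f 2,f 3,f 5] = \<alpha> [f 1,f 4,f 6,f 7]"
        "hodge g vol \<alpha> [f 2,f 3,f 6] = - \<alpha> [f 1,f 4,f 5,f 7]"
    "hodge g vol \<alpha> [f 2,f 3,f 7] = \<alpha> [f 1,f 4,f 5,f 6]" "hodge g vol \<alpha> [f 2,f 4,f 5] = - \<alpha> [f 1,f 3,f 6,f 7]"
        "hodge g vol \<alpha> [f 2,f 4,f 6] = \<alpha> [f 1,f 3,f 5,f 7]"
    "hodge g vol \<alpha> [f 2,f 4,f 7] = - \<alpha> [f 1,f 3,f 5,f 6]" "hodge g vol \<alpha> [f 2,f 5,f 6] = - \<alpha> [f 1,f 3,f 4,f 7]"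
        "hodge g vol \<alpha> [f 2,f 5,f 7] = \<alpha> [f 1,f 3,f 4,f 6]"
    "hodge g vol \<alpha> [f 2,f 6,f 7] = - \<alpha> [f 1,f 3,f 4,f 5]" "hodge g vol \<alpha> [f 3,f 4,f 5] = \<alpha> [f 1,f 2,f 6,f 7]"
        "hodge g vol \<alpha> [f 3,f 4,f 6] = - \<alpha> [f 1,f 2,f 5,f 7]"
    "hodge g vol \<alpha> [f 3,f 4,f 7] = \<alpha> [f 1,f 2,f 5,f 6]" "hodge g vol \<alpha> [f 3,f 5,f 6] = \<alpha> [f 1,f 2,f 4,f 7]"
        "hodge g vol \<alpha> [f 3,f 5,f 7] = - \<alpha> [f 1,f 2,f 4,f 6]"
    "hodge g vol \<alpha> [f 3,f 6,f 7] = \<alpha> [f 1,f 2,f 4,f 5]" "hodge g vol \<alpha> [f 4,f 5,f 6] = - \<alpha> [f 1,f 2,f 3,f 7]"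
        "hodge g vol \<alpha> [f 4,f 5,f 7] = \<alpha> [f 1,f 2,f 3,f 6]"
    "hodge g vol \<alpha> [f 4,f 6,f 7] = - \<alpha> [f 1,f 2,f 3,f 5]" "hodge g vol \<alpha> [f 5,f 6,f 7] = \<alpha> [f 1,f 2,f 3,f 4]"
proof -
  have h: "hodge g vol \<alpha> [f a, f b, f c] = \<alpha> [f i, f j, f k, f l] * eps [i,j,k,l,a,b,c]"
    if "distinct [i,j,k,l,a,b,c]" for i j k l a b c
    using hodge_complement[of "[i,j,k,l]" \<alpha> "[a,b,c]"] assms that by (simp add: numeral_eq_Suc)
  show
    "hodge g vol \<alpha> [f 1,f 2,f 3] = \<alpha> [f 4,f 5,f 6,f 7]" "hodge g vol \<alpha> [f 1,f 2,f 4] = - \<alpha> [f 3,f 5,f 6,f 7]"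
        "hodge g vol \<alpha> [f 1,f 2,f 5] = \<alpha> [f 3,f 4,f 6,f 7]"
    "hodge g vol \<alpha> [f 1,f 2,f 6] = - \<alpha> [f 3,f 4,f 5,f 7]" "hodge g vol \<alpha> [f 1,f 2,f 7] = \<alpha> [f 3,f 4,f 5,f 6]"
        "hodge g vol \<alpha> [f 1,f 3,f 4] = \<alpha> [f 2,f 5,f 6,f 7]"
    "hodge g vol \<alpha> [f 1,f 3,f 5] = - \<alpha> [f 2,f 4,f 6,f 7]" "hodge g vol \<alpha> [f 1,f 3,f 6] = \<alpha> [f 2,f 4,f 5,f 7]"
        "hodge g vol \<alpha> [f 1,f 3,f 7] = - \<alpha> [f 2,f 4,f 5,f 6]"
    "hodge g vol \<alpha> [f 1,f 4,f 5] = \<alpha> [f 2,f 3,f 6,f 7]" "hodge g vol \<alpha> [f 1,f 4,f 6] = - \<alpha> [f 2,f 3,f 5,f 7]"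
        "hodge g vol \<alpha> [f 1,f 4,f 7] = \<alpha> [f 2,f 3,f 5,f 6]"
    "hodge g vol \<alpha> [f 1,f 5,f 6] = \<alpha> [f 2,f 3,f 4,f 7]" "hodge g vol \<alpha> [f 1,f 5,f 7] = - \<alpha> [f 2,f 3,f 4,f 6]"
        "hodge g vol \<alpha> [f 1,f 6,f 7] = \<alpha> [f 2,f 3,f 4,f 5]"
    "hodge g vol \<alpha> [f 2,f 3,f 4] = - \<alpha> [f 1,f 5,f 6,f 7]" "hodge g vol \<alpha> [f 2,f 3,f 5] = \<alpha> [f 1,f 4,f 6,f 7]"
        "hodge g vol \<alpha> [f 2,f 3,f 6] = - \<alpha> [f 1,f 4,f 5,f 7]"
    "hodge g vol \<alpha> [f 2,f 3,f 7] = \<alpha> [f 1,f 4,f 5,f 6]" "hodge g vol \<alpha> [f 2,f 4,f 5] = - \<alpha> [f 1,f 3,f 6,f 7]"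
        "hodge g vol \<alpha> [f 2,f 4,f 6] = \<alpha> [f 1,f 3,f 5,f 7]"
    "hodge g vol \<alpha> [f 2,f 4,f 7] = - \<alpha> [f 1,f 3,f 5,f 6]" "hodge g vol \<alpha> [f 2,f 5,f 6] = - \<alpha> [f 1,f 3,f 4,f 7]"
        "hodge g vol \<alpha> [f 2,f 5,f 7] = \<alpha> [f 1,f 3,f 4,f 6]"
    "hodge g vol \<alpha> [f 2,f 6,f 7] = - \<alpha> [f 1,f 3,f 4,f 5]" "hodge g vol \<alpha> [f 3,f 4,f 5] = \<alpha> [f 1,f 2,f 6,f 7]"
        "hodge g vol \<alpha> [f 3,f 4,f 6] = - \<alpha> [f 1,f 2,f 5,f 7]"
    "hodge g vol \<alpha> [f 3,f 4,f 7] = \<alpha> [f 1,f 2,f 5,f 6]" "hodge g vol \<alpha> [f 3,f 5,f 6] = \<alpha> [f 1,f 2,f 4,f 7]"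
        "hodge g vol \<alpha> [f 3,f 5,f 7] = - \<alpha> [f 1,f 2,f 4,f 6]"
    "hodge g vol \<alpha> [f 3,f 6,f 7] = \<alpha> [f 1,f 2,f 4,f 5]" "hodge g vol \<alpha> [f 4,f 5,f 6] = - \<alpha> [f 1,f 2,f 3,f 7]"
        "hodge g vol \<alpha> [f 4,f 5,f 7] = \<alpha> [f 1,f 2,f 3,f 6]"
    "hodge g vol \<alpha> [f 4,f 6,f 7] = - \<alpha> [f 1,f 2,f 3,f 5]" "hodge g vol \<alpha> [f 5,f 6,f 7] = \<alpha> [f 1,f 2,f 3,f 4]"
    by (simp_all add: h[of 4 5 6 7 1 2 3] h[of 3 5 6 7 1 2 4] h[of 3 4 6 7 1 2 5] h[of 3 4 5 7 1 2 6] h[of 3 4 5 6 1 2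
        7] h[of 2 5 6 7 1 3 4] h[of 2 4 6 7 1 3 5] h[of 2 4 5 7 1 3 6] h[of 2 4 5 6 1 3 7] h[of 2 3 6 7 1 4 5]
        h[of 2 3 5 7 1 4 6] h[of 2 3 5 6 1 4 7] h[of 2 3 4 7 1 5 6] h[of 2 3 4 6 1 5 7] h[of 2 3 4 5 1 6 7] h[of 1 5 6
        7 2 3 4] h[of 1 4 6 7 2 3 5] h[of 1 4 5 7 2 3 6] h[of 1 4 5 6 2 3 7] h[of 1 3 6 7 2 4 5] h[of 1 3 5 7 2 4 6]
        h[of 1 3 5 6 2 4 7] h[of 1 3 4 7 2 5 6] h[of 1 3 4 6 2 5 7] h[of 1 3 4 5 2 6 7] h[of 1 2 6 7 3 4 5] h[of 1 2 5
        7 3 4 6] h[of 1 2 5 6 3 4 7] h[of 1 2 4 7 3 5 6] h[of 1 2 4 6 3 5 7] h[of 1 2 4 5 3 6 7] h[of 1 2 3 7 4 5 6]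
        h[of 1 2 3 6 4 5 7] h[of 1 2 3 5 4 6 7] h[of 1 2 3 4 5 6 7] eps_eq)
qed

lemma frame_eqI3:
  fixes P Q :: "real^7 \<Rightarrow> real^7 \<Rightarrow> real^7 \<Rightarrow> real"
  assumes "\<And>y z. linear (\<lambda>x. P x y z)" "\<And>y z. linear (\<lambda>x. P y x z)" "\<And>y z. linear (\<lambda>x. P y z x)"
    and "\<And>y z. linear (\<lambda>x. Q x y z)" "\<And>y z. linear (\<lambda>x. Q y x z)" "\<And>y z. linear (\<lambda>x. Q y z x)"
    and "\<And>a b c. P (f a) (f b) (f c) = Q (f a) (f b) (f c)"
  shows "P u v w = Q u v w"
proof -
  have "P (f a) (f b) w = Q (f a) (f b) w" for a b
    by (rule linear_frame_eqI[OF assms(3) assms(6) assms(7)])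
  then have "P (f a) v w = Q (f a) v w" for a
    by (rule linear_frame_eqI[OF assms(2) assms(5)])
  then show ?thesis by (rule linear_frame_eqI[OF assms(1) assms(4)])
qed

lemma frame_eqI4:
  fixes P Q :: "real^7 \<Rightarrow> real^7 \<Rightarrow> real^7 \<Rightarrow> real^7 \<Rightarrow> real"
  assumes "\<And>y z t. linear (\<lambda>x. P x y z t)" "\<And>y z t. linear (\<lambda>x. P y x z t)"
      "\<And>y z t. linear (\<lambda>x. P y z x t)" "\<And>y z t. linear (\<lambda>x. P y z t x)"
    and "\<And>y z t. linear (\<lambda>x. Q x y z t)" "\<And>y z t. linear (\<lambda>x. Q y x z t)"
      "\<And>y z t. linear (\<lambda>x. Q y z x t)" "\<And>y z t. linear (\<lambda>x. Q y z t x)"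
    and "\<And>a b c d. P (f a) (f b) (f c) (f d) = Q (f a) (f b) (f c) (f d)"
  shows "P u v w t = Q u v w t"
proof -
  have "P (f a) v w t = Q (f a) v w t" for a
    by (rule frame_eqI3[of "P (f a)" "Q (f a)"]) (rule assms)+
  then show ?thesis by (rule linear_frame_eqI[OF assms(1) assms(5)])
qed

text \<open>The frame identity \<open>phi0_phi0\<close> in coordinates. Read as a formula for \<psi>
  it avoids the volume form, so that \<psi> inherits the regularity of \<phi> and the
  metric.\<close>

lemma I2:
  "(\<Sum>i\<in>UNIV. \<Sum>j\<in>UNIV. gi $ i $ j * (\<phi> [a, b, axis i 1] * \<phi> [c, d, axis j 1])) =
    (a \<bullet> (g *v c)) * (b \<bullet> (g *v d)) - (a \<bullet> (g *v d)) * (b \<bullet> (g *v c)) + \<psi> [a, b, c, d]"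
proof -
  have in1: "linear (\<lambda>x. x \<bullet> w)" "linear (\<lambda>x. w \<bullet> (g *v x))" for w
    using linear_inner_matrix[of 1] by simp_all
  have "(\<Sum>i\<in>UNIV. \<Sum>j\<in>UNIV. gi $ i $ j * (\<phi> [a, b, axis i 1] * \<phi> [c, d, axis j 1])) =
     (\<Sum>m\<in>UNIV. \<phi> [a, b, f m] * \<phi> [c, d, f m])"
    by (rule contraction[where h="\<lambda>x y. \<phi> [a, b, x] * \<phi> [c, d, y]"])
       (intro linear_cmult linear_mult_const linear_\<phi>)+
  also have "\<dots> = (a \<bullet> (g *v c)) * (b \<bullet> (g *v d)) - (a \<bullet> (g *v d)) * (b \<bullet> (g *v c)) + \<psi> [a, b, c, d]"
  proof (rule frame_eqI4[where P="\<lambda>a b c d. \<Sum>m\<in>UNIV. \<phi> [a, b, f m] * \<phi> [c, d, f m]"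
        and Q="\<lambda>a b c d. (a \<bullet> (g *v c)) * (b \<bullet> (g *v d)) - (a \<bullet> (g *v d)) * (b \<bullet> (g *v c)) + \<psi> [a, b, c, d]"])
    show "(\<Sum>m\<in>UNIV. \<phi> [f a, f b, f m] * \<phi> [f c, f d, f m]) =
      (f a \<bullet> (g *v f c)) * (f b \<bullet> (g *v f d)) - (f a \<bullet> (g *v f d)) * (f b \<bullet> (g *v f c)) + \<psi> [f a, f b, f c, f d]"
          for a b c d
      by (simp only: \<phi>_f \<psi>_f phi0_phi0 g_frame)
         (cases "a = c"; cases "b = d"; cases "a = d"; cases "b = c"; simp)
  qed (intro linear_compose_add linear_compose_sub linear_compose_sum ballI linear_cmult linear_mult_const linear_\<phi>
      linear_\<psi> in1)+
  finally show ?thesis .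
qed

text \<open>By \<open>det_metric\<close> the product of determinant and metric is the same for both
  coframes, so the metrics are proportional with some ratio \<open>r\<close>. Inserting this into
  \<open>I1\<close> gives \<open>r ^ 3 = 1\<close>, hence \<open>r = 1\<close>, and then the
  determinants agree too. This is what makes the definite descriptions of metric and volume
  meaningful.\<close>

lemma metric_unique:
  assumes "G2_coframe \<phi> e'"
  shows "transpose e' ** e' = g" "coframe_monomial e' [1,2,3,4,5,6,7] = vol"
proof -
  interpret e': adapted_coframe \<phi> e' by unfold_locales (rule assms)
  define D where "D = coframe_monomial (mat 1) [1,2,3,4,5,6,7] (map (($) e) [1,2,3,4,5,6,7])"
  define D' where "D' = coframe_monomial (mat 1) [1,2,3,4,5,6,7] (map (($) e') [1,2,3,4,5,6,7])"
  define r where "r = D / D'"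
  have D0: "D \<noteq> 0" "D' \<noteq> 0" using det_metric(3) e'.det_metric(3) by (simp_all add: D_def D'_def)
  have uv: "u \<bullet> (e'.g *v v) = r * (u \<bullet> (g *v v))" for u v
    using det_metric(1)[of u v, folded D_def] e'.det_metric(1)[of u v, folded D'_def] D0
    by (simp add: r_def field_simps)
  have comp: "A $ i $ j = axis i 1 \<bullet> (A *v axis j 1)" for A :: "real^7^7" and i j
    by (simp add: matrix_vector_mult_basis inner_axis' column_def)
  have g': "e'.g = r *\<^sub>R g"
    unfolding vec_eq_iff by (simp add: comp uv flip: scaleR_matrix_vector_assoc)
  have r0: "r \<noteq> 0" using D0 by (simp add: r_def)
  have gi': "e'.gi = inverse r *\<^sub>R gi"
  proof (rule matrix_inv_unique)
    have "r *\<^sub>R A ** (inverse r *\<^sub>R B) = (r * inverse r) *\<^sub>R (A ** B)" for A B :: "real^7^7"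
      by (simp add: matrix_matrix_mult_def vec_eq_iff sum_distrib_left mult_ac)
    then show "e'.g ** (inverse r *\<^sub>R gi) = mat 1"
      unfolding g' using r0 matrix_inv_right[OF invertible_g] by simp
  qed
  have "r\<^sup>2 * (6 * (f 1 \<bullet> (e'.g *v f 1))) = 6 * (f 1 \<bullet> (g *v f 1))"
    unfolding e'.I1[symmetric] I1[symmetric] gi' using r0
    by (simp add: sum_distrib_left power2_eq_square field_simps)
  then have "r ^ 3 = 1" unfolding uv by (simp add: g_frame power2_eq_square power3_eq_cube mult_ac)
  then have r: "r = 1" by (metis odd_numeral odd_real_root_power_cancel power_one real_root_pos2 real_root_one
      zero_less_numeral
        odd_pos numeral_3_eq_3 even_Suc even_zero odd_one)
  show "e'.g = g" using g' r by simp
  have "D = D'" using r D0 by (simp add: r_def)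
  then show "e'.vol = vol"
    using det_metric(2)[folded D_def] e'.det_metric(2)[folded D'_def] by (auto simp: fun_eq_iff)
qed

lemma metric_eq: "G2_metric \<phi> = g"
  unfolding G2_metric_def using coframe metric_unique(1) by (intro the_equality) metis+

lemma volume_eq: "G2_volume \<phi> = vol"
  unfolding G2_volume_def using coframe metric_unique(2) by (intro the_equality) metis+

end

section \<open>Torsion at a point\<close>

locale torsion_at_point = adapted_coframe +
  fixes t0 :: real and t1 t3 d\<phi> :: "(real^7) form"
  assumes t1: "alternating_form 1 t1" and t3: "alternating_form 3 t3"
    and t3\<phi>: "\<And>vs. wedge t3 \<phi> vs = 0" and t3\<psi>: "\<And>vs. wedge t3 \<psi> vs = 0"
    and d\<phi>: "\<And>vs. d\<phi> vs = t0 * \<psi> vs + 3 * wedge t1 \<phi> vs + hodge g vol t3 vs"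
begin

text \<open>The double sum is the contraction of \<open>t1\<close> with \<psi>, which is minus star
  of the product of \<open>t1\<close> and \<phi>. It is written in coordinates and not in the frame,
  so that it can be differentiated when the point varies.\<close>

definition T :: "(real^7) form" where
  "T vs = t0 / 6 * \<phi> vs - (\<Sum>i\<in>UNIV. \<Sum>j\<in>UNIV. gi $ i $ j * (t1 [axis i 1] * \<psi> (axis j 1 # vs))) - t3 vs"

lemmas mlin_t1 = alternating_form_mlin[OF t1] and mlin_t3 = alternating_form_mlin[OF t3]
  and skew_t1 = alternating_form_skew[OF t1] and skew_t3 = alternating_form_skew[OF t3]

lemma skew3_t3: "skew3 (\<lambda>a b c. t3 [f a, f b, f c])"
  by (rule skew3_of_skew[OF skew_t3])

lemmas t3_sort = skew3_sort[OF skew3_t3]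

text \<open>The first equation is the single component of the 7-form; the others are the components
  of the 6-form obtained by omitting one frame vector in turn.\<close>

lemma t3_constraints:
  shows
    "t3 [f 1, f 2, f 3] + t3 [f 1, f 4, f 5] + t3 [f 1, f 6, f 7] + t3 [f 2, f 4, f 6] - t3 [f 2, f 5, f 7]
        - t3 [f 3, f 4, f 7] - t3 [f 3, f 5, f 6] = 0" "- t3 [f 2, f 4, f 7] - t3 [f 2, f 5, f 6] - t3 [f 3, f 4, f 6]
        + t3 [f 3, f 5, f 7] = 0" "t3 [f 1, f 4, f 7] + t3 [f 1, f 5, f 6] + t3 [f 3, f 4, f 5] + t3 [f 3, f 6, f 7]
        = 0"
    "t3 [f 1, f 4, f 6] - t3 [f 1, f 5, f 7] - t3 [f 2, f 4, f 5] - t3 [f 2, f 6, f 7] = 0"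
        "- t3 [f 1, f 2, f 7] - t3 [f 1, f 3, f 6] + t3 [f 2, f 3, f 5] + t3 [f 5, f 6, f 7] = 0"
        "- t3 [f 1, f 2, f 6] + t3 [f 1, f 3, f 7] - t3 [f 2, f 3, f 4] - t3 [f 4, f 6, f 7] = 0"
    "t3 [f 1, f 2, f 5] + t3 [f 1, f 3, f 4] + t3 [f 2, f 3, f 7] + t3 [f 4, f 5, f 7] = 0"
        "t3 [f 1, f 2, f 4] - t3 [f 1, f 3, f 5] - t3 [f 2, f 3, f 6] - t3 [f 4, f 5, f 6] = 0"
proof -
  have l: "length vs \<noteq> 3 \<Longrightarrow> t3 vs = 0" for vs by (rule alternating_form_length[OF t3])
  show "t3 [f 1, f 2, f 3] + t3 [f 1, f 4, f 5] + t3 [f 1, f 6, f 7] + t3 [f 2, f 4, f 6] - t3 [f 2, f 5, f 7]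
      - t3 [f 3, f 4, f 7] - t3 [f 3, f 5, f 6] = 0"
    using t3\<psi>[of "[f 1,f 2,f 3,f 4,f 5,f 6,f 7]"]
    by (simp add: wedge_eq_split l \<phi>_f \<psi>_f tables t3_sort)
  show "- t3 [f 2, f 4, f 7] - t3 [f 2, f 5, f 6] - t3 [f 3, f 4, f 6] + t3 [f 3, f 5, f 7] = 0"
    using t3\<phi>[of "[f 2,f 3,f 4,f 5,f 6,f 7]"]
    by (simp add: wedge_eq_split l \<phi>_f \<psi>_f tables t3_sort)
  show "t3 [f 1, f 4, f 7] + t3 [f 1, f 5, f 6] + t3 [f 3, f 4, f 5] + t3 [f 3, f 6, f 7] = 0"
    using t3\<phi>[of "[f 1,f 3,f 4,f 5,f 6,f 7]"]
    by (simp add: wedge_eq_split l \<phi>_f \<psi>_f tables t3_sort)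
  show "t3 [f 1, f 4, f 6] - t3 [f 1, f 5, f 7] - t3 [f 2, f 4, f 5] - t3 [f 2, f 6, f 7] = 0"
    using t3\<phi>[of "[f 1,f 2,f 4,f 5,f 6,f 7]"]
    by (simp add: wedge_eq_split l \<phi>_f \<psi>_f tables t3_sort)
  show "- t3 [f 1, f 2, f 7] - t3 [f 1, f 3, f 6] + t3 [f 2, f 3, f 5] + t3 [f 5, f 6, f 7] = 0"
    using t3\<phi>[of "[f 1,f 2,f 3,f 5,f 6,f 7]"]
    by (simp add: wedge_eq_split l \<phi>_f \<psi>_f tables t3_sort)
  show "- t3 [f 1, f 2, f 6] + t3 [f 1, f 3, f 7] - t3 [f 2, f 3, f 4] - t3 [f 4, f 6, f 7] = 0"
    using t3\<phi>[of "[f 1,f 2,f 3,f 4,f 6,f 7]"]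
    by (simp add: wedge_eq_split l \<phi>_f \<psi>_f tables t3_sort)
  show "t3 [f 1, f 2, f 5] + t3 [f 1, f 3, f 4] + t3 [f 2, f 3, f 7] + t3 [f 4, f 5, f 7] = 0"
    using t3\<phi>[of "[f 1,f 2,f 3,f 4,f 5,f 7]"]
    by (simp add: wedge_eq_split l \<phi>_f \<psi>_f tables t3_sort)
  show "t3 [f 1, f 2, f 4] - t3 [f 1, f 3, f 5] - t3 [f 2, f 3, f 6] - t3 [f 4, f 5, f 6] = 0"
    using t3\<phi>[of "[f 1,f 2,f 3,f 4,f 5,f 6]"]
    by (simp add: wedge_eq_split l \<phi>_f \<psi>_f tables t3_sort)
qed

lemma T_frame: "T [f a, f b, f c] = t0 / 6 * phi0 a b c - (\<Sum>m\<in>UNIV. t1 [f m] * psi0 m a b c) - t3 [f a, f b, f c]"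
proof -
  have l: "linear (\<lambda>x. t1 [x])" using mlinD[OF mlin_t1, of "[]" "[]"] by simp
  have "(\<Sum>i\<in>UNIV. \<Sum>j\<in>UNIV. gi $ i $ j * (t1 [axis i 1] * \<psi> [axis j 1, f a, f b, f c])) =
     (\<Sum>m\<in>UNIV. t1 [f m] * \<psi> [f m, f a, f b, f c])"
    by (rule contraction[where h="\<lambda>x y. t1 [x] * \<psi> [y, f a, f b, f c]"])
       (intro linear_cmult linear_mult_const linear_\<psi> l)+
  then show ?thesis by (simp add: T_def \<phi>_f \<psi>_f)
qed

lemma mlin_T: "mlin k T"
proof (rule mlinI)
  fix xs ys :: "(real^7) list"
  have "linear (\<lambda>v. \<psi> (y # xs @ v # ys))" for y
    using mlinD[OF mlin_\<psi> refl, of "y # xs" ys] by simp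
  then show "linear (\<lambda>v. T (xs @ v # ys))"
    unfolding T_def by (intro linear_compose_sub linear_compose_sum ballI linear_cmult
      mlinD[OF mlin_\<phi> refl] mlinD[OF mlin_t3 refl])
qed

lemma skew_T: "skew T"
proof (rule skewI)
  fix xs ys and a b :: "real^7"
  have "\<psi> (y # xs @ a # b # ys) = - \<psi> (y # xs @ b # a # ys)" for y
    using skewD[OF skew_\<psi>, of "y # xs" a b ys] by simp
  then show "T (xs @ a # b # ys) = - T (xs @ b # a # ys)"
    unfolding T_def skewD[OF skew_\<phi>, of xs a b ys] skewD[OF skew_t3, of xs a b ys] by (simp add: sum_negf)
qed

lemma mlin_d\<phi>: "mlin k d\<phi>" and skew_d\<phi>: "skew d\<phi>"
proof -
  have "d\<phi> = (\<lambda>vs. t0 * \<psi> vs + 3 * wedge t1 \<phi> vs + hodge g vol t3 vs)" using d\<phi> by blast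
  then show "mlin k d\<phi>" "skew d\<phi>"
    by (auto intro!: mlin_add mlin_cmult mlin_\<psi> mlin_wedge mlin_t1 mlin_\<phi> mlin_hodge mlin_coframe_monomial
        skew_add skew_cmult skew_\<psi> skew_wedge skew_t1 skew_\<phi> skew_hodge skew_coframe_monomial)
qed

text \<open>The part \<open>t0 * \<psi>\<close> contributes 7 because \<phi> has seven unit
  components. The product of \<open>t1\<close> with \<phi> and \<phi> vanishes, and the part from
  \<open>t3\<close> is the first of the constraints.\<close>

lemma star_d\<phi>_\<phi>: "hodge g vol (wedge d\<phi> \<phi>) [] = 7 * t0"
proof -
  have "hodge g vol (wedge d\<phi> \<phi>) (map f []) = wedge d\<phi> \<phi> (map f [1,2,3,4,5,6,7]) * eps ([1,2,3,4,5,6,7] @ [])"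
    by (rule hodge_complement) (auto intro!: mlin_wedge mlin_d\<phi> mlin_\<phi> skew_wedge skew_d\<phi> skew_\<phi>)
  then have "hodge g vol (wedge d\<phi> \<phi>) [] = wedge d\<phi> \<phi> [f 1,f 2,f 3,f 4,f 5,f 6,f 7]" by (simp add: eps_eq)
  also have "\<dots> = 7 * t0"
    using t3_constraints(1)
    by (simp add: wedge_eq_split[of d\<phi>] \<phi>_length \<phi>_f tables)
       (simp add: d\<phi> wedge_1_3[OF t1] \<phi>_f \<psi>_f tables star3_table[OF mlin_t3 skew_t3])
  finally show ?thesis .
qed

text \<open>Subtracting star d\<phi> turns the coefficient 7/6 of \<open>t0 * \<phi>\<close> into
  1/6 and lowers the coefficient 4 of the Lee form to 1, leaving minus \<open>t3\<close>.\<close>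

lemma torsion_eq:
  "1 / 6 * hodge g vol (wedge d\<phi> \<phi>) [] * \<phi> [u,v,w] - hodge g vol d\<phi> [u,v,w]
    + hodge g vol (wedge (\<lambda>vs. 4 * t1 vs) \<phi>) [u,v,w] = T [u,v,w]"
proof -
  let ?L = "\<lambda>l. 1 / 6 * hodge g vol (wedge d\<phi> \<phi>) [] * \<phi> l - hodge g vol d\<phi> l
      + hodge g vol (wedge (\<lambda>vs. 4 * t1 vs) \<phi>) l"
  have w4: "mlin k (wedge (\<lambda>vs. 4 * t1 vs) \<phi>)" "skew (wedge (\<lambda>vs. 4 * t1 vs) \<phi>)" for k
    by (auto intro!: mlin_wedge mlin_cmult mlin_t1 mlin_\<phi> skew_wedge skew_cmult skew_t1 skew_\<phi>)
  have mL: "mlin k ?L" for k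
    unfolding diff_conv_add_uminus
    by (intro mlin_add mlin_cmult mlin_\<phi> mlin_cmult[of _ _ "-1", simplified] mlin_hodge mlin_coframe_monomial)
  have sL: "skew ?L"
    unfolding diff_conv_add_uminus
    by (intro skew_add skew_cmult skew_\<phi> skew_cmult[of _ "-1", simplified] skew_hodge skew_coframe_monomial)
  have "?L [f a, f b, f c] = T [f a, f b, f c]" for a b c
  proof (rule skew3_eqI[OF skew3_of_skew[OF sL] skew3_of_skew[OF skew_T]])
    have "\<forall>a b. idx a < idx b \<longrightarrow> (\<forall>c. idx b < idx c \<longrightarrow> ?L [f a, f b, f c] = T [f a, f b, f c])"
      unfolding forall_sorted_3
      by (simp add: star_d\<phi>_\<phi> T_frame \<phi>_f star4_table[OF mlin_d\<phi> skew_d\<phi>] star4_table[OF w4] wedge_cmult_left)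
         (simp add: d\<phi> wedge_1_3[OF t1] \<phi>_f \<psi>_f sum_7 tables star3_table[OF mlin_t3 skew_t3])
    then show "idx a < idx b \<Longrightarrow> idx b < idx c \<Longrightarrow> ?L [f a, f b, f c] = T [f a, f b, f c]" for a b c by blast
  qed
  moreover have "linear (\<lambda>x. ?L [x,y,z])" "linear (\<lambda>x. ?L [y,x,z])" "linear (\<lambda>x. ?L [y,z,x])"
    "linear (\<lambda>x. T [x,y,z])" "linear (\<lambda>x. T [y,x,z])" "linear (\<lambda>x. T [y,z,x])" for y z
    using mlinD[OF mL, of "[]" "[y,z]"] mlinD[OF mL, of "[y]" "[z]"] mlinD[OF mL, of "[y,z]" "[]"]
      mlinD[OF mlin_T, of "[]" "[y,z]"] mlinD[OF mlin_T, of "[y]" "[z]"] mlinD[OF mlin_T, of "[y,z]" "[]"] by simp_all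
  ultimately show ?thesis
    by - (rule frame_eqI3[of "\<lambda>u v w. ?L [u,v,w]" "\<lambda>u v w. T [u,v,w]"])
qed

lemma T_length: "length vs \<noteq> 3 \<Longrightarrow> T vs = 0"
proof -
  assume a: "length vs \<noteq> 3"
  have "\<psi> (x # vs) = 0" for x
  proof -
    have "\<phi> (map h is) = 0" if "length is = 7 - Suc (length vs)" for h and "is" :: "7 list"
      using that a by (intro \<phi>_length) auto
    then show ?thesis unfolding \<psi>_def hodge_def by (simp add: Let_def)
  qed
  then show ?thesis using a by (simp add: T_def \<phi>_length alternating_form_length[OF t3])
qed

text \<open>Only the middle part of \<open>T\<close> survives the product with \<phi>: \<phi> has
  odd degree, so its square is zero, and \<open>t3\<close> is annihilated by assumption. Six
  distinct indices omit exactly one, so the seven increasing lists suffice.\<close>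

lemma T_wedge_\<phi>_frame:
  assumes "length is = 6"
  shows "wedge T \<phi> (map f is) = - 4 * hodge g vol t1 (map f is)"
proof (cases "distinct is")
  case False
  then show ?thesis
    by (simp add: skew_repeat[OF skew_map[OF skew_wedge[OF skew_T skew_\<phi>]], OF False]
        skew_repeat[OF skew_map[OF skew_hodge[OF skew_coframe_monomial]], OF False])
next
  case True
  then have "set is \<noteq> UNIV" using assms distinct_card[OF True] by auto
  then obtain i where i: "i \<notin> set is" by blast
  then have d: "distinct (i # is)" using True by simp
  define J where "J = filter (\<lambda>j. j \<noteq> i) [1,2,3,4,5,6,7]"
  have "set J = {j \<in> set [1,2,3,4,5,6,7]. j \<noteq> i}" by (simp only: J_def set_filter)
  also have "\<dots> = - {i}" unfolding list.set UNIV_7[symmetric] by blast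
  also have "\<dots> = set is"
  proof -
    have "set [i] = - set is" by (rule distinct_index_set) (use assms d in simp_all)
    then show ?thesis by auto
  qed
  finally have ms: "mset is = mset J"
    using True distinct_filter[of "[1,2,3,4,5,6,7::7]" "\<lambda>j. j \<noteq> i"] set_eq_iff_mset_eq_distinct[of "is" J]
    unfolding J_def by simp
  have key: "wedge T \<phi> (map f J) = - 4 * hodge g vol t1 (map f J)"
  proof -
    have h: "hodge g vol t1 (map f K) = t1 [f j] * eps (j # K)" if "distinct (j # K)" "length K = 6" for j K
      using hodge_complement[of "[j]" t1 K] that mlin_t1 skew_t1 by simp
    have "\<forall>i. wedge T \<phi> (map f (filter (\<lambda>j. j \<noteq> i) [1,2,3,4,5,6,7])) =
        - 4 * (t1 [f i] * eps (i # filter (\<lambda>j. j \<noteq> i) [1,2,3,4,5,6,7]))"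
      unfolding forall_7 using t3_constraints
      by (simp add: wedge_eq_split T_length \<phi>_length \<phi>_f tables eps_eq) (simp add: T_frame sum_7 tables)
    moreover have "distinct (i # J)" "length J = 6" using d ms assms
        by (metis distinct.simps(2) mset_eq_setD mset_eq_imp_distinct_iff, metis ms size_mset)
    ultimately show ?thesis using h[of i J] by (simp add: J_def)
  qed
  \<comment> \<open>The difference of the two sides is skew, so its square does not depend on the
    order of the indices; squaring avoids tracking the sign of the permutation.\<close>
  define F where "F l = wedge T \<phi> (map f l) + 4 * hodge g vol t1 (map f l)" for l
  have skF: "skew F"
    unfolding F_def by (intro skew_map skew_add skew_cmult skew_wedge skew_T skew_\<phi> skew_hodge skew_coframe_monomial)
  have "F is * F is = F J * F J"
  proof (rule adjacent_swap_invariant[where h="\<lambda>l. F l * F l", OF _ ms])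
    show "F (xs @ a # b # ys) * F (xs @ a # b # ys) = F (xs @ b # a # ys) * F (xs @ b # a # ys)" for xs a b ys
      unfolding skewD[OF skF, of xs a b ys] by simp
  qed
  then show ?thesis using key by (simp add: F_def)
qed

lemma T_wedge_\<phi>:
  assumes "length vs = 6" shows "wedge T \<phi> vs = - 4 * hodge g vol t1 vs"
  using T_wedge_\<phi>_frame assms
  by - (rule mlin_frame_eqI[of 6 "wedge T \<phi>" "\<lambda>vs. - 4 * hodge g vol t1 vs"];
      blast intro: mlin_wedge mlin_T mlin_\<phi> mlin_cmult mlin_hodge mlin_coframe_monomial)

end

section \<open>Twice differentiable functions\<close>

lemma differentiable_transform_open:
  assumes "f differentiable (at x)" "open U" "x \<in> U" "\<And>y. y \<in> U \<Longrightarrow> f y = g y"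
  shows "g differentiable (at x)"
  using assms unfolding differentiable_def by (meson has_derivative_transform_within_open)

text \<open>Mere existence of second derivatives: the class is closed under the operations below,
  and second derivatives are exchanged only for the components of \<phi>, which are smooth.\<close>

definition C2_on :: "'a::real_normed_vector set \<Rightarrow> ('a \<Rightarrow> real) \<Rightarrow> bool" where
  "C2_on U f \<longleftrightarrow> (\<forall>x\<in>U. f differentiable (at x)) \<and>
     (\<forall>v. \<forall>x\<in>U. (\<lambda>y. frechet_derivative f (at y) v) differentiable (at x))"

lemma C2_onD: "C2_on U f \<Longrightarrow> x \<in> U \<Longrightarrow> f differentiable (at x)"
  "C2_on U f \<Longrightarrow> x \<in> U \<Longrightarrow> (\<lambda>y. frechet_derivative f (at y) v) differentiable (at x)"
  unfolding C2_on_def by blast+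

lemma C2_onI:
  assumes "open U" "\<And>x. x \<in> U \<Longrightarrow> f differentiable (at x)"
    and "\<And>x v. x \<in> U \<Longrightarrow> frechet_derivative f (at x) v = D v x"
    and "\<And>x v. x \<in> U \<Longrightarrow> D v differentiable (at x)"
  shows "C2_on U f"
  unfolding C2_on_def
proof (intro conjI allI ballI)
  fix v x assume x: "x \<in> U"
  show "(\<lambda>y. frechet_derivative f (at y) v) differentiable (at x)"
    by (rule differentiable_transform_open[OF assms(4)[OF x] assms(1) x]) (simp add: assms(3))
qed (rule assms(2))

lemma smooth_on_C2: assumes "smooth_on U f" shows "C2_on U f"
proof -
  have "Ck_on (Suc (Suc 0)) U f" using assms unfolding smooth_on_def by blast
  then show ?thesis unfolding C2_on_def by simp
qed

context
  fixes U :: "'a::real_normed_vector set"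
  assumes U: "open U"
begin

lemma C2_const: "C2_on U (\<lambda>x. c)"
  by (rule C2_onI[OF U, where D="\<lambda>v x. 0"]) auto

lemma C2_add: "C2_on U f \<Longrightarrow> C2_on U g \<Longrightarrow> C2_on U (\<lambda>x. f x + g x)"
  by (rule C2_onI[OF U, where D="\<lambda>v x. frechet_derivative f (at x) v + frechet_derivative g (at x) v"])
     (auto intro!: frechet_derivative_add differentiable_add dest: C2_onD)

lemma C2_mult: "C2_on U f \<Longrightarrow> C2_on U g \<Longrightarrow> C2_on U (\<lambda>x. f x * g x)"
  by (rule C2_onI[OF U, where D="\<lambda>v x. f x * frechet_derivative g (at x) v + frechet_derivative f (at x) v * g x"])
     (auto intro!: frechet_derivative_mult differentiable_add differentiable_mult dest: C2_onD)

lemma C2_sum: "(\<And>i. i \<in> I \<Longrightarrow> C2_on U (f i)) \<Longrightarrow> C2_on U (\<lambda>x. \<Sum>i\<in>I. f i x)"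
  by (induction I rule: infinite_finite_induct) (auto intro!: C2_const C2_add)

lemma C2_prod: "(\<And>i. i \<in> I \<Longrightarrow> C2_on U (f i)) \<Longrightarrow> C2_on U (\<lambda>x. \<Prod>i\<in>I. f i x)"
  by (induction I rule: infinite_finite_induct) (auto intro!: C2_const C2_mult)

lemma C2_cong:
  assumes "C2_on U f" "\<And>x. x \<in> U \<Longrightarrow> f x = g x" shows "C2_on U g"
proof (rule C2_onI[OF U])
  show "g differentiable (at x)" if "x \<in> U" for x
    by (rule differentiable_transform_open[OF C2_onD(1)[OF assms(1) that] U that assms(2)])
  show "frechet_derivative g (at x) v = frechet_derivative f (at x) v" if "x \<in> U" for x v
    using frechet_derivative_transform_within_open[OF C2_onD(1)[OF assms(1) that] U that assms(2)] by simp
  show "(\<lambda>x. frechet_derivative f (at x) v) differentiable (at x)" if "x \<in> U" for x v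
    by (rule C2_onD(2)[OF assms(1) that])
qed

lemma C2_compose:
  assumes f: "C2_on U f" and h: "\<And>x. x \<in> U \<Longrightarrow> (h has_real_derivative h' (f x)) (at (f x))"
    and h': "\<And>x. x \<in> U \<Longrightarrow> h' differentiable (at (f x))"
  shows "C2_on U (\<lambda>x. h (f x))"
proof (rule C2_onI[OF U, where D="\<lambda>v x. h' (f x) * frechet_derivative f (at x) v"])
  fix x assume x: "x \<in> U"
  note fx = C2_onD(1)[OF f x, unfolded frechet_derivative_works]
  have d: "((\<lambda>x. h (f x)) has_derivative (\<lambda>v. h' (f x) * frechet_derivative f (at x) v)) (at x)"
    using has_derivative_compose[OF fx h[OF x, unfolded has_field_derivative_def]] .
  then show "(\<lambda>x. h (f x)) differentiable (at x)" unfolding differentiable_def by blast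
  show "frechet_derivative (\<lambda>x. h (f x)) (at x) v = h' (f x) * frechet_derivative f (at x) v" for v
    by (rule frechet_derivativeI[OF d])
  have "(\<lambda>x. h' (f x)) differentiable (at x)"
    using differentiable_chain_at[OF C2_onD(1)[OF f x] h'[OF x]] by (simp add: comp_def)
  then show "(\<lambda>x. h' (f x) * frechet_derivative f (at x) v) differentiable (at x)" for v
    by (intro differentiable_mult C2_onD(2)[OF f x])
qed

lemma C2_inverse:
  assumes "C2_on U f" "\<And>x. x \<in> U \<Longrightarrow> f x \<noteq> 0" shows "C2_on U (\<lambda>x. inverse (f x))"
proof (rule C2_compose[OF assms(1), where h'="\<lambda>t. - (inverse t * inverse t)"])
  fix x assume "x \<in> U"
  then have 0: "f x \<noteq> 0" by (rule assms(2))
  show "(inverse has_real_derivative - (inverse (f x) * inverse (f x))) (at (f x))"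
    using DERIV_inverse[OF 0] by (simp add: power2_eq_square numeral_eq_Suc)
  show "(\<lambda>t. - (inverse t * inverse t)) differentiable (at (f x))"
    using 0 by (intro differentiable_minus differentiable_mult differentiable_inverse differentiable_ident) auto
qed

text \<open>\<open>root 3\<close> is the odd root on all reals, so \<open>f\<close> may have either
  sign; only the zero of its argument is singular.\<close>

lemma C2_cube_root:
  assumes "C2_on U f" "\<And>x. x \<in> U \<Longrightarrow> f x \<noteq> 0" shows "C2_on U (\<lambda>x. root 3 (f x))"
proof (rule C2_compose[OF assms(1), where h'="\<lambda>t. inverse (3 * (root 3 t * root 3 t))"])
  fix x assume "x \<in> U"
  then have 0: "f x \<noteq> 0" by (rule assms(2))
  have d: "(root 3 has_real_derivative inverse (3 * (root 3 t * root 3 t))) (at t)" if "t \<noteq> 0" for t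
    using DERIV_odd_real_root[of 3 t] that by (simp add: power2_eq_square)
  then show "(root 3 has_real_derivative inverse (3 * (root 3 (f x) * root 3 (f x)))) (at (f x))" using 0 .
  have "root 3 differentiable (at (f x))" using d[OF 0] real_differentiable_def by blast
  then show "(\<lambda>t. inverse (3 * (root 3 t * root 3 t))) differentiable (at (f x))"
    using 0 by (intro differentiable_inverse differentiable_mult differentiable_const) auto
qed

lemma C2_det:
  fixes A :: "'a \<Rightarrow> real^'n^'n"
  assumes "\<And>i j. C2_on U (\<lambda>x. A x $ i $ j)" shows "C2_on U (\<lambda>x. det (A x))"
  unfolding det_def by (intro C2_sum C2_mult C2_const C2_prod assms)

text \<open>Cramer's rule: an entry of the inverse is a quotient of two determinants, the numerator
  having one column replaced by a unit vector.\<close>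

lemma C2_matrix_inv:
  fixes A :: "'a \<Rightarrow> real^'n^'n"
  assumes "\<And>i j. C2_on U (\<lambda>x. A x $ i $ j)" "\<And>x. x \<in> U \<Longrightarrow> invertible (A x)"
  shows "C2_on U (\<lambda>x. matrix_inv (A x) $ i $ j)"
proof -
  have 0: "det (A x) \<noteq> 0" if "x \<in> U" for x using assms(2)[OF that] invertible_det_nz by blast
  define B where "B x = (\<chi> k l. if l = i then (axis j 1 :: real^'n) $ k else A x $ k $ l)" for x
  have "C2_on U (\<lambda>x. det (B x) * inverse (det (A x)))"
  proof (intro C2_mult C2_inverse C2_det 0)
    show "C2_on U (\<lambda>x. B x $ k $ l)" for k l
      by (cases "l = i") (simp_all add: B_def C2_const assms(1))
  qed (simp_all add: assms(1))
  moreover have "det (B x) * inverse (det (A x)) = matrix_inv (A x) $ i $ j" if x: "x \<in> U" for x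
  proof -
    have "A x *v (matrix_inv (A x) *v axis j 1) = axis j 1"
      using matrix_inv_right[OF assms(2)[OF x]] by (simp add: matrix_vector_mul_assoc)
    then have "matrix_inv (A x) *v axis j 1 = (\<chi> k. det (\<chi> i' l. if l = k then (axis j 1 :: real^'n) $ i'
        else A x $ i' $ l) / det (A x))"
      using cramer[OF 0[OF x]] by blast
    then have "(matrix_inv (A x) *v axis j 1) $ i = det (B x) / det (A x)" by (simp add: B_def)
    then show ?thesis by (simp add: matrix_vector_mult_basis column_def divide_inverse)
  qed
  ultimately show ?thesis by (rule C2_cong)
qed

end

section \<open>Symmetry of second derivatives\<close>

lemma line_derivative:
  fixes f :: "'a::real_normed_vector \<Rightarrow> real"
  assumes "f differentiable (at (p + s *\<^sub>R v))"
  shows "((\<lambda>s. f (p + s *\<^sub>R v)) has_real_derivative frechet_derivative f (at (p + s *\<^sub>R v)) v) (at s)"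
proof -
  have l: "((\<lambda>s. p + s *\<^sub>R v) has_derivative (\<lambda>h. h *\<^sub>R v)) (at s)"
    by (auto intro!: derivative_eq_intros)
  have "((\<lambda>s. f (p + s *\<^sub>R v)) has_derivative (\<lambda>h. frechet_derivative f (at (p + s *\<^sub>R v)) (h *\<^sub>R v))) (at s)"
    by (rule has_derivative_compose[OF l]) (use assms in \<open>simp add: frechet_derivative_works[symmetric]\<close>)
  moreover have "frechet_derivative f (at (p + s *\<^sub>R v)) (h *\<^sub>R v) = frechet_derivative f (at (p + s *\<^sub>R v)) v * h"
      for h
    using linear_scale[OF linear_frechet_derivative[OF assms]] by simp
  ultimately show ?thesis by (simp add: has_field_derivative_def)
qed

text \<open>Both iterated derivatives are values, at nearby points, of the same second difference.\<close>

lemma second_difference: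
  fixes f :: "'a::real_normed_vector \<Rightarrow> real"
  assumes f: "\<And>y. y \<in> ball x r \<Longrightarrow> f differentiable (at y)"
    and fv: "\<And>y. y \<in> ball x r \<Longrightarrow> (\<lambda>z. frechet_derivative f (at z) v) differentiable (at y)"
    and h: "0 < h" "h * (norm v + norm w) < r"
  obtains q where "dist x q \<le> h * (norm v + norm w)"
    "f (x + h *\<^sub>R v + h *\<^sub>R w) - f (x + h *\<^sub>R v) - f (x + h *\<^sub>R w) + f x =
       h * h * frechet_derivative (\<lambda>z. frechet_derivative f (at z) v) (at q) w"
proof -
  have in_ball: "norm (s *\<^sub>R v + t *\<^sub>R w) \<le> h * (norm v + norm w)" if "0 \<le> s" "s \<le> h" "0 \<le> t" "t \<le> h" for s t
  proof -
    have "norm (s *\<^sub>R v + t *\<^sub>R w) \<le> s * norm v + t * norm w"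
      using norm_triangle_ineq[of "s *\<^sub>R v" "t *\<^sub>R w"] that by simp
    also have "\<dots> \<le> h * norm v + h * norm w" using that by (intro add_mono mult_right_mono) auto
    finally show ?thesis by (simp add: distrib_left)
  qed
  have ball: "x + s *\<^sub>R v + t *\<^sub>R w \<in> ball x r" if "0 \<le> s" "s \<le> h" "0 \<le> t" "t \<le> h" for s t
  proof -
    have "x - (x + s *\<^sub>R v + t *\<^sub>R w) = - (s *\<^sub>R v + t *\<^sub>R w)" by simp
    then have "dist x (x + s *\<^sub>R v + t *\<^sub>R w) = norm (s *\<^sub>R v + t *\<^sub>R w)"
      by (simp only: dist_norm norm_minus_cancel)
    then show ?thesis using in_ball[OF that] h(2) by simp
  qed
  let ?\<phi> = "\<lambda>s. f ((x + h *\<^sub>R w) + s *\<^sub>R v) - f (x + s *\<^sub>R v)"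
  have "\<exists>s>0. s < h \<and> ?\<phi> h - ?\<phi> 0 = (h - 0) * (frechet_derivative f (at ((x + h *\<^sub>R w) + s *\<^sub>R v)) v
      - frechet_derivative f (at (x + s *\<^sub>R v)) v)"
  proof (rule MVT2[OF h(1)])
    fix s assume s: "0 \<le> s" "s \<le> h"
    have "(x + h *\<^sub>R w) + s *\<^sub>R v \<in> ball x r" "x + s *\<^sub>R v \<in> ball x r"
      using ball[OF s, of h] ball[OF s, of 0] h(1) by (simp_all add: add_ac)
    then show "(?\<phi> has_real_derivative (frechet_derivative f (at ((x + h *\<^sub>R w) + s *\<^sub>R v)) v
        - frechet_derivative f (at (x + s *\<^sub>R v)) v)) (at s)"
      by (intro DERIV_diff line_derivative f)
  qed
  then obtain s where s: "0 < s" "s < h" and e1: "?\<phi> h - ?\<phi> 0 =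
      h * (frechet_derivative f (at ((x + h *\<^sub>R w) + s *\<^sub>R v)) v - frechet_derivative f (at (x + s *\<^sub>R v)) v)" by auto
  let ?F = "\<lambda>z. frechet_derivative f (at z) v"
  have "\<exists>t>0. t < h \<and> ?F ((x + s *\<^sub>R v) + h *\<^sub>R w) - ?F ((x + s *\<^sub>R v) + 0 *\<^sub>R w) =
      (h - 0) * frechet_derivative ?F (at ((x + s *\<^sub>R v) + t *\<^sub>R w)) w"
  proof (rule MVT2[OF h(1)])
    fix t assume "0 \<le> t" "t \<le> h"
    then show "((\<lambda>t. ?F ((x + s *\<^sub>R v) + t *\<^sub>R w)) has_real_derivative frechet_derivative ?F (at ((x + s *\<^sub>R v)
        + t *\<^sub>R w)) w) (at t)"
      using s by (intro line_derivative fv ball) auto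
  qed
  then obtain t where t: "0 < t" "t < h" and e2: "?F ((x + s *\<^sub>R v) + h *\<^sub>R w) - ?F (x + s *\<^sub>R v) =
      h * frechet_derivative ?F (at ((x + s *\<^sub>R v) + t *\<^sub>R w)) w" by auto
  show thesis
  proof (rule that)
    have "x - (x + s *\<^sub>R v + t *\<^sub>R w) = - (s *\<^sub>R v + t *\<^sub>R w)" by simp
    then have "dist x (x + s *\<^sub>R v + t *\<^sub>R w) = norm (s *\<^sub>R v + t *\<^sub>R w)"
      by (simp only: dist_norm norm_minus_cancel)
    then show "dist x (x + s *\<^sub>R v + t *\<^sub>R w) \<le> h * (norm v + norm w)" using in_ball s t by simp
    have "f (x + h *\<^sub>R v + h *\<^sub>R w) - f (x + h *\<^sub>R v) - f (x + h *\<^sub>R w) + f x = ?\<phi> h - ?\<phi> 0"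
      by (simp add: add_ac)
    also have "\<dots> = h * (?F ((x + s *\<^sub>R v) + h *\<^sub>R w) - ?F (x + s *\<^sub>R v))"
      unfolding e1 by (simp add: add_ac)
    finally show "f (x + h *\<^sub>R v + h *\<^sub>R w) - f (x + h *\<^sub>R v) - f (x + h *\<^sub>R w) + f x =
       h * h * frechet_derivative ?F (at (x + s *\<^sub>R v + t *\<^sub>R w)) w" unfolding e2 by simp
  qed
qed

theorem frechet_derivative_commute:
  fixes f :: "'a::real_normed_vector \<Rightarrow> real"
  assumes "smooth_on U f" "open U" "x \<in> U"
  shows "frechet_derivative (\<lambda>y. frechet_derivative f (at y) v) (at x) w =
    frechet_derivative (\<lambda>y. frechet_derivative f (at y) w) (at x) v"
proof -
  let ?F = "\<lambda>v w y. frechet_derivative (\<lambda>z. frechet_derivative f (at z) v) (at y) w"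
  obtain r where r: "r > 0" "ball x r \<subseteq> U" using assms(2,3) openE by blast
  have C2: "C2_on U f" by (rule smooth_on_C2[OF assms(1)])
  have "Ck_on (Suc (Suc 0)) U f" using assms(1) unfolding smooth_on_def by blast
  then have "continuous_on U (?F v w)" for v w by simp
  then have cont: "isCont (?F v w) x" for v w using assms(2,3) continuous_on_eq_continuous_at by blast
  \<comment> \<open>The summand 1 only keeps the divisor in the step size \<open>h\<close> positive
    when both vectors are zero.\<close>
  define m where "m = norm v + norm w + 1"
  have m: "m > 0" unfolding m_def by (simp add: add_nonneg_pos)
  have "\<bar>?F v w x - ?F w v x\<bar> \<le> e" if e: "e > 0" for e
  proof -
    obtain d1 where d1: "d1 > 0" "\<And>q. dist q x < d1 \<Longrightarrow> dist (?F v w q) (?F v w x) < e / 2"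
      using cont[of v w, unfolded continuous_at_eps_delta] e by (metis half_gt_zero)
    obtain d2 where d2: "d2 > 0" "\<And>q. dist q x < d2 \<Longrightarrow> dist (?F w v q) (?F w v x) < e / 2"
      using cont[of w v, unfolded continuous_at_eps_delta] e by (metis half_gt_zero)
    define h where "h = min r (min d1 d2) / m"
    have h: "h > 0" using r d1(1) d2(1) m by (simp add: h_def)
    have "h * (norm v + norm w) < h * m" using h by (simp add: m_def)
    also have "h * m = min r (min d1 d2)" using m by (simp add: h_def)
    finally have hb: "h * (norm v + norm w) < r" "h * (norm v + norm w) < d1" "h * (norm w + norm v) < d2"
        "h * (norm w + norm v) < r"
      by (simp_all add: add.commute)
    have df: "\<And>y. y \<in> ball x r \<Longrightarrow> f differentiable (at y)"
      "\<And>v y. y \<in> ball x r \<Longrightarrow> (\<lambda>z. frechet_derivative f (at z) v) differentiable (at y)"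
      using C2_onD[OF C2] r(2) by blast+
    obtain q where q: "dist x q \<le> h * (norm v + norm w)"
      "f (x + h *\<^sub>R v + h *\<^sub>R w) - f (x + h *\<^sub>R v) - f (x + h *\<^sub>R w) + f x = h * h * ?F v w q"
      using second_difference[OF df h hb(1)] by blast
    obtain q' where q': "dist x q' \<le> h * (norm w + norm v)"
      "f (x + h *\<^sub>R w + h *\<^sub>R v) - f (x + h *\<^sub>R w) - f (x + h *\<^sub>R v) + f x = h * h * ?F w v q'"
      using second_difference[OF df h hb(4)] by blast
    have "h * h * ?F v w q = h * h * ?F w v q'"
      unfolding q(2)[symmetric] q'(2)[symmetric] by (simp add: add_ac)
    then have "?F v w q = ?F w v q'" using h by simp
    moreover have "\<bar>?F v w q - ?F v w x\<bar> < e / 2" "\<bar>?F w v q' - ?F w v x\<bar> < e / 2"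
      using d1(2)[of q] d2(2)[of q'] q(1) q'(1) hb by (simp_all add: dist_commute dist_real_def)
    ultimately show ?thesis by linarith
  qed
  then have "\<bar>?F v w x - ?F w v x\<bar> \<le> 0" by (rule field_le_epsilon[of _ 0, simplified])
  then show ?thesis by simp
qed

section \<open>The connection with torsion\<close>

context adapted_coframe
begin

text \<open>Contravariant components in the fixed coframe \<open>e\<close>. They will be taken of
  the inverse metric at nearby points, where the frame dual to \<open>e\<close> is no longer
  orthonormal.\<close>

definition upper :: "real^7^7 \<Rightarrow> 7 \<Rightarrow> 7 \<Rightarrow> real" where
  "upper A a b = (\<Sum>i\<in>UNIV. \<Sum>j\<in>UNIV. A $ i $ j * (e $ a $ i * e $ b $ j))"

definition lower :: "real^7^7 \<Rightarrow> 7 \<Rightarrow> 7 \<Rightarrow> real" where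
  "lower M a b = f a \<bullet> (M *v f b)"

lemma contraction_upper:
  assumes "\<And>y. linear (\<lambda>x. h x y)" "\<And>x. linear (\<lambda>y. h x y)"
  shows "(\<Sum>i\<in>UNIV. \<Sum>j\<in>UNIV. A $ i $ j * h (axis i 1) (axis j 1)) =
    (\<Sum>a\<in>UNIV. \<Sum>b\<in>UNIV. upper A a b * h (f a) (f b) :: real)"
proof -
  have "h (axis i 1) (axis j 1) = (\<Sum>a\<in>UNIV. \<Sum>b\<in>UNIV. e $ a $ i * e $ b $ j * h (f a) (f b))" for i j
  proof -
    have "h (axis i 1) (axis j 1) = (\<Sum>a\<in>UNIV. e $ a $ i * h (f a) (axis j 1))"
      using linear_sum_scale[OF assms(1), of "\<lambda>a. e $ a $ i" f UNIV "axis j 1"] axis_expand[of i] by simp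
    also have "\<dots> = (\<Sum>a\<in>UNIV. e $ a $ i * (\<Sum>b\<in>UNIV. e $ b $ j * h (f a) (f b)))"
      using linear_sum_scale[OF assms(2), of _ "\<lambda>a. e $ a $ j" f UNIV] axis_expand[of j] by simp
    finally show ?thesis by (simp add: sum_distrib_left mult_ac)
  qed
  then have "(\<Sum>i\<in>UNIV. \<Sum>j\<in>UNIV. A $ i $ j * h (axis i 1) (axis j 1)) =
    (\<Sum>i\<in>UNIV. \<Sum>j\<in>UNIV. \<Sum>a\<in>UNIV. \<Sum>b\<in>UNIV. A $ i $ j * (e $ a $ i * e $ b $ j) * h (f a) (f b))"
    by (simp add: sum_distrib_left mult_ac)
  also have "\<dots> = (\<Sum>i\<in>UNIV. \<Sum>a\<in>UNIV. \<Sum>j\<in>UNIV. \<Sum>b\<in>UNIV. A $ i $ j * (e $ a $ i * e $ b $ j) * h (f a) (f b))"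
    by (rule sum.cong[OF refl], rule sum.swap)
  also have "\<dots> = (\<Sum>a\<in>UNIV. \<Sum>i\<in>UNIV. \<Sum>j\<in>UNIV. \<Sum>b\<in>UNIV. A $ i $ j * (e $ a $ i * e $ b $ j) * h (f a) (f b))"
    by (rule sum.swap)
  also have "\<dots> = (\<Sum>a\<in>UNIV. \<Sum>i\<in>UNIV. \<Sum>b\<in>UNIV. \<Sum>j\<in>UNIV. A $ i $ j * (e $ a $ i * e $ b $ j) * h (f a) (f b))"
    by (rule sum.cong[OF refl], rule sum.cong[OF refl], rule sum.swap)
  also have "\<dots> = (\<Sum>a\<in>UNIV. \<Sum>b\<in>UNIV. \<Sum>i\<in>UNIV. \<Sum>j\<in>UNIV. A $ i $ j * (e $ a $ i * e $ b $ j) * h (f a) (f b))"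
    by (rule sum.cong[OF refl], rule sum.swap)
  finally show ?thesis by (simp add: upper_def sum_distrib_right)
qed

lemma upper_gi: "upper gi a b = (if a = b then 1 else 0)"
proof -
  have l: "linear (\<lambda>v. (e *v v) $ c)" for c by (rule linear_coordinate)
  have "upper gi a b = (\<Sum>i\<in>UNIV. \<Sum>j\<in>UNIV. gi $ i $ j * ((e *v axis i 1) $ a * (e *v axis j 1) $ b))"
    by (simp add: upper_def matrix_vector_mult_basis column_def)
  also have "\<dots> = (\<Sum>m\<in>UNIV. (e *v f m) $ a * (e *v f m) $ b)"
    by (rule contraction[where h="\<lambda>x y. (e *v x) $ a * (e *v y) $ b"]; intro linear_cmult linear_mult_const l)
  also have "\<dots> = (\<Sum>m\<in>UNIV. (if m = a then 1 else 0) * (if m = b then 1 else 0))"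
    by (intro sum.cong refl) (simp add: e_f axis_def)
  also have "\<dots> = (if a = b then 1 else 0)" by (simp add: if_distrib[of "\<lambda>x. x * _"] cong: if_cong)
  finally show ?thesis .
qed

lemma upper_lower:
  assumes "A ** M = mat 1"
  shows "(\<Sum>b\<in>UNIV. upper A a b * lower M b c) = (if a = c then 1 else 0)"
proof -
  have l: "linear (\<lambda>v. (e *v v) $ c)" for c by (rule linear_coordinate)
  have li: "linear (\<lambda>v. v \<bullet> w)" for w :: "real^7" using linear_inner_matrix(1)[of 1 w] by simp
  have "(\<Sum>b\<in>UNIV. upper A a b * lower M b c) = (\<Sum>a'\<in>UNIV. \<Sum>b\<in>UNIV. upper A a' b * ((e *v f a') $ a * (f b \<bullet> (M *v f
      c))))"
  proof -
    have "(\<Sum>b\<in>UNIV. upper A a' b * ((e *v f a') $ a * (f b \<bullet> (M *v f c)))) =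
      (if a' = a then \<Sum>b\<in>UNIV. upper A a b * lower M b c else 0)" for a'
      by (simp add: e_f axis_def lower_def)
    then show ?thesis by simp
  qed
  also have "\<dots> = (\<Sum>i\<in>UNIV. \<Sum>j\<in>UNIV. A $ i $ j * ((e *v axis i 1) $ a * (axis j 1 \<bullet> (M *v f c))))"
    by (rule contraction_upper[where h="\<lambda>x y. (e *v x) $ a * (y \<bullet> (M *v f c))", symmetric]; intro linear_cmult
        linear_mult_const l li)
  also have "\<dots> = (\<Sum>i\<in>UNIV. e $ a $ i * (A *v (M *v f c)) $ i)"
    by (simp add: matrix_vector_mult_basis column_def inner_axis' matrix_vector_mult_def[of A] sum_distrib_left
        mult_ac)
  also have "\<dots> = (e *v f c) $ a"
    using assms by (simp add: matrix_vector_mul_assoc) (simp add: matrix_vector_mult_def)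
  finally show ?thesis by (simp add: e_f axis_def)
qed

end

text \<open>The hypotheses of the theorem in one chart, with \<tau>_2 = 0 already inserted into the
  equation for d star \<phi>. Full smoothness is kept for \<phi>, whose second derivatives have to
  commute.\<close>

locale local_G2T =
  fixes U :: "(real^7) set" and \<phi> \<tau>1 \<tau>3 :: "real^7 \<Rightarrow> (real^7) form" and t0 :: "real^7 \<Rightarrow> real"
  assumes U: "open U"
    and coframe_ex: "\<And>x. x \<in> U \<Longrightarrow> \<exists>e. G2_coframe (\<phi> x) e"
    and smooth_\<phi>: "\<And>vs. smooth_on U (\<lambda>x. \<phi> x vs)"
    and C2_\<tau>1: "\<And>vs. C2_on U (\<lambda>x. \<tau>1 x vs)" and C2_\<tau>3: "\<And>vs. C2_on U (\<lambda>x. \<tau>3 x vs)" and C2_t0: "C2_on U t0"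
    and \<tau>1: "\<And>x. x \<in> U \<Longrightarrow> alternating_form 1 (\<tau>1 x)" and \<tau>3: "\<And>x. x \<in> U \<Longrightarrow> alternating_form 3 (\<tau>3 x)"
    and \<tau>3_\<phi>: "\<And>x vs. x \<in> U \<Longrightarrow> wedge (\<tau>3 x) (\<phi> x) vs = 0"
    and \<tau>3_\<psi>: "\<And>x vs. x \<in> U \<Longrightarrow> wedge (\<tau>3 x) (star \<phi> \<phi> x) vs = 0"
    and d\<phi>: "\<And>x vs. x \<in> U \<Longrightarrow> ext_d \<phi> x vs =
      t0 x * star \<phi> \<phi> x vs + 3 * wedge (\<tau>1 x) (\<phi> x) vs + star \<phi> \<tau>3 x vs"
    and d\<psi>: "\<And>x vs. x \<in> U \<Longrightarrow> ext_d (star \<phi> \<phi>) x vs = 4 * wedge (\<tau>1 x) (star \<phi> \<phi> x) vs"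
    and dT: "\<And>x vs. x \<in> U \<Longrightarrow> ext_d (torsion_form \<phi> (lee_form \<tau>1)) x vs = 0"
begin

text \<open>A pointwise choice without any continuity in \<open>x\<close>. It is never
  differentiated: \<open>G\<close>, \<open>\<psi>\<close> and \<open>T\<close> do not depend on it,
  and derivatives at a point use the frame frozen there.\<close>

definition e :: "real^7 \<Rightarrow> real^7^7" where "e x = (SOME e. G2_coframe (\<phi> x) e)"
definition G :: "real^7 \<Rightarrow> real^7^7" where "G x = G2_metric (\<phi> x)"
definition Gi :: "real^7 \<Rightarrow> real^7^7" where "Gi x = matrix_inv (G x)"
definition \<psi> :: "real^7 \<Rightarrow> (real^7) form" where "\<psi> = star \<phi> \<phi>"
definition T :: "real^7 \<Rightarrow> (real^7) form" where
  "T x vs = t0 x / 6 * \<phi> x vs - (\<Sum>i\<in>UNIV. \<Sum>j\<in>UNIV. Gi x $ i $ j * (\<tau>1 x [axis i 1] * \<psi> x (axis j 1 # vs))) - \<tau>3 x vs"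

lemma coframe: "x \<in> U \<Longrightarrow> adapted_coframe (\<phi> x) (e x)"
  unfolding e_def adapted_coframe_def using coframe_ex by (rule someI_ex)

lemma
  assumes "x \<in> U"
  shows G_eq: "G x = transpose (e x) ** e x"
    and star_eq: "star \<phi> \<alpha> x = hodge (transpose (e x) ** e x) (coframe_monomial (e x) [1,2,3,4,5,6,7]) (\<alpha> x)"
    and \<psi>_eq: "\<psi> x = adapted_coframe.\<psi> (\<phi> x) (e x)"
proof -
  interpret p: adapted_coframe "\<phi> x" "e x" by (rule coframe[OF assms])
  show "G x = p.g" by (simp only: G_def p.metric_eq)
  show s: "star \<phi> \<alpha> x = hodge p.g p.vol (\<alpha> x)" for \<alpha> by (simp only: star_def p.metric_eq p.volume_eq)
  show "\<psi> x = p.\<psi>" unfolding \<psi>_def s p.\<psi>_def ..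
qed

lemma at_point:
  assumes "x \<in> U" shows "torsion_at_point (\<phi> x) (e x) (t0 x) (\<tau>1 x) (\<tau>3 x) (ext_d \<phi> x)"
proof -
  interpret a: adapted_coframe "\<phi> x" "e x" by (rule coframe[OF assms])
  have s: "star \<phi> \<phi> x = a.\<psi>" using \<psi>_eq[OF assms] by (simp add: \<psi>_def)
  show ?thesis
  proof
    show "wedge (\<tau>3 x) a.\<psi> vs = 0" for vs using \<tau>3_\<psi>[OF assms, of vs] by (simp only: s)
    show "ext_d \<phi> x vs = t0 x * a.\<psi> vs + 3 * wedge (\<tau>1 x) (\<phi> x) vs + hodge a.g a.vol (\<tau>3 x) vs" for vs
      using d\<phi>[OF assms, of vs] by (simp only: a.\<psi>_def star_eq[OF assms])
  qed (use \<tau>1[OF assms] \<tau>3[OF assms] \<tau>3_\<phi>[OF assms] in auto)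
qed

lemma T_eq: "x \<in> U \<Longrightarrow> T x = torsion_at_point.T (\<phi> x) (e x) (t0 x) (\<tau>1 x) (\<tau>3 x)"
proof -
  assume x: "x \<in> U"
  interpret p: torsion_at_point "\<phi> x" "e x" "t0 x" "\<tau>1 x" "\<tau>3 x" "ext_d \<phi> x" by (rule at_point[OF x])
  show ?thesis unfolding T_def[abs_def] p.T_def[abs_def] Gi_def G_eq[OF x] \<psi>_eq[OF x] ..
qed

section \<open>Regularity of the metric, \<psi> and T\<close>

lemma C2_\<phi>: "C2_on U (\<lambda>x. \<phi> x vs)"
  by (rule smooth_on_C2[OF smooth_\<phi>])

text \<open>The metric is recovered from \<open>\<phi>\<close> with the same differentiability: \<open>B\<close> is polynomial in \<open>\<phi>\<close> and
  equals \<open>Det\<close> times the metric, and contracting \<open>\<phi>\<close> with itself by the inverse of \<open>B\<close> gives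
  \<open>42 / Det\<^sup>3\<close>, since \<open>|\<phi>|\<^sup>2 = 42\<close> as a full contraction.\<close>

definition B :: "real^7 \<Rightarrow> real^7^7" where
  "B x = (\<chi> i j. G2_det_metric (\<phi> x) (axis i 1) (axis j 1))"

lemma C2_B: "C2_on U (\<lambda>x. B x $ i $ j)"
  unfolding B_def G2_det_metric_def by (simp, intro C2_sum C2_mult C2_\<phi> C2_const U)

definition Det :: "real^7 \<Rightarrow> real" where
  "Det x = 144 * coframe_monomial (mat 1) [1,2,3,4,5,6,7] (map (($) (e x)) [1,2,3,4,5,6,7])"

lemma Det_nz: "x \<in> U \<Longrightarrow> Det x \<noteq> 0"
  using adapted_coframe.det_metric(3)[OF coframe] by (simp add: Det_def)

lemma matrix_entry: "A $ i $ j = axis i 1 \<bullet> (A *v axis j 1)" for A :: "real^7^7"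
  by (simp add: matrix_vector_mult_basis inner_axis' column_def)

lemma B_eq: assumes "x \<in> U" shows "B x = Det x *\<^sub>R G x"
proof -
  interpret p: adapted_coframe "\<phi> x" "e x" by (rule coframe[OF assms])
  show ?thesis unfolding G_eq[OF assms]
    by (simp add: vec_eq_iff B_def p.det_metric(1) Det_def[symmetric] del: list.map)
       (simp add: matrix_entry[of p.g])
qed

lemma G_inv: "x \<in> U \<Longrightarrow> invertible (G x)"
  using adapted_coframe.invertible_g[OF coframe] by (simp add: G_eq)

lemma GiG: "x \<in> U \<Longrightarrow> Gi x ** G x = mat 1"
  unfolding Gi_def by (rule matrix_inv_left[OF G_inv])

lemma B_inverse:
  assumes x: "x \<in> U" shows "B x ** (inverse (Det x) *\<^sub>R Gi x) = mat 1"
proof -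
  have "r *\<^sub>R A ** (s *\<^sub>R C) = (r * s) *\<^sub>R (A ** C)" for A C :: "real^7^7" and r s
    by (simp add: matrix_matrix_mult_def vec_eq_iff sum_distrib_left mult_ac)
  then show ?thesis
    using Det_nz[OF x] matrix_inv_right[OF G_inv[OF x]] by (simp add: B_eq[OF x] Gi_def)
qed

lemma invB: "x \<in> U \<Longrightarrow> invertible (B x)"
  using B_inverse invertible_right_inverse by blast

lemma matrix_inv_B: "x \<in> U \<Longrightarrow> matrix_inv (B x) = inverse (Det x) *\<^sub>R Gi x"
  by (rule matrix_inv_unique[OF B_inverse])

definition cub :: "real^7 \<Rightarrow> real" where
  "cub x = (\<Sum>m\<in>UNIV. \<Sum>n\<in>UNIV. matrix_inv (B x) $ m $ n *
    (\<Sum>i\<in>UNIV. \<Sum>j\<in>UNIV. matrix_inv (B x) $ i $ j * (\<Sum>k\<in>UNIV. \<Sum>l\<in>UNIV. matrix_inv (B x) $ k $ l *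
      (\<phi> x [axis m 1, axis i 1, axis k 1] * \<phi> x [axis n 1, axis j 1, axis l 1]))))"

lemma C2_cub: "C2_on U cub"
  unfolding cub_def[abs_def] by (intro C2_sum C2_mult C2_\<phi> C2_matrix_inv C2_B invB U)

lemma cub_eq: assumes x: "x \<in> U" shows "cub x = 42 * inverse (Det x ^ 3)"
proof -
  interpret p: adapted_coframe "\<phi> x" "e x" by (rule coframe[OF x])
  have Gx: "Gi x = p.gi" by (simp add: Gi_def G_eq[OF x])
  have "cub x = inverse (Det x) ^ 3 * (\<Sum>m\<in>UNIV. \<Sum>n\<in>UNIV. p.gi $ m $ n * (\<Sum>i\<in>UNIV. \<Sum>j\<in>UNIV. p.gi $ i $ j *
     (\<Sum>k\<in>UNIV. \<Sum>l\<in>UNIV. p.gi $ k $ l * (\<phi> x [axis m 1, axis i 1, axis k 1] * \<phi> x [axis n 1, axis j 1, axis l 1]))))"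
    unfolding cub_def matrix_inv_B[OF x] Gx by (simp add: sum_distrib_left power3_eq_cube mult_ac)
  also have "\<dots> = inverse (Det x) ^ 3 * (\<Sum>m\<in>UNIV. \<Sum>n\<in>UNIV. p.gi $ m $ n * (6 * (axis m 1 \<bullet> (p.g *v axis n 1))))"
    unfolding p.I1 ..
  also have "(\<Sum>m\<in>UNIV. \<Sum>n\<in>UNIV. p.gi $ m $ n * (6 * (axis m 1 \<bullet> (p.g *v axis n 1))))
      = (\<Sum>a\<in>UNIV. 6 * (p.f a \<bullet> (p.g *v p.f a)))"
    by (rule p.contraction[where h="\<lambda>x y. 6 * (x \<bullet> (p.g *v y))"]; rule linear_inner_matrix)
  also have "\<dots> = 42" by (simp add: p.g_frame)
  finally show ?thesis by (simp add: power_inverse)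
qed

lemma C2_Det: "C2_on U Det"
proof -
  have "C2_on U (\<lambda>x. root 3 (42 * inverse (cub x)))"
    by (intro C2_cube_root C2_mult C2_const C2_inverse C2_cub U) (auto simp: cub_eq Det_nz)
  moreover have "root 3 (42 * inverse (cub x)) = Det x" if "x \<in> U" for x
    using Det_nz[OF that] by (simp add: cub_eq[OF that] odd_real_root_power_cancel)
  ultimately show ?thesis by (rule C2_cong[OF U])
qed

lemma C2_G: "C2_on U (\<lambda>x. G x $ i $ j)"
proof (rule C2_cong[OF U])
  show "C2_on U (\<lambda>x. inverse (Det x) * B x $ i $ j)"
    by (intro C2_mult C2_inverse C2_Det C2_B U) (auto simp: Det_nz)
  show "inverse (Det x) * B x $ i $ j = G x $ i $ j" if "x \<in> U" for x
    using Det_nz[OF that] by (simp add: B_eq[OF that])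
qed

lemma C2_Gi: "C2_on U (\<lambda>x. Gi x $ i $ j)"
  unfolding Gi_def by (intro C2_matrix_inv C2_G G_inv U)

lemma C2_inner: "C2_on U (\<lambda>x. u \<bullet> (G x *v v))"
proof -
  have "u \<bullet> (M *v v) = (\<Sum>i\<in>UNIV. \<Sum>j\<in>UNIV. u $ i * (M $ i $ j * v $ j))" for M :: "real^7^7"
    by (simp add: inner_vec_def matrix_vector_mult_def sum_distrib_left)
  then show ?thesis by (simp, intro C2_sum C2_mult C2_G C2_const U)
qed

lemma \<psi>_length: assumes "x \<in> U" "length vs \<noteq> 4" shows "\<psi> x vs = 0"
proof -
  interpret p: adapted_coframe "\<phi> x" "e x" by (rule coframe[OF assms(1)])
  have "\<phi> x (map h is) = 0" if "length is = 7 - length vs" for h and "is" :: "7 list"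
    using that assms(2) by (intro p.\<phi>_length) auto
  then show ?thesis unfolding \<psi>_eq[OF assms(1)] p.\<psi>_def hodge_def by (simp add: Let_def)
qed

lemma \<psi>_I2: "x \<in> U \<Longrightarrow> \<psi> x [a,b,c,d] = (\<Sum>i\<in>UNIV. \<Sum>j\<in>UNIV. Gi x $ i $ j * (\<phi> x [a, b, axis i 1] * \<phi> x [c, d, axis j 1]))
    + (- 1) * ((a \<bullet> (G x *v c)) * (b \<bullet> (G x *v d))) + (a \<bullet> (G x *v d)) * (b \<bullet> (G x *v c))"
  using adapted_coframe.I2[OF coframe, of x a b c d] by (simp add: Gi_def G_eq \<psi>_eq)

lemma C2_\<psi>: "C2_on U (\<lambda>x. \<psi> x vs)"
proof (cases "length vs = 4")
  case True
  then obtain a b c d where vs: "vs = [a,b,c,d]" by (auto simp: numeral_eq_Suc length_Suc_conv)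
  show ?thesis unfolding vs
    by (rule C2_cong[OF U _ \<psi>_I2[symmetric]]) (intro C2_add C2_sum C2_mult C2_\<phi> C2_Gi C2_inner C2_const U)+
next
  case False
  show ?thesis by (rule C2_cong[OF U C2_const[OF U]]) (simp add: \<psi>_length False)
qed

lemma C2_T: "C2_on U (\<lambda>x. T x vs)"
proof -
  have "C2_on U (\<lambda>x. t0 x * (1 / 6) * \<phi> x vs + (- 1) * (\<Sum>i\<in>UNIV. \<Sum>j\<in>UNIV. Gi x $ i $ j * (\<tau>1 x [axis i 1] * \<psi> x (axis
      j 1 # vs)))
     + (- 1) * \<tau>3 x vs)"
    by (intro C2_add C2_sum C2_mult C2_\<phi> C2_Gi C2_\<psi> C2_\<tau>1 C2_\<tau>3 C2_t0 C2_const U)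
  then show ?thesis unfolding T_def by simp
qed

lemma mlin_\<phi>: "x \<in> U \<Longrightarrow> mlin k (\<phi> x)" using adapted_coframe.mlin_\<phi>[OF coframe] by simp
lemma skew_\<phi>: "x \<in> U \<Longrightarrow> skew (\<phi> x)" using adapted_coframe.skew_\<phi>[OF coframe] by simp
lemma mlin_T: "x \<in> U \<Longrightarrow> mlin k (T x)" using torsion_at_point.mlin_T[OF at_point] by (simp add: T_eq)
lemma skew_T: "x \<in> U \<Longrightarrow> skew (T x)" using torsion_at_point.skew_T[OF at_point] by (simp add: T_eq)

lemmas diff_\<phi> = C2_onD(1)[OF C2_\<phi>] and diff_\<psi> = C2_onD(1)[OF C2_\<psi>] and diff_T = C2_onD(1)[OF C2_T]
  and diff_inner = C2_onD(1)[OF C2_inner] and diff_Gi = C2_onD(1)[OF C2_Gi]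

lemma torsion_form_eq:
  assumes x: "x \<in> U" shows "torsion_form \<phi> (lee_form \<tau>1) x [u,v,w] = T x [u,v,w]"
proof -
  interpret p: torsion_at_point "\<phi> x" "e x" "t0 x" "\<tau>1 x" "\<tau>3 x" "ext_d \<phi> x" by (rule at_point[OF x])
  show ?thesis
    using p.torsion_eq[of u v w] unfolding torsion_form_def lee_form_def star_eq[OF x] T_eq[OF x] .
qed

text \<open>The agreement of \<open>T\<close> with the torsion form is known on three arguments,
  which is all that the exterior derivative on four arguments sees; it holds on an open set, so the
  derivatives agree as well.\<close>

lemma ext_d_T: assumes x: "x \<in> U" shows "ext_d T x [a,b,c,d] = 0"
proof -
  have "ext_d T x [a,b,c,d] = ext_d (torsion_form \<phi> (lee_form \<tau>1)) x [a,b,c,d]"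
    unfolding ext_d_def
  proof (rule sum.cong[OF refl])
    fix i assume i: "i \<in> {..<length [a,b,c,d]}"
    have "length (take i [a,b,c,d] @ drop (Suc i) [a,b,c,d]) = 3" using i by auto
    moreover have "\<exists>u v w. l = [u,v,w]" if "length l = 3" for l :: "(real^7) list"
      using that by (auto simp: numeral_eq_Suc length_Suc_conv)
    ultimately obtain u v w where l: "take i [a,b,c,d] @ drop (Suc i) [a,b,c,d] = [u,v,w]" by blast
    have "frechet_derivative (\<lambda>y. T y [u,v,w]) (at x) = frechet_derivative (\<lambda>y. torsion_form \<phi> (lee_form \<tau>1) y
        [u,v,w]) (at x)"
      by (rule frechet_derivative_transform_within_open[OF diff_T[OF x] U x]) (simp add: torsion_form_eq)
    then show "(- 1) ^ i * frechet_derivative (\<lambda>y. T y (take i [a,b,c,d] @ drop (Suc i) [a,b,c,d])) (at x) ([a,b,c,d]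
        ! i) =
      (- 1) ^ i * frechet_derivative (\<lambda>y. torsion_form \<phi> (lee_form \<tau>1) y (take i [a,b,c,d] @ drop (Suc i) [a,b,c,d]))
          (at x) ([a,b,c,d] ! i)"
      unfolding l by simp
  qed
  then show ?thesis using dT[OF x] by simp
qed

end

lemma differentiable_sumI:
  "(\<And>i. i \<in> I \<Longrightarrow> h i differentiable F) \<Longrightarrow> finite I \<Longrightarrow> (\<lambda>x. \<Sum>i\<in>I. h i x) differentiable F"
  by (rule differentiable_sum) auto

section \<open>First derivatives in a frame frozen at a point\<close>

context local_G2T
begin

definition Dg :: "real^7 \<Rightarrow> real^7 \<Rightarrow> real^7 \<Rightarrow> real^7 \<Rightarrow> real" where
  "Dg y u v w = frechet_derivative (\<lambda>z. v \<bullet> (G z *v w)) (at y) u"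

text \<open>Koszul's formula for constant vector fields, whose brackets vanish: the pairing of
  \<open>w\<close> with the Levi-Civita derivative of \<open>v\<close> along
  \<open>u\<close>.\<close>

definition Glow :: "real^7 \<Rightarrow> real^7 \<Rightarrow> real^7 \<Rightarrow> real^7 \<Rightarrow> real" where
  "Glow y u v w = (Dg y u v w + Dg y v u w - Dg y w u v) / 2"

definition Nlow :: "real^7 \<Rightarrow> real^7 \<Rightarrow> real^7 \<Rightarrow> real^7 \<Rightarrow> real" where
  "Nlow y u v w = Glow y u v w + T y [u,v,w] / 2"

lemma G_sym: "x \<in> U \<Longrightarrow> v \<bullet> (G x *v w) = w \<bullet> (G x *v v)"
proof -
  assume x: "x \<in> U"
  interpret p: adapted_coframe "\<phi> x" "e x" by (rule coframe[OF x])
  show ?thesis unfolding G_eq[OF x] p.g_inner by (rule inner_commute)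
qed

lemma Dg_sym: assumes "x \<in> U" shows "Dg x u v w = Dg x u w v"
  unfolding Dg_def
  by (subst frechet_derivative_transform_within_open[OF diff_inner[OF assms] U assms G_sym]) simp_all

lemma constant_derivative:
  assumes "x \<in> U" "h differentiable (at x)" "\<And>y. y \<in> U \<Longrightarrow> h y = c"
  shows "frechet_derivative h (at x) v = 0"
  using frechet_derivative_transform_within_open[OF assms(2) U assms(1), of "\<lambda>y. c"] assms(3) by simp

lemma negated_derivative:
  fixes h k :: "real^7 \<Rightarrow> real"
  assumes "x \<in> U" "h differentiable (at x)" "k differentiable (at x)" "\<And>y. y \<in> U \<Longrightarrow> h y = - k y"
  shows "frechet_derivative h (at x) v = - frechet_derivative k (at x) v"
  using frechet_derivative_transform_within_open[OF assms(2) U assms(1), of "\<lambda>y. - k y"] assms(4)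
  by (simp add: frechet_derivative_minus[OF assms(3)])

lemma C2_upper: "p \<in> U \<Longrightarrow> C2_on U (\<lambda>x. adapted_coframe.upper (e p) (Gi x) a b)"
proof -
  assume "p \<in> U"
  then interpret p: adapted_coframe "\<phi> p" "e p" by (rule coframe)
  show ?thesis unfolding p.upper_def by (intro C2_sum C2_mult C2_Gi C2_const U)
qed

text \<open>Differentiation of the product of the inverse metric with the metric, which is constant;
  in the frame at \<open>p\<close> both factors are the identity matrix at \<open>p\<close>.\<close>

lemma upper_derivative:
  assumes p: "p \<in> U"
  defines "f \<equiv> adapted_coframe.f (e p)"
  shows "frechet_derivative (\<lambda>x. adapted_coframe.upper (e p) (Gi x) a c) (at p) u = - Dg p u (f a) (f c)"
proof -
  interpret p: adapted_coframe "\<phi> p" "e p" by (rule coframe[OF p])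
  note dU = C2_onD(1)[OF C2_upper[OF p] p] and dI = diff_inner[OF p]
  have "frechet_derivative (\<lambda>x. \<Sum>b\<in>UNIV. p.upper (Gi x) a b * (p.f b \<bullet> (G x *v p.f c))) (at p) u = 0"
  proof (rule constant_derivative[OF p])
    show "(\<lambda>x. \<Sum>b\<in>UNIV. p.upper (Gi x) a b * (p.f b \<bullet> (G x *v p.f c))) differentiable (at p)"
      by (intro differentiable_sumI finite differentiable_mult dU dI)
    show "(\<Sum>b\<in>UNIV. p.upper (Gi x) a b * (p.f b \<bullet> (G x *v p.f c))) = (if a = c then 1 else 0)" if "x \<in> U" for x
      using p.upper_lower[OF GiG[OF that], of a c] unfolding p.lower_def .
  qed
  also have "frechet_derivative (\<lambda>x. \<Sum>b\<in>UNIV. p.upper (Gi x) a b * (p.f b \<bullet> (G x *v p.f c))) (at p) u =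
    (\<Sum>b\<in>UNIV. p.upper (Gi p) a b * Dg p u (p.f b) (p.f c) + frechet_derivative (\<lambda>x. p.upper (Gi x) a b) (at p) u
        * (p.f b \<bullet> (G p *v p.f c)))"
    by (subst frechet_derivative_sum) (simp_all add: differentiable_mult dU dI frechet_derivative_mult Dg_def)
  also have "\<dots> = Dg p u (p.f a) (p.f c) + frechet_derivative (\<lambda>x. p.upper (Gi x) a c) (at p) u"
  proof -
    have "p.upper (Gi p) a b = (if a = b then 1 else 0)" "p.f b \<bullet> (G p *v p.f c) = (if b = c then 1 else 0)" for b
      using p.upper_gi[of a b] p.g_frame[of b c] by (simp_all add: Gi_def G_eq[OF p])
    then show ?thesis by (simp add: sum.distrib if_distrib[of "\<lambda>x. x * _"] if_distrib[of "\<lambda>x. _ * x"] cong: if_cong)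
  qed
  finally show ?thesis unfolding f_def by simp
qed

text \<open>In the frame frozen at \<open>p\<close> the identities \<open>I1\<close> and
  \<open>I2\<close> hold near \<open>p\<close>, with \<open>upper\<close> as inverse metric. Their
  derivatives at \<open>p\<close> are \<open>e1\<close> and \<open>e2\<close> of
  \<open>first_order_algebra\<close>; the equations for d\<phi> and d\<psi> are \<open>e3\<close>
  and \<open>e4\<close>.\<close>

lemma first_order_frame:
  assumes p: "p \<in> U"
  defines "f \<equiv> adapted_coframe.f (e p)"
  shows "frechet_derivative (\<lambda>y. \<phi> y [f a, f b, f c]) (at p) (f i) = act3 (\<lambda>a m. Nlow p (f i) (f a) (f m)) phi0 a b c"
proof -
  interpret p: torsion_at_point "\<phi> p" "e p" "t0 p" "\<tau>1 p" "\<tau>3 p" "ext_d \<phi> p" by (rule at_point[OF p])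
  have f: "f = p.f" by (simp add: f_def)
  let ?u = "\<lambda>x. p.upper (Gi x)"
  let ?D = "\<lambda>i h. frechet_derivative h (at p) (f i)"
  define P where "P i a b c = ?D i (\<lambda>y. \<phi> y [f a, f b, f c])" for i a b c
  define S where "S i a b c d = ?D i (\<lambda>y. \<psi> y [f a, f b, f c, f d])" for i a b c d
  define d where "d i a b = Dg p (f i) (f a) (f b)" for i a b
  note diffs = C2_onD(1)[OF C2_upper[OF p] p] diff_inner[OF p] diff_\<phi>[OF p] diff_\<psi>[OF p]
  have up: "?u p a b = (if a = b then 1 else 0)" for a b
    using p.upper_gi[of a b] by (simp add: Gi_def G_eq[OF p])
  have Du: "?D i (\<lambda>x. ?u x a b) = - d i a b" for i a b
    using upper_derivative[OF p] by (simp add: d_def f_def)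
  have inn: "f a \<bullet> (G p *v f b) = (if a = b then 1 else 0)" for a b
    using p.g_frame[of a b] by (simp add: G_eq[OF p] f)
  have ph: "\<phi> p [f a, f b, f c] = phi0 a b c" for a b c by (simp add: p.\<phi>_f f)
  have lin\<phi>: "linear (\<lambda>v. \<phi> x [v, b, c] * k)" "linear (\<lambda>v. \<phi> x [a, v, c] * k)" "linear (\<lambda>v. \<phi> x [a, b, v] * k)"
     "linear (\<lambda>v. k * \<phi> x [v, b, c])" "linear (\<lambda>v. k * \<phi> x [a, v, c])" "linear (\<lambda>v. k * \<phi> x [a, b, v])" if "x \<in> U"
         for x a b c k
    using adapted_coframe.linear_\<phi>[OF coframe[OF that]] by (auto intro!: linear_cmult linear_mult_const)
  have skP: "skew3 (P i)" for i
    unfolding skew3_def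
  proof (intro allI conjI)
    fix a b c
    have sk: "\<phi> y [f a, f b, f c] = - \<phi> y [f b, f a, f c]" "\<phi> y [f a, f b, f c] = - \<phi> y [f a, f c, f b]" if "y \<in> U"
        for y
      using skew3_of_skew[OF skew_\<phi>[OF that], of f] unfolding skew3_def by blast+
    show "P i a b c = - P i b a c" "P i a b c = - P i a c b"
      unfolding P_def by (rule negated_derivative[OF p diff_\<phi>[OF p] diff_\<phi>[OF p]], rule sk, assumption)+
  qed
  have e1: "(\<Sum>c\<in>UNIV. \<Sum>k\<in>UNIV. P i a c k * phi0 b c k) + (\<Sum>c\<in>UNIV. \<Sum>k\<in>UNIV. P i b c k * phi0 a c k)
     - 2 * (\<Sum>c\<in>UNIV. \<Sum>l\<in>UNIV. (\<Sum>k\<in>UNIV. phi0 b k l * d i c k) * phi0 a c l) = 6 * d i a b" for i a b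
  proof -
    let ?in = "\<lambda>c c' x. \<Sum>k\<in>UNIV. \<Sum>k'\<in>UNIV. ?u x k k' * (\<phi> x [f a, f c, f k] * \<phi> x [f b, f c', f k'])"
    have I: "(\<Sum>c\<in>UNIV. \<Sum>c'\<in>UNIV. ?u x c c' * ?in c c' x) = 6 * (f a \<bullet> (G x *v f b))" if x: "x \<in> U" for x
    proof -
      interpret x: adapted_coframe "\<phi> x" "e x" by (rule coframe[OF x])
      have in2: "(\<Sum>k\<in>UNIV. \<Sum>l\<in>UNIV. Gi x $ k $ l * (\<phi> x [f a, v, axis k 1] * \<phi> x [f b, w, axis l 1])) =
         (\<Sum>k\<in>UNIV. \<Sum>k'\<in>UNIV. ?u x k k' * (\<phi> x [f a, v, f k] * \<phi> x [f b, w, f k']))" for v w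
        unfolding f by (rule p.contraction_upper[where h="\<lambda>y z. \<phi> x [p.f a, v, y] * \<phi> x [p.f b, w, z]"]; rule
            lin\<phi>[OF x])
      have "6 * (f a \<bullet> (G x *v f b)) = (\<Sum>i\<in>UNIV. \<Sum>j\<in>UNIV. Gi x $ i $ j * (\<Sum>k\<in>UNIV. \<Sum>k'\<in>UNIV. ?u x k k' *
          (\<phi> x [f a, axis i 1, f k] * \<phi> x [f b, axis j 1, f k'])))"
        using x.I1[of "f a" "f b"] unfolding in2[symmetric] by (simp only: Gi_def G_eq[OF x])
      also have "\<dots> = (\<Sum>c\<in>UNIV. \<Sum>c'\<in>UNIV. ?u x c c' * ?in c c' x)"
        unfolding f
        by (rule p.contraction_upper[where h="\<lambda>y z. \<Sum>k\<in>UNIV. \<Sum>k'\<in>UNIV. ?u x k k' * (\<phi> x [p.f a, y, p.f k] * \<phi> x [p.f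
            b, z, p.f k'])"];
            intro linear_compose_sum ballI linear_cmult lin\<phi>[OF x])
      finally show ?thesis ..
    qed
    have dm: "?in c c' differentiable (at p)" for c c'
      by (intro differentiable_sumI finite differentiable_mult diffs)
    have Din: "?D i (?in c c') = (\<Sum>k\<in>UNIV. \<Sum>k'\<in>UNIV. ?u p k k' * (phi0 a c k * P i b c' k' + P i a c k * phi0 b c' k')
        - d i k k' * (phi0 a c k * phi0 b c' k'))" for c c'
      by (subst frechet_derivative_sum; (intro differentiable_sumI finite differentiable_mult diffs)?;
          subst frechet_derivative_sum; (intro differentiable_sumI finite differentiable_mult diffs)?;
          simp add: frechet_derivative_mult differentiable_mult diffs Du ph P_def)
    have "?D i (\<lambda>x. \<Sum>c\<in>UNIV. \<Sum>c'\<in>UNIV. ?u x c c' * ?in c c' x) = ?D i (\<lambda>x. 6 * (f a \<bullet> (G x *v f b)))"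
      by (subst frechet_derivative_transform_within_open[OF _ U p I])
         (auto intro!: differentiable_sumI finite differentiable_mult diffs dm)
    also have "\<dots> = 6 * d i a b" by (simp add: frechet_derivative_cmult diffs d_def Dg_def)
    finally have "6 * d i a b = (\<Sum>c\<in>UNIV. \<Sum>c'\<in>UNIV. ?u p c c' * ?D i (?in c c') - d i c c' * ?in c c' p)"
      by (subst (asm) frechet_derivative_sum; (intro differentiable_sumI finite differentiable_mult diffs dm)?;
          subst (asm) frechet_derivative_sum; (intro differentiable_sumI finite differentiable_mult diffs dm)?;
          simp add: frechet_derivative_mult differentiable_mult diffs dm Du)
    also have "\<dots> = (\<Sum>c\<in>UNIV. ?D i (?in c c)) - (\<Sum>c\<in>UNIV. \<Sum>c'\<in>UNIV. d i c c' * ?in c c' p)"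
      by (simp add: up sum_subtractf if_distrib[of "\<lambda>x. x * _"] cong: if_cong)
    finally have E0: "6 * d i a b = (\<Sum>c\<in>UNIV. ?D i (?in c c)) - (\<Sum>c\<in>UNIV. \<Sum>c'\<in>UNIV. d i c c' * ?in c c' p)" .
    have A: "?in c c' p = (\<Sum>k\<in>UNIV. phi0 a c k * phi0 b c' k)" for c c'
      by (simp add: up ph if_distrib[of "\<lambda>x. x * _"] cong: if_cong)
    have A': "?D i (?in c c) = (\<Sum>k\<in>UNIV. phi0 a c k * P i b c k) + (\<Sum>k\<in>UNIV. P i a c k * phi0 b c k)
        - (\<Sum>k\<in>UNIV. \<Sum>k'\<in>UNIV. d i k k' * (phi0 a c k * phi0 b c k'))" for c
      unfolding Din by (simp add: up sum_subtractf sum.distrib if_distrib[of "\<lambda>x. x * _"] cong: if_cong)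
    have E: "6 * d i a b = (\<Sum>c\<in>UNIV. \<Sum>k\<in>UNIV. phi0 a c k * P i b c k) + (\<Sum>c\<in>UNIV. \<Sum>k\<in>UNIV. P i a c k * phi0 b c k)
      - (\<Sum>c\<in>UNIV. \<Sum>k\<in>UNIV. \<Sum>k'\<in>UNIV. d i k k' * (phi0 a c k * phi0 b c k'))
      - (\<Sum>c\<in>UNIV. \<Sum>c'\<in>UNIV. d i c c' * (\<Sum>k\<in>UNIV. phi0 a c k * phi0 b c' k))"
      unfolding E0 A A' sum_subtractf sum.distrib ..
    have sw: "phi0 a b c = - phi0 a c b" for a b c using skew3_phi0 unfolding skew3_def by blast
    let ?K = "\<Sum>c\<in>UNIV. \<Sum>l\<in>UNIV. (\<Sum>k\<in>UNIV. phi0 b k l * d i c k) * phi0 a c l"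
    have "(\<Sum>c\<in>UNIV. \<Sum>c'\<in>UNIV. d i c c' * (\<Sum>k\<in>UNIV. phi0 a c k * phi0 b c' k)) = ?K"
      unfolding sum_distrib_left sum_distrib_right
      by (rule sum.cong[OF refl], subst sum.swap) (simp add: mult_ac)
    moreover have "(\<Sum>c\<in>UNIV. \<Sum>k\<in>UNIV. \<Sum>k'\<in>UNIV. d i k k' * (phi0 a c k * phi0 b c k')) = ?K"
    proof -
      have "(\<Sum>c\<in>UNIV. \<Sum>k\<in>UNIV. \<Sum>k'\<in>UNIV. d i k k' * (phi0 a c k * phi0 b c k')) =
         (\<Sum>k\<in>UNIV. \<Sum>c\<in>UNIV. \<Sum>k'\<in>UNIV. d i k k' * (phi0 a c k * phi0 b c k'))" by (rule sum.swap)
      also have "\<dots> = ?K"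
        unfolding sum_distrib_right
        by (intro sum.cong refl) (subst sw[of a], subst sw[of b], simp add: mult_ac)
      finally show ?thesis .
    qed
    ultimately show ?thesis using E by (simp add: mult.commute)
  qed
  have e2: "S i a b c k = (\<Sum>m\<in>UNIV. P i a b m * phi0 c k m) + (\<Sum>m\<in>UNIV. phi0 a b m * P i c k m)
      - (\<Sum>m\<in>UNIV. \<Sum>n\<in>UNIV. phi0 a b m * phi0 c k n * d i m n)
      - d i a c * (if b = k then 1 else 0) - (if a = c then 1 else 0) * d i b k
      + d i a k * (if b = c then 1 else 0) + (if a = k then 1 else 0) * d i b c" for i a b c k
  proof -
    let ?R = "\<lambda>x. \<Sum>m\<in>UNIV. \<Sum>n\<in>UNIV. ?u x m n * (\<phi> x [f a, f b, f m] * \<phi> x [f c, f k, f n])"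
    have I: "\<psi> x [f a, f b, f c, f k] = ?R x
        + (- 1) * ((f a \<bullet> (G x *v f c)) * (f b \<bullet> (G x *v f k))) + (f a \<bullet> (G x *v f k)) * (f b \<bullet> (G x *v f c))" if x:
            "x \<in> U" for x
    proof -
      have "(\<Sum>i\<in>UNIV. \<Sum>j\<in>UNIV. Gi x $ i $ j * (\<phi> x [f a, f b, axis i 1] * \<phi> x [f c, f k, axis j 1])) = ?R x"
        unfolding f by (rule p.contraction_upper[where h="\<lambda>y z. \<phi> x [p.f a, p.f b, y] * \<phi> x [p.f c, p.f k, z]"]; rule
            lin\<phi>[OF x])
      then show ?thesis using \<psi>_I2[OF x, of "f a" "f b" "f c" "f k"] by simp
    qed
    have dR: "?R differentiable (at p)"
      by (intro differentiable_sumI finite differentiable_mult diffs)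
    have DR: "?D i ?R = (\<Sum>m\<in>UNIV. \<Sum>n\<in>UNIV. ?u p m n * (phi0 a b m * P i c k n + P i a b m * phi0 c k n)
        - d i m n * (phi0 a b m * phi0 c k n))"
      by (subst frechet_derivative_sum; (intro differentiable_sumI finite differentiable_mult diffs)?;
          subst frechet_derivative_sum; (intro differentiable_sumI finite differentiable_mult diffs)?;
          simp add: frechet_derivative_mult differentiable_mult diffs Du ph P_def)
    have "S i a b c k = ?D i (\<lambda>x. ?R x
        + (- 1) * ((f a \<bullet> (G x *v f c)) * (f b \<bullet> (G x *v f k))) + (f a \<bullet> (G x *v f k)) * (f b \<bullet> (G x *v f c)))"
      unfolding S_def by (subst frechet_derivative_transform_within_open[OF diff_\<psi>[OF p] U p I]) auto
    also have "\<dots> = ?D i ?R + (- 1) * ((f a \<bullet> (G p *v f c)) * d i b k + d i a c * (f b \<bullet> (G p *v f k)))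
       + ((f a \<bullet> (G p *v f k)) * d i b c + d i a k * (f b \<bullet> (G p *v f c)))"
      by (simp only: frechet_derivative_add frechet_derivative_mult frechet_derivative_cmult differentiable_add
          differentiable_mult
          differentiable_const diffs dR d_def Dg_def frechet_derivative_const mult_zero_left add_0_right)
    also have "\<dots> = (\<Sum>m\<in>UNIV. P i a b m * phi0 c k m) + (\<Sum>m\<in>UNIV. phi0 a b m * P i c k m)
      - (\<Sum>m\<in>UNIV. \<Sum>n\<in>UNIV. phi0 a b m * phi0 c k n * d i m n)
      - d i a c * (if b = k then 1 else 0) - (if a = c then 1 else 0) * d i b k
      + d i a k * (if b = c then 1 else 0) + (if a = k then 1 else 0) * d i b c"
      unfolding DR inn up
      by (simp add: sum_subtractf sum.distrib distrib_left if_distrib[of "\<lambda>x. x * _"] if_distrib[of "(*) _"] mult_ac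
          cong: if_cong)
    finally show ?thesis .
  qed
  have e3: "alt3 P a b c k = t0 p * psi0 a b c k + 3 * wedge13 (\<lambda>m. \<tau>1 p [f m]) phi0 a b c k
      + hodge p.g p.vol (\<tau>3 p) [f a, f b, f c, f k]" for a b c k
  proof -
    have "alt3 P a b c k = ext_d \<phi> p [f a, f b, f c, f k]"
      by (simp add: ext_d_Cons diffs ext_d_Nil alt3_def P_def)
    then show ?thesis unfolding p.d\<phi> wedge_1_3[OF p.t1] wedge13_def f p.\<phi>_f p.\<psi>_f by simp
  qed
  have e4: "alt4 S a b c k l = 4 * wedge14 (\<lambda>m. \<tau>1 p [f m]) psi0 a b c k l" for a b c k l
  proof -
    have "alt4 S a b c k l = ext_d \<psi> p [f a, f b, f c, f k, f l]"
      by (simp add: ext_d_Cons diffs ext_d_Nil alt4_def S_def)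
    also have "\<dots> = 4 * wedge (\<tau>1 p) (\<psi> p) [f a, f b, f c, f k, f l]"
      using d\<psi>[OF p] by (simp only: \<psi>_def)
    finally show ?thesis unfolding wedge_1_4[OF p.t1] wedge14_def f \<psi>_eq[OF p] p.\<psi>_f .
  qed
  have TT: "T p [f a, f b, f c] = t0 p / 6 * phi0 a b c - (\<Sum>m\<in>UNIV. \<tau>1 p [f m] * psi0 m a b c) - \<tau>3 p [f a, f b, f c]"
      for a b c
    unfolding T_eq[OF p] f by (rule p.T_frame)
  have ds: "d i a b = d i b a" for i a b unfolding d_def by (rule Dg_sym[OF p])
  have Nl: "Nlow p (f i) (f a) (f m) = (d i a m + d a i m - d m i a) / 2 + T p [f i, f a, f m] / 2" for i a m
    by (simp add: Nlow_def Glow_def d_def)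
  note st = p.star3_table[OF p.mlin_t3 p.skew_t3, folded f] and con = p.t3_constraints[folded f]
  have "P i a b c = act3 (\<lambda>a m. Nlow p (f i) (f a) (f m)) phi0 a b c"
    by (rule first_order_algebra[where ?t3.0="\<lambda>a b c. \<tau>3 p [f a, f b, f c]" and T="\<lambda>a b c. T p [f a, f b, f c]"
        and ?t1.0="\<lambda>m. \<tau>1 p [f m]" and ?t0.0="t0 p" and ?s3.0="\<lambda>a b c k. hodge p.g p.vol (\<tau>3 p) [f a, f b, f c, f k]"
        and P=P and S=S and Dg=d and N="\<lambda>i a m. Nlow p (f i) (f a) (f m)",
        OF p.skew3_t3[folded f] TT con st skP ds e1 e2 e3 e4 Nl])
  then show ?thesis by (simp add: P_def)
qed

end

section \<open>Curvature\<close>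

text \<open>Terms in which the two matrices act on different slots cancel in the commutator; those
  acting twice on the same slot give the matrix products.\<close>

lemma act3_commutator:
  "act3 A (act3 B X) a b c - act3 B (act3 A X) a b c =
    act3 (\<lambda>a n. (\<Sum>m\<in>UNIV. A a m * B m n) - (\<Sum>m\<in>UNIV. B a m * A m n)) X a b c"
proof -
  define S where "S A B a b F = (\<Sum>m\<in>UNIV. \<Sum>n\<in>UNIV. A a m * B b n * F m n)" for A B :: "7 \<Rightarrow> 7 \<Rightarrow> real" and a b F
  have S: "S B A b a (\<lambda>n m. F m n) = S A B a b F" for A B a b and F :: "7 \<Rightarrow> 7 \<Rightarrow> real"
    unfolding S_def by (subst sum.swap) (simp add: mult_ac)
  define C where "C A B a Y = (\<Sum>n\<in>UNIV. (\<Sum>m\<in>UNIV. A a m * B m n) * Y n)" for A B :: "7 \<Rightarrow> 7 \<Rightarrow> real" and a Y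
  have C: "(\<Sum>m\<in>UNIV. A a m * (\<Sum>n\<in>UNIV. B m n * Y n)) = C A B a Y" for A B :: "7 \<Rightarrow> 7 \<Rightarrow> real" and a Y
    unfolding C_def sum_distrib_left sum_distrib_right by (subst sum.swap) (simp add: mult_ac)
  have SS: "(\<Sum>m\<in>UNIV. A a m * (\<Sum>n\<in>UNIV. B b n * F m n)) = S A B a b F" for A B :: "7 \<Rightarrow> 7 \<Rightarrow> real" and a b F
    unfolding S_def sum_distrib_left by (simp add: mult_ac)
  have exp: "act3 A (act3 B X) a b c =
      (C A B a (\<lambda>n. X n b c) + S A B a b (\<lambda>m n. X m n c) + S A B a c (\<lambda>m n. X m b n))
      + (S A B b a (\<lambda>m n. X n m c) + C A B b (\<lambda>n. X a n c) + S A B b c (\<lambda>m n. X a m n))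
      + (S A B c a (\<lambda>m n. X n b m) + S A B c b (\<lambda>m n. X a n m) + C A B c (\<lambda>n. X a b n))" for A B
    by (simp only: act3_def distrib_left sum.distrib C[symmetric] SS[symmetric])
  show ?thesis
    unfolding exp
    using S[of B A b a "\<lambda>m n. X m n c"] S[of B A c a "\<lambda>m n. X m b n"] S[of B A c b "\<lambda>m n. X a m n"]
      S[of B A a b "\<lambda>m n. X n m c"] S[of B A a c "\<lambda>m n. X n b m"] S[of B A b c "\<lambda>m n. X a n m"]
    by (simp add: act3_def left_diff_distrib sum_subtractf C_def)
qed

section \<open>The parallel equation on the whole chart\<close>

context local_G2T
begin

lemma linear_inner_G: "linear (\<lambda>v. v \<bullet> (G x *v w))" "linear (\<lambda>v. w \<bullet> (G x *v v))"
  using linear_inner_matrix[of 1] by simp_all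

lemma linear_Dg:
  assumes "x \<in> U"
  shows "linear (\<lambda>u. Dg x u v w)" "linear (\<lambda>v. Dg x u v w)" "linear (\<lambda>w. Dg x u v w)"
  unfolding Dg_def
  by (rule linear_frechet_derivative[OF diff_inner[OF assms]],
      (rule linear_frechet_derivative_family[OF _ diff_inner[OF assms] U assms]; rule linear_inner_G)+)

lemma linear_Glow:
  assumes "x \<in> U"
  shows "linear (\<lambda>u. Glow x u v w)" "linear (\<lambda>v. Glow x u v w)" "linear (\<lambda>w. Glow x u v w)"
proof -
  have d: "linear h \<Longrightarrow> linear (\<lambda>v. h v / 2)" for h :: "real^7 \<Rightarrow> real"
    using linear_cmult[of h "1/2"] by simp
  show "linear (\<lambda>u. Glow x u v w)" "linear (\<lambda>v. Glow x u v w)" "linear (\<lambda>w. Glow x u v w)"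
    unfolding Glow_def by (intro d linear_compose_sub linear_compose_add linear_Dg[OF assms])+
qed

lemma Glow_sym: "x \<in> U \<Longrightarrow> Glow x u v w = Glow x v u w"
  unfolding Glow_def using Dg_sym[of x w u v] by simp

lemma Glow_metric: "x \<in> U \<Longrightarrow> Glow x u v w + Glow x u w v = Dg x u v w"
  unfolding Glow_def using Dg_sym[of x] by (simp add: field_simps)

lemma linear_T:
  assumes "x \<in> U"
  shows "linear (\<lambda>v. T x [v, b, c])" "linear (\<lambda>v. T x [a, v, c])" "linear (\<lambda>v. T x [a, b, v])"
  using mlinD[OF mlin_T[OF assms], of "[]" "[b,c]"] mlinD[OF mlin_T[OF assms], of "[a]" "[c]"]
    mlinD[OF mlin_T[OF assms], of "[a,b]" "[]"] by simp_all

lemma linear_Nlow: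
  assumes "x \<in> U"
  shows "linear (\<lambda>u. Nlow x u v w)" "linear (\<lambda>v. Nlow x u v w)" "linear (\<lambda>w. Nlow x u v w)"
proof -
  have d: "linear h \<Longrightarrow> linear (\<lambda>v. h v / 2)" for h :: "real^7 \<Rightarrow> real"
    using linear_cmult[of h "1/2"] by simp
  show "linear (\<lambda>u. Nlow x u v w)" "linear (\<lambda>v. Nlow x u v w)" "linear (\<lambda>w. Nlow x u v w)"
    unfolding Nlow_def by (intro d linear_compose_add linear_Glow[OF assms] linear_T[OF assms])+
qed

lemma linear_\<phi>:
  assumes "x \<in> U"
  shows "linear (\<lambda>v. \<phi> x [v, b, c])" "linear (\<lambda>v. \<phi> x [a, v, c])" "linear (\<lambda>v. \<phi> x [a, b, v])"
  using mlinD[OF mlin_\<phi>[OF assms], of "[]" "[b,c]"] mlinD[OF mlin_\<phi>[OF assms], of "[a]" "[c]"]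
    mlinD[OF mlin_\<phi>[OF assms], of "[a,b]" "[]"] by simp_all

text \<open>The connection with torsion \<open>T\<close> preserves \<open>\<phi>\<close>.\<close>

lemma \<phi>_parallel:
  assumes x: "x \<in> U"
  shows "frechet_derivative (\<lambda>y. \<phi> y [a, b, c]) (at x) u =
    (\<Sum>i\<in>UNIV. \<Sum>j\<in>UNIV. Gi x $ i $ j * (Nlow x u a (axis i 1) * \<phi> x [axis j 1, b, c]))
    + (\<Sum>i\<in>UNIV. \<Sum>j\<in>UNIV. Gi x $ i $ j * (Nlow x u b (axis i 1) * \<phi> x [a, axis j 1, c]))
    + (\<Sum>i\<in>UNIV. \<Sum>j\<in>UNIV. Gi x $ i $ j * (Nlow x u c (axis i 1) * \<phi> x [a, b, axis j 1]))"
proof -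
  interpret p: adapted_coframe "\<phi> x" "e x" by (rule coframe[OF x])
  note lin = linear_mult_const linear_cmult linear_compose_sum ballI
      linear_Nlow[OF x] linear_\<phi>[OF x] linear_compose_add
  have lin_D: "linear (\<lambda>a. frechet_derivative (\<lambda>y. \<phi> y [a, b, c]) (at x) u)"
      "linear (\<lambda>a. frechet_derivative (\<lambda>y. \<phi> y [b, a, c]) (at x) u)"
    "linear (\<lambda>a. frechet_derivative (\<lambda>y. \<phi> y [b, c, a]) (at x) u)" for b c u
    by ((rule linear_frechet_derivative_family[OF _ diff_\<phi>[OF x] U x]; rule linear_\<phi>; assumption)+)
  show ?thesis
  \<comment> \<open>Both sides are linear in all four vectors, so the identity in the frame at
    \<open>x\<close> suffices. The resulting equation no longer refers to that frame and can be read
    in a frame frozen at another point.\<close>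
  proof (rule p.frame_eqI4[where P="\<lambda>u a b c. frechet_derivative (\<lambda>y. \<phi> y [a, b, c]) (at x) u" and
      Q="\<lambda>u a b c. (\<Sum>i\<in>UNIV. \<Sum>j\<in>UNIV. Gi x $ i $ j * (Nlow x u a (axis i 1) * \<phi> x [axis j 1, b, c]))
      + (\<Sum>i\<in>UNIV. \<Sum>j\<in>UNIV. Gi x $ i $ j * (Nlow x u b (axis i 1) * \<phi> x [a, axis j 1, c]))
      + (\<Sum>i\<in>UNIV. \<Sum>j\<in>UNIV. Gi x $ i $ j * (Nlow x u c (axis i 1) * \<phi> x [a, b, axis j 1]))"])
    fix i a b c
    have Gi: "Gi x = p.gi" by (simp add: Gi_def G_eq[OF x])
    have "frechet_derivative (\<lambda>y. \<phi> y [p.f a, p.f b, p.f c]) (at x) (p.f i) =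
      (\<Sum>m\<in>UNIV. Nlow x (p.f i) (p.f a) (p.f m) * \<phi> x [p.f m, p.f b, p.f c])
      + (\<Sum>m\<in>UNIV. Nlow x (p.f i) (p.f b) (p.f m) * \<phi> x [p.f a, p.f m, p.f c])
      + (\<Sum>m\<in>UNIV. Nlow x (p.f i) (p.f c) (p.f m) * \<phi> x [p.f a, p.f b, p.f m])"
      unfolding first_order_frame[OF x] act3_def p.\<phi>_f ..
    also have "(\<Sum>m\<in>UNIV. Nlow x (p.f i) (p.f a) (p.f m) * \<phi> x [p.f m, p.f b, p.f c]) =
        (\<Sum>k\<in>UNIV. \<Sum>j\<in>UNIV. Gi x $ k $ j * (Nlow x (p.f i) (p.f a) (axis k 1) * \<phi> x [axis j 1, p.f b, p.f c]))"
      unfolding Gi by (rule p.contraction[where h="\<lambda>y z. Nlow x (p.f i) (p.f a) y * \<phi> x [z, p.f b, p.f c]",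
          symmetric]; intro lin)
    also have "(\<Sum>m\<in>UNIV. Nlow x (p.f i) (p.f b) (p.f m) * \<phi> x [p.f a, p.f m, p.f c]) =
        (\<Sum>k\<in>UNIV. \<Sum>j\<in>UNIV. Gi x $ k $ j * (Nlow x (p.f i) (p.f b) (axis k 1) * \<phi> x [p.f a, axis j 1, p.f c]))"
      unfolding Gi by (rule p.contraction[where h="\<lambda>y z. Nlow x (p.f i) (p.f b) y * \<phi> x [p.f a, z, p.f c]",
          symmetric]; intro lin)
    also have "(\<Sum>m\<in>UNIV. Nlow x (p.f i) (p.f c) (p.f m) * \<phi> x [p.f a, p.f b, p.f m]) =
        (\<Sum>k\<in>UNIV. \<Sum>j\<in>UNIV. Gi x $ k $ j * (Nlow x (p.f i) (p.f c) (axis k 1) * \<phi> x [p.f a, p.f b, axis j 1]))"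
      unfolding Gi by (rule p.contraction[where h="\<lambda>y z. Nlow x (p.f i) (p.f c) y * \<phi> x [p.f a, p.f b, z]",
          symmetric]; intro lin)
    finally show "frechet_derivative (\<lambda>y. \<phi> y [p.f a, p.f b, p.f c]) (at x) (p.f i) =
      (\<Sum>k\<in>UNIV. \<Sum>j\<in>UNIV. Gi x $ k $ j * (Nlow x (p.f i) (p.f a) (axis k 1) * \<phi> x [axis j 1, p.f b, p.f c]))
      + (\<Sum>k\<in>UNIV. \<Sum>j\<in>UNIV. Gi x $ k $ j * (Nlow x (p.f i) (p.f b) (axis k 1) * \<phi> x [p.f a, axis j 1, p.f c]))
      + (\<Sum>k\<in>UNIV. \<Sum>j\<in>UNIV. Gi x $ k $ j * (Nlow x (p.f i) (p.f c) (axis k 1) * \<phi> x [p.f a, p.f b, axis j 1]))" .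
  qed (rule linear_frechet_derivative[OF diff_\<phi>[OF x]] lin_D | intro lin)+
qed

lemma diff_Dg: "x \<in> U \<Longrightarrow> (\<lambda>y. Dg y u v w) differentiable (at x)"
  unfolding Dg_def by (rule C2_onD(2)[OF C2_inner])

lemma diff_Glow: "x \<in> U \<Longrightarrow> (\<lambda>y. Glow y u v w) differentiable (at x)"
  unfolding Glow_def divide_inverse
  by (intro differentiable_mult differentiable_diff differentiable_add diff_Dg differentiable_const)

lemma diff_Nlow: "x \<in> U \<Longrightarrow> (\<lambda>y. Nlow y u v w) differentiable (at x)"
  unfolding Nlow_def divide_inverse
  by (intro differentiable_mult differentiable_add diff_Glow diff_T differentiable_const)

end

text \<open>Components in the constant frame that is adapted at the base point \<open>p\<close>.\<close>

locale local_G2T_point = local_G2T +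
  fixes p assumes p: "p \<in> U"
begin

sublocale a: torsion_at_point "\<phi> p" "e p" "t0 p" "\<tau>1 p" "\<tau>3 p" "ext_d \<phi> p"
  by (rule at_point[OF p])

abbreviation "f \<equiv> a.f"
definition D :: "7 \<Rightarrow> (real^7 \<Rightarrow> real) \<Rightarrow> real" where "D i h = frechet_derivative h (at p) (f i)"
abbreviation "up a b y \<equiv> a.upper (Gi y) a b"
definition Cup :: "7 \<Rightarrow> 7 \<Rightarrow> 7 \<Rightarrow> real^7 \<Rightarrow> real" where
  "Cup a b c y = (\<Sum>m\<in>UNIV. up m c y * Glow y (f a) (f b) (f m))"
definition Nup :: "7 \<Rightarrow> 7 \<Rightarrow> 7 \<Rightarrow> real^7 \<Rightarrow> real" where
  "Nup a b c y = (\<Sum>m\<in>UNIV. up m c y * Nlow y (f a) (f b) (f m))"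
abbreviation "ph a b c y \<equiv> \<phi> y [f a, f b, f c]"
abbreviation "TT a b c y \<equiv> T y [f a, f b, f c]"

lemma D_add: "h differentiable (at p) \<Longrightarrow> k differentiable (at p) \<Longrightarrow> D i (\<lambda>y. h y + k y) = D i h + D i k"
  and D_mult: "h differentiable (at p) \<Longrightarrow> k differentiable (at p) \<Longrightarrow> D i (\<lambda>y. h y * k y) = h p * D i k + D i h * k p"
  and D_cmult: "h differentiable (at p) \<Longrightarrow> D i (\<lambda>y. c * h y) = c * D i h"
  and D_sum: "(\<And>j. j \<in> J \<Longrightarrow> F j differentiable (at p)) \<Longrightarrow> D i (\<lambda>y. \<Sum>j\<in>J. F j y) = (\<Sum>j\<in>J. D i (F j))"
  unfolding D_def by (simp_all add: frechet_derivative_add frechet_derivative_mult frechet_derivative_cmult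
      frechet_derivative_sum)

lemma D_cong: "h differentiable (at p) \<Longrightarrow> (\<And>y. y \<in> U \<Longrightarrow> h y = k y) \<Longrightarrow> D i h = D i k"
  unfolding D_def by (simp add: frechet_derivative_transform_within_open[OF _ U p])

lemmas diff_up = C2_onD(1)[OF C2_upper[OF p] p]
lemmas diffs = diff_up diff_\<phi>[OF p] diff_T[OF p] diff_Glow[OF p] diff_Nlow[OF p]

lemma diff_Nup: "Nup a b c differentiable (at p)" and diff_Cup: "Cup a b c differentiable (at p)"
  unfolding Nup_def[abs_def] Cup_def[abs_def] by (intro differentiable_sumI finite differentiable_mult diffs)+

lemma up_p: "up a b p = (if a = b then 1 else 0)"
  using a.upper_gi[of a b] by (simp add: Gi_def G_eq[OF p])

lemma D_up: "D i (up a b) = - Dg p (f i) (f a) (f b)"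
  unfolding D_def by (rule upper_derivative[OF p])

lemma Nup_p: "Nup a b c p = Nlow p (f a) (f b) (f c)" and Cup_p: "Cup a b c p = Glow p (f a) (f b) (f c)"
  by (simp_all add: Nup_def Cup_def up_p if_distrib[of "\<lambda>x. x * _"] cong: if_cong)

lemma D_ph: "D i (ph a b c) = act3 (\<lambda>a m. Nup i a m p) phi0 a b c"
  unfolding D_def Nup_p by (rule first_order_frame[OF p])

lemma ph_p: "ph a b c p = phi0 a b c" by (rule a.\<phi>_f)

text \<open>\<open>\<phi>_parallel\<close> at a nearby point \<open>y\<close>, read in the frame
  frozen at \<open>p\<close>. There the frame need not be orthonormal, so the index is raised by
  \<open>up\<close>; as the equation holds on all of \<open>U\<close> it may be differentiated at
  \<open>p\<close>.\<close>

lemma parallel_frame: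
  assumes y: "y \<in> U"
  shows "frechet_derivative (ph a b c) (at y) (f i) =
    (\<Sum>n\<in>UNIV. Nup i a n y * ph n b c y) + (\<Sum>n\<in>UNIV. Nup i b n y * ph a n c y) + (\<Sum>n\<in>UNIV. Nup i c n y * ph a b n y)"
proof -
  have K: "(\<Sum>k\<in>UNIV. \<Sum>j\<in>UNIV. Gi y $ k $ j * (Nlow y u v (axis k 1) * h (axis j 1))) =
     (\<Sum>n\<in>UNIV. (\<Sum>m\<in>UNIV. up m n y * Nlow y u v (f m)) * h (f n))" if "linear h" for u v h
  proof -
    have "(\<Sum>k\<in>UNIV. \<Sum>j\<in>UNIV. Gi y $ k $ j * (Nlow y u v (axis k 1) * h (axis j 1))) =
      (\<Sum>m\<in>UNIV. \<Sum>n\<in>UNIV. up m n y * (Nlow y u v (f m) * h (f n)))"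
      by (rule a.contraction_upper[where h="\<lambda>z w. Nlow y u v z * h w"]; intro linear_mult_const linear_cmult
          linear_Nlow[OF y] that)
    also have "\<dots> = (\<Sum>n\<in>UNIV. \<Sum>m\<in>UNIV. up m n y * (Nlow y u v (f m) * h (f n)))" by (rule sum.swap)
    finally show ?thesis unfolding sum_distrib_right mult.assoc .
  qed
  show ?thesis
    unfolding \<phi>_parallel[OF y] Nup_def
    using K[OF linear_\<phi>(1)[OF y]] K[OF linear_\<phi>(2)[OF y]] K[OF linear_\<phi>(3)[OF y]] by simp
qed

definition DN where "DN i a b c = D i (Nup a b c)"
definition RN where "RN i j k l = DN i j k l - DN j i k l + (\<Sum>m\<in>UNIV. Nup j k m p * Nup i m l p
    - Nup i k m p * Nup j m l p)"

text \<open>Differentiating \<open>parallel_frame\<close> once more and exchanging the two second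
  derivatives of \<phi> leaves the action of the curvature, the quadratic terms combining to a
  commutator.\<close>

lemma holonomy: "act3 (RN i j) phi0 a b c = 0"
proof -
  let ?N = "\<lambda>i a m. Nup i a m p"
  have second: "frechet_derivative (\<lambda>y. frechet_derivative (ph a b c) (at y) (f i)) (at p) (f j) =
     act3 (DN j i) phi0 a b c + act3 (?N i) (act3 (?N j) phi0) a b c" for i j
  proof -
    have "frechet_derivative (\<lambda>y. frechet_derivative (ph a b c) (at y) (f i)) (at p) (f j) =
      D j (\<lambda>y. (\<Sum>n\<in>UNIV. Nup i a n y * ph n b c y) + (\<Sum>n\<in>UNIV. Nup i b n y * ph a n c y)
          + (\<Sum>n\<in>UNIV. Nup i c n y * ph a b n y))"
      unfolding D_def
      by (subst frechet_derivative_transform_within_open[OF C2_onD(2)[OF C2_\<phi> p] U p parallel_frame]) simp_all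
    also have "\<dots> = (\<Sum>n\<in>UNIV. ?N i a n * D j (ph n b c) + DN j i a n * phi0 n b c)
       + (\<Sum>n\<in>UNIV. ?N i b n * D j (ph a n c) + DN j i b n * phi0 a n c)
       + (\<Sum>n\<in>UNIV. ?N i c n * D j (ph a b n) + DN j i c n * phi0 a b n)"
      by (simp add: D_add D_sum D_mult differentiable_sumI differentiable_add differentiable_mult diff_Nup diffs ph_p
          DN_def)
    also have "\<dots> = act3 (DN j i) phi0 a b c + act3 (?N i) (act3 (?N j) phi0) a b c"
      unfolding D_ph by (simp add: act3_def sum.distrib)
    finally show ?thesis .
  qed
  have "act3 (DN j i) phi0 a b c + act3 (?N i) (act3 (?N j) phi0) a b c = act3 (DN i j) phi0 a b c
      + act3 (?N j) (act3 (?N i) phi0) a b c"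
    unfolding second[symmetric] by (rule frechet_derivative_commute[OF smooth_\<phi> U p])
  then have "act3 (DN i j) phi0 a b c - act3 (DN j i) phi0 a b c + (act3 (?N j) (act3 (?N i) phi0) a b c
      - act3 (?N i) (act3 (?N j) phi0) a b c) = 0"
    by simp
  then have "act3 (DN i j) phi0 a b c - act3 (DN j i) phi0 a b c +
      act3 (\<lambda>a n. (\<Sum>m\<in>UNIV. ?N j a m * ?N i m n) - (\<Sum>m\<in>UNIV. ?N i a m * ?N j m n)) phi0 a b c = 0"
    unfolding act3_commutator .
  moreover have "act3 (RN i j) phi0 a b c = act3 (DN i j) phi0 a b c - act3 (DN j i) phi0 a b c +
      act3 (\<lambda>a n. (\<Sum>m\<in>UNIV. ?N j a m * ?N i m n) - (\<Sum>m\<in>UNIV. ?N i a m * ?N j m n)) phi0 a b c"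
    by (simp add: act3_def RN_def sum_subtractf distrib_right left_diff_distrib sum.distrib)
  ultimately show ?thesis by simp
qed

definition DC where "DC i a b c = D i (Cup a b c)"
definition DT where "DT i a b c = D i (TT a b c)"

lemma curvature_contraction:
  "(\<Sum>i\<in>UNIV. \<Sum>j\<in>UNIV. DC i j j i - DC j i j i + (\<Sum>m\<in>UNIV. Cup j j m p * Cup i m i p - Cup i j m p * Cup j m i p)) =
    ((\<Sum>a\<in>UNIV. \<Sum>b\<in>UNIV. \<Sum>c\<in>UNIV. TT a b c p * TT a b c p)
      - psi0_pair (\<lambda>i j k l. \<Sum>m\<in>UNIV. TT i l m p * TT j k m p)) / 4"
proof (rule curvature_algebra[where DN=DN and N="\<lambda>a b c. Nup a b c p" and R=RN and DT=DT])
  show "Cup a b m p = Cup b a m p" for a b m unfolding Cup_p by (rule Glow_sym[OF p])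
  show "DC i a b c = DC i b a c" for i a b c
    unfolding DC_def by (rule D_cong[OF diff_Cup]) (simp add: Cup_def Glow_sym[of _ "f a" "f b"])
  show "skew3 (\<lambda>a b c. TT a b c p)" by (rule skew3_of_skew[OF skew_T[OF p]])
  show "skew3 (DT i)" for i
    unfolding skew3_def
  proof (intro allI conjI)
    fix a b c
    have sk: "TT a b c y = - TT b a c y" "TT a b c y = - TT a c b y" if "y \<in> U" for y
      using skew3_of_skew[OF skew_T[OF that], of f] unfolding skew3_def by blast+
    show "DT i a b c = - DT i b a c" "DT i a b c = - DT i a c b"
      unfolding DT_def D_def by (rule negated_derivative[OF p diff_T[OF p] diff_T[OF p]], rule sk, assumption)+
  qed
  show "Nup a b c p = Cup a b c p + TT a b c p / 2" for a b c unfolding Nup_p Cup_p Nlow_def ..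
  show "DN i a b c = DC i a b c - (\<Sum>m\<in>UNIV. (Cup i c m p + Cup i m c p) * TT a b m p) / 2 + DT i a b c / 2"
      for i a b c
  proof -
    have "Nup a b c = (\<lambda>y. Cup a b c y + (1 / 2) * (\<Sum>m\<in>UNIV. up m c y * TT a b m y))"
      by (simp add: Nup_def Cup_def Nlow_def distrib_left sum.distrib sum_divide_distrib fun_eq_iff)
    then have "DN i a b c = DC i a b c + (1 / 2) * (\<Sum>m\<in>UNIV. up m c p * DT i a b m + D i (up m c) * TT a b m p)"
      unfolding DN_def DC_def DT_def
      by (simp add: D_add D_cmult D_sum D_mult diff_Cup differentiable_mult differentiable_sumI diffs del:
          times_divide_eq_left)
    also have "(\<Sum>m\<in>UNIV. up m c p * DT i a b m + D i (up m c) * TT a b m p) =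
      DT i a b c - (\<Sum>m\<in>UNIV. (Cup i c m p + Cup i m c p) * TT a b m p)"
    proof -
      \<comment> \<open>The derivative of the metric is the symmetrisation of the Levi-Civita
        coefficients (\<open>Glow_metric\<close>), so raising the index of \<open>T\<close> produces
        the correction term that \<open>curvature_algebra\<close> expects.\<close>
      have "D i (up m c) = - (Cup i c m p + Cup i m c p)" for m
        unfolding D_up Cup_p using Glow_metric[OF p, of "f i" "f m" "f c"] by simp
      then show ?thesis by (simp add: sum.distrib sum_subtractf up_p sum_negf if_distrib[of "\<lambda>x. x * _"]
          minus_mult_left[symmetric] del: minus_add_distrib cong: if_cong)
    qed
    finally show ?thesis by (simp add: diff_divide_distrib)
  qed
  show "RN i j k l = DN i j k l - DN j i k l + (\<Sum>m\<in>UNIV. Nup j k m p * Nup i m l p - Nup i k m p * Nup j m l p)"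
      for i j k l
    by (rule RN_def)
  show "act3 (RN i j) phi0 a b c = 0" for i j a b c by (rule holonomy)
  show "alt3 DT a b c d = 0" for a b c d
    using ext_d_T[OF p, of "f a" "f b" "f c" "f d"]
    by (simp add: ext_d_Cons diff_T[OF p] ext_d_Nil alt3_def DT_def D_def)
qed

end

section \<open>Scalar curvature\<close>

definition wedge33 :: "(7 \<Rightarrow> 7 \<Rightarrow> 7 \<Rightarrow> real) \<Rightarrow> (7 \<Rightarrow> 7 \<Rightarrow> 7 \<Rightarrow> real) \<Rightarrow> 7 \<Rightarrow> 7 \<Rightarrow> 7 \<Rightarrow> 7 \<Rightarrow> 7 \<Rightarrow> 7 \<Rightarrow> real" where
  "wedge33 X Y a b c d k l = X a b c * Y d k l - X a b d * Y c k l + X a b k * Y c d l - X a b l * Y c d k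
      + X a c d * Y b k l - X a c k * Y b d l + X a c l * Y b d k + X a d k * Y b c l - X a d l * Y b c k
      + X a k l * Y b c d - X b c d * Y a k l + X b c k * Y a d l - X b c l * Y a d k - X b d k * Y a c l
      + X b d l * Y a c k - X b k l * Y a c d + X c d k * Y a b l - X c d l * Y a b k + X c k l * Y a b d
      - X d k l * Y a b c"

lemma wedge_3_3:
  fixes h :: "7 \<Rightarrow> 'a"
  assumes "\<And>vs. length vs \<noteq> 3 \<Longrightarrow> \<alpha> vs = 0" "\<And>vs. length vs \<noteq> 3 \<Longrightarrow> \<beta> vs = 0"
  shows "wedge \<alpha> \<beta> [h a, h b, h c, h d, h k, h l] =
    wedge33 (\<lambda>a b c. \<alpha> [h a, h b, h c]) (\<lambda>a b c. \<beta> [h a, h b, h c]) a b c d k l"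
  unfolding wedge33_def by (simp add: wedge_eq_split assms)

text \<open>The part of the Leibniz rule that differentiates the second factor; the minus sign comes
  from moving the differentiating index past a form of degree 3.\<close>

lemma wedge33_alternation:
  "wedge33 t (P 1) 2 3 4 5 6 7 - (wedge33 t (P 2) 1 3 4 5 6 7 - (wedge33 t (P 3) 1 2 4 5 6 7
      - (wedge33 t (P 4) 1 2 3 5 6 7 - (wedge33 t (P 5) 1 2 3 4 6 7 - (wedge33 t (P 6) 1 2 3 4 5 7 - wedge33 t (P 7) 1
      2 3 4 5 6))))) = - (t 1 2 3 * alt3 P 4 5 6 7 - t 1 2 4 * alt3 P 3 5 6 7 + t 1 2 5 * alt3 P 3 4 6 7
      - t 1 2 6 * alt3 P 3 4 5 7 + t 1 2 7 * alt3 P 3 4 5 6 + t 1 3 4 * alt3 P 2 5 6 7 - t 1 3 5 * alt3 P 2 4 6 7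
      + t 1 3 6 * alt3 P 2 4 5 7 - t 1 3 7 * alt3 P 2 4 5 6 + t 1 4 5 * alt3 P 2 3 6 7 - t 1 4 6 * alt3 P 2 3 5 7
      + t 1 4 7 * alt3 P 2 3 5 6 + t 1 5 6 * alt3 P 2 3 4 7 - t 1 5 7 * alt3 P 2 3 4 6 + t 1 6 7 * alt3 P 2 3 4 5
      - t 2 3 4 * alt3 P 1 5 6 7 + t 2 3 5 * alt3 P 1 4 6 7 - t 2 3 6 * alt3 P 1 4 5 7 + t 2 3 7 * alt3 P 1 4 5 6
      - t 2 4 5 * alt3 P 1 3 6 7 + t 2 4 6 * alt3 P 1 3 5 7 - t 2 4 7 * alt3 P 1 3 5 6 - t 2 5 6 * alt3 P 1 3 4 7
      + t 2 5 7 * alt3 P 1 3 4 6 - t 2 6 7 * alt3 P 1 3 4 5 + t 3 4 5 * alt3 P 1 2 6 7 - t 3 4 6 * alt3 P 1 2 5 7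
      + t 3 4 7 * alt3 P 1 2 5 6 + t 3 5 6 * alt3 P 1 2 4 7 - t 3 5 7 * alt3 P 1 2 4 6 + t 3 6 7 * alt3 P 1 2 4 5
      - t 4 5 6 * alt3 P 1 2 3 7 + t 4 5 7 * alt3 P 1 2 3 6 - t 4 6 7 * alt3 P 1 2 3 5 + t 5 6 7 * alt3 P 1 2 3 4)"
  unfolding wedge33_def alt3_def by algebra

text \<open>The part of the Leibniz rule that differentiates the first factor: it is the product of
  the alternation of \<open>Q\<close> with \<phi>, so only the complements of the seven triples of
  \<phi> enter.\<close>

lemma wedge33_closed:
  assumes z: "\<And>a b c d. alt3 Q a b c d = 0"
  shows "wedge33 (Q 1) phi0 2 3 4 5 6 7 - (wedge33 (Q 2) phi0 1 3 4 5 6 7 - (wedge33 (Q 3) phi0 1 2 4 5 6 7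
      - (wedge33 (Q 4) phi0 1 2 3 5 6 7 - (wedge33 (Q 5) phi0 1 2 3 4 6 7 - (wedge33 (Q 6) phi0 1 2 3 4 5 7 - wedge33
      (Q 7) phi0 1 2 3 4 5 6))))) = 0"
  using z[of 4 5 6 7] z[of 2 3 6 7] z[of 2 3 4 5] z[of 1 3 5 7] z[of 1 3 4 6] z[of 1 2 5 6] z[of 1 2 4 7]
  unfolding wedge33_def alt3_def phi0_table mult_zero_right mult_1_right mult_minus_right by linarith

lemma (in torsion_at_point) star_d\<phi>_frame:
  "hodge g vol d\<phi> [f a, f b, f c] = t0 * phi0 a b c - 3 * (\<Sum>m\<in>UNIV. t1 [f m] * psi0 m a b c) + t3 [f a, f b, f c]"
proof (rule skew3_eqI)
  show "skew3 (\<lambda>a b c. hodge g vol d\<phi> [f a, f b, f c])"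
    by (intro skew3_of_skew skew_hodge skew_coframe_monomial)
  have n: "skew3 X \<Longrightarrow> skew3 Y \<Longrightarrow> skew3 (\<lambda>a b c. X a b c + Y a b c)" for X Y :: "7 \<Rightarrow> 7 \<Rightarrow> 7 \<Rightarrow> real"
    using skew3_diff[of X "\<lambda>a b c. - 1 * Y a b c"] skew3_cmult[of Y "- 1"] by simp
  show "skew3 (\<lambda>a b c. t0 * phi0 a b c - 3 * (\<Sum>m\<in>UNIV. t1 [f m] * psi0 m a b c) + t3 [f a, f b, f c])"
    by (intro n skew3_diff skew3_cmult skew3_phi0 skew3_psi0_contract skew3_t3)
  have "\<forall>a b. idx a < idx b \<longrightarrow> (\<forall>c. idx b < idx c \<longrightarrow> hodge g vol d\<phi> [f a, f b, f c] =
      t0 * phi0 a b c - 3 * (\<Sum>m\<in>UNIV. t1 [f m] * psi0 m a b c) + t3 [f a, f b, f c])"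
    unfolding forall_sorted_3
    by (simp add: star4_table[OF mlin_d\<phi> skew_d\<phi>])
       (simp add: d\<phi> wedge_1_3[OF t1] \<phi>_f \<psi>_f sum_7 tables star3_table[OF mlin_t3 skew_t3])
  then show "idx a < idx b \<Longrightarrow> idx b < idx c \<Longrightarrow> hodge g vol d\<phi> [f a, f b, f c] =
      t0 * phi0 a b c - 3 * (\<Sum>m\<in>UNIV. t1 [f m] * psi0 m a b c) + t3 [f a, f b, f c]" for a b c by blast
qed

lemma phi0_orthogonal:
  "(\<Sum>a\<in>UNIV. \<Sum>b\<in>UNIV. \<Sum>c\<in>UNIV. phi0 a b c * phi0 a b c) = 42"
  "(\<Sum>a\<in>UNIV. \<Sum>b\<in>UNIV. \<Sum>c\<in>UNIV. phi0 a b c * (\<Sum>m\<in>UNIV. t m * psi0 m a b c)) = 0"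
  "(\<Sum>a\<in>UNIV. \<Sum>b\<in>UNIV. \<Sum>c\<in>UNIV. (\<Sum>m\<in>UNIV. t m * psi0 m a b c) * (\<Sum>m\<in>UNIV. t m * psi0 m a b c)) =
    24 * (\<Sum>m\<in>UNIV. t m * t m)"
  by (simp_all add: sum_7 tables)

context torsion_at_point
begin

lemma t3_orthogonal:
  "(\<Sum>a\<in>UNIV. \<Sum>b\<in>UNIV. \<Sum>c\<in>UNIV. phi0 a b c * t3 [f a, f b, f c]) = 0"
  "(\<Sum>a\<in>UNIV. \<Sum>b\<in>UNIV. \<Sum>c\<in>UNIV. (\<Sum>m\<in>UNIV. t m * psi0 m a b c) * t3 [f a, f b, f c]) = 0"
proof -
  show "(\<Sum>a\<in>UNIV. \<Sum>b\<in>UNIV. \<Sum>c\<in>UNIV. phi0 a b c * t3 [f a, f b, f c]) = 0"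
    by (simp add: sum_7 tables t3_sort) (use t3_constraints(1) in linarith)
  have "\<forall>m. (\<Sum>a\<in>UNIV. \<Sum>b\<in>UNIV. \<Sum>c\<in>UNIV. psi0 m a b c * t3 [f a, f b, f c]) = 0"
    unfolding forall_7
    by (intro conjI; simp add: sum_7 tables t3_sort; use t3_constraints in linarith)
  then have z: "(\<Sum>a\<in>UNIV. \<Sum>b\<in>UNIV. \<Sum>c\<in>UNIV. psi0 m a b c * t3 [f a, f b, f c]) = 0" for m by blast
  have "(\<Sum>a\<in>UNIV. \<Sum>b\<in>UNIV. \<Sum>c\<in>UNIV. (\<Sum>m\<in>UNIV. t m * psi0 m a b c) * t3 [f a, f b, f c]) =
     (\<Sum>a\<in>UNIV. \<Sum>b\<in>UNIV. \<Sum>m\<in>UNIV. \<Sum>c\<in>UNIV. t m * (psi0 m a b c * t3 [f a, f b, f c]))"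
    unfolding sum_distrib_right mult.assoc by (rule sum.cong[OF refl], rule sum.cong[OF refl], rule sum.swap)
  also have "\<dots> = (\<Sum>a\<in>UNIV. \<Sum>m\<in>UNIV. \<Sum>b\<in>UNIV. \<Sum>c\<in>UNIV. t m * (psi0 m a b c * t3 [f a, f b, f c]))"
    by (rule sum.cong[OF refl], rule sum.swap)
  also have "\<dots> = (\<Sum>m\<in>UNIV. \<Sum>a\<in>UNIV. \<Sum>b\<in>UNIV. \<Sum>c\<in>UNIV. t m * (psi0 m a b c * t3 [f a, f b, f c]))"
    by (rule sum.swap)
  also have "\<dots> = 0" by (simp only: sum_distrib_left[symmetric] z) simp
  finally show "(\<Sum>a\<in>UNIV. \<Sum>b\<in>UNIV. \<Sum>c\<in>UNIV. (\<Sum>m\<in>UNIV. t m * psi0 m a b c) * t3 [f a, f b, f c]) = 0" .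
qed

text \<open>\<open>T\<close> and star d\<phi> are combinations of the same three mutually orthogonal
  3-forms, of squared lengths 42, \<open>24 * n1\<close> and \<open>n3\<close>, with coefficients
  (t0/6, -1, -1) and (t0, -3, 1). The opposite signs at \<open>n3\<close> are what permits its
  elimination.\<close>

lemma torsion_products:
  defines "n1 \<equiv> \<Sum>m\<in>UNIV. t1 [f m] * t1 [f m]"
    and "n3 \<equiv> \<Sum>a\<in>UNIV. \<Sum>b\<in>UNIV. \<Sum>c\<in>UNIV. t3 [f a, f b, f c] * t3 [f a, f b, f c]"
  shows "(\<Sum>a\<in>UNIV. \<Sum>b\<in>UNIV. \<Sum>c\<in>UNIV. T [f a, f b, f c] * T [f a, f b, f c]) = 7 / 6 * t0\<^sup>2 + 24 * n1 + n3"
    and "(\<Sum>a\<in>UNIV. \<Sum>b\<in>UNIV. \<Sum>c\<in>UNIV. T [f a, f b, f c] * hodge g vol d\<phi> [f a, f b, f c]) = 7 * t0\<^sup>2 + 72 * n1 - n3"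
proof -
  define I where "I X Y = (\<Sum>a\<in>UNIV. \<Sum>b\<in>UNIV. \<Sum>c\<in>UNIV. X a b c * Y a b c)" for X Y :: "7 \<Rightarrow> 7 \<Rightarrow> 7 \<Rightarrow> real"
  define x where "x a b c = (\<Sum>m\<in>UNIV. t1 [f m] * psi0 m a b c)" for a b c
  define s where "s a b c = t3 [f a, f b, f c]" for a b c
  have sym: "I X Y = I Y X" for X Y unfolding I_def by (simp add: mult.commute)
  have lin: "I (\<lambda>a b c. k * X a b c + l * Y a b c + m * Z a b c) W = k * I X W + l * I Y W + m * I Z W"
      for k l m X Y Z W
    unfolding I_def by (simp add: distrib_right sum.distrib sum_distrib_left mult.assoc)
  have v: "I phi0 phi0 = 42" "I phi0 x = 0" "I x x = 24 * n1" "I phi0 s = 0" "I x s = 0" "I s s = n3"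
    unfolding I_def x_def s_def n1_def n3_def by (rule phi0_orthogonal t3_orthogonal refl)+
  have T: "(\<lambda>a b c. T [f a, f b, f c]) = (\<lambda>a b c. (t0 / 6) * phi0 a b c + (- 1) * x a b c + (- 1) * s a b c)"
    by (simp add: T_frame x_def s_def)
  have S: "(\<lambda>a b c. hodge g vol d\<phi> [f a, f b, f c]) = (\<lambda>a b c. t0 * phi0 a b c + (- 3) * x a b c + 1 * s a b c)"
    by (simp add: star_d\<phi>_frame x_def s_def)
  have v': "I x phi0 = 0" "I s phi0 = 0" "I s x = 0" using v sym by metis+
  let ?T = "\<lambda>a b c. T [f a, f b, f c]"
  have IT: "I ?T Z = (t0 / 6) * I phi0 Z + (- 1) * I x Z + (- 1) * I s Z" for Z unfolding T by (rule lin)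
  have vT: "I phi0 ?T = 7 * t0" "I x ?T = - 24 * n1" "I s ?T = - n3"
    unfolding sym[of _ ?T] IT by (simp_all add: v v')
  have "I ?T ?T = t0 / 6 * (7 * t0) + (- 1) * (- 24 * n1) + (- 1) * (- n3)"
    unfolding IT[of ?T] vT ..
  then show "(\<Sum>a\<in>UNIV. \<Sum>b\<in>UNIV. \<Sum>c\<in>UNIV. T [f a, f b, f c] * T [f a, f b, f c]) = 7 / 6 * t0\<^sup>2 + 24 * n1 + n3"
    by (simp add: I_def power2_eq_square)
  have IS: "I (\<lambda>a b c. hodge g vol d\<phi> [f a, f b, f c]) Z = t0 * I phi0 Z + (- 3) * I x Z + 1 * I s Z" for Z
    unfolding S by (rule lin)
  have "I (\<lambda>a b c. hodge g vol d\<phi> [f a, f b, f c]) ?T = t0 * (7 * t0) + (- 3) * (- 24 * n1) + 1 * (- n3)"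
    unfolding IS vT ..
  then show "(\<Sum>a\<in>UNIV. \<Sum>b\<in>UNIV. \<Sum>c\<in>UNIV. T [f a, f b, f c] * hodge g vol d\<phi> [f a, f b, f c]) = 7 * t0\<^sup>2 + 72 * n1
      - n3"
    by (simp add: I_def power2_eq_square mult.commute[of "T _"])
qed

end

section \<open>The Riemann tensor as a trilinear map\<close>

context local_G2T
begin

lemma Gi_sym: "x \<in> U \<Longrightarrow> Gi x $ i $ j = Gi x $ j $ i"
proof -
  assume x: "x \<in> U"
  interpret p: adapted_coframe "\<phi> x" "e x" by (rule coframe[OF x])
  show ?thesis unfolding Gi_def G_eq[OF x] p.gi_component by (simp add: mult.commute)
qed

definition Cv :: "real^7 \<Rightarrow> real^7 \<Rightarrow> real^7 \<Rightarrow> real^7" where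
  "Cv y u v = (\<chi> l. \<Sum>m\<in>UNIV. Gi y $ m $ l * Glow y u v (axis m 1))"

lemma christoffel_eq: "x \<in> U \<Longrightarrow> christoffel G l i j x = Cv x (axis i 1) (axis j 1) $ l"
  unfolding christoffel_def Cv_def pd_def Glow_def Dg_def matrix_entry[of "G _"] Gi_def[symmetric]
  by (simp add: Gi_sym[of x _ l] sum_divide_distrib)

lemma linear_Cv:
  assumes "x \<in> U"
  shows "linear (\<lambda>u. Cv x u v $ l)" "linear (\<lambda>v. Cv x u v $ l)"
  unfolding Cv_def vec_lambda_beta by (intro linear_compose_sum ballI linear_cmult linear_Glow[OF assms])+

lemma linear_vec: "(\<And>l. linear (\<lambda>u. h u $ l)) \<Longrightarrow> linear h" for h :: "real^7 \<Rightarrow> real^7"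
  by (simp add: linear_iff vec_eq_iff)

lemma linear_Cv':
  assumes "x \<in> U"
  shows "linear (\<lambda>u. Cv x u v)" "linear (\<lambda>v. Cv x u v)"
  by (rule linear_vec, rule linear_Cv[OF assms])+

lemma diff_Cv: "x \<in> U \<Longrightarrow> (\<lambda>y. Cv y u v $ l) differentiable (at x)"
  unfolding Cv_def vec_lambda_beta by (intro differentiable_sumI finite differentiable_mult diff_Gi diff_Glow)

text \<open>Without a bracket term, since constant vector fields commute. Allowing arbitrary vectors
  makes the tensor available in a frozen frame.\<close>

definition Rv :: "real^7 \<Rightarrow> real^7 \<Rightarrow> real^7 \<Rightarrow> real^7 \<Rightarrow> real^7" where
  "Rv x u v w = (\<chi> l. frechet_derivative (\<lambda>y. Cv y v w $ l) (at x) u - frechet_derivative (\<lambda>y. Cv y u w $ l) (at x) v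
     + (Cv x u (Cv x v w) $ l - Cv x v (Cv x u w) $ l))"

lemma riemann_eq:
  assumes x: "x \<in> U" shows "riemann G l k i j x = Rv x (axis i 1) (axis j 1) (axis k 1) $ l"
proof -
  have pd: "pd i (christoffel G l j k) x = frechet_derivative (\<lambda>y. Cv y (axis j 1) (axis k 1) $ l) (at x) (axis i 1)"
      for i j
    unfolding pd_def
    by (subst frechet_derivative_transform_within_open[OF diff_Cv[OF x] U x christoffel_eq[symmetric]]) simp_all
  have lin: "Cv x u v $ l = (\<Sum>m\<in>UNIV. Cv x u (axis m 1) $ l * v $ m)" for u v
    using linear_sum_scale[OF linear_Cv(2)[OF x, of u l], of "\<lambda>m. v $ m" "\<lambda>m. axis m 1" UNIV] basis_expansion[of v]
    by (simp add: scalar_mult_eq_scaleR mult.commute)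
  show ?thesis
    unfolding riemann_def pd Rv_def vec_lambda_beta christoffel_eq[OF x] sum_subtractf
    by (subst (3) lin, subst (4) lin) simp
qed

lemma linear_Rv:
  assumes x: "x \<in> U"
  shows "linear (\<lambda>u. Rv x u v w $ l)" "linear (\<lambda>v. Rv x u v w $ l)" "linear (\<lambda>w. Rv x u v w $ l)"
proof -
  note fam = linear_frechet_derivative_family[OF _ diff_Cv[OF x] U x] and lf =
      linear_frechet_derivative[OF diff_Cv[OF x]]
  have c: "linear (\<lambda>v. Cv x u (h v) $ l)" if "linear h" for u and h :: "real^7 \<Rightarrow> real^7"
    using linear_compose[OF that linear_Cv(2)[OF x, of u l]] by (simp add: comp_def)
  have f1: "linear (\<lambda>v. frechet_derivative (\<lambda>y. Cv y v w $ l) (at x) u)"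
      "linear (\<lambda>v. frechet_derivative (\<lambda>y. Cv y w v $ l) (at x) u)" for w u
    by (rule fam, rule linear_Cv, assumption)+
  show "linear (\<lambda>u. Rv x u v w $ l)" "linear (\<lambda>v. Rv x u v w $ l)" "linear (\<lambda>w. Rv x u v w $ l)"
    unfolding Rv_def vec_lambda_beta
    by (intro linear_compose_add linear_compose_sub lf f1 linear_Cv(1)[OF x] c linear_Cv'[OF x])+
qed

end

context local_G2T_point
begin

lemma Cup_eq: assumes y: "y \<in> U" shows "Cup b c d y = (e p *v Cv y (f b) (f c)) $ d"
proof -
  have l: "linear (\<lambda>v. (e p *v v) $ d)" by (rule linear_coordinate)
  have "(\<Sum>i\<in>UNIV. \<Sum>j\<in>UNIV. Gi y $ i $ j * (Glow y (f b) (f c) (axis i 1) * (e p *v axis j 1) $ d)) =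
    (\<Sum>m\<in>UNIV. \<Sum>n\<in>UNIV. up m n y * (Glow y (f b) (f c) (f m) * (e p *v f n) $ d))"
    by (rule a.contraction_upper[where h="\<lambda>z w. Glow y (f b) (f c) z * (e p *v w) $ d"];
        intro linear_mult_const linear_cmult linear_Glow[OF y] l)
  also have "\<dots> = Cup b c d y"
    by (simp add: Cup_def a.e_f axis_def if_distrib[of "(*) _"] cong: if_cong)
  also have "(\<Sum>i\<in>UNIV. \<Sum>j\<in>UNIV. Gi y $ i $ j * (Glow y (f b) (f c) (axis i 1) * (e p *v axis j 1) $ d)) =
     (\<Sum>j\<in>UNIV. \<Sum>i\<in>UNIV. Gi y $ i $ j * (Glow y (f b) (f c) (axis i 1) * (e p *v axis j 1) $ d))"
    by (rule sum.swap)
  also have "\<dots> = (e p *v Cv y (f b) (f c)) $ d"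
  proof -
    have mv: "(e p *v w) $ d = (\<Sum>j\<in>UNIV. e p $ d $ j * w $ j)" for w
      by (simp add: matrix_vector_mult_def)
    have ax: "(e p *v axis j 1) $ d = e p $ d $ j" for j by (simp add: matrix_vector_mult_basis column_def)
    show ?thesis unfolding ax mv[of "Cv y (f b) (f c)"]
      unfolding Cv_def vec_lambda_beta sum_distrib_left by (simp only: mult_ac)
  qed
  finally show ?thesis by simp
qed

text \<open>The frame and the coframe at \<open>p\<close> are constant, so taking components
  commutes with the derivatives.\<close>

lemma Rv_frame:
  "(e p *v Rv p (f a) (f b) (f c)) $ d = DC a b c d - DC b a c d
    + (\<Sum>m\<in>UNIV. Cup b c m p * Cup a m d p - Cup a c m p * Cup b m d p)"
proof -
  have D1: "(\<Sum>l\<in>UNIV. e p $ d $ l * frechet_derivative (\<lambda>y. Cv y v w $ l) (at p) (f i))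
      = D i (\<lambda>y. (e p *v Cv y v w) $ d)" for v w i
    by (simp add: D_def[symmetric] matrix_vector_mult_def[of _ "Cv _ _ _"] D_sum D_cmult diff_Cv[OF p]
        differentiable_mult)
  have D2: "D i (\<lambda>y. (e p *v Cv y (f b) (f c)) $ d) = DC i b c d" for i b c
    unfolding DC_def by (rule D_cong[OF diff_Cup Cup_eq, symmetric])
  have comp: "(e p *v Cv p (f a) (Cv p (f b) (f c))) $ d = (\<Sum>m\<in>UNIV. Cup b c m p * Cup a m d p)" for a b c
  proof -
    have l: "linear (\<lambda>v. (e p *v Cv p (f a) v) $ d)"
      using linear_compose[OF linear_Cv'(2)[OF p, of "f a"] linear_coordinate[of "e p" d]] by (simp add: comp_def)
    show ?thesis
      using a.linear_frame[OF l, of "Cv p (f b) (f c)"] by (simp add: Cup_eq[OF p])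
  qed
  have "(e p *v Rv p (f a) (f b) (f c)) $ d =
    D a (\<lambda>y. (e p *v Cv y (f b) (f c)) $ d) - D b (\<lambda>y. (e p *v Cv y (f a) (f c)) $ d)
    + ((e p *v Cv p (f a) (Cv p (f b) (f c))) $ d - (e p *v Cv p (f b) (Cv p (f a) (f c))) $ d)"
    unfolding D1[symmetric] Rv_def
    by (simp add: matrix_vector_mult_def distrib_left right_diff_distrib sum.distrib sum_subtractf)
  then show ?thesis unfolding D2 comp by (simp add: sum_subtractf)
qed

lemma scalar_curvature_frame:
  "scalar_curvature G p = (\<Sum>i\<in>UNIV. \<Sum>j\<in>UNIV. DC i j j i - DC j i j i
     + (\<Sum>m\<in>UNIV. Cup j j m p * Cup i m i p - Cup i j m p * Cup j m i p))"
proof -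
  have "scalar_curvature G p = (\<Sum>j\<in>UNIV. \<Sum>k\<in>UNIV. Gi p $ j $ k * (\<Sum>i\<in>UNIV. Rv p (axis i 1) (axis j 1) (axis k 1) $
      i))"
    unfolding scalar_curvature_def ricci_def riemann_eq[OF p] Gi_def ..
  also have "\<dots> = (\<Sum>b\<in>UNIV. \<Sum>i\<in>UNIV. Rv p (axis i 1) (f b) (f b) $ i)"
    unfolding Gi_def G_eq[OF p]
    by (rule a.contraction[where h="\<lambda>v w. \<Sum>i\<in>UNIV. Rv p (axis i 1) v w $ i"]; intro linear_compose_sum ballI
        linear_Rv[OF p])
  also have "\<dots> = (\<Sum>b\<in>UNIV. \<Sum>a\<in>UNIV. (e p *v Rv p (f a) (f b) (f b)) $ a)"
    by (intro sum.cong[OF refl] a.trace_frame linear_vec linear_Rv[OF p])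
  finally show ?thesis unfolding Rv_frame by (subst sum.swap)
qed

definition W :: "real^7 \<Rightarrow> (real^7) form" where "W y = wedge (T y) (\<phi> y)"

lemma C2_W: "C2_on U (\<lambda>y. W y vs)"
  unfolding W_def wedge_def by (intro C2_sum C2_mult C2_T C2_\<phi> C2_const U)

text \<open>Replacing star \<tau>_1 by a multiple of the product of T and \<phi> lets dT = 0 enter
  the codifferential. In lengths other than 6 the Hodge formula evaluates a 1-form on the wrong
  number of arguments and gives zero.\<close>

lemma star_\<tau>1: "y \<in> U \<Longrightarrow> star \<phi> \<tau>1 y vs = (if length vs = 6 then (- 1 / 4) * W y vs else 0)"
proof -
  assume y: "y \<in> U"
  interpret y: torsion_at_point "\<phi> y" "e y" "t0 y" "\<tau>1 y" "\<tau>3 y" "ext_d \<phi> y" by (rule at_point[OF y])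
  show ?thesis
  proof (cases "length vs = 6")
    case True
    then show ?thesis using y.T_wedge_\<phi>[OF True] by (simp add: W_def star_eq[OF y] T_eq[OF y])
  next
    case False
    then show ?thesis using hodge_degree[OF y.t1, of vs] by (simp add: star_eq[OF y])
  qed
qed

lemma diff_star_\<tau>1: "(\<lambda>y. star \<phi> \<tau>1 y vs) differentiable (at p)"
proof (rule differentiable_transform_open[OF _ U p])
  show "(\<lambda>y. if length vs = 6 then (- 1 / 4) * W y vs else 0) differentiable (at p)"
    by (cases "length vs = 6") (simp_all add: differentiable_mult C2_onD(1)[OF C2_W p] del: mult_minus1
        mult_minus_left)
qed (simp add: star_\<tau>1)

lemma codifferential_W: "codifferential1 \<phi> \<tau>1 p = ext_d W p [f 1,f 2,f 3,f 4,f 5,f 6,f 7] / 4"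
proof -
  let ?L = "[f 1,f 2,f 3,f 4,f 5,f 6,f 7]"
  let ?\<beta> = "ext_d (star \<phi> \<tau>1) p"
  have m: "mlin k ?\<beta>" for k
    by (rule mlin_ext_d[OF _ diff_star_\<tau>1 U p]) (simp add: star_eq mlin_hodge mlin_coframe_monomial)
  have s: "skew ?\<beta>"
    by (rule skew_ext_d[OF _ diff_star_\<tau>1 U p]) (simp add: star_eq skew_hodge skew_coframe_monomial)
  have "hodge a.g a.vol ?\<beta> (map f []) = ?\<beta> (map f [1,2,3,4,5,6,7]) * eps ([1,2,3,4,5,6,7] @ [])"
    by (rule a.hodge_complement) (simp_all add: m s)
  then have "codifferential1 \<phi> \<tau>1 p = - ?\<beta> ?L"
    by (simp add: codifferential1_def star_eq[OF p] eps_eq)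
  also have "?\<beta> ?L = (- 1 / 4) * ext_d W p ?L"
    unfolding ext_d_def sum_distrib_left
  proof (rule sum.cong[OF refl])
    fix i assume i: "i \<in> {..<length ?L}"
    let ?l = "take i ?L @ drop (Suc i) ?L"
    have len: "length ?l = 6" using i by (simp only: length_append length_take length_drop) auto
    have "frechet_derivative (\<lambda>y. star \<phi> \<tau>1 y ?l) (at p) = frechet_derivative (\<lambda>y. (- 1 / 4) * W y ?l) (at p)"
      by (rule frechet_derivative_transform_within_open[OF diff_star_\<tau>1 U p]) (simp only: star_\<tau>1 len refl if_True)
    then show "(- 1) ^ i * frechet_derivative (\<lambda>y. star \<phi> \<tau>1 y ?l) (at p) (?L ! i) =
      (- 1 / 4) * ((- 1) ^ i * frechet_derivative (\<lambda>y. W y ?l) (at p) (?L ! i))"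
      by (simp only: frechet_derivative_cmult[OF C2_onD(1)[OF C2_W p]] mult_ac)
  qed
  finally show ?thesis by simp
qed

lemma D_diff: "h differentiable (at p) \<Longrightarrow> k differentiable (at p) \<Longrightarrow> D i (\<lambda>y. h y - k y) = D i h - D i k"
  unfolding D_def by (rule frechet_derivative_diff)

lemma D_W: "D i (\<lambda>y. W y [f a, f b, f c, f d, f k, f l]) =
    wedge33 (\<lambda>a b c. TT a b c p) (\<lambda>a b c. D i (ph a b c)) a b c d k l + wedge33 (DT i) phi0 a b c d k l"
proof -
  have "D i (\<lambda>y. W y [f a, f b, f c, f d, f k, f l]) =
      D i (\<lambda>y. wedge33 (\<lambda>a b c. TT a b c y) (\<lambda>a b c. ph a b c y) a b c d k l)"
  proof (rule D_cong[OF C2_onD(1)[OF C2_W p]])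
    fix y assume y: "y \<in> U"
    interpret y: torsion_at_point "\<phi> y" "e y" "t0 y" "\<tau>1 y" "\<tau>3 y" "ext_d \<phi> y" by (rule at_point[OF y])
    show "W y [f a, f b, f c, f d, f k, f l] = wedge33 (\<lambda>a b c. TT a b c y) (\<lambda>a b c. ph a b c y) a b c d k l"
      unfolding W_def by (rule wedge_3_3) (simp_all add: y.\<phi>_length y.T_length T_eq[OF y])
  qed
  also have "\<dots> = wedge33 (\<lambda>a b c. TT a b c p) (\<lambda>a b c. D i (ph a b c)) a b c d k l + wedge33 (DT i) phi0 a b c d k l"
    unfolding wedge33_def
    by (simp only: D_add D_diff D_mult differentiable_add differentiable_diff differentiable_mult diffs DT_def ph_p)
  finally show ?thesis .
qed

text \<open>The Leibniz rule for T \<and> \<phi>: the term with dT vanishes and minus T \<and>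
  d\<phi> remains, expanded over increasing triples and their complements.\<close>

lemma ext_d_W:
  fixes P defines "P i a b c \<equiv> D i (ph a b c)"
  shows "ext_d W p [f 1,f 2,f 3,f 4,f 5,f 6,f 7] = - (TT 1 2 3 p * alt3 P 4 5 6 7 - TT 1 2 4 p * alt3 P 3 5 6 7
      + TT 1 2 5 p * alt3 P 3 4 6 7 - TT 1 2 6 p * alt3 P 3 4 5 7 + TT 1 2 7 p * alt3 P 3 4 5 6
      + TT 1 3 4 p * alt3 P 2 5 6 7 - TT 1 3 5 p * alt3 P 2 4 6 7 + TT 1 3 6 p * alt3 P 2 4 5 7
      - TT 1 3 7 p * alt3 P 2 4 5 6 + TT 1 4 5 p * alt3 P 2 3 6 7 - TT 1 4 6 p * alt3 P 2 3 5 7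
      + TT 1 4 7 p * alt3 P 2 3 5 6 + TT 1 5 6 p * alt3 P 2 3 4 7 - TT 1 5 7 p * alt3 P 2 3 4 6
      + TT 1 6 7 p * alt3 P 2 3 4 5 - TT 2 3 4 p * alt3 P 1 5 6 7 + TT 2 3 5 p * alt3 P 1 4 6 7
      - TT 2 3 6 p * alt3 P 1 4 5 7 + TT 2 3 7 p * alt3 P 1 4 5 6 - TT 2 4 5 p * alt3 P 1 3 6 7
      + TT 2 4 6 p * alt3 P 1 3 5 7 - TT 2 4 7 p * alt3 P 1 3 5 6 - TT 2 5 6 p * alt3 P 1 3 4 7
      + TT 2 5 7 p * alt3 P 1 3 4 6 - TT 2 6 7 p * alt3 P 1 3 4 5 + TT 3 4 5 p * alt3 P 1 2 6 7
      - TT 3 4 6 p * alt3 P 1 2 5 7 + TT 3 4 7 p * alt3 P 1 2 5 6 + TT 3 5 6 p * alt3 P 1 2 4 7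
      - TT 3 5 7 p * alt3 P 1 2 4 6 + TT 3 6 7 p * alt3 P 1 2 4 5 - TT 4 5 6 p * alt3 P 1 2 3 7
      + TT 4 5 7 p * alt3 P 1 2 3 6 - TT 4 6 7 p * alt3 P 1 2 3 5 + TT 5 6 7 p * alt3 P 1 2 3 4)"
proof -
  have z: "alt3 DT a b c d = 0" for a b c d
    using ext_d_T[OF p, of "f a" "f b" "f c" "f d"]
    by (simp add: ext_d_Cons diff_T[OF p] ext_d_Nil alt3_def DT_def D_def)
  have "ext_d W p [f 1,f 2,f 3,f 4,f 5,f 6,f 7] =
      D 1 (\<lambda>y. W y [f 2,f 3,f 4,f 5,f 6,f 7]) - (D 2 (\<lambda>y. W y [f 1,f 3,f 4,f 5,f 6,f 7])
      - (D 3 (\<lambda>y. W y [f 1,f 2,f 4,f 5,f 6,f 7]) - (D 4 (\<lambda>y. W y [f 1,f 2,f 3,f 5,f 6,f 7])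
      - (D 5 (\<lambda>y. W y [f 1,f 2,f 3,f 4,f 6,f 7]) - (D 6 (\<lambda>y. W y [f 1,f 2,f 3,f 4,f 5,f 7])
      - D 7 (\<lambda>y. W y [f 1,f 2,f 3,f 4,f 5,f 6]))))))"
    by (simp add: ext_d_Cons C2_onD(1)[OF C2_W p] ext_d_Nil D_def)
  moreover have "(\<lambda>a b c. D i (ph a b c)) = P i" for i by (intro ext) (simp add: P_def)
  ultimately show ?thesis
    unfolding D_W
    using wedge33_alternation[of "\<lambda>a b c. TT a b c p" P] wedge33_closed[OF z] by (simp only:)
qed

end

context local_G2T_point
begin

text \<open>Expresses the prescribed d\<phi> through T alone, which identifies its dual
  \<open>sd\<close> with the array in \<open>torsion_quartic\<close>.\<close>

lemma d\<phi>_frame: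
  assumes "idx a < idx b" "idx b < idx c" "idx c < idx d"
  shows "ext_d \<phi> p [f a, f b, f c, f d] = alt3 (\<lambda>i. act3 (\<lambda>a m. TT i a m p / 2) phi0) a b c d"
proof -
  have T: "TT a b c p = t0 p / 6 * phi0 a b c - (\<Sum>m\<in>UNIV. \<tau>1 p [f m] * psi0 m a b c) - \<tau>3 p [f a, f b, f c]" for a b c
    unfolding T_eq[OF p] by (rule a.T_frame)
  note st = a.star3_table[OF a.mlin_t3 a.skew_t3] and con = a.t3_constraints
  have "alt3 (\<lambda>i. act3 (\<lambda>a m. TT i a m p / 2) phi0) a b c d =
      t0 p * psi0 a b c d + 3 * wedge13 (\<lambda>m. \<tau>1 p [f m]) phi0 a b c d + hodge a.g a.vol (\<tau>3 p) [f a, f b, f c, f d]"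
    by (rule alt_torsion[where ?t3.0="\<lambda>a b c. \<tau>3 p [f a, f b, f c]" and T="\<lambda>a b c. TT a b c p" and ?t0.0="t0 p"
        and ?t1.0="\<lambda>m. \<tau>1 p [f m]" and ?s3.0="\<lambda>a b c d. hodge a.g a.vol (\<tau>3 p) [f a, f b, f c, f d]",
        OF a.skew3_t3 T con st assms])
  then show ?thesis unfolding a.d\<phi> wedge_1_3[OF a.t1] wedge13_def a.\<phi>_f a.\<psi>_f by simp
qed

definition sd :: "7 \<Rightarrow> 7 \<Rightarrow> 7 \<Rightarrow> real" where "sd a b c = hodge a.g a.vol (ext_d \<phi> p) [f a, f b, f c]"

lemma skew3_sd: "skew3 sd"
  unfolding sd_def[abs_def] by (intro skew3_of_skew skew_hodge skew_coframe_monomial)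

lemma skew3_TT: "skew3 (\<lambda>a b c. TT a b c p)"
  by (rule skew3_of_skew[OF skew_T[OF p]])

lemma torsion_quartic_frame:
  "psi0_pair (\<lambda>i j k l. \<Sum>m\<in>UNIV. TT i l m p * TT j k m p) =
    2 / 3 * (\<Sum>a\<in>UNIV. \<Sum>b\<in>UNIV. \<Sum>c\<in>UNIV. TT a b c p * sd a b c)"
  unfolding psi0_pair_def
  by (rule torsion_quartic[where T="\<lambda>a b c. TT a b c p" and sd=sd, OF skew3_TT skew3_sd];
      simp only: sd_def a.star4_table[OF a.mlin_d\<phi> a.skew_d\<phi>]; subst d\<phi>_frame; simp add: idx_simps)

text \<open>The divisor 24 is the 4 of \<open>codifferential_W\<close> times the six orderings of
  each increasing triple.\<close>

lemma codifferential_frame: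
  "codifferential1 \<phi> \<tau>1 p = - (\<Sum>a\<in>UNIV. \<Sum>b\<in>UNIV. \<Sum>c\<in>UNIV. TT a b c p * sd a b c) / 24"
proof -
  have P: "alt3 (\<lambda>i a b c. D i (ph a b c)) a b c d = ext_d \<phi> p [f a, f b, f c, f d]" for a b c d
    by (simp add: ext_d_Cons diffs ext_d_Nil alt3_def D_def)
  have "ext_d W p [f 1,f 2,f 3,f 4,f 5,f 6,f 7] = - (TT 1 2 3 p * sd 1 2 3 + TT 1 2 4 p * sd 1 2 4
      + TT 1 2 5 p * sd 1 2 5 + TT 1 2 6 p * sd 1 2 6 + TT 1 2 7 p * sd 1 2 7 + TT 1 3 4 p * sd 1 3 4
      + TT 1 3 5 p * sd 1 3 5 + TT 1 3 6 p * sd 1 3 6 + TT 1 3 7 p * sd 1 3 7 + TT 1 4 5 p * sd 1 4 5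
      + TT 1 4 6 p * sd 1 4 6 + TT 1 4 7 p * sd 1 4 7 + TT 1 5 6 p * sd 1 5 6 + TT 1 5 7 p * sd 1 5 7
      + TT 1 6 7 p * sd 1 6 7 + TT 2 3 4 p * sd 2 3 4 + TT 2 3 5 p * sd 2 3 5 + TT 2 3 6 p * sd 2 3 6
      + TT 2 3 7 p * sd 2 3 7 + TT 2 4 5 p * sd 2 4 5 + TT 2 4 6 p * sd 2 4 6 + TT 2 4 7 p * sd 2 4 7
      + TT 2 5 6 p * sd 2 5 6 + TT 2 5 7 p * sd 2 5 7 + TT 2 6 7 p * sd 2 6 7 + TT 3 4 5 p * sd 3 4 5
      + TT 3 4 6 p * sd 3 4 6 + TT 3 4 7 p * sd 3 4 7 + TT 3 5 6 p * sd 3 5 6 + TT 3 5 7 p * sd 3 5 7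
      + TT 3 6 7 p * sd 3 6 7 + TT 4 5 6 p * sd 4 5 6 + TT 4 5 7 p * sd 4 5 7 + TT 4 6 7 p * sd 4 6 7
      + TT 5 6 7 p * sd 5 6 7)"
    unfolding ext_d_W P sd_def a.star4_table[OF a.mlin_d\<phi> a.skew_d\<phi>] by simp
  then show ?thesis unfolding codifferential_W skew3_inner[OF skew3_TT skew3_sd] by simp
qed

lemma covector_norm_frame: "covector_norm_sq (G p) (\<tau>1 p) = (\<Sum>m\<in>UNIV. \<tau>1 p [f m] * \<tau>1 p [f m])"
proof -
  have l: "linear (\<lambda>x. \<tau>1 p [x])" using mlinD[OF a.mlin_t1, of "[]" "[]"] by simp
  show ?thesis
    unfolding covector_norm_sq_def G_eq[OF p] mult.assoc
    by (rule a.contraction[where h="\<lambda>x y. \<tau>1 p [x] * \<tau>1 p [y]"]; intro linear_cmult linear_mult_const l)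
qed

text \<open>Let X be the full contraction of T with star d\<phi> and |T|^2 that of T with itself.
  The curvature is |T|^2/4 - X/6 = (|T|^2 + X)/4 - 5X/12. In the first summand \<tau>_3 cancels, and
  it equals 49/24 t0^2 + 24 |\<tau>_1|^2; the second is 10 times the codifferential -X/24.\<close>

lemma scalar_curvature_eq:
  "scalar_curvature G p = 10 * codifferential1 \<phi> \<tau>1 p + 49 / 24 * (t0 p)\<^sup>2 + 24 * covector_norm_sq (G p) (\<tau>1 p)"
  using a.torsion_products[folded T_eq[OF p] sd_def]
  unfolding scalar_curvature_frame curvature_contraction torsion_quartic_frame codifferential_frame
      covector_norm_frame
  by (simp add: field_simps)

end

theorem proposition3p1:
  fixes M :: "('a::{t2_space, second_countable_topology}, 7) chart set"
    and \<phi> :: "('a, 7) form_field"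
    and \<tau>\<^sub>0 :: "'a \<Rightarrow> real"
    and \<tau>\<^sub>1 \<tau>\<^sub>2 \<tau>\<^sub>3 :: "('a, 7) form_field"
  assumes "smooth_atlas M"
    and "strong_G2T_structure M \<phi> \<tau>\<^sub>0 \<tau>\<^sub>1 \<tau>\<^sub>2 \<tau>\<^sub>3"
  shows "\<forall>c\<in>M. \<forall>p\<in>fst c.
    scalar_curvature (\<lambda>x. G2_metric (\<phi> c x)) (snd c p) =
      10 * codifferential1 (\<phi> c) (\<tau>\<^sub>1 c) (snd c p) + 49 / 24 * (\<tau>\<^sub>0 p)\<^sup>2
      + 24 * covector_norm_sq (G2_metric (\<phi> c (snd c p))) (\<tau>\<^sub>1 c (snd c p))"
proof (intro ballI)
  fix c q assume c: "c \<in> M" and q: "q \<in> fst c"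
  define U where "U = snd c ` fst c"
  define t0 where "t0 = \<tau>\<^sub>0 \<circ> inv_into (fst c) (snd c)"
  note strong = assms(2)[unfolded strong_G2T_structure_def G2_structure_def intrinsic_torsion_def Let_def]
  have chart: "open U \<and> (\<exists>h. homeomorphism (fst c) U (snd c) h)"
    using assms(1) c unfolding smooth_atlas_def U_def by (elim conjE) simp
  then have open_U: "open U" by blast
  obtain h where "homeomorphism (fst c) U (snd c) h" using chart by blast
  \<comment> \<open>Injectivity of the chart makes \<open>inv_into\<close> a true inverse, so that
    the coordinate expression \<open>t0\<close> has the value of \<tau>_0 at the point.\<close>
  then have "inj_on (snd c) (fst c)" unfolding homeomorphism_def by (auto intro: inj_on_inverseI)
  then have t0_eq: "t0 (snd c p) = \<tau>\<^sub>0 p" if "p \<in> fst c" for p using that by (simp add: t0_def)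
  have forms: "differential_form M 3 \<phi>" "differential_form M 1 \<tau>\<^sub>1" "differential_form M 3 \<tau>\<^sub>3"
    and sm_\<tau>0: "smooth_function M \<tau>\<^sub>0"
    and van: "vanishes M \<tau>\<^sub>2" "vanishes M (\<lambda>c. ext_d (torsion_form (\<phi> c) (lee_form (\<tau>\<^sub>1 c))))"
    and coframes: "\<forall>c\<in>M. \<forall>x\<in>snd c ` fst c. \<exists>e. G2_coframe (\<phi> c x) e"
    using strong by - (elim conjE; assumption)+
  have sm_t0: "smooth_on U t0"
    using sm_\<tau>0 c unfolding smooth_function_def U_def t0_def by blast
  have df: "alternating_form 3 (\<phi> c x)" "alternating_form 1 (\<tau>\<^sub>1 c x)" "alternating_form 3 (\<tau>\<^sub>3 c x)" if "x \<in> U" for x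
    using forms[unfolded differential_form_def, THEN conjunct1, rule_format, OF c] that unfolding U_def by auto
  have sm: "smooth_on U (\<lambda>x. \<phi> c x vs)" "smooth_on U (\<lambda>x. \<tau>\<^sub>1 c x vs)" "smooth_on U (\<lambda>x. \<tau>\<^sub>3 c x vs)" for vs
    using forms[unfolded differential_form_def, THEN conjunct1, rule_format, OF c] unfolding U_def by simp_all
  have cof: "\<exists>e. G2_coframe (\<phi> c x) e" if "x \<in> U" for x
    using coframes c that unfolding U_def by blast
  have \<tau>2: "\<tau>\<^sub>2 c x vs = 0" if "x \<in> U" for x vs
    using van c that unfolding vanishes_def U_def by blast
  have closed: "ext_d (torsion_form (\<phi> c) (lee_form (\<tau>\<^sub>1 c))) x vs = 0" if "x \<in> U" for x vs
    using van c that unfolding vanishes_def U_def by blast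
  have eqs: "wedge (\<tau>\<^sub>3 c x) (\<phi> c x) vs = 0" "wedge (\<tau>\<^sub>3 c x) (star (\<phi> c) (\<phi> c) x) vs = 0"
      "ext_d (\<phi> c) x vs = t0 x * star (\<phi> c) (\<phi> c) x vs + 3 * wedge (\<tau>\<^sub>1 c x) (\<phi> c x) vs + star (\<phi> c) (\<tau>\<^sub>3 c) x vs"
      "ext_d (star (\<phi> c) (\<phi> c)) x vs = 4 * wedge (\<tau>\<^sub>1 c x) (star (\<phi> c) (\<phi> c) x) vs" if x: "x \<in> U" for x vs
  proof -
    obtain p where p: "p \<in> fst c" "x = snd c p" using x unfolding U_def by blast
    \<comment> \<open>Here \<tau>_2 = 0 removes the star term from the equation for d star
      \<phi>.\<close>
    have "star (\<phi> c) (\<tau>\<^sub>2 c) x vs = 0" unfolding star_def by (rule hodge_zero[OF \<tau>2[OF x]])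
    moreover note conjunct1[OF conjunct2[OF strong], THEN conjunct2, THEN conjunct2, THEN conjunct2, THEN conjunct2,
        rule_format, OF c p(1), of vs]
    ultimately show "wedge (\<tau>\<^sub>3 c x) (\<phi> c x) vs = 0" "wedge (\<tau>\<^sub>3 c x) (star (\<phi> c) (\<phi> c) x) vs = 0"
      "ext_d (\<phi> c) x vs = t0 x * star (\<phi> c) (\<phi> c) x vs + 3 * wedge (\<tau>\<^sub>1 c x) (\<phi> c x) vs + star (\<phi> c) (\<tau>\<^sub>3 c) x vs"
      "ext_d (star (\<phi> c) (\<phi> c)) x vs = 4 * wedge (\<tau>\<^sub>1 c x) (star (\<phi> c) (\<phi> c) x) vs"
      unfolding p(2) t0_eq[OF p(1)] by simp_all
  qed
  interpret local_G2T_point U "\<phi> c" "\<tau>\<^sub>1 c" "\<tau>\<^sub>3 c" t0 "snd c q"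
  proof
    show "snd c q \<in> U" using q by (simp add: U_def)
  qed (rule open_U cof sm(1) smooth_on_C2[OF sm(2)] smooth_on_C2[OF sm(3)] smooth_on_C2[OF sm_t0] df eqs closed;
      assumption?)+
  show "scalar_curvature (\<lambda>x. G2_metric (\<phi> c x)) (snd c q) =
      10 * codifferential1 (\<phi> c) (\<tau>\<^sub>1 c) (snd c q) + 49 / 24 * (\<tau>\<^sub>0 q)\<^sup>2
      + 24 * covector_norm_sq (G2_metric (\<phi> c (snd c q))) (\<tau>\<^sub>1 c (snd c q))"
    using scalar_curvature_eq unfolding G_def[abs_def] t0_eq[OF q] .
qed

end
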